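(* Let $X$ be a spectrally negative Lévy process (not the negative of a subordinator). Let $0\leq a\leq b\leq c$, with $c>0$ if $X$ has paths of unbounded variation, let $p,q\geq 0$ and $0\leq x\leq c$. Then $$ \mathbb E_x\left[\mathrm e^{-p\tau_c^+ - q\int_0^{\tau_c^+}\mathbf 1_{(a,b)}(X_s)\,\mathrm ds};\,\tau_c^+<\tau_0^-\right] = \frac{\mathcal W_a^{(p,q)}(x) - q\int_b^x W^{(p)}(x-z)\mathcal W_a^{(p,q)}(z)\,\mathrm dz}{\mathcal W_a^{(p,q)}(c) - q\int_b^c W^{(p)}(c-z)\mathcal W_a^{(p,q)}(z)\,\mathrm dz}. $$
   Context: $X=(X_t)_{t\geq0}$ is a spectrally negative Lévy process: a process with stationary independent increments and no positive jumps; the case where $X$ is the negative of a subordinator (non-increasing paths) is excluded. $\mathbb P_x$ is the law of $X$ with $X_0=x$, $\mathbb E_x$ the expectation, and $\mathbb E_x[Y;A]:=\mathbb E_x[Y\mathbf 1_A]$. The Laplace exponent is defined by $\mathbb E_0[\mathrm e^{\lambda X_t}]=\mathrm e^{t\psi(\lambda)}$, $\lambda,t\geq0$, and $\Phi(q)=\sup\{\lambda\geq0:\psi(\lambda)=q\}$ for $q\geq0$. First passage times: $\tau_y^-=\inf\{t>0: X_t<y\}$ and $\tau_y^+=\inf\{t>0:X_t>y\}$, with $\inf\emptyset=\infty$. Scale functions: for $q\geq0$, $W^{(q)}$ is the unique function that is continuous on $[0,\infty)$ with $\int_0^\infty \mathrm e^{-\lambda y}W^{(q)}(y)\,\mathrm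 dy = \frac1{\psi(\lambda)-q}$ for $\lambda>\Phi(q)$, extended by $W^{(q)}(x)=0$ for $x<0$. For $p,q,a\geq0$ and $x\in\mathbb R$: $$\mathcal W_a^{(p,q)}(x)=W^{(p+q)}(x)-q\int_0^a W^{(p+q)}(x-y)W^{(p)}(y)\,\mathrm dy.$$ Since $W^{(p)}$ vanishes on $(-\infty,0)$, integrals of the form $\int_b^x W^{(p)}(x-z)(\cdots)\,\mathrm dz$ are $0$ when $x\leq b$. *)

theory Defs
  imports "HOL-Probability.Probability"
begin

text \<open>
  The locale describes the process started at \<open>0\<close>, that is, under the law \<open>P_0\<close>; only times
  \<open>t \<ge> 0\<close> matter. Right-continuity with left limits is required of every path (the usual version
  on the canonical space), so that first passage times are measurable without completing \<open>M\<close>.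
\<close>

locale levy_process = prob_space M for M :: "'w measure" +
  fixes X :: "real \<Rightarrow> 'w \<Rightarrow> real"
  assumes random_variable_X: "\<And>t. 0 \<le> t \<Longrightarrow> random_variable borel (X t)"
    and starts_at_0: "AE \<omega> in M. X 0 \<omega> = 0"
    and right_continuous: "\<And>\<omega> t. \<omega> \<in> space M \<Longrightarrow> 0 \<le> t \<Longrightarrow> continuous (at_right t) (\<lambda>s. X s \<omega>)"
    and left_limits: "\<And>\<omega> t. \<omega> \<in> space M \<Longrightarrow> 0 < t \<Longrightarrow> \<exists>l. ((\<lambda>s. X s \<omega>) \<longlongrightarrow> l) (at_left t)"
    and independent_increments:
      "\<And>(n::nat) (t::nat \<Rightarrow> real). 0 \<le> t 0 \<Longrightarrow> incseq t \<Longrightarrow>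
        indep_vars (\<lambda>_. borel) (\<lambda>i \<omega>. X (t (Suc i)) \<omega> - X (t i) \<omega>) {..<n}"
    and stationary_increments:
      "\<And>s t. 0 \<le> s \<Longrightarrow> 0 \<le> t \<Longrightarrow>
        distr M borel (\<lambda>\<omega>. X (s + t) \<omega> - X s \<omega>) = distr M borel (\<lambda>\<omega>. X t \<omega> - X 0 \<omega>)"

text \<open>The last assumption excludes negatives of subordinators.\<close>

locale spectrally_negative_levy_process = levy_process +
  assumes no_positive_jumps:
      "AE \<omega> in M. \<forall>t>0. X t \<omega> \<le> Lim (at_left t) (\<lambda>s. X s \<omega>)"
    and not_neg_subordinator:
      "\<not> (AE \<omega> in M. \<forall>s t. 0 \<le> s \<longrightarrow> s \<le> t \<longrightarrow> X t \<omega> \<le> X s \<omega>)"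

definition bounded_variation_upto :: "real \<Rightarrow> (real \<Rightarrow> real) \<Rightarrow> bool" where
  "bounded_variation_upto T f \<longleftrightarrow>
    (\<exists>B. \<forall>(n::nat) (u::nat \<Rightarrow> real). 0 \<le> u 0 \<longrightarrow> incseq u \<longrightarrow> u n \<le> T \<longrightarrow>
      (\<Sum>i<n. \<bar>f (u (Suc i)) - f (u i)\<bar>) \<le> B)"

text \<open>
  For a Levy process, almost surely all paths have bounded variation on every compact interval or
  almost surely none has, so ``unbounded variation'' is the negation of the following.
\<close>

definition bounded_variation_paths :: "'w measure \<Rightarrow> (real \<Rightarrow> 'w \<Rightarrow> real) \<Rightarrow> bool" where
  "bounded_variation_paths M X \<longleftrightarrow>
    (AE \<omega> in M. \<forall>T\<ge>0. bounded_variation_upto T (\<lambda>t. X t \<omega>))"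

definition laplace_exponent :: "'w measure \<Rightarrow> (real \<Rightarrow> 'w \<Rightarrow> real) \<Rightarrow> real \<Rightarrow> real" where
  "laplace_exponent M X \<theta> =
    (THE r. \<forall>t\<ge>0. (\<integral>\<omega>. exp (\<theta> * X t \<omega>) \<partial>M) = exp (t * r))"

definition right_inverse_exponent :: "'w measure \<Rightarrow> (real \<Rightarrow> 'w \<Rightarrow> real) \<Rightarrow> real \<Rightarrow> real" where
  "right_inverse_exponent M X q = Sup {\<theta>. 0 \<le> \<theta> \<and> laplace_exponent M X \<theta> = q}"

definition is_scale_function ::
    "'w measure \<Rightarrow> (real \<Rightarrow> 'w \<Rightarrow> real) \<Rightarrow> real \<Rightarrow> (real \<Rightarrow> real) \<Rightarrow> bool" where
  "is_scale_function M X q W \<longleftrightarrow>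
    continuous_on {0..} W \<and> (\<forall>x<0. W x = 0) \<and>
    (\<forall>\<theta>>right_inverse_exponent M X q.
      set_integrable lborel {0..} (\<lambda>y. exp (- \<theta> * y) * W y) \<and>
      (LBINT y:{0..}. exp (- \<theta> * y) * W y) = 1 / (laplace_exponent M X \<theta> - q))"

text \<open>First passage times of a path; the infimum of the empty set is \<open>\<infinity>\<close>.\<close>

definition passage_below :: "real \<Rightarrow> (real \<Rightarrow> real) \<Rightarrow> ereal" where
  "passage_below y f = Inf {ereal t | t. 0 < t \<and> f t < y}"

definition passage_above :: "real \<Rightarrow> (real \<Rightarrow> real) \<Rightarrow> ereal" where
  "passage_above y f = Inf {ereal t | t. 0 < t \<and> f t > y}"

text \<open>
  \<open>expect_from M X x Y A\<close> is \<open>E_x[Y; A]\<close> for a functional \<open>Y\<close> and an event \<open>A\<close> of the path: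
  the law \<open>P_x\<close> is that of \<open>x + X\<close> under \<open>P_0\<close>.
\<close>

definition expect_from :: "'w measure \<Rightarrow> (real \<Rightarrow> 'w \<Rightarrow> real) \<Rightarrow> real \<Rightarrow>
    ((real \<Rightarrow> real) \<Rightarrow> real) \<Rightarrow> (real \<Rightarrow> real) set \<Rightarrow> real" where
  "expect_from M X x Y A =
    (\<integral>\<omega>. Y (\<lambda>t. x + X t \<omega>) * indicator A (\<lambda>t. x + X t \<omega>) \<partial>M)"

definition scale_W2 ::
    "(real \<Rightarrow> real \<Rightarrow> real) \<Rightarrow> real \<Rightarrow> real \<Rightarrow> real \<Rightarrow> real \<Rightarrow> real" where
  "scale_W2 W a p q x = W (p + q) x - q * (LBINT y:{0..a}. W (p + q) (x - y) * W p y)"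

end

theory Submission
  imports Defs
begin

text \<open>
  Let \<open>f\<close> be a nonnegative bounded function supported above \<open>c\<close>, and let \<open>u\<close> be the resolvent of
  the process killed below \<open>0\<close>, with discounting at rate \<open>p + q 1\<^bsub>(a,b)\<^esub>\<close>, applied to \<open>f\<close>. As the
  process creeps upwards, the strong Markov property at \<open>\<tau>\<^sub>c\<^sup>+\<close> gives \<open>u(x) = g(x) u(c)\<close> for
  \<open>x \<le> c\<close>, where \<open>g(x)\<close> is the expectation in question. Time reversal and the exponential
  martingale give the Laplace transform of the resolvent killed at the constant rate \<open>p\<close>, hence its
  kernel in terms of \<open>W\<^bsup>(p)\<^esup>\<close>, and the resolvent identity becomes the Volterra equation
  \<open>u = k W\<^bsup>(p)\<^esup> + q W\<^bsup>(p)\<^esup> * (1\<^bsub>(a,b)\<^esub> u)\<close> on \<open>[0, c]\<close> with a constant \<open>k\<close>. The numerator of the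
  formula solves the same equation with \<open>k = 1\<close>, so \<open>u\<close> is a multiple of it, and
  \<open>g(x) = u(x) / u(c)\<close>.
\<close>

section \<open>Laplace transforms and convolutions\<close>

text \<open>The scale functions are given only by their Laplace transforms at large arguments, so
  neither sign nor monotonicity is at hand. The transform of the resolvent is therefore taken in the
  starting point: for indicators of half-open intervals both the resolvent and its candidate formula
  are right-continuous there, and equal transforms give equality at every point, not just almost
  everywhere. General f follow by comparing measures, with the negative part of the kernel moved to
  the other side. The constant k contains an integral of f against the transform of the passage
  times; it is never evaluated, because it cancels in the quotient. Cancelling requires u(c) to be
  nonzero: for c > 0 because the path enters (c, c + 1) immediately, and for c = 0, allowed only
  under bounded variation, because the scale function does not vanish at 0. Each strong Markov
  argument is the Markov property at fixed times, summed over the dyadic values of an approximation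
  to the passage time from the right, followed by a limit. Expectations stay in [0, \<infinity>] as
  long as possible, and identities are arranged so that nothing is subtracted before it is known to
  be finite.\<close>

lemma continuous_at_rightI_seq:
  fixes f :: "real \<Rightarrow> real"
  assumes "x < b" and "\<And>S. (\<And>n. x < S n) \<Longrightarrow> (\<And>n. S n < b) \<Longrightarrow> decseq S \<Longrightarrow> S \<longlonglongrightarrow> x \<Longrightarrow> (\<lambda>n. f (S n)) \<longlonglongrightarrow> f x"
  shows "continuous (at_right x) f"
  unfolding continuous_within
  by (rule tendsto_at_right_sequentially[OF assms(1)]) (rule assms(2))

text \<open>Under t = exp(-x), the transforms at \<open>\<theta>0 + n\<close> are the moments of a
  weighted copy of \<open>k\<close> on [0,1], so by Weierstrass approximation it annihilates every
  continuous function of exp(-x). Right-continuity would give \<open>k\<close> a constant sign just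
  to the right of a nonzero value, which a bump supported there detects.\<close>

lemma laplace_transform_eq_0:
  fixes k :: "real \<Rightarrow> real"
  assumes int: "\<And>\<theta>. \<theta> \<ge> \<theta>0 \<Longrightarrow> set_integrable lborel {0..} (\<lambda>x. exp (- \<theta> * x) * k x)"
    and zero: "\<And>\<theta>. \<theta> \<ge> \<theta>0 \<Longrightarrow> (LBINT x:{0..}. exp (- \<theta> * x) * k x) = 0"
    and rc: "\<And>x. 0 \<le> x \<Longrightarrow> continuous (at_right x) k"
    and "0 \<le> x0"
  shows "k x0 = 0"
proof (rule ccontr)
  assume k0: "k x0 \<noteq> 0"
  define h where "h = (\<lambda>x. indicator {0..} x * (exp (- \<theta>0 * x) * k x))"
  have h_int: "integrable lborel h"
    using int[of \<theta>0] by (simp add: h_def set_integrable_def)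
  have pw_eq: "h x * exp (- x) ^ n = indicator {0..} x *\<^sub>R (exp (- (\<theta>0 + real n) * x) * k x)" for n x
  proof -
    have "exp (- x) ^ n = exp (- real n * x)" by (simp add: exp_of_nat_mult [symmetric])
    then show ?thesis unfolding h_def by (simp add: exp_add [symmetric] algebra_simps)
  qed
  have pw_int: "integrable lborel (\<lambda>x. h x * exp (- x) ^ n)" for n
    unfolding pw_eq using int[of "\<theta>0 + n"] by (simp add: set_integrable_def)
  have pw: "(\<integral>x. h x * exp (- x) ^ n \<partial>lborel) = 0" for n
    unfolding pw_eq using zero[of "\<theta>0 + n"] by (simp add: set_lebesgue_integral_def)
  have h_neg: "h x = 0" if "x < 0" for x using that by (simp add: h_def)
  have poly: "(\<integral>x. h x * g (exp (- x)) \<partial>lborel) = 0 \<and> integrable lborel (\<lambda>x. h x * g (exp (- x)))"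
    if g: "real_polynomial_function g" for g :: "real \<Rightarrow> real"
  proof -
    obtain c n where g: "g = (\<lambda>x. \<Sum>i\<le>n. c i * x ^ i)"
      using g by (auto simp: real_polynomial_function_iff_sum)
    have eq: "h x * g (exp (- x)) = (\<Sum>i\<le>n. c i * (h x * exp (- x) ^ i))" for x
      unfolding g by (simp add: sum_distrib_left algebra_simps)
    show ?thesis unfolding eq using pw pw_int by (simp add: integral_sum)
  qed
  have cont: "(\<integral>x. h x * \<phi> (exp (- x)) \<partial>lborel) = 0"
    if \<phi>: "continuous_on UNIV \<phi>" for \<phi> :: "real \<Rightarrow> real"
  proof -
    have \<phi>m[measurable]: "\<phi> \<in> borel_measurable borel" using \<phi> by (rule borel_measurable_continuous_onI)
    have "compact (\<phi> ` {0..1})" using \<phi> by (intro compact_continuous_image continuous_on_subset[OF \<phi>]) auto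
    then obtain B where B: "\<And>t. t \<in> {0..1} \<Longrightarrow> \<bar>\<phi> t\<bar> \<le> B"
      by (metis bounded_iff compact_imp_bounded imageI real_norm_def)
    have int\<phi>: "integrable lborel (\<lambda>x. h x * \<phi> (exp (- x)))"
    proof (rule Bochner_Integration.integrable_bound[where f="\<lambda>x. h x * B"])
      show "integrable lborel (\<lambda>x. h x * B)" using h_int by simp
      have [measurable]: "h \<in> borel_measurable borel" using h_int by (simp add: borel_measurable_integrable[of lborel, simplified])
      show "(\<lambda>x. h x * \<phi> (exp (- x))) \<in> borel_measurable lborel" by simp
      have "\<bar>h x * \<phi> (exp (- x))\<bar> \<le> \<bar>h x * B\<bar>" for x
      proof (cases "x < 0")
        case False
        then have "\<bar>\<phi> (exp (- x))\<bar> \<le> B" by (intro B) auto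
        then show ?thesis unfolding abs_mult by (intro mult_left_mono) auto
      qed (simp add: h_neg)
      then show "AE x in lborel. norm (h x * \<phi> (exp (- x))) \<le> norm (h x * B)" by simp
    qed
    have "\<bar>\<integral>x. h x * \<phi> (exp (- x)) \<partial>lborel\<bar> \<le> e * (\<integral>x. \<bar>h x\<bar> \<partial>lborel)" if "e > 0" for e
    proof -
      obtain g where g: "real_polynomial_function g" "\<And>x. x \<in> {0..1} \<Longrightarrow> \<bar>\<phi> x - g x\<bar> < e"
        using Stone_Weierstrass_real_polynomial_function[of "{0..1::real}" \<phi> e] \<phi> \<open>e > 0\<close>
        by (auto intro: continuous_on_subset)
      have "(\<integral>x. h x * \<phi> (exp (- x)) \<partial>lborel) = (\<integral>x. h x * \<phi> (exp (- x)) - h x * g (exp (- x)) \<partial>lborel)"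
        using int\<phi> poly[OF g(1)] by simp
      also have "\<bar>\<dots>\<bar> \<le> (\<integral>x. \<bar>h x\<bar> * e \<partial>lborel)"
        unfolding real_norm_def[symmetric]
      proof (rule Bochner_Integration.integral_norm_bound_integral)
        show "integrable lborel (\<lambda>x. h x * \<phi> (exp (- x)) - h x * g (exp (- x)))"
          using int\<phi> poly[OF g(1)] by simp
        show "integrable lborel (\<lambda>x. norm (h x) * e)" using h_int by simp
        fix x
        show "norm (h x * \<phi> (exp (- x)) - h x * g (exp (- x))) \<le> norm (h x) * e"
        proof (cases "x < 0")
          case False
          then have "\<bar>\<phi> (exp (- x)) - g (exp (- x))\<bar> \<le> e" by (intro less_imp_le g) auto
          then show ?thesis by (simp add: abs_mult mult_left_mono flip: right_diff_distrib)
        qed (simp add: h_neg)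
      qed
      finally show ?thesis by (simp add: mult.commute)
    qed
    note this[of "inverse (real (Suc n))" for n]
    then have "\<bar>\<integral>x. h x * \<phi> (exp (- x)) \<partial>lborel\<bar> \<le> inverse (real (Suc n)) * (\<integral>x. \<bar>h x\<bar> \<partial>lborel)" for n
      by simp
    then have "\<bar>\<integral>x. h x * \<phi> (exp (- x)) \<partial>lborel\<bar> \<le> 0 * (\<integral>x. \<bar>h x\<bar> \<partial>lborel)"
      by (intro LIMSEQ_le[OF tendsto_const tendsto_mult_right[OF LIMSEQ_inverse_real_of_nat]]) auto
    then show ?thesis by simp
  qed
  have "\<forall>\<^sub>F x in at_right x0. \<bar>k x - k x0\<bar> < \<bar>k x0\<bar>"
    using tendstoD[OF rc[OF \<open>0 \<le> x0\<close>, unfolded continuous_within], of "\<bar>k x0\<bar>"] k0 by (simp add: dist_real_def)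
  then obtain b where b: "b > x0" "\<And>x. x0 < x \<Longrightarrow> x < b \<Longrightarrow> \<bar>k x - k x0\<bar> < \<bar>k x0\<bar>"
    by (auto simp: eventually_at_right_field)
  \<comment> \<open>A bump in the variable t = exp(-x): the product is positive exactly for t
    between exp(-b) and exp(-x0), that is, for x between \<open>x0\<close> and
    \<open>b\<close>.\<close>
  define \<phi> where "\<phi> = (\<lambda>t::real. max 0 ((exp (- x0) - t) * (t - exp (- b))))"
  have \<phi>c: "continuous_on UNIV \<phi>" unfolding \<phi>_def by (intro continuous_intros)
  then have [measurable]: "\<phi> \<in> borel_measurable borel" by (rule borel_measurable_continuous_onI)
  have [measurable]: "h \<in> borel_measurable borel" using h_int by (simp add: borel_measurable_integrable[of lborel, simplified])
  have \<phi>0: "\<phi> (exp (- x)) = 0" if "x \<notin> {x0<..<b}" for x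
  proof (cases "x \<le> x0")
    case True
    then have "exp (- x0) - exp (- x) \<le> 0" "exp (- x) - exp (- b) \<ge> 0" using b by auto
    then have "(exp (- x0) - exp (- x)) * (exp (- x) - exp (- b)) \<le> 0" by (rule mult_nonpos_nonneg)
    then show ?thesis unfolding \<phi>_def by (simp only: max.absorb1)
  next
    case False
    then have "exp (- x0) - exp (- x) \<ge> 0" "exp (- x) - exp (- b) \<le> 0" using that by auto
    then have "(exp (- x0) - exp (- x)) * (exp (- x) - exp (- b)) \<le> 0" by (rule mult_nonneg_nonpos)
    then show ?thesis unfolding \<phi>_def by (simp only: max.absorb1)
  qed
  have \<phi>1: "\<phi> (exp (- x)) > 0" if "x \<in> {x0<..<b}" for x
    using that by (auto simp: \<phi>_def less_max_iff_disj intro!: mult_pos_pos)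
  have sgn: "sgn (k x0) * k x > 0" if "x \<in> {x0<..<b}" for x
    using b(2)[of x] that by (cases "k x0 > 0") (auto simp: abs_if split: if_splits)
  define F where "F = (\<lambda>x. sgn (k x0) * (h x * \<phi> (exp (- x))))"
  have Fpos: "F x > 0" if "x \<in> {x0<..<b}" for x
  proof -
    have "F x = (sgn (k x0) * k x) * (exp (- \<theta>0 * x) * \<phi> (exp (- x)))"
      using that \<open>0 \<le> x0\<close> by (simp add: F_def h_def)
    then show ?thesis using sgn[OF that] \<phi>1[OF that] by (simp only: mult_pos_pos exp_gt_zero)
  qed
  have Fnn: "F x \<ge> 0" for x using Fpos[of x] \<phi>0[of x] by (cases "x \<in> {x0<..<b}") (auto simp: F_def)
  have "integrable lborel F"
  proof (rule Bochner_Integration.integrable_bound[where f="\<lambda>x. h x"])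
    show "integrable lborel h" by fact
    show "F \<in> borel_measurable lborel" unfolding F_def by simp
    have "\<bar>F x\<bar> \<le> \<bar>h x\<bar>" for x
    proof (cases "x \<in> {x0<..<b}")
      case True
      then have "exp (-x) \<le> 1" "exp (-x0) \<le> 1" "exp (- b) < exp (- x)" "exp (- x) < exp (- x0)" using \<open>0 \<le> x0\<close> by auto
      then have "(exp (- x0) - exp (- x)) * (exp (- x) - exp (- b)) \<le> 1 * 1"
        using exp_gt_zero[of "-b"] exp_gt_zero[of "-x"] by (intro mult_mono) linarith+
      then have "\<bar>\<phi> (exp (- x))\<bar> \<le> 1" by (auto simp: \<phi>_def)
      then show ?thesis unfolding F_def abs_mult using k0
        by (simp add: abs_sgn_eq) (meson abs_ge_zero mult_left_le)
    qed (simp add: F_def \<phi>0)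
    then show "AE x in lborel. norm (F x) \<le> norm (h x)" by simp
  qed
  moreover have "(\<integral>x. F x \<partial>lborel) = 0" unfolding F_def using cont[OF \<phi>c] by simp
  ultimately have "AE x in lborel. F x = 0" using Fnn by (subst (asm) integral_nonneg_eq_0_iff_AE) auto
  then have "AE x in lborel. x \<notin> {x0<..<b}" by eventually_elim (use Fpos in force)
  then have "emeasure lborel {x0<..<b} = 0"
    by (subst (asm) AE_iff_measurable[of "{x0<..<b}"]) auto
  then show False using b by simp
qed

text \<open>The class in which convolutions always converge: the integrand of a convolution at x
  lives on [0,x], and local boundedness suffices there. Continuity is not part of it, because scale
  functions may jump at 0 and indicators of intervals are needed as well.\<close>

definition causal :: "(real \<Rightarrow> real) \<Rightarrow> bool" where
  "causal f \<longleftrightarrow> f \<in> borel_measurable borel \<and> (\<forall>x<0. f x = 0) \<and> (\<forall>d. \<exists>B. \<forall>x\<le>d. \<bar>f x\<bar> \<le> B)"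

definition conv :: "(real \<Rightarrow> real) \<Rightarrow> (real \<Rightarrow> real) \<Rightarrow> real \<Rightarrow> real" where
  "conv f g x = (LBINT y. f (x - y) * g y)"

section \<open>Convolution algebra of causal functions\<close>

lemma causal_measurable: "causal f \<Longrightarrow> f \<in> borel_measurable borel"
  by (simp add: causal_def)

lemma causal_neg: "causal f \<Longrightarrow> x < 0 \<Longrightarrow> f x = 0"
  by (simp add: causal_def)

lemma causal_bound:
  assumes "causal f" obtains B where "B > 0" "\<And>x. x \<le> d \<Longrightarrow> \<bar>f x\<bar> \<le> B"
proof -
  obtain B where "\<forall>x\<le>d. \<bar>f x\<bar> \<le> B" using assms unfolding causal_def by blast
  then show ?thesis by (intro that[of "max B 1"]) (auto simp: le_max_iff_disj)
qed

lemma causal_continuous: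
  assumes "continuous_on {0..} f" "\<forall>x<0. f x = 0" shows "causal f"
proof -
  have "(\<lambda>x. indicator {0..} x *\<^sub>R f x) \<in> borel_measurable borel"
    by (rule borel_measurable_continuous_on_indicator[OF _ assms(1)]) auto
  also have "(\<lambda>x. indicator {0..} x *\<^sub>R f x) = f" using assms(2) by (auto simp: fun_eq_iff indicator_def)
  finally have "f \<in> borel_measurable borel" .
  moreover have "\<exists>B. \<forall>x\<le>d. \<bar>f x\<bar> \<le> B" for d
  proof -
    have "compact (f ` {0..d})" using assms(1) by (intro compact_continuous_image) (auto elim: continuous_on_subset)
    then obtain B where "\<And>t. t \<in> {0..d} \<Longrightarrow> \<bar>f t\<bar> \<le> B"
      by (metis bounded_iff compact_imp_bounded imageI real_norm_def)
    then show ?thesis using assms(2) by (intro exI[of _ "max B 0"]) (metis abs_zero atLeastAtMost_iff linorder_not_le max.bounded_iff max.cobounded2 order_trans max.cobounded1)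
  qed
  ultimately show ?thesis using assms(2) by (auto simp: causal_def)
qed

text \<open>One integrable majorant serves all x up to \<open>d\<close>, so it yields integrability,
  local boundedness of the convolution, and dominated convergence when x varies.\<close>

lemma conv_bound:
  assumes f: "causal f" and g: "causal g"
  obtains B where "B > 0" "\<And>x y. x \<le> d \<Longrightarrow> \<bar>f (x - y) * g y\<bar> \<le> B * indicator {0..d} y"
proof -
  obtain B1 where B1: "B1 > 0" "\<And>x. x \<le> d \<Longrightarrow> \<bar>f x\<bar> \<le> B1" using causal_bound[OF f] by blast
  obtain B2 where B2: "B2 > 0" "\<And>x. x \<le> d \<Longrightarrow> \<bar>g x\<bar> \<le> B2" using causal_bound[OF g] by blast
  show ?thesis
  proof (rule that[of "B1 * B2"])
    fix x y :: real assume "x \<le> d"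
    show "\<bar>f (x - y) * g y\<bar> \<le> B1 * B2 * indicator {0..d} y"
    proof (cases "0 \<le> y \<and> y \<le> x")
      case True
      then show ?thesis using B1 B2 \<open>x \<le> d\<close> by (simp add: abs_mult mult_mono')
    next
      case False
      then have "f (x - y) * g y = 0" using causal_neg[OF f, of "x - y"] causal_neg[OF g, of y] by auto
      then show ?thesis using B1(1) B2(1) by (simp only: abs_zero) simp
    qed
  qed (use B1 B2 in auto)
qed

lemma integrable_Icc_bound: "integrable lborel (\<lambda>y. (B::real) * indicator {0..d::real} y)"
  using integrable_real_indicator[of "{0..d::real}" lborel] by (cases "0 \<le> d") auto

lemma conv_integrable:
  assumes f: "causal f" and g: "causal g"
  shows "integrable lborel (\<lambda>y. f (x - y) * g y)"
proof -
  note [measurable] = causal_measurable[OF f] causal_measurable[OF g]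
  obtain B where B: "B > 0" "\<And>x' y. x' \<le> x \<Longrightarrow> \<bar>f (x' - y) * g y\<bar> \<le> B * indicator {0..x} y"
    using conv_bound[OF f g, of x] by blast
  show ?thesis
    by (rule Bochner_Integration.integrable_bound[OF integrable_Icc_bound[of B x]])
       (use B(1) B(2)[OF order.refl] in \<open>auto simp: abs_mult\<close>)
qed

lemma causal_conv:
  assumes f: "causal f" and g: "causal g"
  shows "causal (conv f g)"
proof -
  note [measurable] = causal_measurable[OF f] causal_measurable[OF g]
  have 1: "conv f g \<in> borel_measurable borel" unfolding conv_def[abs_def] by measurable
  have 2: "conv f g x = 0" if "x < 0" for x
  proof -
    have "f (x - y) * g y = 0" for y using causal_neg[OF f, of "x - y"] causal_neg[OF g, of y] that by (cases "y < 0") auto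
    then show ?thesis unfolding conv_def by (simp only:) simp
  qed
  have 3: "\<exists>C. \<forall>x\<le>d. \<bar>conv f g x\<bar> \<le> C" for d
  proof -
    obtain B where B: "B > 0" "\<And>x' y. x' \<le> d \<Longrightarrow> \<bar>f (x' - y) * g y\<bar> \<le> B * indicator {0..d} y"
      using conv_bound[OF f g, of d] by blast
    show ?thesis
    proof (intro exI allI impI)
      fix x assume "x \<le> d"
      show "\<bar>conv f g x\<bar> \<le> (LBINT y. B * indicator {0..d} y)"
        unfolding conv_def real_norm_def[symmetric]
        by (rule Bochner_Integration.integral_norm_bound_integral[OF conv_integrable[OF f g] integrable_Icc_bound])
           (use B(2)[OF \<open>x \<le> d\<close>] in auto)
    qed
  qed
  from 1 2 3 show ?thesis by (auto simp: causal_def)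
qed

lemma causal_add: "causal f \<Longrightarrow> causal g \<Longrightarrow> causal (\<lambda>x. f x + g x)"
  unfolding causal_def
proof (intro conjI allI)
  fix d assume *: "f \<in> borel_measurable borel \<and> (\<forall>x<0. f x = 0) \<and> (\<forall>d. \<exists>B. \<forall>x\<le>d. \<bar>f x\<bar> \<le> B)"
    "g \<in> borel_measurable borel \<and> (\<forall>x<0. g x = 0) \<and> (\<forall>d. \<exists>B. \<forall>x\<le>d. \<bar>g x\<bar> \<le> B)"
  then obtain B C where "\<forall>x\<le>d. \<bar>f x\<bar> \<le> B" "\<forall>x\<le>d. \<bar>g x\<bar> \<le> C" by meson
  then show "\<exists>B. \<forall>x\<le>d. \<bar>f x + g x\<bar> \<le> B"
    by (intro exI[of _ "B + C"]) (meson abs_triangle_ineq add_mono order_trans)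
qed auto

lemma causal_cmult: "causal f \<Longrightarrow> causal (\<lambda>x. c * f x)"
  unfolding causal_def
proof (intro conjI allI)
  fix d assume *: "f \<in> borel_measurable borel \<and> (\<forall>x<0. f x = 0) \<and> (\<forall>d. \<exists>B. \<forall>x\<le>d. \<bar>f x\<bar> \<le> B)"
  then obtain B where "\<forall>x\<le>d. \<bar>f x\<bar> \<le> B" by meson
  then show "\<exists>B. \<forall>x\<le>d. \<bar>c * f x\<bar> \<le> B"
    by (intro exI[of _ "\<bar>c\<bar> * B"]) (simp add: abs_mult mult_left_mono)
qed auto

lemma causal_diff: "causal f \<Longrightarrow> causal g \<Longrightarrow> causal (\<lambda>x. f x - g x)"
  using causal_add[OF _ causal_cmult[of g "-1"]] by simp

lemma causal_indicator:
  assumes "causal f" "A \<in> sets borel" shows "causal (\<lambda>x. indicator A x * f x)"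
proof -
  have "\<bar>indicator A x * f x\<bar> \<le> \<bar>f x\<bar>" for x by (simp add: indicator_def)
  then show ?thesis using assms unfolding causal_def by (auto intro: order_trans) (meson order_trans)
qed

lemma conv_diff_left: "causal f \<Longrightarrow> causal g \<Longrightarrow> causal h \<Longrightarrow> conv (\<lambda>x. f x - g x) h x = conv f h x - conv g h x"
  unfolding conv_def by (subst Bochner_Integration.integral_diff[symmetric]) (auto intro: conv_integrable simp: left_diff_distrib right_diff_distrib distrib_left)

lemma conv_diff_right: "causal f \<Longrightarrow> causal g \<Longrightarrow> causal h \<Longrightarrow> conv h (\<lambda>x. f x - g x) x = conv h f x - conv h g x"
  unfolding conv_def by (subst Bochner_Integration.integral_diff[symmetric]) (auto intro: conv_integrable simp: left_diff_distrib right_diff_distrib distrib_left)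

lemma conv_cmult_right: "conv h (\<lambda>x. c * f x) x = c * conv h f x"
  unfolding conv_def by (simp flip: integral_mult_right_zero add: algebra_simps)

lemma conv_cmult_left: "conv (\<lambda>x. c * f x) h x = c * conv f h x"
  unfolding conv_def by (simp flip: integral_mult_right_zero add: algebra_simps)

lemma conv_assoc:
  assumes f: "causal f" and g: "causal g" and h: "causal h"
  shows "conv f (conv g h) x = conv (conv f g) h x"
proof -
  note [measurable] = causal_measurable[OF f] causal_measurable[OF g] causal_measurable[OF h]
  obtain B1 where B1: "B1 > 0" "\<And>y. y \<le> x \<Longrightarrow> \<bar>f y\<bar> \<le> B1" using causal_bound[OF f] by blast
  obtain B2 where B2: "B2 > 0" "\<And>y. y \<le> x \<Longrightarrow> \<bar>g y\<bar> \<le> B2" using causal_bound[OF g] by blast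
  obtain B3 where B3: "B3 > 0" "\<And>y. y \<le> x \<Longrightarrow> \<bar>h y\<bar> \<le> B3" using causal_bound[OF h] by blast
  let ?F = "\<lambda>y z. f (x - y) * (g (y - z) * h z)"
  have int: "integrable (lborel \<Otimes>\<^sub>M lborel) (\<lambda>(y, z). ?F y z)"
  proof (rule Bochner_Integration.integrable_bound)
    have "integrable (lborel \<Otimes>\<^sub>M lborel) (\<lambda>p. B1 * B2 * B3 * indicator ({0..x} \<times> {0..x}) p :: real)"
      using lborel.emeasure_pair_measure_Times[of "{0..x}" lborel "{0..x}"]
      by (intro integrable_mult_right integrable_real_indicator) (auto simp: ennreal_mult_less_top emeasure_lborel_Icc_eq)
    then show "integrable (lborel \<Otimes>\<^sub>M lborel) (\<lambda>p. B1 * B2 * B3 * indicator ({0..x} \<times> {0..x}) p :: real)" .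
    show "(\<lambda>(y, z). ?F y z) \<in> borel_measurable (lborel \<Otimes>\<^sub>M lborel)" by measurable
    have "\<bar>?F y z\<bar> \<le> B1 * B2 * B3 * indicator ({0..x} \<times> {0..x}) (y, z)" for y z
    proof (cases "0 \<le> z \<and> z \<le> y \<and> y \<le> x")
      case True
      have "\<bar>f (x - y)\<bar> * (\<bar>g (y - z)\<bar> * \<bar>h z\<bar>) \<le> B1 * (B2 * B3)" using True B1 B2 B3 by (intro mult_mono) auto
      then show ?thesis using True by (simp add: abs_mult)
    next
      case False
      then have "?F y z = 0" using causal_neg[OF f, of "x - y"] causal_neg[OF g, of "y - z"] causal_neg[OF h, of z] by force
      then show ?thesis using B1(1) B2(1) B3(1) by (simp only: abs_zero) simp
    qed
    then show "AE p in lborel \<Otimes>\<^sub>M lborel. norm (case p of (y, z) \<Rightarrow> ?F y z) \<le> norm (B1 * B2 * B3 * indicator ({0..x} \<times> {0..x}) p :: real)"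
      using B1 B2 B3 by (auto simp: split_beta)
  qed
  have "conv f (conv g h) x = (LBINT y. LBINT z. ?F y z)"
    unfolding conv_def by (simp flip: integral_mult_right_zero)
  also have "\<dots> = (LBINT z. LBINT y. ?F y z)"
    using lborel_pair.Fubini_integral[OF int] by simp
  also have "\<dots> = (LBINT z. (LBINT y. f (x - y) * g (y - z)) * h z)"
    by (simp flip: integral_mult_left_zero add: mult.assoc)
  also have "\<dots> = (LBINT z. (LBINT w. f (x - z - w) * g w) * h z)"
    by (subst lborel_integral_real_affine[of 1 "\<lambda>y. f (x - y) * g (y - z)" z for z])
       (auto simp: algebra_simps)
  finally show ?thesis unfolding conv_def .
qed

text \<open>The weight factors as exp(-\<theta> (x - y)) exp(-\<theta> y), so a weighted convolution
  is the convolution of the weighted functions. Absolute values and translation invariance justify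
  Fubini.\<close>

lemma conv_laplace:
  fixes f g :: "real \<Rightarrow> real"
  assumes f: "causal f" and g: "causal g"
    and fi: "set_integrable lborel {0..} (\<lambda>y. exp (- \<theta> * y) * f y)"
    and gi: "set_integrable lborel {0..} (\<lambda>y. exp (- \<theta> * y) * g y)"
  shows "set_integrable lborel {0..} (\<lambda>y. exp (- \<theta> * y) * conv f g y)"
    and "(LBINT y:{0..}. exp (- \<theta> * y) * conv f g y) =
      (LBINT y:{0..}. exp (- \<theta> * y) * f y) * (LBINT y:{0..}. exp (- \<theta> * y) * g y)"
proof -
  note [measurable] = causal_measurable[OF f] causal_measurable[OF g] causal_measurable[OF causal_conv[OF f g]]
  have drop: "indicator {0..} y *\<^sub>R (exp (- \<theta> * y) * k y) = exp (- \<theta> * y) * k y" if "causal k" for k :: "real \<Rightarrow> real" and y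
    using causal_neg[OF that] by (auto simp: indicator_def)
  let ?f = "\<lambda>y. exp (- \<theta> * y) * f y" and ?g = "\<lambda>y. exp (- \<theta> * y) * g y"
  have fi': "integrable lborel ?f" using fi unfolding set_integrable_def drop[OF f] .
  have gi': "integrable lborel ?g" using gi unfolding set_integrable_def drop[OF g] .
  have int: "integrable (lborel \<Otimes>\<^sub>M lborel) (\<lambda>(y, x). ?f (x - y) * ?g y)"
  proof (rule lborel_pair.Fubini_integrable)
    show "(\<lambda>(y, x). ?f (x - y) * ?g y) \<in> borel_measurable (lborel \<Otimes>\<^sub>M lborel)" by measurable
    have sh: "(LBINT x. \<bar>?f (x - y)\<bar>) = (LBINT x. \<bar>?f x\<bar>)" for y
      using lborel_integral_real_affine[of 1 "\<lambda>x. \<bar>?f (x - y)\<bar>" y] by simp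
    have "integrable lborel (\<lambda>y. (LBINT x. \<bar>?f (x - y)\<bar>) * \<bar>?g y\<bar>)"
      unfolding sh using gi' by simp
    then show "integrable lborel (\<lambda>x. LBINT y. norm (case (x, y) of (y, x) \<Rightarrow> ?f (x - y) * ?g y))"
      by (simp add: abs_mult flip: integral_mult_left_zero)
    have "integrable lborel (\<lambda>x. ?f (x - y))" for y
      using lborel_integrable_real_affine[OF fi', of 1 "-y"] by (simp add: algebra_simps)
    then show "AE x in lborel. integrable lborel (\<lambda>y. case (x, y) of (y, x) \<Rightarrow> ?f (x - y) * ?g y)"
      by simp
  qed
  have eq: "(LBINT y. ?f (x - y) * ?g y) = exp (- \<theta> * x) * conv f g x" for x
    unfolding conv_def by (simp flip: integral_mult_right_zero exp_add add: algebra_simps)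
  have "integrable lborel (\<lambda>x. LBINT y. ?f (x - y) * ?g y)"
    using lborel_pair.integrable_snd[OF int] by simp
  then show "set_integrable lborel {0..} (\<lambda>y. exp (- \<theta> * y) * conv f g y)"
    unfolding set_integrable_def drop[OF causal_conv[OF f g]] eq .
  have "(LBINT x. exp (- \<theta> * x) * conv f g x) = (LBINT y. LBINT x. ?f (x - y) * ?g y)"
    unfolding eq[symmetric] using lborel_pair.Fubini_integral[OF int] by simp
  also have "\<dots> = (LBINT y. (LBINT x. ?f (x - y)) * ?g y)"
    by simp
  also have "\<dots> = (LBINT y. (LBINT x. ?f x) * ?g y)"
    by (subst lborel_integral_real_affine[of 1 "\<lambda>x. ?f (x - y)" y for y]) simp_all
  finally show "(LBINT y:{0..}. exp (- \<theta> * y) * conv f g y) =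
      (LBINT y:{0..}. exp (- \<theta> * y) * f y) * (LBINT y:{0..}. exp (- \<theta> * y) * g y)"
    unfolding set_lebesgue_integral_def drop[OF f] drop[OF g] drop[OF causal_conv[OF f g]] by simp
qed

text \<open>A jump of \<open>f\<close> at 0 does no harm, not even to continuity of the convolution
  at 0: it affects the integrand only at y = x, a null set.\<close>

lemma conv_continuous:
  assumes f: "causal f" and g: "causal g" and fc: "continuous_on {0..} f"
  shows "isCont (conv f g) x"
  unfolding continuous_at_sequentially comp_def
proof (intro allI impI)
  note [measurable] = causal_measurable[OF f] causal_measurable[OF g]
  fix S assume S: "S \<longlonglongrightarrow> x"
  then obtain d where d: "\<And>n. \<bar>S n\<bar> \<le> d" by (metis Bseq_def convergentI convergent_imp_Bseq real_norm_def)
  then have d': "S n \<le> d" for n using abs_le_D1 by blast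
  obtain B where B: "B > 0" "\<And>x' y. x' \<le> d \<Longrightarrow> \<bar>f (x' - y) * g y\<bar> \<le> B * indicator {0..d} y"
    using conv_bound[OF f g, of d] by blast
  show "(\<lambda>n. conv f g (S n)) \<longlonglongrightarrow> conv f g x"
    unfolding conv_def
  proof (rule integral_dominated_convergence[OF _ _ integrable_Icc_bound[of B d]])
    have "(\<lambda>n. f (S n - y)) \<longlonglongrightarrow> f (x - y)" if "y \<noteq> x" for y
    proof (cases "y < x")
      case True
      have "continuous_on {0<..} f" using fc by (rule continuous_on_subset) auto
      then have "isCont f (x - y)" using True by (intro continuous_on_interior[of "{0<..}"]) (auto simp: interior_open)
      then show ?thesis by (rule isCont_tendsto_compose) (intro tendsto_intros S)
    next
      case False
      then have "\<forall>\<^sub>F n in sequentially. S n < y" using order_tendstoD(2)[OF S, of y] that by auto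
      then have "\<forall>\<^sub>F n in sequentially. f (S n - y) = f (x - y)"
        by eventually_elim (use False that causal_neg[OF f] in auto)
      then show ?thesis by (rule tendsto_eventually)
    qed
    moreover have "AE y in lborel. y \<noteq> x" by (rule AE_lborel_singleton)
    ultimately show "AE y in lborel. (\<lambda>n. f (S n - y) * g y) \<longlonglongrightarrow> f (x - y) * g y"
      by (auto intro!: tendsto_mult_right elim!: eventually_mono)
    show "AE y in lborel. norm (f (S n - y) * g y) \<le> B * indicator {0..d} y" for n
      using B(2)[OF d'[of n]] by auto
  qed measurable
qed

lemma conv_right_continuous:
  assumes "causal f" "causal g" "continuous_on {0..} f"
  shows "continuous (at_right x) (conv f g)"
  using conv_continuous[OF assms] by (rule continuous_at_imp_continuous_at_within)

text \<open>In the supremum norm with weight exp(-\<mu> y) the integral operator has norm at most C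
  / \<mu>. The choice \<mu> = 2 C + 1 makes this at most 1/2, so the norm S of \<open>D\<close>,
  finite by the bound \<open>B\<close>, satisfies S \<le> S / 2.\<close>

lemma volterra_zero:
  fixes D :: "real \<Rightarrow> real"
  assumes m[measurable]: "D \<in> borel_measurable borel" and B: "\<And>x. x \<in> {0..d} \<Longrightarrow> \<bar>D x\<bar> \<le> B"
    and "C \<ge> 0" and le: "\<And>x. x \<in> {0..d} \<Longrightarrow> \<bar>D x\<bar> \<le> C * (LBINT y:{0..x}. \<bar>D y\<bar>)"
    and x: "x \<in> {0..d}"
  shows "D x = 0"
proof -
  define \<mu> where "\<mu> = 2 * C + 1"
  define S where "S = (SUP y\<in>{0..d}. exp (- \<mu> * y) * \<bar>D y\<bar>)"
  have \<mu>: "\<mu> > 0" "C / \<mu> \<le> 1 / 2" using \<open>C \<ge> 0\<close> by (auto simp: \<mu>_def field_simps)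
  have bd: "bdd_above ((\<lambda>y. exp (- \<mu> * y) * \<bar>D y\<bar>) ` {0..d})"
  proof (rule bdd_aboveI2)
    fix y assume y: "y \<in> {0..d}"
    then have "exp (- \<mu> * y) * \<bar>D y\<bar> \<le> 1 * B" using \<mu> B[OF y] by (intro mult_mono) auto
    then show "exp (- \<mu> * y) * \<bar>D y\<bar> \<le> B" by simp
  qed
  have up: "exp (- \<mu> * y) * \<bar>D y\<bar> \<le> S" if "y \<in> {0..d}" for y
    unfolding S_def using that bd by (intro cSUP_upper)
  have S0: "S \<ge> 0" using up[OF x] by (meson abs_ge_zero exp_ge_zero mult_nonneg_nonneg order_trans)
  have Dle: "\<bar>D y\<bar> \<le> S * exp (\<mu> * y)" if "y \<in> {0..d}" for y
    using up[OF that] by (simp add: exp_minus field_simps)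
  have "exp (- \<mu> * y) * \<bar>D y\<bar> \<le> S / 2" if y: "y \<in> {0..d}" for y
  proof -
    have FT: "set_integrable lborel {0..y} (\<lambda>z. S * exp (\<mu> * z))"
      by (intro borel_integrable_atLeastAtMost') (intro continuous_intros)
    have I: "(LBINT z:{0..y}. S * exp (\<mu> * z)) = S * exp (\<mu> * y) / \<mu> - S * exp (\<mu> * 0) / \<mu>"
      unfolding set_lebesgue_integral_def
    proof (rule integral_FTC_Icc)
      show "0 \<le> y" using y by simp
      show "((\<lambda>y. S * exp (\<mu> * y) / \<mu>) has_vector_derivative S * exp (\<mu> * x)) (at x within {0..y})" for x
        using \<mu> by (auto simp: has_real_derivative_iff_has_vector_derivative[symmetric] intro!: derivative_eq_intros)
      show "continuous_on {0..y} (\<lambda>z. S * exp (\<mu> * z))" by (intro continuous_intros)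
    qed
    have "(LBINT z:{0..y}. \<bar>D z\<bar>) \<le> (LBINT z:{0..y}. S * exp (\<mu> * z))"
    proof (rule set_integral_mono[OF _ FT])
      show "set_integrable lborel {0..y} (\<lambda>z. \<bar>D z\<bar>)" unfolding set_integrable_def
        by (rule Bochner_Integration.integrable_bound[OF FT[unfolded set_integrable_def]])
           (use y Dle S0 in \<open>auto simp: indicator_def\<close>)
      show "\<bar>D z\<bar> \<le> S * exp (\<mu> * z)" if "z \<in> {0..y}" for z using that y by (intro Dle) auto
    qed
    also have "\<dots> \<le> S * exp (\<mu> * y) / \<mu>" using I S0 \<mu> by simp
    finally have "\<bar>D y\<bar> \<le> C * (S * exp (\<mu> * y) / \<mu>)"
      using le[OF y] \<open>C \<ge> 0\<close> by (meson mult_left_mono order_trans)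
    also have "\<dots> = (C / \<mu>) * (S * exp (\<mu> * y))" by simp
    also have "\<dots> \<le> 1 / 2 * (S * exp (\<mu> * y))" using \<mu> S0 by (intro mult_right_mono) auto
    finally show ?thesis by (simp add: exp_minus field_simps)
  qed
  then have "S \<le> S / 2" unfolding S_def[symmetric] using x by (subst S_def) (rule cSUP_least, auto)
  then have "S = 0" using S0 by simp
  then show ?thesis using Dle[OF x] by simp
qed

section \<open>Integrals over intervals and an exponential chain rule\<close>

lemma set_integrable_Icc_bounded:
  fixes g :: "real \<Rightarrow> real"
  assumes [measurable]: "g \<in> borel_measurable borel" and "\<And>x. x \<in> {a..b} \<Longrightarrow> \<bar>g x\<bar> \<le> B"
  shows "set_integrable lborel {a..b} g"
  unfolding set_integrable_def
proof (rule Bochner_Integration.integrable_bound[of _ "\<lambda>x. B * indicator {a..b} x"])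
  show "integrable lborel (\<lambda>x. B * indicator {a..b} x)"
    by (intro integrable_mult_right integrable_real_indicator) (auto simp: emeasure_lborel_Icc_eq)
  have "B * indicator {a..b} x \<ge> \<bar>g x\<bar> * indicator {a..b} x" for x using assms(2)[of x] by (auto simp: indicator_def)
  then have "norm (indicator {a..b} x *\<^sub>R g x) \<le> norm (B * indicator {a..b} x)" for x
    using order_trans[OF _ abs_ge_self, of _ "B * indicator {a..b} x"] by (simp add: abs_mult mult.commute)
  then show "AE x in lborel. norm (indicator {a..b} x *\<^sub>R g x) \<le> norm (B * indicator {a..b} x)" by simp
qed simp

lemma LBINT_Icc_split:
  fixes g :: "real \<Rightarrow> real"
  assumes "set_integrable lborel {a..c} g" "a \<le> b" "b \<le> c"
  shows "(LBINT s:{a..c}. g s) = (LBINT s:{a..b}. g s) + (LBINT s:{b..c}. g s)"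
proof -
  have 1: "set_integrable lborel {a..b} g" "set_integrable lborel {b..c} g"
    using assms by (auto elim!: set_integrable_subset)
  have "(LBINT s:{a..c}. g s) = (LBINT s:{a..b}. g s) + (LBINT s:{b<..c}. g s)"
    using assms 1 by (subst set_integral_Un[symmetric]) (auto elim!: set_integrable_subset simp: ivl_disj_un)
  also have "(LBINT s:{b<..c}. g s) = (LBINT s:{b..c}. g s)"
    by (rule set_integral_discrete_difference[of "{b}"]) (auto)
  finally show ?thesis .
qed

lemma exp_diff_le: "exp x - exp y \<le> exp x * (x - y)" for x y :: real
proof -
  have "exp x * (1 + (y - x)) \<le> exp x * exp (y - x)"
    by (intro mult_left_mono exp_ge_add_one_self) auto
  then show ?thesis by (simp add: exp_diff algebra_simps)
qed

lemma abs_exp_diff_le: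
  fixes x y m :: real
  assumes "x \<le> m" "y \<le> m" shows "\<bar>exp x - exp y\<bar> \<le> exp m * \<bar>x - y\<bar>"
proof -
  have "exp a - exp b \<le> exp m * \<bar>a - b\<bar>" if "a \<le> m" for a b :: real
  proof -
    have "exp a * (a - b) \<le> exp a * \<bar>a - b\<bar>" by (intro mult_left_mono) auto
    also have "\<dots> \<le> exp m * \<bar>a - b\<bar>" using that by (intro mult_right_mono) auto
    finally show ?thesis using exp_diff_le[of a b] by simp
  qed
  from this[of x y] this[of y x] assms show ?thesis by (simp add: abs_le_iff abs_minus_commute)
qed

lemma abs_exp_diff_linear_le:
  fixes x y m :: real
  assumes "x \<le> m" "y \<le> m" shows "\<bar>exp x - exp y - (x - y) * exp y\<bar> \<le> exp m * (x - y)\<^sup>2"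
proof -
  have l: "0 \<le> exp x - exp y - (x - y) * exp y" using exp_diff_le[of y x] by (simp add: algebra_simps)
  have "exp x - exp y - (x - y) * exp y \<le> (x - y) * (exp x - exp y)"
    using exp_diff_le[of x y] by (simp add: algebra_simps)
  also have "\<dots> \<le> \<bar>x - y\<bar> * (exp m * \<bar>x - y\<bar>)"
    by (rule order_trans[OF abs_ge_self]) (simp only: abs_mult, intro mult_left_mono abs_exp_diff_le assms, simp)
  also have "\<dots> = exp m * (x - y)\<^sup>2"
    by (metis abs_mult_self_eq mult.left_commute power2_eq_square)
  finally show ?thesis using l by simp
qed

text \<open>Cutting [0,d] into N equal pieces bounds the total change by N C (d/N)^2, which tends to
  0.\<close>

lemma constant_if_quadratic_increments:
  fixes D :: "real \<Rightarrow> real"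
  assumes "0 \<le> d" and D: "\<And>s t. 0 \<le> s \<Longrightarrow> s \<le> t \<Longrightarrow> t \<le> d \<Longrightarrow> \<bar>D t - D s\<bar> \<le> C * (t - s)\<^sup>2"
  shows "D d = D 0"
proof -
  have "\<bar>D d - D 0\<bar> \<le> C * d\<^sup>2 * inverse (real (Suc n))" for n
  proof -
    let ?N = "Suc n"
    have "D d - D 0 = (\<Sum>i<?N. D (real (Suc i) * d / ?N) - D (real i * d / ?N))"
      using sum_lessThan_telescope[of "\<lambda>i. D (real i * d / ?N)" ?N] by simp
    also have "\<bar>\<dots>\<bar> \<le> (\<Sum>i<?N. C * (d / ?N)\<^sup>2)"
    proof (rule order_trans[OF sum_abs sum_mono])
      fix i assume "i \<in> {..<?N}"
      then have i: "real (Suc i) \<le> real ?N" by auto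
      have "real (Suc i) * d / ?N \<le> real ?N * d / ?N" using i \<open>0 \<le> d\<close> by (intro divide_right_mono mult_right_mono) auto
      then have "\<bar>D (real (Suc i) * d / ?N) - D (real i * d / ?N)\<bar> \<le> C * (real (Suc i) * d / ?N - real i * d / ?N)\<^sup>2"
        using \<open>0 \<le> d\<close> by (intro D) (auto intro!: divide_right_mono mult_right_mono)
      also have "real (Suc i) * d / ?N - real i * d / ?N = d / ?N"
        by (simp add: distrib_right flip: diff_divide_distrib)
      finally show "\<bar>D (real (Suc i) * d / ?N) - D (real i * d / ?N)\<bar> \<le> C * (d / ?N)\<^sup>2" .
    qed
    also have "\<dots> = real ?N * (C * (d / real ?N)\<^sup>2)" by (simp only: sum_constant card_lessThan)
    also have "\<dots> = C * d\<^sup>2 * inverse (real ?N)"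
    proof -
      have "N * (C * (d / N)\<^sup>2) = C * d\<^sup>2 * inverse N" if "N \<noteq> 0" for N :: real
        using that by (simp add: power2_eq_square field_simps)
      then show ?thesis by (simp only: of_nat_neq_0 not_False_eq_True)
    qed
    finally show ?thesis .
  qed
  then have "\<bar>D d - D 0\<bar> \<le> C * d\<^sup>2 * 0"
    by (intro LIMSEQ_le[OF tendsto_const tendsto_mult_left[OF LIMSEQ_inverse_real_of_nat]]) auto
  then show ?thesis by simp
qed

text \<open>The integrand need not be continuous, so the fundamental theorem of calculus does not apply.\<close>

lemma exp_integral_identity:
  fixes g :: "real \<Rightarrow> real"
  assumes [measurable]: "g \<in> borel_measurable borel" and g: "\<And>s. 0 \<le> g s" "\<And>s. g s \<le> 1" and d: "0 \<le> d"
  shows "exp (\<kappa> * (LBINT s:{0..d}. g s)) - 1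
    = \<kappa> * (LBINT s:{0..d}. g s * exp (\<kappa> * (LBINT r:{0..s}. g r)))"
proof -
  define G where "G t = (LBINT s:{0..t}. g s)" for t
  define B where "B = exp (\<bar>\<kappa>\<bar> * d)"
  have gint: "set_integrable lborel {s..t} g" for s t
    using g by (intro set_integrable_Icc_bounded[where B=1]) auto
  have Gdiff: "G t - G s = (LBINT r:{s..t}. g r)" if "0 \<le> s" "s \<le> t" for s t
    unfolding G_def using LBINT_Icc_split[OF gint that] by simp
  have bnd: "0 \<le> (LBINT r:{s..t}. g r) \<and> (LBINT r:{s..t}. g r) \<le> t - s" if "s \<le> t" for s t
  proof -
    have "(LBINT r:{s..t}. g r) \<le> (LBINT r:{s..t}. 1)"
      using g by (intro set_integral_mono gint set_integrable_Icc_bounded[where B=1]) auto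
    moreover have "0 \<le> (LBINT r:{s..t}. g r)" unfolding set_lebesgue_integral_def
      using g by (intro Bochner_Integration.integral_nonneg) auto
    ultimately show ?thesis using that by (simp add: set_lebesgue_integral_def)
  qed
  have Gm: "G s \<le> G t" "G t - G s \<le> t - s" if "0 \<le> s" "s \<le> t" for s t
    using Gdiff[OF that] bnd[OF that(2)] by auto
  have [measurable]: "G \<in> borel_measurable borel"
  proof -
    have "(\<lambda>(t, s). if 0 \<le> s \<and> s \<le> t then g s else 0) \<in> borel_measurable (borel \<Otimes>\<^sub>M lborel)" by measurable
    then have "(\<lambda>t. LBINT s. (if 0 \<le> s \<and> s \<le> t then g s else 0)) \<in> borel_measurable borel" by measurable
    also have "(\<lambda>t. LBINT s. (if 0 \<le> s \<and> s \<le> t then g s else 0)) = G"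
      unfolding G_def set_lebesgue_integral_def by (intro ext Bochner_Integration.integral_cong) (auto simp: indicator_def)
    finally show ?thesis .
  qed
  have G0: "0 \<le> G t" "G t \<le> d" if "0 \<le> t" "t \<le> d" for t
    using bnd[of 0 t] that by (auto simp: G_def)
  have mB: "\<kappa> * G t \<le> \<bar>\<kappa>\<bar> * d" if "0 \<le> t" "t \<le> d" for t
    using G0[OF that] by (metis abs_ge_self abs_ge_zero abs_mult abs_of_nonneg mult_left_mono order_trans)
  define I where "I t = (LBINT s:{0..t}. g s * exp (\<kappa> * G s))" for t
  have hint: "set_integrable lborel {s..t} (\<lambda>r. g r * exp (\<kappa> * G r))" if "0 \<le> s" "t \<le> d" for s t
  proof (rule set_integrable_Icc_bounded)
    fix x assume "x \<in> {s..t}"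
    then have "exp (\<kappa> * G x) \<le> B" unfolding B_def using that mB[of x] by auto
    then show "\<bar>g x * exp (\<kappa> * G x)\<bar> \<le> 1 * B" unfolding abs_mult using g[of x] by (intro mult_mono) auto
  qed measurable
  \<comment> \<open>Over [s,t] the difference changes only to second order. Replacing exp(\<kappa> G
    r) by its value at s and the Taylor remainder of exp each cost at most \<kappa>^2 B (t - s)^2,
    hence the factor 2 in the constant.\<close>
  have "exp (\<kappa> * G d) - \<kappa> * I d = exp (\<kappa> * G 0) - \<kappa> * I 0"
  proof (rule constant_if_quadratic_increments[where C="2 * \<kappa>\<^sup>2 * B" and D="\<lambda>t. exp (\<kappa> * G t) - \<kappa> * I t"])
    fix s t assume st: "0 \<le> s" "s \<le> t" "t \<le> d"
    let ?u = "\<kappa> * G s" and ?v = "\<kappa> * G t"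
    have gu: "set_integrable lborel {s..t} (\<lambda>r. g r * exp ?u)"
      using gint[of s t] by (simp add: set_integrable_def flip: mult.assoc)
    define c where "c = \<bar>\<kappa>\<bar> * B * (t - s)"
    have Idiff: "I t - I s = (LBINT r:{s..t}. g r * exp (\<kappa> * G r))"
      unfolding I_def using LBINT_Icc_split[OF hint st(1,2)] st by simp
    have "(LBINT r:{s..t}. g r * (exp (\<kappa> * G r) - exp ?u)) = (I t - I s) - (G t - G s) * exp ?u"
      unfolding Idiff Gdiff[OF st(1,2)] right_diff_distrib
      using set_integral_diff(2)[OF hint[of s t] gu] st by simp
    moreover have "\<bar>LBINT r:{s..t}. g r * (exp (\<kappa> * G r) - exp ?u)\<bar> \<le> (LBINT r:{s..t}. c)"
      unfolding set_lebesgue_integral_def real_norm_def[symmetric]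
    proof (rule Bochner_Integration.integral_norm_bound_integral)
      show "integrable lborel (\<lambda>r. indicator {s..t} r *\<^sub>R (g r * (exp (\<kappa> * G r) - exp ?u)))"
        using set_integral_diff(1)[OF hint[of s t] gu] st
        by (simp add: set_integrable_def right_diff_distrib)
      show "integrable lborel (\<lambda>r. indicator {s..t} r *\<^sub>R c)"
        by (simp add: emeasure_lborel_Icc_eq)
      fix r
      show "norm (indicator {s..t} r *\<^sub>R (g r * (exp (\<kappa> * G r) - exp ?u))) \<le> indicator {s..t} r *\<^sub>R c"
      proof (cases "r \<in> {s..t}")
        case True
        have "\<bar>exp (\<kappa> * G r) - exp ?u\<bar> \<le> B * \<bar>\<kappa> * G r - ?u\<bar>"
          unfolding B_def using True st by (intro abs_exp_diff_le mB) auto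
        also have "\<dots> = B * (\<bar>\<kappa>\<bar> * (G r - G s))" using Gm[of s r] True st
          by (simp add: abs_mult flip: right_diff_distrib)
        also have "\<dots> \<le> B * (\<bar>\<kappa>\<bar> * (t - s))" using Gm[of s r] True st
          by (intro mult_left_mono) (auto simp: B_def)
        finally have "\<bar>g r\<bar> * \<bar>exp (\<kappa> * G r) - exp ?u\<bar> \<le> 1 * (B * (\<bar>\<kappa>\<bar> * (t - s)))"
          using g[of r] by (intro mult_mono) auto
        then show ?thesis using True by (simp add: abs_mult mult_ac c_def)
      qed simp
    qed
    moreover have "(LBINT r:{s..t}. c) = \<bar>\<kappa>\<bar> * B * (t - s)\<^sup>2"
      using st by (simp add: set_lebesgue_integral_def power2_eq_square c_def)
    ultimately have 1: "\<bar>(I t - I s) - (G t - G s) * exp ?u\<bar> \<le> \<bar>\<kappa>\<bar> * B * (t - s)\<^sup>2" by simp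
    have "\<bar>exp ?v - exp ?u - (?v - ?u) * exp ?u\<bar> \<le> B * (?v - ?u)\<^sup>2"
      unfolding B_def using st by (intro abs_exp_diff_linear_le mB) auto
    also have "(?v - ?u)\<^sup>2 = \<kappa>\<^sup>2 * (G t - G s)\<^sup>2" by (simp add: power_mult_distrib flip: right_diff_distrib)
    also have "B * (\<kappa>\<^sup>2 * (G t - G s)\<^sup>2) \<le> B * (\<kappa>\<^sup>2 * (t - s)\<^sup>2)"
      using Gm[OF st(1,2)] by (intro mult_left_mono power_mono) (auto simp: B_def)
    finally have 2: "\<bar>exp ?v - exp ?u - (?v - ?u) * exp ?u\<bar> \<le> \<kappa>\<^sup>2 * B * (t - s)\<^sup>2" by (simp add: mult_ac)
    have "\<bar>\<kappa> * ((I t - I s) - (G t - G s) * exp ?u)\<bar> \<le> \<bar>\<kappa>\<bar> * (\<bar>\<kappa>\<bar> * B * (t - s)\<^sup>2)"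
      unfolding abs_mult using 1 by (rule mult_left_mono) simp
    also have "\<dots> = \<kappa>\<^sup>2 * B * (t - s)\<^sup>2" by (simp add: power2_eq_square flip: mult.assoc)
    finally have 3: "\<bar>\<kappa> * ((I t - I s) - (G t - G s) * exp ?u)\<bar> \<le> \<kappa>\<^sup>2 * B * (t - s)\<^sup>2" .
    have "(exp ?v - \<kappa> * I t) - (exp ?u - \<kappa> * I s) =
      (exp ?v - exp ?u - (?v - ?u) * exp ?u) - \<kappa> * ((I t - I s) - (G t - G s) * exp ?u)"
      by (simp add: algebra_simps)
    then show "\<bar>exp ?v - \<kappa> * I t - (exp ?u - \<kappa> * I s)\<bar> \<le> 2 * \<kappa>\<^sup>2 * B * (t - s)\<^sup>2"
      using 2 3 by simp
  qed (rule d)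
  moreover have "G 0 = 0" "I 0 = 0" using bnd[of 0 0]
     unfolding G_def I_def by (auto simp: set_lebesgue_integral_def intro!: integral_eq_zero_AE eventually_mono[OF AE_lborel_singleton[of 0]])
  ultimately show ?thesis unfolding I_def G_def by simp
qed

section \<open>Path space and the Markov property\<close>

text \<open>Sets of this product sigma-algebra depend on countably many coordinates only. Conditions
  on a whole time interval are therefore expressed through rational times or limits along dyadic
  times.\<close>

abbreviation path_space :: "(real \<Rightarrow> real) measure" where
  "path_space \<equiv> PiM UNIV (\<lambda>_. borel)"

lemma measurable_path_space:
  assumes "\<And>t. (\<lambda>\<omega>. f \<omega> t) \<in> borel_measurable N"
  shows "f \<in> measurable N path_space"
  by (rule measurable_PiM_single') (use assms in auto)

lemma (in prob_space) indep_var_cong_space: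
  assumes "\<And>\<omega>. \<omega> \<in> space M \<Longrightarrow> A \<omega> = A' \<omega>" "\<And>\<omega>. \<omega> \<in> space M \<Longrightarrow> B \<omega> = B' \<omega>" and ind: "indep_var S A' T B'"
  shows "indep_var S A T B"
proof -
  have "A -` C \<inter> space M = A' -` C \<inter> space M" "B -` D \<inter> space M = B' -` D \<inter> space M" for C D
    using assms by auto
  moreover have "random_variable S A = random_variable S A'" "random_variable T B = random_variable T B'"
    using assms by (auto intro!: measurable_cong)
  ultimately show ?thesis using ind unfolding indep_var_eq by simp
qed

text \<open>Starting at 0 on the whole space removes a null set from all identities about single
  paths. A general process is reduced to this case by subtracting its initial value.\<close>

locale snlp = spectrally_negative_levy_process +
  assumes X_0: "\<omega> \<in> space M \<Longrightarrow> X 0 \<omega> = 0"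
begin

text \<open>Since the coordinates range over all reals while nothing is known about negative times,
  these are sent to time 0. The same convention is used for the past \<open>stopped\<close> and the
  future \<open>shifted\<close> at a time s.\<close>

definition path :: "'a \<Rightarrow> real \<Rightarrow> real" where
  "path \<omega> t = X (max 0 t) \<omega>"

definition stopped :: "real \<Rightarrow> 'a \<Rightarrow> real \<Rightarrow> real" where
  "stopped s \<omega> t = X (min s (max 0 t)) \<omega>"

definition shifted :: "real \<Rightarrow> 'a \<Rightarrow> real \<Rightarrow> real" where
  "shifted s \<omega> t = X (s + max 0 t) \<omega> - X s \<omega>"

lemma X_measurable[measurable (raw)]: "0 \<le> t \<Longrightarrow> X t \<in> borel_measurable M"
  by (rule random_variable_X)

lemma path_measurable[measurable]: "path \<in> measurable M path_space"
  unfolding path_def by (intro measurable_path_space) auto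

lemma stopped_measurable[measurable]: "0 \<le> s \<Longrightarrow> stopped s \<in> measurable M path_space"
  unfolding stopped_def by (intro measurable_path_space) auto

lemma shifted_measurable[measurable]: "0 \<le> s \<Longrightarrow> shifted s \<in> measurable M path_space"
  unfolding shifted_def by (intro measurable_path_space) auto

text \<open>Independent increments are assumed along increasing sequences indexed by all naturals. A
  finite set of times is therefore listed as such a sequence, constant after its last element;
  repeated times merely produce zero increments.\<close>

lemma sorted_times:
  fixes J :: "real set"
  assumes "finite J" "0 \<in> J" "\<And>x. x \<in> J \<Longrightarrow> 0 \<le> x \<and> x \<le> s" "s \<in> J"
  obtains n :: nat and \<beta> :: "nat \<Rightarrow> real" where "\<beta> 0 = 0" "incseq \<beta>" "\<beta> n = s" "\<And>i. i \<ge> n \<Longrightarrow> \<beta> i = s"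
    "\<And>x. x \<in> J \<Longrightarrow> \<exists>i\<le>n. \<beta> i = x"
proof -
  define l where "l = sorted_list_of_set J"
  have l: "sorted l" "set l = J" "l \<noteq> []" using assms by (auto simp: l_def)
  define n where "n = length l - 1"
  define \<beta> where "\<beta> i = l ! (min i n)" for i
  have nl: "n < length l" using l(3) by (simp add: n_def)
  have inc: "incseq \<beta>" unfolding incseq_def \<beta>_def
    using nl by (auto intro!: sorted_nth_mono[OF l(1)])
  have mem: "\<exists>i\<le>n. \<beta> i = x" if "x \<in> J" for x
  proof -
    have "x \<in> set l" using that l(2) by simp
    then obtain i where i: "i < length l" "l ! i = x" unfolding in_set_conv_nth by blast
    then have "i \<le> n" by (simp add: n_def)
    then have "\<beta> i = x" using i by (simp add: \<beta>_def min_absorb1)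
    then show ?thesis using \<open>i \<le> n\<close> by blast
  qed
  have inJ: "\<beta> i \<in> J" for i unfolding \<beta>_def using nl l(2) by (metis min.strict_coboundedI2 nth_mem)
  have "\<beta> 0 = 0"
  proof -
    obtain i where "\<beta> i = 0" using mem[OF assms(2)] by auto
    then have "\<beta> 0 \<le> 0" using incseqD[OF inc, of 0 i] by simp
    then show ?thesis using assms(3)[OF inJ[of 0]] by simp
  qed
  moreover have n: "\<beta> n = s"
  proof -
    obtain i where "i \<le> n" "\<beta> i = s" using mem[OF assms(4)] by auto
    then have "s \<le> \<beta> n" using incseqD[OF inc, of i n] by simp
    then show ?thesis using assms(3)[OF inJ[of n]] by simp
  qed
  moreover have "\<beta> i = s" if "i \<ge> n" for i using n that by (simp add: \<beta>_def min_def)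
  ultimately show ?thesis using inc mem by (intro that[of \<beta> n])
qed

text \<open>Take one partition that contains all relevant times before s, then s, then all relevant
  times after it. Coordinates of the stopped path are partial sums over the first block of
  increments, those of the shifted path over the second, and disjoint blocks are
  independent.\<close>

lemma stopped_shifted_indep_finite:
  assumes s: "0 \<le> s" and J: "finite J" and L: "finite L"
  shows "indep_var (PiM J (\<lambda>_. borel)) (\<lambda>\<omega>. restrict (stopped s \<omega>) J)
    (PiM L (\<lambda>_. borel)) (\<lambda>\<omega>. restrict (shifted s \<omega>) L)"
proof -
  define cJ where "cJ j = min s (max 0 j)" for j :: real
  obtain n \<beta> where \<beta>: "\<beta> 0 = 0" "incseq \<beta>" "\<beta> n = s" "\<And>i. i \<ge> n \<Longrightarrow> \<beta> i = s"
    "\<And>x. x \<in> insert 0 (insert s (cJ ` J)) \<Longrightarrow> \<exists>i\<le>n. \<beta> i = x"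
  proof (rule sorted_times[of "insert 0 (insert s (cJ ` J))" s])
    show "\<And>x. x \<in> insert 0 (insert s (cJ ` J)) \<Longrightarrow> 0 \<le> x \<and> x \<le> s" using s by (auto simp: cJ_def)
  qed (use J in auto)
  define S where "S = Max (insert 0 (max 0 ` L))"
  have S: "x \<le> S" if "x \<in> insert 0 (max 0 ` L)" for x unfolding S_def using that L by (intro Max_ge) auto
  have SI: "S \<in> insert 0 (max 0 ` L)" unfolding S_def using L by (intro Max_in) auto
  obtain m \<gamma> where \<gamma>: "\<gamma> 0 = 0" "incseq \<gamma>" "\<gamma> m = S" "\<And>i. i \<ge> m \<Longrightarrow> \<gamma> i = S"
    "\<And>x. x \<in> insert 0 (max 0 ` L) \<Longrightarrow> \<exists>i\<le>m. \<gamma> i = x"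
  proof (rule sorted_times[of "insert 0 (max 0 ` L)" S])
    show "\<And>x. x \<in> insert 0 (max 0 ` L) \<Longrightarrow> 0 \<le> x \<and> x \<le> S" using S by auto
    show "S \<in> insert 0 (max 0 ` L)" using SI by simp
  qed (use L in auto)
  \<comment> \<open>Truncated subtraction glues the two lists: up to index \<open>n\<close> the
    second summand is \<gamma> 0 = 0, and from \<open>n\<close> on the first one is the constant
    s.\<close>
  define t where "t i = \<beta> i + \<gamma> (i - n)" for i
  have t0: "t 0 = 0" by (simp add: t_def \<beta> \<gamma>)
  have t1: "t i = \<beta> i" if "i \<le> n" for i using that by (simp add: t_def \<gamma>)
  have t2: "t (n + i) = s + \<gamma> i" for i by (simp add: t_def \<beta>(4))
  have tinc: "incseq t" unfolding t_def incseq_def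
    using \<beta>(2) \<gamma>(2) by (auto intro!: add_mono simp: incseq_def)
  define D where "D i \<omega> = X (t (Suc i)) \<omega> - X (t i) \<omega>" for i \<omega>
  have ind: "indep_vars (\<lambda>_. borel) D {..<n+m}"
    unfolding D_def using independent_increments[of t "n+m"] t0 tinc by simp
  have "\<forall>j\<in>J. \<exists>k. k \<le> n \<and> \<beta> k = cJ j" using \<beta>(5) by blast
  from bchoice[OF this] obtain a where a: "\<And>j. j \<in> J \<Longrightarrow> a j \<le> n \<and> \<beta> (a j) = cJ j" by blast
  have "\<forall>l\<in>L. \<exists>k. k \<le> m \<and> \<gamma> k = max 0 l" using \<gamma>(5) by blast
  from bchoice[OF this] obtain b where b: "\<And>l. l \<in> L \<Longrightarrow> b l \<le> m \<and> \<gamma> (b l) = max 0 l" by blast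
  have tel1: "X (t k) \<omega> = (\<Sum>i<k. D i \<omega>)" if "\<omega> \<in> space M" for k \<omega>
    unfolding D_def using sum_lessThan_telescope[of "\<lambda>i. X (t i) \<omega>" k] X_0[OF that] t0 by simp
  have tel2: "X (t (n + k)) \<omega> - X (t n) \<omega> = (\<Sum>i=n..<n+k. D i \<omega>)" for k \<omega>
    unfolding D_def using sum_Suc_diff'[of n "n+k" "\<lambda>i. X (t i) \<omega>"] by simp
  have I: "indep_var (PiM {..<n} (\<lambda>_. borel)) (\<lambda>\<omega>. restrict (\<lambda>i. D i \<omega>) {..<n})
     (PiM {n..<n+m} (\<lambda>_. borel)) (\<lambda>\<omega>. restrict (\<lambda>i. D i \<omega>) {n..<n+m})"
    by (rule indep_var_restrict[OF ind]) auto
  have I2: "indep_var (PiM J (\<lambda>_. borel)) ((\<lambda>v. \<lambda>j\<in>J. \<Sum>i<a j. v i :: real) \<circ> (\<lambda>\<omega>. restrict (\<lambda>i. D i \<omega>) {..<n}))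
     (PiM L (\<lambda>_. borel)) ((\<lambda>v. \<lambda>l\<in>L. \<Sum>i=n..<n+b l. v i :: real) \<circ> (\<lambda>\<omega>. restrict (\<lambda>i. D i \<omega>) {n..<n+m}))"
    by (rule indep_var_compose[OF I])
       (use a b in \<open>force intro!: measurable_restrict borel_measurable_sum measurable_component_singleton\<close>)+
  have 1: "restrict (stopped s \<omega>) J = (\<lambda>j\<in>J. \<Sum>i<a j. restrict (\<lambda>i. D i \<omega>) {..<n} i)" if "\<omega> \<in> space M" for \<omega>
  proof (rule restrict_ext)
    fix j assume j: "j \<in> J"
    have "stopped s \<omega> j = X (t (a j)) \<omega>" using a[OF j] t1[of "a j"] by (simp add: stopped_def cJ_def)
    also have "\<dots> = (\<Sum>i<a j. D i \<omega>)" by (rule tel1[OF that])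
    also have "\<dots> = (\<Sum>i<a j. restrict (\<lambda>i. D i \<omega>) {..<n} i)" using a[OF j] by (intro sum.cong) auto
    finally show "stopped s \<omega> j = (\<Sum>i<a j. restrict (\<lambda>i. D i \<omega>) {..<n} i)" .
  qed
  have 2: "restrict (shifted s \<omega>) L = (\<lambda>l\<in>L. \<Sum>i=n..<n+b l. restrict (\<lambda>i. D i \<omega>) {n..<n+m} i)" for \<omega>
  proof (rule restrict_ext)
    fix l assume l: "l \<in> L"
    have "shifted s \<omega> l = X (t (n + b l)) \<omega> - X (t n) \<omega>"
      using b[OF l] t2[of "b l"] t1[of n] \<beta>(3) by (simp add: shifted_def)
    also have "\<dots> = (\<Sum>i=n..<n+b l. D i \<omega>)" by (rule tel2)
    also have "\<dots> = (\<Sum>i=n..<n+b l. restrict (\<lambda>i. D i \<omega>) {n..<n+m} i)" using b[OF l] by (intro sum.cong) auto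
    finally show "shifted s \<omega> l = (\<Sum>i=n..<n+b l. restrict (\<lambda>i. D i \<omega>) {n..<n+m} i)" .
  qed
  show ?thesis
    by (rule indep_var_cong_space[OF _ _ I2]) (simp_all add: 1 2)
qed

text \<open>The increments along u + \<gamma> are independent with laws that do not depend on u, and
  the coordinates are the same function of them for every u. Comparing u = s with u = 0 gives the
  claim.\<close>

lemma shifted_law_finite:
  assumes s: "0 \<le> s" and L: "finite L"
  shows "distr M (PiM L (\<lambda>_. borel)) (\<lambda>\<omega>. restrict (shifted s \<omega>) L) =
    distr M (PiM L (\<lambda>_. borel)) (\<lambda>\<omega>. restrict (path \<omega>) L)"
proof -
  define S where "S = Max (insert 0 (max 0 ` L))"
  have S: "x \<le> S" if "x \<in> insert 0 (max 0 ` L)" for x unfolding S_def using that L by (intro Max_ge) auto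
  have SI: "S \<in> insert 0 (max 0 ` L)" unfolding S_def using L by (intro Max_in) auto
  obtain m \<gamma> where \<gamma>: "\<gamma> 0 = 0" "incseq \<gamma>" "\<gamma> m = S" "\<And>i. i \<ge> m \<Longrightarrow> \<gamma> i = S"
    "\<And>x. x \<in> insert 0 (max 0 ` L) \<Longrightarrow> \<exists>i\<le>m. \<gamma> i = x"
  proof (rule sorted_times[of "insert 0 (max 0 ` L)" S])
    show "\<And>x. x \<in> insert 0 (max 0 ` L) \<Longrightarrow> 0 \<le> x \<and> x \<le> S" using S by auto
    show "S \<in> insert 0 (max 0 ` L)" using SI by simp
  qed (use L in auto)
  have \<gamma>nn: "0 \<le> \<gamma> i" for i using incseqD[OF \<gamma>(2), of 0 i] \<gamma>(1) by simp
  have "\<forall>l\<in>L. \<exists>k. k \<le> m \<and> \<gamma> k = max 0 l" using \<gamma>(5) by blast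
  from bchoice[OF this] obtain b where b: "\<And>l. l \<in> L \<Longrightarrow> b l \<le> m \<and> \<gamma> (b l) = max 0 l" by blast
  define D where "D u i \<omega> = X (u + \<gamma> (Suc i)) \<omega> - X (u + \<gamma> i) \<omega>" for u i \<omega>
  have Dm: "D u i \<in> borel_measurable M" if "0 \<le> u" for u i
    unfolding D_def using that \<gamma>nn by (intro borel_measurable_diff X_measurable) auto
  \<comment> \<open>One increment more than the coordinates need: the index set must be nonempty for
    independence to be expressed as a product law, and \<open>m\<close> may be 0.\<close>
  let ?I = "{..<Suc m}"
  have ind: "indep_vars (\<lambda>_. borel) (D u) ?I" if "0 \<le> u" for u
    unfolding D_def using that \<gamma>(1,2) by (intro independent_increments) (auto simp: incseq_def)
  have D_fun: "D u i = (\<lambda>\<omega>. X (u + \<gamma> (Suc i)) \<omega> - X (u + \<gamma> i) \<omega>)" for u i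
    by (simp add: fun_eq_iff D_def)
  have DI: "distr M borel (D u i) = distr M borel (\<lambda>\<omega>. X (\<gamma> (Suc i) - \<gamma> i) \<omega> - X 0 \<omega>)" if "0 \<le> u" for u i
    using stationary_increments[of "u + \<gamma> i" "\<gamma> (Suc i) - \<gamma> i"] that \<gamma>nn incseqD[OF \<gamma>(2), of i "Suc i"]
    by (simp add: D_fun add.assoc)
  have law: "distr M (PiM ?I (\<lambda>_. borel)) (\<lambda>\<omega>. \<lambda>i\<in>?I. D u i \<omega>) = PiM ?I (\<lambda>i. distr M borel (\<lambda>\<omega>. X (\<gamma> (Suc i) - \<gamma> i) \<omega> - X 0 \<omega>))" if "0 \<le> u" for u
    using iffD1[OF indep_vars_iff_distr_eq_PiM'[of ?I "D u" "\<lambda>_. borel"] ind[OF that]] Dm[OF that] DI[OF that]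
    by (simp add: lessThan_empty_iff)
  define F where "F v = (\<lambda>l\<in>L. \<Sum>i<b l. v i :: real)" for v
  have Fm: "F \<in> measurable (PiM ?I (\<lambda>_. borel)) (PiM L (\<lambda>_. borel))"
    unfolding F_def using b by (force intro!: measurable_restrict borel_measurable_sum measurable_component_singleton)
  have *: "restrict (shifted u \<omega>) L = F (\<lambda>i\<in>?I. D u i \<omega>)" for u \<omega>
    unfolding F_def
  proof (rule restrict_ext)
    fix l assume l: "l \<in> L"
    have "shifted u \<omega> l = X (u + \<gamma> (b l)) \<omega> - X (u + \<gamma> 0) \<omega>"
      using b[OF l] by (simp add: shifted_def \<gamma>)
    also have "\<dots> = (\<Sum>i<b l. D u i \<omega>)" unfolding D_def
      using sum_lessThan_telescope[of "\<lambda>i. X (u + \<gamma> i) \<omega>" "b l"] by simp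
    also have "\<dots> = (\<Sum>i<b l. (\<lambda>i\<in>?I. D u i \<omega>) i)" using b[OF l] by (intro sum.cong) auto
    finally show "shifted u \<omega> l = (\<Sum>i<b l. (\<lambda>i\<in>?I. D u i \<omega>) i)" .
  qed
  have vm: "(\<lambda>\<omega>. \<lambda>i\<in>?I. D u i \<omega>) \<in> measurable M (PiM ?I (\<lambda>_. borel))" if "0 \<le> u" for u
    by (intro measurable_restrict Dm that)
  have "distr M (PiM L (\<lambda>_. borel)) (\<lambda>\<omega>. restrict (shifted u \<omega>) L) =
     distr (PiM ?I (\<lambda>i. distr M borel (\<lambda>\<omega>. X (\<gamma> (Suc i) - \<gamma> i) \<omega> - X 0 \<omega>))) (PiM L (\<lambda>_. borel)) F" if "0 \<le> u" for u
    unfolding law[OF that, symmetric] by (subst distr_distr[OF Fm vm[OF that]]) (simp add: * comp_def)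
  from this[OF s] this[of 0] have "distr M (PiM L (\<lambda>_. borel)) (\<lambda>\<omega>. restrict (shifted s \<omega>) L) =
     distr M (PiM L (\<lambda>_. borel)) (\<lambda>\<omega>. restrict (shifted 0 \<omega>) L)" by simp
  also have "\<dots> = distr M (PiM L (\<lambda>_. borel)) (\<lambda>\<omega>. restrict (path \<omega>) L)"
    by (rule distr_cong) (auto simp: shifted_def path_def X_0)
  finally show ?thesis .
qed

lemma emb_vimage:
  "f -` prod_emb UNIV (\<lambda>_. borel) J (Pi\<^sub>E J E) \<inter> space M = (\<lambda>\<omega>. restrict (f \<omega>) J) -` (Pi\<^sub>E J E) \<inter> space M"
  for f :: "'a \<Rightarrow> real \<Rightarrow> real" and E :: "real \<Rightarrow> real set"
  by (auto simp: prod_emb_def PiE_def)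

lemma shifted_law:
  assumes s: "0 \<le> s"
  shows "distr M path_space (shifted s) = distr M path_space path"
proof (rule measure_eqI_PiM_infinite)
  note [measurable] = shifted_measurable[OF s]
  show "finite_measure (distr M path_space (shifted s))"
    by (intro prob_space.finite_measure prob_space_distr) simp
  fix J :: "real set" and A :: "real \<Rightarrow> real set" assume J: "finite J" "\<And>i. i \<in> J \<Longrightarrow> A i \<in> sets borel"
  have P: "Pi\<^sub>E J A \<in> sets (PiM J (\<lambda>_. borel))" using J by (intro sets_PiM_I_finite) auto
  have E: "prod_emb UNIV (\<lambda>_. borel) J (Pi\<^sub>E J A) \<in> sets path_space" using J P by (intro measurable_prod_emb) auto
  have r1: "(\<lambda>\<omega>. restrict (f \<omega>) J) \<in> measurable M (PiM J (\<lambda>_. borel))" if "f \<in> measurable M path_space" for f :: "'a \<Rightarrow> real \<Rightarrow> real"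
    by (rule measurable_compose[OF that measurable_restrict_subset]) simp
  have em: "emeasure (distr M path_space f) (prod_emb UNIV (\<lambda>_. borel) J (Pi\<^sub>E J A)) =
     emeasure (distr M (PiM J (\<lambda>_. borel)) (\<lambda>\<omega>. restrict (f \<omega>) J)) (Pi\<^sub>E J A)"
     if f: "f \<in> measurable M path_space" for f
    using E P by (simp add: emeasure_distr f r1 emb_vimage)
  show "emeasure (distr M path_space (shifted s)) (prod_emb UNIV (\<lambda>_. borel) J (Pi\<^sub>E J A)) =
     emeasure (distr M path_space path) (prod_emb UNIV (\<lambda>_. borel) J (Pi\<^sub>E J A))"
    by (simp add: em shifted_law_finite[OF s J(1)])
qed auto

text \<open>Cylinder sets form an intersection-stable generator on either side, so independence of
  the finite-dimensional marginals carries over to the whole paths.\<close>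

lemma stopped_shifted_indep:
  assumes s: "0 \<le> s"
  shows "indep_var path_space (stopped s) path_space (shifted s)"
proof -
  note [measurable] = shifted_measurable[OF s] stopped_measurable[OF s]
  let ?G = "prod_algebra UNIV (\<lambda>_. borel :: real measure) :: (real \<Rightarrow> real) set set"
  have gen: "{f -` A \<inter> space M | A. A \<in> sets path_space} = sigma_sets (space M) {f -` A \<inter> space M | A. A \<in> ?G}"
    for f :: "'a \<Rightarrow> real \<Rightarrow> real"
    unfolding sets_PiM by (rule sigma_sets_vimage_commute) (auto simp: PiE_def)
  have st: "Int_stable {f -` A \<inter> space M | A. A \<in> ?G}" for f :: "'a \<Rightarrow> real \<Rightarrow> real"
    unfolding Int_stable_def
  proof safe
    fix A B assume AB: "A \<in> ?G" "B \<in> ?G"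
    show "\<exists>C. (f -` A \<inter> space M) \<inter> (f -` B \<inter> space M) = f -` C \<inter> space M \<and> C \<in> ?G"
      using Int_stableD[OF Int_stable_prod_algebra AB] by (intro exI[of _ "A \<inter> B"]) auto
  qed
  have GS: "?G \<subseteq> sets path_space" unfolding sets_PiM by auto
  have "indep_set {stopped s -` A \<inter> space M | A. A \<in> ?G} {shifted s -` A \<inter> space M | A. A \<in> ?G}"
    unfolding indep_sets2_eq
  proof (intro conjI ballI)
    show "{stopped s -` A \<inter> space M |A. A \<in> ?G} \<subseteq> events" "{shifted s -` A \<inter> space M |A. A \<in> ?G} \<subseteq> events"
      using GS by auto
    fix a b assume "a \<in> {stopped s -` A \<inter> space M |A. A \<in> ?G}" "b \<in> {shifted s -` A \<inter> space M |A. A \<in> ?G}"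
    then obtain A B where ab: "a = stopped s -` A \<inter> space M" "b = shifted s -` B \<inter> space M" "A \<in> ?G" "B \<in> ?G" by auto
    obtain J E where A: "A = prod_emb UNIV (\<lambda>_. borel) J (Pi\<^sub>E J E)" "finite J" "\<And>i. i \<in> J \<Longrightarrow> E i \<in> sets borel"
      using prod_algebraE[OF ab(3)] by metis
    obtain L F where B: "B = prod_emb UNIV (\<lambda>_. borel) L (Pi\<^sub>E L F)" "finite L" "\<And>i. i \<in> L \<Longrightarrow> F i \<in> sets borel"
      using prod_algebraE[OF ab(4)] by metis
    have "Pi\<^sub>E J E \<in> sets (PiM J (\<lambda>_. borel))" "Pi\<^sub>E L F \<in> sets (PiM L (\<lambda>_. borel))"
      using A B by (auto intro!: sets_PiM_I_finite)
    from indep_varD[OF stopped_shifted_indep_finite[OF s A(2) B(2)] this]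
    show "prob (a \<inter> b) = prob a * prob b"
      unfolding ab A B emb_vimage
      by (simp add: Int_def vimage_def conj_ac)
  qed
  from indep_set_sigma_sets[OF this st st] show ?thesis
    unfolding indep_var_eq gen[symmetric]
    using sigma_sets_vimage_commute[of "stopped s" "space M" UNIV "sets path_space"] sigma_sets_vimage_commute[of "shifted s" "space M" UNIV "sets path_space"]
      sets.sigma_sets_eq[of path_space] by (simp add: space_PiM PiE_def)
qed

text \<open>Past and future have the product law and the future is distributed like the whole path.
  With values in [0, \<infinity>] no integrability has to be checked before use.\<close>

lemma markov:
  assumes s: "0 \<le> s" and \<Psi>[measurable]: "(\<lambda>(v, w). \<Psi> v w) \<in> borel_measurable (path_space \<Otimes>\<^sub>M path_space)"
  shows "(\<integral>\<^sup>+\<omega>. \<Psi> (stopped s \<omega>) (shifted s \<omega>) \<partial>M) = (\<integral>\<^sup>+\<omega>. (\<integral>\<^sup>+\<omega>'. \<Psi> (stopped s \<omega>) (path \<omega>') \<partial>M) \<partial>M)"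
proof -
  note [measurable] = shifted_measurable[OF s] stopped_measurable[OF s]
  interpret Q: prob_space "distr M path_space path" by (rule prob_space_distr) simp
  have \<Psi>2: "\<Psi> v \<in> borel_measurable path_space" for v
    using measurable_compose[OF measurable_Pair1' \<Psi>, of v] by (simp add: space_PiM PiE_def)
  have "(\<integral>\<^sup>+\<omega>. \<Psi> (stopped s \<omega>) (shifted s \<omega>) \<partial>M)
    = (\<integral>\<^sup>+p. (case p of (v, w) \<Rightarrow> \<Psi> v w) \<partial>distr M (path_space \<Otimes>\<^sub>M path_space) (\<lambda>\<omega>. (stopped s \<omega>, shifted s \<omega>)))"
    by (subst nn_integral_distr) auto
  also have "distr M (path_space \<Otimes>\<^sub>M path_space) (\<lambda>\<omega>. (stopped s \<omega>, shifted s \<omega>))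
    = distr M path_space (stopped s) \<Otimes>\<^sub>M distr M path_space path"
    using stopped_shifted_indep[OF s] shifted_law[OF s] unfolding indep_var_distribution_eq by simp
  also have "(\<integral>\<^sup>+p. (case p of (v, w) \<Rightarrow> \<Psi> v w) \<partial>\<dots>)
    = (\<integral>\<^sup>+v. (\<integral>\<^sup>+w. \<Psi> v w \<partial>distr M path_space path) \<partial>distr M path_space (stopped s))"
    by (subst Q.nn_integral_fst[symmetric]) (auto simp: measurable_cong_sets[OF sets_pair_measure_cong[OF sets_distr sets_distr] refl])
  also have "\<dots> = (\<integral>\<^sup>+\<omega>. (\<integral>\<^sup>+\<omega>'. \<Psi> (stopped s \<omega>) (path \<omega>') \<partial>M) \<partial>M)"
    using \<Psi>2 by (simp add: nn_integral_distr)
  finally show ?thesis .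
qed

end

section \<open>Upward passage at dyadic times\<close>

text \<open>The right endpoint of the dyadic cell with index \<open>k\<close>, hence the shift by
  one: it lies strictly to the right of every time in the cell and is never 0. Approximation
  strictly from the right is what right-continuity of the paths asks for.\<close>

definition grid :: "nat \<Rightarrow> nat \<Rightarrow> real" where
  "grid n k = (real k + 1) / 2 ^ n"

lemma grid_pos: "0 < grid n k" by (simp add: grid_def)

lemma grid_nonneg[simp]: "0 \<le> grid n k" using grid_pos[of n k] by simp

lemma grid_floor:
  assumes "0 \<le> t"
  shows "t < grid n (nat \<lfloor>2 ^ n * t\<rfloor>)" "grid n (nat \<lfloor>2 ^ n * t\<rfloor>) \<le> t + (1/2) ^ n"
proof -
  have r: "real (nat \<lfloor>2 ^ n * t\<rfloor>) = of_int \<lfloor>2 ^ n * t\<rfloor>" using assms by simp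
  have "2 ^ n * t < real (nat \<lfloor>2 ^ n * t\<rfloor>) + 1" unfolding r by linarith
  then show "t < grid n (nat \<lfloor>2 ^ n * t\<rfloor>)" by (simp add: grid_def field_simps)
  have "real (nat \<lfloor>2 ^ n * t\<rfloor>) \<le> 2 ^ n * t" unfolding r by linarith
  then show "grid n (nat \<lfloor>2 ^ n * t\<rfloor>) \<le> t + (1/2) ^ n" by (simp add: grid_def field_simps)
qed

lemma grid_floor_tendsto:
  assumes "0 \<le> t" shows "(\<lambda>n. grid n (nat \<lfloor>2 ^ n * t\<rfloor>)) \<longlonglongrightarrow> t"
proof (rule tendsto_sandwich[of "\<lambda>_. t" _ _ "\<lambda>n. t + (1/2) ^ n"])
  have "(\<lambda>n. t + (1/2) ^ n) \<longlonglongrightarrow> t + 0" by (intro tendsto_add tendsto_const LIMSEQ_realpow_zero) auto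
  then show "(\<lambda>n. t + (1/2) ^ n) \<longlonglongrightarrow> t" by simp
qed (use grid_floor[OF assms] in \<open>auto intro!: less_imp_le always_eventually\<close>)

text \<open>Additivity gives linearity on dyadic times; any other time is approached by them from
  the right, where the limit at 0 controls the remainder.\<close>

lemma additive_linear:
  fixes l :: "real \<Rightarrow> real"
  assumes add: "\<And>s t. 0 \<le> s \<Longrightarrow> 0 \<le> t \<Longrightarrow> l (s + t) = l s + l t"
    and lim: "(l \<longlongrightarrow> 0) (at_right 0)" and t: "0 \<le> t"
  shows "l t = t * l 1"
proof -
  have l0: "l 0 = 0" using add[of 0 0] by simp
  have nat: "l (real k * s) = real k * l s" if "0 \<le> s" for k s
  proof (induction k)
    case (Suc k)
    then show ?case using add[of "real k * s" s] that by (simp add: algebra_simps)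
  qed (simp add: l0)
  have gr: "l (grid n k) = grid n k * l 1" for n k
  proof -
    have "l 1 = 2 ^ n * l (1 / 2 ^ n)" using nat[of "1 / 2 ^ n" "2 ^ n"] by simp
    then show ?thesis using nat[of "1 / 2 ^ n" "Suc k"] by (simp add: grid_def field_simps)
  qed
  define r where "r n = grid n (nat \<lfloor>2 ^ n * t\<rfloor>)" for n
  have r: "r n > t" for n unfolding r_def using grid_floor(1)[OF t] by simp
  have rt: "r \<longlonglongrightarrow> t" unfolding r_def by (rule grid_floor_tendsto[OF t])
  have "(\<lambda>n. r n - t) \<longlonglongrightarrow> t - t" by (intro tendsto_intros rt)
  then have "filterlim (\<lambda>n. r n - t) (at_right 0) sequentially"
    using r by (auto simp: filterlim_at intro!: always_eventually)
  then have "(\<lambda>n. l (r n - t)) \<longlonglongrightarrow> 0" by (rule filterlim_compose[OF lim])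
  then have "(\<lambda>n. l t + l (r n - t)) \<longlonglongrightarrow> l t + 0" by (intro tendsto_intros)
  moreover have "l t + l (r n - t) = r n * l 1" for n
    using add[of t "r n - t"] t r[of n] gr by (simp add: r_def)
  ultimately have "(\<lambda>n. r n * l 1) \<longlonglongrightarrow> l t" by simp
  moreover have "(\<lambda>n. r n * l 1) \<longlonglongrightarrow> t * l 1" by (intro tendsto_intros rt)
  ultimately show ?thesis by (rule LIMSEQ_unique)
qed

text \<open>Rational times make this measurable on the path space; on a right-continuous path it says that
  the level \<open>y\<close> is exceeded in \<open>(0, t)\<close>, that is, \<open>\<tau>\<^sub>y\<^sup>+ < t\<close>.\<close>

definition crossed :: "real \<Rightarrow> real \<Rightarrow> (real \<Rightarrow> real) \<Rightarrow> bool" where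
  "crossed y t w \<longleftrightarrow> (\<exists>r\<in>\<rat>. 0 < r \<and> r < t \<and> y < w r)"

lemma crossed_measurable[measurable (raw)]:
  assumes [measurable]: "f \<in> borel_measurable N" "g \<in> borel_measurable N" "h \<in> measurable N path_space"
  shows "Measurable.pred N (\<lambda>x. crossed (f x) (g x) (h x))"
proof -
  have "crossed (f x) (g x) (h x) \<longleftrightarrow> (\<exists>i::rat. 0 < real_of_rat i \<and> real_of_rat i < g x \<and> f x < h x (real_of_rat i))" for x
    by (auto simp: crossed_def Rats_def)
  then show ?thesis by simp
qed

lemma crossed_mono: "crossed y t w \<Longrightarrow> y' \<le> y \<Longrightarrow> t \<le> t' \<Longrightarrow> crossed y' t' w"
  unfolding crossed_def by force

context snlp begin

section \<open>First passage upwards on sample paths\<close>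

lemma X_right_continuous: "\<omega> \<in> space M \<Longrightarrow> 0 \<le> t \<Longrightarrow> ((\<lambda>s. X s \<omega>) \<longlongrightarrow> X t \<omega>) (at_right t)"
  using right_continuous[of \<omega> t] by (simp add: continuous_within)

lemma path_eq[simp]: "0 \<le> t \<Longrightarrow> path \<omega> t = X t \<omega>"
  by (simp add: path_def)

lemma stopped_eq: "0 \<le> t \<Longrightarrow> t \<le> s \<Longrightarrow> stopped s \<omega> t = X t \<omega>"
  by (simp add: stopped_def min_def)

lemma shifted_eq: "0 \<le> t \<Longrightarrow> shifted s \<omega> t = X (s + t) \<omega> - X s \<omega>"
  by (simp add: shifted_def)

lemma ex_rat_right:
  assumes "\<omega> \<in> space M" "0 \<le> r" "r < t" "y < X r \<omega>"
  shows "\<exists>q\<in>\<rat>. r < q \<and> q < t \<and> y < X q \<omega>"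
proof -
  have "\<forall>\<^sub>F s in at_right r. y < X s \<omega>"
    using order_tendstoD(1)[OF X_right_continuous[OF assms(1,2)] assms(4)] .
  then obtain b where b: "b > r" "\<And>s. r < s \<Longrightarrow> s < b \<Longrightarrow> y < X s \<omega>"
    by (auto simp: eventually_at_right_field)
  obtain q where "q \<in> \<rat>" "r < q" "q < min b t" using Rats_dense_in_real[of r "min b t"] b(1) assms(3) by auto
  then show ?thesis using b by auto
qed

lemma crossed_path:
  assumes "\<omega> \<in> space M"
  shows "crossed y t (path \<omega>) \<longleftrightarrow> (\<exists>r. 0 < r \<and> r < t \<and> y < X r \<omega>)"
proof
  assume "\<exists>r. 0 < r \<and> r < t \<and> y < X r \<omega>"
  then obtain r where r: "0 < r" "r < t" "y < X r \<omega>" by auto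
  obtain q where "q \<in> \<rat>" "r < q" "q < t" "y < X q \<omega>"
    using ex_rat_right[OF assms, of r t y] r by auto
  then show "crossed y t (path \<omega>)" using r unfolding crossed_def by (intro bexI[of _ q]) auto
qed (auto simp: crossed_def)

lemma crossed_shifted:
  assumes "\<omega> \<in> space M" "0 \<le> s"
  shows "crossed y t (shifted s \<omega>) \<longleftrightarrow> (\<exists>r. s < r \<and> r < s + t \<and> X s \<omega> + y < X r \<omega>)"
proof
  assume "\<exists>r. s < r \<and> r < s + t \<and> X s \<omega> + y < X r \<omega>"
  then obtain r where r: "s < r" "r < s + t" "X s \<omega> + y < X r \<omega>" by auto
  have "\<forall>\<^sub>F u in at_right r. X s \<omega> + y < X u \<omega>"
    using order_tendstoD(1)[OF X_right_continuous[of \<omega> r] r(3)] assms r by simp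
  then obtain b where b: "b > r" "\<And>u. r < u \<Longrightarrow> u < b \<Longrightarrow> X s \<omega> + y < X u \<omega>"
    by (auto simp: eventually_at_right_field)
  obtain q where "q \<in> \<rat>" "r - s < q" "q < min (b - s) t" using Rats_dense_in_real[of "r - s" "min (b - s) t"] b(1) r by auto
  then show "crossed y t (shifted s \<omega>)" unfolding crossed_def using b(2)[of "s + q"] r
    by (intro bexI[of _ q]) (auto simp: shifted_eq)
next
  assume "crossed y t (shifted s \<omega>)"
  then obtain q where "0 < q" "q < t" "y < shifted s \<omega> q" unfolding crossed_def by auto
  then show "\<exists>r. s < r \<and> r < s + t \<and> X s \<omega> + y < X r \<omega>"
    by (intro exI[of _ "s + q"]) (auto simp: shifted_eq)
qed

lemma crossed_stopped: "t \<le> s \<Longrightarrow> crossed y t (stopped s \<omega>) \<longleftrightarrow> crossed y t (path \<omega>)"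
  unfolding crossed_def by (intro bex_cong) (auto simp: stopped_eq)

definition \<tau> :: "real \<Rightarrow> 'a \<Rightarrow> ereal" where
  "\<tau> y \<omega> = passage_above y (\<lambda>t. X t \<omega>)"

text \<open>If the level is never exceeded the value is 0, so the integrands below carry a separate
  test of finiteness.\<close>

abbreviation T :: "real \<Rightarrow> 'a \<Rightarrow> real" where
  "T y \<omega> \<equiv> real_of_ereal (\<tau> y \<omega>)"

lemma \<tau>_less_iff: "\<omega> \<in> space M \<Longrightarrow> \<tau> y \<omega> < ereal t \<longleftrightarrow> crossed y t (path \<omega>)"
  unfolding \<tau>_def passage_above_def Inf_less_iff crossed_path by auto

lemma \<tau>_nonneg: "0 \<le> \<tau> y \<omega>"
  unfolding \<tau>_def passage_above_def by (intro Inf_greatest) auto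

lemma T_nonneg[simp]: "0 \<le> T y \<omega>"
  using \<tau>_nonneg by (simp add: real_of_ereal_pos)

lemma \<tau>_finite: "\<tau> y \<omega> < \<infinity> \<Longrightarrow> \<tau> y \<omega> = ereal (T y \<omega>)"
  using \<tau>_nonneg[of y \<omega>] by (cases "\<tau> y \<omega>") auto

lemma T_less_iff: "\<omega> \<in> space M \<Longrightarrow> \<tau> y \<omega> < \<infinity> \<Longrightarrow> T y \<omega> < t \<longleftrightarrow> crossed y t (path \<omega>)"
  using \<tau>_less_iff[of \<omega> y t] \<tau>_finite[of y \<omega>] by (metis less_ereal.simps(1))

lemma crossed_imp_finite: "\<omega> \<in> space M \<Longrightarrow> crossed y t (path \<omega>) \<Longrightarrow> \<tau> y \<omega> < \<infinity>"
  using \<tau>_less_iff[of \<omega> y t] by auto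

text \<open>Measurability jointly in the level is needed because the level is integrated by Fubini
  and, for a process that starts at 0 only almost surely, is itself random.\<close>

lemma \<tau>_measurable_pair[measurable]: "(\<lambda>(y, \<omega>). \<tau> y \<omega>) \<in> borel_measurable (borel \<Otimes>\<^sub>M M)"
proof (rule borel_measurableI_less)
  fix t :: ereal
  \<comment> \<open>\<open>crossed\<close> takes a real time, so the extended bound is truncated at
    every natural number; for an infinite bound the truncations exhaust all finite passage
    times.\<close>
  have eq: "{p \<in> space (borel \<Otimes>\<^sub>M M). (case p of (y, \<omega>) \<Rightarrow> \<tau> y \<omega>) < t} =
    (\<Union>n::nat. {p \<in> space (borel \<Otimes>\<^sub>M M). t > 0 \<and> crossed (fst p) (real_of_ereal (min (ereal n) t)) (path (snd p))})"
  proof safe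
    fix y \<omega> assume p: "(y, \<omega>) \<in> space (borel \<Otimes>\<^sub>M M)" and l: "\<tau> y \<omega> < t"
    from p have \<omega>: "\<omega> \<in> space M" by (simp add: space_pair_measure)
    have t: "0 < t" using l \<tau>_nonneg[of y \<omega>] by (rule order.strict_trans1[rotated])
    obtain n :: nat where "\<tau> y \<omega> < ereal n"
      using l \<tau>_nonneg[of y \<omega>] reals_Archimedean2 by (cases "\<tau> y \<omega>") auto
    then have "\<tau> y \<omega> < min (ereal n) t" using l by simp
    also have "min (ereal n) t = ereal (real_of_ereal (min (ereal n) t))" using t by (cases t) (auto simp: min_def)
    finally show "(y, \<omega>) \<in> (\<Union>n::nat. {p \<in> space (borel \<Otimes>\<^sub>M M). t > 0 \<and> crossed (fst p) (real_of_ereal (min (ereal n) t)) (path (snd p))})"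
      using p t by (auto simp: \<tau>_less_iff[OF \<omega>])
  next
    fix y \<omega> n assume p: "(y, \<omega>) \<in> space (borel \<Otimes>\<^sub>M M)" and t: "0 < t"
      and c: "crossed (fst (y, \<omega>)) (real_of_ereal (min (ereal (real n)) t)) (path (snd (y, \<omega>)))"
    from p have \<omega>: "\<omega> \<in> space M" by (simp add: space_pair_measure)
    have "min (ereal n) t = ereal (real_of_ereal (min (ereal n) t))" using t by (cases t) (auto simp: min_def)
    then show "\<tau> y \<omega> < t" using c \<tau>_less_iff[OF \<omega>, of y "real_of_ereal (min (ereal n) t)"] by (metis fst_conv snd_conv min_less_iff_conj)
  qed
  show "{p \<in> space (borel \<Otimes>\<^sub>M M). (case p of (y, \<omega>) \<Rightarrow> \<tau> y \<omega>) < t} \<in> sets (borel \<Otimes>\<^sub>M M)"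
    unfolding eq by measurable
qed

lemma \<tau>_measurable[measurable (raw)]:
  assumes [measurable]: "f \<in> borel_measurable N" "g \<in> measurable N M"
  shows "(\<lambda>x. \<tau> (f x) (g x)) \<in> borel_measurable N"
  using measurable_compose[OF measurable_Pair[OF assms] \<tau>_measurable_pair] by simp

text \<open>Without positive jumps the value at t is at most the left limit, and that is a limit of
  values not exceeding y.\<close>

lemma no_jump_up: "AE \<omega> in M. \<forall>t y. 0 < t \<longrightarrow> \<not> crossed y t (path \<omega>) \<longrightarrow> X t \<omega> \<le> y"
  using no_positive_jumps AE_space
proof eventually_elim
  case (elim \<omega>)
  show ?case
  proof (intro allI impI)
    fix t y assume t: "0 < t" and nc: "\<not> crossed y t (path \<omega>)"
    obtain l where l: "((\<lambda>s. X s \<omega>) \<longlongrightarrow> l) (at_left t)" using left_limits[OF elim(2) t] by auto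
    then have "Lim (at_left t) (\<lambda>s. X s \<omega>) = l" by (intro tendsto_Lim) auto
    then have "X t \<omega> \<le> l" using elim(1) t by auto
    also have "l \<le> y"
    proof (rule tendsto_upperbound[OF l])
      have "\<forall>\<^sub>F s in at_left t. s \<in> {0<..<t}" using t by (rule eventually_at_left_real)
      then show "\<forall>\<^sub>F s in at_left t. X s \<omega> \<le> y"
        by eventually_elim (use nc in \<open>force simp: crossed_path[OF elim(2)] not_less\<close>)
    qed simp
    finally show "X t \<omega> \<le> y" .
  qed
qed

text \<open>The process creeps upwards: no overshoot because there are no positive jumps, and no
  undershoot because right-continuity would keep the path below y for a while after the passage
  time. A single null set serves all levels.\<close>

lemma X_at_T: "AE \<omega> in M. \<forall>y\<ge>0. \<tau> y \<omega> < \<infinity> \<longrightarrow> X (T y \<omega>) \<omega> = y"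
  using no_jump_up AE_space
proof eventually_elim
  case (elim \<omega>)
  show ?case
  proof (intro allI impI)
    fix y :: real assume y: "0 \<le> y" and fin: "\<tau> y \<omega> < \<infinity>"
    have "\<not> crossed y (T y \<omega>) (path \<omega>)" using T_less_iff[OF elim(2) fin, of "T y \<omega>"] by simp
    then have le: "X (T y \<omega>) \<omega> \<le> y" using elim(1) y X_0[OF elim(2)] T_nonneg[of y \<omega>]
      by (cases "T y \<omega> = 0") (auto simp: less_le simp del: T_nonneg)
    have "\<not> X (T y \<omega>) \<omega> < y"
    proof
      assume "X (T y \<omega>) \<omega> < y"
      then have "\<forall>\<^sub>F s in at_right (T y \<omega>). X s \<omega> < y"
        using order_tendstoD(2)[OF X_right_continuous[OF elim(2), of "T y \<omega>"]] by simp
      then obtain b where b: "b > T y \<omega>" "\<And>s. T y \<omega> < s \<Longrightarrow> s < b \<Longrightarrow> X s \<omega> < y"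
        by (auto simp: eventually_at_right_field)
      from b(1) obtain r where r: "0 < r" "r < b" "y < X r \<omega>"
        using T_less_iff[OF elim(2) fin, of b] crossed_path[OF elim(2)] by auto
      have "r \<le> T y \<omega>" using b(2)[of r] r by (meson not_le order_less_asym)
      moreover have "\<not> r < T y \<omega>" using \<open>\<not> crossed y (T y \<omega>) (path \<omega>)\<close> r crossed_path[OF elim(2)] by auto
      ultimately have "r = T y \<omega>" by simp
      then show False using r le by simp
    qed
    then show "X (T y \<omega>) \<omega> = y" using le by simp
  qed
qed

definition cell :: "nat \<Rightarrow> real \<Rightarrow> 'a \<Rightarrow> nat" where
  "cell n y \<omega> = nat \<lfloor>2 ^ n * T y \<omega>\<rfloor>"

abbreviation gridT :: "nat \<Rightarrow> real \<Rightarrow> 'a \<Rightarrow> real" where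
  "gridT n y \<omega> \<equiv> grid n (cell n y \<omega>)"

lemma cell_measurable[measurable]: "cell n y \<in> measurable M (count_space UNIV)"
  unfolding cell_def by measurable

lemma gridT_bounds: "T y \<omega> < gridT n y \<omega>" "gridT n y \<omega> \<le> T y \<omega> + (1/2) ^ n"
  using grid_floor[of "T y \<omega>" n] by (auto simp: cell_def)

lemma gridT_tendsto: "(\<lambda>n. gridT n y \<omega>) \<longlonglongrightarrow> T y \<omega>"
  unfolding cell_def by (rule grid_floor_tendsto) simp

lemma X_gridT_tendsto: "\<omega> \<in> space M \<Longrightarrow> (\<lambda>n. X (gridT n y \<omega>) \<omega>) \<longlonglongrightarrow> X (T y \<omega>) \<omega>"
  by (rule filterlim_compose[OF X_right_continuous[of \<omega> "T y \<omega>"]])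
     (use gridT_tendsto gridT_bounds(1)[of y \<omega>] in \<open>auto simp: filterlim_at less_imp_neq[symmetric] intro!: always_eventually\<close>)

text \<open>The event depends on the path before \<open>grid n k\<close> only, so it is visible on
  the path stopped there. This is the stopping time property of the dyadic approximation.\<close>

lemma cell_iff:
  assumes "\<omega> \<in> space M"
  shows "\<tau> y \<omega> < \<infinity> \<and> cell n y \<omega> = k \<longleftrightarrow> crossed y (grid n k) (path \<omega>) \<and> \<not> crossed y (real k / 2 ^ n) (path \<omega>)"
proof (cases "\<tau> y \<omega> < \<infinity>")
  case True
  have "cell n y \<omega> = k \<longleftrightarrow> real k \<le> 2 ^ n * T y \<omega> \<and> 2 ^ n * T y \<omega> < real k + 1"
    unfolding cell_def by (auto simp: nat_eq_iff floor_eq_iff)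
  also have "\<dots> \<longleftrightarrow> \<not> T y \<omega> < real k / 2 ^ n \<and> T y \<omega> < grid n k"
    by (auto simp: grid_def field_simps not_less)
  finally show ?thesis using True unfolding T_less_iff[OF assms True] by blast
next
  case False
  then show ?thesis using crossed_imp_finite[OF assms] by blast
qed

text \<open>The strong Markov property at the dyadic times \<open>gridT n y\<close>, which decrease to \<open>\<tau>\<^sub>y\<^sup>+\<close>.\<close>

lemma markov_gridT:
  fixes g :: "nat \<Rightarrow> (real \<Rightarrow> real) \<Rightarrow> ennreal" and \<Psi> :: "nat \<Rightarrow> real \<Rightarrow> (real \<Rightarrow> real) \<Rightarrow> ennreal"
  assumes g: "\<And>k. g k \<in> borel_measurable path_space"
    and \<Psi>: "\<And>k. (\<lambda>(x, w). \<Psi> k x w) \<in> borel_measurable (borel \<Otimes>\<^sub>M path_space)"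
  shows "(\<integral>\<^sup>+\<omega>. of_bool (\<tau> y \<omega> < \<infinity>) * g (cell n y \<omega>) (stopped (gridT n y \<omega>) \<omega>) *
        \<Psi> (cell n y \<omega>) (X (gridT n y \<omega>) \<omega>) (shifted (gridT n y \<omega>) \<omega>) \<partial>M) =
    (\<integral>\<^sup>+\<omega>. of_bool (\<tau> y \<omega> < \<infinity>) * g (cell n y \<omega>) (stopped (gridT n y \<omega>) \<omega>) *
        (\<integral>\<^sup>+\<omega>'. \<Psi> (cell n y \<omega>) (X (gridT n y \<omega>) \<omega>) (path \<omega>') \<partial>M) \<partial>M)"
proof -
  note [measurable] = g \<Psi>
  have \<Psi>'[measurable]: "(\<lambda>x. \<Psi> k (f x) (h x)) \<in> borel_measurable N" if "f \<in> borel_measurable N" "h \<in> measurable N path_space" for k f h and N :: "'x measure"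
    using measurable_compose[OF measurable_Pair[OF that] \<Psi>[of k]] by simp
  have V[measurable]: "(\<lambda>x. \<integral>\<^sup>+\<omega>'. \<Psi> k x (path \<omega>') \<partial>M) \<in> borel_measurable borel" for k
    by measurable
  define I :: "nat \<Rightarrow> (real \<Rightarrow> real) \<Rightarrow> ennreal" where
    "I k w = of_bool (crossed y (grid n k) w \<and> \<not> crossed y (real k / 2 ^ n) w)" for k w
  have I[measurable]: "I k \<in> borel_measurable path_space" for k unfolding I_def by measurable
  have I_eq: "I k (stopped (grid n k) \<omega>) = of_bool (\<tau> y \<omega> < \<infinity> \<and> cell n y \<omega> = k)" if "\<omega> \<in> space M" for k \<omega>
    unfolding I_def cell_iff[OF that]
    by (subst (1 2) crossed_stopped) (auto simp: grid_def divide_right_mono)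
  have split: "of_bool (\<tau> y \<omega> < \<infinity>) * F (cell n y \<omega>) = (\<Sum>k. I k (stopped (grid n k) \<omega>) * F k)"
    if "\<omega> \<in> space M" for \<omega> and F :: "nat \<Rightarrow> ennreal"
  proof -
    have "(\<Sum>k. I k (stopped (grid n k) \<omega>) * F k) = (\<Sum>k\<in>{cell n y \<omega>}. I k (stopped (grid n k) \<omega>) * F k)"
      by (rule suminf_finite) (auto simp: I_eq[OF that])
    then show ?thesis by (simp add: I_eq[OF that])
  qed
  have st: "(\<integral>\<^sup>+\<omega>. I k (stopped (grid n k) \<omega>) * (g k (stopped (grid n k) \<omega>) * \<Psi> k (X (grid n k) \<omega>) (shifted (grid n k) \<omega>)) \<partial>M) =
    (\<integral>\<^sup>+\<omega>. I k (stopped (grid n k) \<omega>) * (g k (stopped (grid n k) \<omega>) * (\<integral>\<^sup>+\<omega>'. \<Psi> k (X (grid n k) \<omega>) (path \<omega>') \<partial>M)) \<partial>M)" for k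
  proof -
    \<comment> \<open>The position at the grid time is a coordinate of the stopped path, so it
      belongs to the past and stays fixed when the future is replaced by an independent
      copy.\<close>
    have Xs: "X (grid n k) \<omega> = stopped (grid n k) \<omega> (grid n k)" for \<omega> by (simp add: stopped_eq)
    have m: "(\<lambda>(v, w). I k v * (g k v * \<Psi> k (v (grid n k)) w)) \<in> borel_measurable (path_space \<Otimes>\<^sub>M path_space)"
      by measurable
    show ?thesis unfolding Xs
      by (subst markov[OF grid_nonneg m]) (simp add: nn_integral_cmult)
  qed
  have "(\<integral>\<^sup>+\<omega>. of_bool (\<tau> y \<omega> < \<infinity>) * (g (cell n y \<omega>) (stopped (gridT n y \<omega>) \<omega>) *
        \<Psi> (cell n y \<omega>) (X (gridT n y \<omega>) \<omega>) (shifted (gridT n y \<omega>) \<omega>)) \<partial>M) =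
     (\<integral>\<^sup>+\<omega>. (\<Sum>k. I k (stopped (grid n k) \<omega>) * (g k (stopped (grid n k) \<omega>) * \<Psi> k (X (grid n k) \<omega>) (shifted (grid n k) \<omega>))) \<partial>M)"
    by (intro nn_integral_cong split)
  also have "\<dots> = (\<Sum>k. \<integral>\<^sup>+\<omega>. I k (stopped (grid n k) \<omega>) * (g k (stopped (grid n k) \<omega>) * \<Psi> k (X (grid n k) \<omega>) (shifted (grid n k) \<omega>)) \<partial>M)"
    by (rule nn_integral_suminf) measurable
  also have "\<dots> = (\<Sum>k. \<integral>\<^sup>+\<omega>. I k (stopped (grid n k) \<omega>) * (g k (stopped (grid n k) \<omega>) * (\<integral>\<^sup>+\<omega>'. \<Psi> k (X (grid n k) \<omega>) (path \<omega>') \<partial>M)) \<partial>M)"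
    by (simp only: st)
  also have "\<dots> = (\<integral>\<^sup>+\<omega>. (\<Sum>k. I k (stopped (grid n k) \<omega>) * (g k (stopped (grid n k) \<omega>) * (\<integral>\<^sup>+\<omega>'. \<Psi> k (X (grid n k) \<omega>) (path \<omega>') \<partial>M))) \<partial>M)"
    by (rule nn_integral_suminf[symmetric]) measurable
  also have "\<dots> = (\<integral>\<^sup>+\<omega>. of_bool (\<tau> y \<omega> < \<infinity>) * (g (cell n y \<omega>) (stopped (gridT n y \<omega>) \<omega>) *
        (\<integral>\<^sup>+\<omega>'. \<Psi> (cell n y \<omega>) (X (gridT n y \<omega>) \<omega>) (path \<omega>') \<partial>M)) \<partial>M)"
    by (intro nn_integral_cong split[symmetric])
  finally show ?thesis by (simp add: mult.assoc)
qed

end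

section \<open>The Laplace exponent and the exponential martingale at upward passage\<close>

context snlp begin

definition cross_prob :: "real \<Rightarrow> real \<Rightarrow> ennreal" where
  "cross_prob y t = (\<integral>\<^sup>+\<omega>. of_bool (crossed y t (path \<omega>)) \<partial>M)"

text \<open>There is no overshoot at \<open>y\<close>, so after \<open>\<tau>\<^sub>y\<^sup>+\<close> the path still has to climb by \<open>z\<close>.\<close>

lemma cross_prob_add:
  assumes y: "0 \<le> y" and z: "0 < z"
  shows "cross_prob (y + z) t \<le> cross_prob y t * cross_prob (z / 2) t"
proof -
  \<comment> \<open>Since X at the dyadic time may already lie a little above y, only half of the
    climb z is demanded afterwards; the other half absorbs the error. The minimum with the dyadic
    time keeps the first test within the stopped path and does not change the event.\<close>
  define F :: "nat \<Rightarrow> 'a \<Rightarrow> ennreal" where "F n \<omega> = of_bool (\<tau> y \<omega> < \<infinity>) * of_bool (crossed y (min t (gridT n y \<omega>)) (stopped (gridT n y \<omega>) \<omega>)) *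
     of_bool (crossed (z / 2) t (shifted (gridT n y \<omega>) \<omega>))" for n \<omega>
  have cr: "crossed y (min t (gridT n y \<omega>)) (stopped (gridT n y \<omega>) \<omega>) \<longleftrightarrow> crossed y t (path \<omega>)"
    if "\<omega> \<in> space M" "\<tau> y \<omega> < \<infinity>" for n \<omega>
    using that T_less_iff[OF that] gridT_bounds(1)[of y \<omega> n] by (subst crossed_stopped) (auto simp flip: T_less_iff[OF that])
  have Fm[measurable]: "F n \<in> borel_measurable M" for n
  proof -
    have "(\<lambda>\<omega>. of_bool (\<tau> y \<omega> < \<infinity>) * of_bool (crossed y (min t (grid n k)) (stopped (grid n k) \<omega>)) *
       of_bool (crossed (z / 2) t (shifted (grid n k) \<omega>)) :: ennreal) \<in> borel_measurable M" for k
      using shifted_measurable[OF grid_nonneg, of n k, measurable] stopped_measurable[OF grid_nonneg, of n k, measurable] by measurable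
    from measurable_compose_countable[OF this cell_measurable[of n y]] show ?thesis
      unfolding F_def[abs_def] .
  qed
  have le: "(\<integral>\<^sup>+\<omega>. F n \<omega> \<partial>M) \<le> cross_prob y t * cross_prob (z / 2) t" for n
  proof -
    have "(\<integral>\<^sup>+\<omega>. F n \<omega> \<partial>M) = (\<integral>\<^sup>+\<omega>. of_bool (\<tau> y \<omega> < \<infinity>) * of_bool (crossed y (min t (gridT n y \<omega>)) (stopped (gridT n y \<omega>) \<omega>)) *
       (\<integral>\<^sup>+\<omega>'. of_bool (crossed (z / 2) t (path \<omega>')) \<partial>M) \<partial>M)"
      unfolding F_def by (rule markov_gridT[of "\<lambda>k w. of_bool (crossed y (min t (grid n k)) w)" "\<lambda>k x w. of_bool (crossed (z / 2) t w)" y n]) measurable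
    also have "\<dots> \<le> (\<integral>\<^sup>+\<omega>. of_bool (crossed y t (path \<omega>)) * cross_prob (z / 2) t \<partial>M)"
      by (intro nn_integral_mono mult_right_mono) (auto simp: cr cross_prob_def)
    also have "\<dots> = cross_prob y t * cross_prob (z / 2) t"
      unfolding cross_prob_def by (rule nn_integral_multc) measurable
    finally show ?thesis .
  qed
  have "AE \<omega> in M. of_bool (crossed (y + z) t (path \<omega>)) \<le> liminf (\<lambda>n. F n \<omega>)"
    using X_at_T AE_space
  proof eventually_elim
    case (elim \<omega>)
    show ?case
    proof (cases "crossed (y + z) t (path \<omega>)")
      case True
      then obtain r where r: "0 < r" "r < t" "y + z < X r \<omega>" using crossed_path[OF elim(2)] by auto
      have c: "crossed y t (path \<omega>)" using crossed_mono[OF True] z by simp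
      have fin: "\<tau> y \<omega> < \<infinity>" by (rule crossed_imp_finite[OF elim(2) c])
      have XT: "X (T y \<omega>) \<omega> = y" using elim(1) fin y by auto
      have "T y \<omega> \<le> r"
      proof (rule ccontr)
        assume "\<not> T y \<omega> \<le> r"
        then have "crossed y (T y \<omega>) (path \<omega>)" using r z crossed_path[OF elim(2)] by (auto intro!: exI[of _ r])
        then show False using T_less_iff[OF elim(2) fin, of "T y \<omega>"] by simp
      qed
      moreover have "T y \<omega> \<noteq> r" using XT r z by auto
      ultimately have "T y \<omega> < r" by simp
      then have "\<forall>\<^sub>F n in sequentially. gridT n y \<omega> < r" by (rule order_tendstoD(2)[OF gridT_tendsto])
      moreover have "\<forall>\<^sub>F n in sequentially. X (gridT n y \<omega>) \<omega> < y + z / 2"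
        using X_gridT_tendsto[OF elim(2), of y] XT z by (intro order_tendstoD(2)) auto
      ultimately have "\<forall>\<^sub>F n in sequentially. 1 \<le> F n \<omega>"
      proof eventually_elim
        case (elim n)
        have gp: "0 < gridT n y \<omega>" by (rule grid_pos)
        have "crossed (z / 2) t (shifted (gridT n y \<omega>) \<omega>)"
          using crossed_shifted[OF \<open>\<omega> \<in> space M\<close> grid_nonneg, of "z / 2" t n "cell n y \<omega>"] r elim gp
          by (auto intro!: exI[of _ r] simp del: grid_nonneg)
        then show ?case using fin c cr[OF \<open>\<omega> \<in> space M\<close> fin] by (simp add: F_def)
      qed
      then have "1 \<le> liminf (\<lambda>n. F n \<omega>)" by (rule Liminf_bounded)
      then show ?thesis by (simp add: True)
    qed simp
  qed
  then have "cross_prob (y + z) t \<le> (\<integral>\<^sup>+\<omega>. liminf (\<lambda>n. F n \<omega>) \<partial>M)"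
    unfolding cross_prob_def by (rule nn_integral_mono_AE)
  also have "\<dots> \<le> liminf (\<lambda>n. \<integral>\<^sup>+\<omega>. F n \<omega> \<partial>M)"
    by (rule nn_integral_liminf) measurable
  also have "\<dots> \<le> cross_prob y t * cross_prob (z / 2) t"
    by (rule Liminf_le) (simp_all add: le always_eventually)
  finally show ?thesis .
qed

text \<open>Each further climb by 2 costs at least an independent climb by 1, so the running
  supremum has geometric tails.\<close>

lemma cross_prob_power: "cross_prob (2 * real k) t \<le> cross_prob 1 t ^ k"
proof (induction k)
  case 0
  have "cross_prob 0 t \<le> (\<integral>\<^sup>+\<omega>. 1 \<partial>M)" unfolding cross_prob_def by (intro nn_integral_mono) auto
  then show ?case by (simp add: emeasure_space_1)
next
  case (Suc k)
  have "cross_prob (2 * real k + 2) t \<le> cross_prob (2 * real k) t * cross_prob (2 / 2) t"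
    by (rule cross_prob_add) auto
  also have "\<dots> \<le> cross_prob 1 t ^ k * cross_prob 1 t" using Suc by (intro mult_mono) auto
  finally show ?case by (simp add: algebra_simps)
qed

lemma cross_prob_small:
  assumes "0 < \<delta>" obtains t where "0 < t" "cross_prob 1 t \<le> \<delta>"
proof -
  have "(\<lambda>n. \<integral>\<^sup>+\<omega>. of_bool (crossed 1 (inverse (real (Suc n))) (path \<omega>)) \<partial>M) \<longlonglongrightarrow> (\<integral>\<^sup>+\<omega>. 0 \<partial>M)"
  proof (rule nn_integral_dominated_convergence[where w="\<lambda>_. 1"])
    show "AE \<omega> in M. (\<lambda>n. of_bool (crossed 1 (inverse (real (Suc n))) (path \<omega>)) :: ennreal) \<longlonglongrightarrow> 0"
    proof (rule AE_I2)
      fix \<omega> assume \<omega>: "\<omega> \<in> space M"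
      have "\<forall>\<^sub>F s in at_right 0. X s \<omega> < 1"
        using order_tendstoD(2)[OF X_right_continuous[OF \<omega>, of 0], of 1] X_0[OF \<omega>] by simp
      then obtain b where b: "b > 0" "\<And>s. 0 < s \<Longrightarrow> s < b \<Longrightarrow> X s \<omega> < 1" by (auto simp: eventually_at_right_field)
      have "\<forall>\<^sub>F n in sequentially. inverse (real (Suc n)) < b"
        using order_tendstoD(2)[OF LIMSEQ_inverse_real_of_nat b(1)] .
      then have "\<forall>\<^sub>F n in sequentially. (of_bool (crossed 1 (inverse (real (Suc n))) (path \<omega>)) :: ennreal) = 0"
        by eventually_elim (use b(2) in \<open>force simp: crossed_path[OF \<omega>]\<close>)
      then show "(\<lambda>n. of_bool (crossed 1 (inverse (real (Suc n))) (path \<omega>)) :: ennreal) \<longlonglongrightarrow> 0"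
        by (rule tendsto_eventually)
    qed
  qed (auto simp: emeasure_space_1)
  then have "(\<lambda>n. cross_prob 1 (inverse (real (Suc n)))) \<longlonglongrightarrow> 0" by (simp add: cross_prob_def)
  from order_tendstoD(2)[OF this assms] obtain n where "cross_prob 1 (inverse (real (Suc n))) < \<delta>"
    by (auto simp: eventually_sequentially)
  then show ?thesis by (intro that[of "inverse (real (Suc n))"]) auto
qed

text \<open>One integrable majorant for all small times: sort the values of X into bands of width 2
  and charge band k to the event that level 2k is exceeded before \<open>t0\<close>. It gives both
  finiteness of exponential moments and their continuity at time 0.\<close>

lemma exp_dominated:
  assumes \<theta>: "0 \<le> \<theta>"
  obtains t0 G where "0 < t0" "G \<in> borel_measurable M" "(\<integral>\<^sup>+\<omega>. G \<omega> \<partial>M) < \<infinity>"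
    "\<And>t \<omega>. \<omega> \<in> space M \<Longrightarrow> 0 \<le> t \<Longrightarrow> t < t0 \<Longrightarrow> ennreal (exp (\<theta> * X t \<omega>)) \<le> G \<omega>"
proof -
  \<comment> \<open>Band k carries the weight exp(2 \<theta> (k + 1)), so a crossing probability of
    at most exp(-(2 \<theta> + 1)) leaves a geometric series with ratio exp(-1).\<close>
  obtain t0 where t0: "0 < t0" "cross_prob 1 t0 \<le> ennreal (exp (- (2 * \<theta> + 1)))"
    by (rule cross_prob_small[of "ennreal (exp (- (2 * \<theta> + 1)))"]) simp
  define G :: "'a \<Rightarrow> ennreal" where "G \<omega> = 1 + (\<Sum>k. ennreal (exp (2 * \<theta> * (real k + 1))) * of_bool (crossed (2 * real k) t0 (path \<omega>)))" for \<omega>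
  have Gm: "G \<in> borel_measurable M" unfolding G_def by measurable
  have "(\<integral>\<^sup>+\<omega>. G \<omega> \<partial>M) = 1 + (\<Sum>k. ennreal (exp (2 * \<theta> * (real k + 1))) * cross_prob (2 * real k) t0)"
    unfolding G_def cross_prob_def
    by (subst nn_integral_add) (auto simp: emeasure_space_1 nn_integral_suminf nn_integral_cmult)
  also have "\<dots> \<le> 1 + (\<Sum>k. ennreal (exp (2 * \<theta>) * exp (- 1) ^ k))"
  proof (intro add_left_mono suminf_le)
    fix k
    have "cross_prob (2 * real k) t0 \<le> ennreal (exp (- (2 * \<theta> + 1))) ^ k"
      by (rule order_trans[OF cross_prob_power power_mono]) (use t0 in auto)
    then have "ennreal (exp (2 * \<theta> * (real k + 1))) * cross_prob (2 * real k) t0 \<le>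
      ennreal (exp (2 * \<theta> * (real k + 1))) * ennreal (exp (- (2 * \<theta> + 1)) ^ k)"
      by (intro mult_left_mono) (auto simp: ennreal_power)
    also have "\<dots> = ennreal (exp (2 * \<theta> * (real k + 1)) * exp (- (2 * \<theta> + 1)) ^ k)" by (simp add: ennreal_mult)
    also have "exp (2 * \<theta> * (real k + 1)) * exp (- (2 * \<theta> + 1)) ^ k = exp (2 * \<theta>) * exp (- 1) ^ k"
      by (simp add: exp_add[symmetric] exp_of_nat_mult[symmetric] algebra_simps)
    finally show "ennreal (exp (2 * \<theta> * (real k + 1))) * cross_prob (2 * real k) t0 \<le> ennreal (exp (2 * \<theta>) * exp (- 1) ^ k)" .
  qed auto
  also have "\<dots> < \<infinity>"
  proof -
    have "(\<Sum>k. ennreal (exp (2 * \<theta>) * exp (- 1) ^ k)) \<noteq> \<infinity>"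
      by (subst suminf_ennreal2) (auto intro!: summable_mult summable_geometric)
    then show ?thesis by (simp add: less_top)
  qed
  finally have "(\<integral>\<^sup>+\<omega>. G \<omega> \<partial>M) < \<infinity>" .
  moreover have "ennreal (exp (\<theta> * X t \<omega>)) \<le> G \<omega>" if \<omega>: "\<omega> \<in> space M" and t: "0 \<le> t" "t < t0" for t \<omega>
  proof (cases "X t \<omega> \<le> 0")
    case True
    then have "exp (\<theta> * X t \<omega>) \<le> 1" using \<theta> by (simp add: mult_nonneg_nonpos)
    then have "ennreal (exp (\<theta> * X t \<omega>)) \<le> 1 + 0" using ennreal_leI[of _ 1] by simp
    also have "\<dots> \<le> G \<omega>" unfolding G_def by (intro add_left_mono) simp
    finally show ?thesis .
  next
    case False
    then have tpos: "t > 0" using t X_0[OF \<omega>] by (cases "t = 0") auto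
    \<comment> \<open>Ceiling minus one instead of the floor makes the band half-open at the left,
      because \<open>crossed\<close> asks for strict excess over 2k.\<close>
    define k where "k = nat (\<lceil>X t \<omega> / 2\<rceil> - 1)"
    have rk: "real k = of_int \<lceil>X t \<omega> / 2\<rceil> - 1" using False by (simp add: k_def)
    have "real k < X t \<omega> / 2" unfolding rk by linarith
    moreover have "X t \<omega> / 2 \<le> real k + 1" unfolding rk by simp
    ultimately have k: "2 * real k < X t \<omega>" "X t \<omega> \<le> 2 * (real k + 1)" by (simp_all add: field_simps)
    have "crossed (2 * real k) t0 (path \<omega>)" using k(1) t tpos by (auto simp: crossed_path[OF \<omega>] intro!: exI[of _ t])
    then have "ennreal (exp (\<theta> * X t \<omega>)) \<le> ennreal (exp (2 * \<theta> * (real k + 1))) * of_bool (crossed (2 * real k) t0 (path \<omega>))"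
      using k(2) \<theta> mult_left_mono[OF k(2) \<theta>] by (auto intro!: ennreal_leI simp: algebra_simps)
    also have "\<dots> \<le> (\<Sum>k. ennreal (exp (2 * \<theta> * (real k + 1))) * of_bool (crossed (2 * real k) t0 (path \<omega>)))"
    proof -
      have "f k \<le> suminf f" for f :: "nat \<Rightarrow> ennreal" using sum_le_suminf[OF summableI, of "{k}" f] by simp
      then show ?thesis .
    qed
    also have "\<dots> \<le> G \<omega>" unfolding G_def by simp
    finally show ?thesis .
  qed
  ultimately show ?thesis using t0(1) Gm that by blast
qed

section \<open>The Laplace exponent and its growth\<close>

definition mgf :: "real \<Rightarrow> real \<Rightarrow> ennreal" where
  "mgf \<theta> t = (\<integral>\<^sup>+\<omega>. ennreal (exp (\<theta> * X t \<omega>)) \<partial>M)"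

lemma mgf_add:
  assumes "0 \<le> s" "0 \<le> t" shows "mgf \<theta> (s + t) = mgf \<theta> s * mgf \<theta> t"
proof -
  have "mgf \<theta> (s + t) = (\<integral>\<^sup>+\<omega>. ennreal (exp (\<theta> * stopped s \<omega> s)) * ennreal (exp (\<theta> * shifted s \<omega> t)) \<partial>M)"
    unfolding mgf_def using assms
    by (intro nn_integral_cong) (simp add: stopped_eq shifted_eq algebra_simps exp_add[symmetric] flip: ennreal_mult)
  also have "\<dots> = (\<integral>\<^sup>+\<omega>. \<integral>\<^sup>+\<omega>'. ennreal (exp (\<theta> * stopped s \<omega> s)) * ennreal (exp (\<theta> * path \<omega>' t)) \<partial>M \<partial>M)"
    by (rule markov[OF assms(1)]) measurable
  also have "\<dots> = mgf \<theta> s * mgf \<theta> t"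
    unfolding mgf_def using assms by (simp add: nn_integral_cmult nn_integral_multc stopped_eq)
  finally show ?thesis .
qed

text \<open>Finiteness is known for small times only; n equal steps of length less than
  \<open>t0\<close> and multiplicativity extend it.\<close>

lemma mgf_finite:
  assumes \<theta>: "0 \<le> \<theta>" and t: "0 \<le> t" shows "mgf \<theta> t < \<infinity>"
proof -
  obtain t0 G where t0: "0 < t0" "G \<in> borel_measurable M" "(\<integral>\<^sup>+\<omega>. G \<omega> \<partial>M) < \<infinity>"
    "\<And>t \<omega>. \<omega> \<in> space M \<Longrightarrow> 0 \<le> t \<Longrightarrow> t < t0 \<Longrightarrow> ennreal (exp (\<theta> * X t \<omega>)) \<le> G \<omega>"
    using exp_dominated[OF \<theta>] by blast
  have small: "mgf \<theta> s < \<infinity>" if "0 \<le> s" "s < t0" for s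
  proof -
    have "mgf \<theta> s \<le> (\<integral>\<^sup>+\<omega>. G \<omega> \<partial>M)" unfolding mgf_def using that t0(4) by (intro nn_integral_mono) auto
    then show ?thesis using t0(3) by simp
  qed
  obtain n :: nat where n: "t / t0 < real n" using reals_Archimedean2 by blast
  have n0: "0 < n" using n t t0 by (cases n) (auto simp: divide_less_0_iff)
  have pw: "mgf \<theta> (real k * (t / n)) = mgf \<theta> (t / n) ^ k" for k
  proof (induction k)
    case 0
    have "mgf \<theta> 0 = (\<integral>\<^sup>+\<omega>. 1 \<partial>M)" unfolding mgf_def by (intro nn_integral_cong) (simp add: X_0)
    then show ?case by (simp add: emeasure_space_1)
  next
    case (Suc k)
    then show ?case using mgf_add[of "t / n" "real k * (t / n)" \<theta>] t by (simp add: distrib_right add_divide_distrib)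
  qed
  have "mgf \<theta> (t / n) < \<infinity>" using n n0 t t0 by (intro small) (auto simp: field_simps)
  then have "mgf \<theta> (real n * (t / n)) < \<infinity>" unfolding pw by (simp add: power_less_top_ennreal)
  then show ?thesis using n0 by simp
qed

lemma exp_X_integrable:
  assumes "0 \<le> \<theta>" "0 \<le> t" shows "integrable M (\<lambda>\<omega>. exp (\<theta> * X t \<omega>))"
  using mgf_finite[OF assms] assms(2) by (intro integrableI_nonneg) (auto simp: mgf_def)

abbreviation \<psi> :: "real \<Rightarrow> real" where
  "\<psi> \<equiv> laplace_exponent M X"

lemma mgf_eq_integral:
  assumes "0 \<le> \<theta>" "0 \<le> t" shows "mgf \<theta> t = ennreal (\<integral>\<omega>. exp (\<theta> * X t \<omega>) \<partial>M)"
  unfolding mgf_def by (rule nn_integral_eq_integral[OF exp_X_integrable[OF assms]]) simp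

text \<open>This justifies the definite description behind the Laplace exponent: the exponential
  moments are positive, multiplicative in time and continuous at 0, so their logarithm is linear in
  t.\<close>

lemma integral_exp_X:
  assumes \<theta>: "0 \<le> \<theta>" and t: "0 \<le> t" shows "(\<integral>\<omega>. exp (\<theta> * X t \<omega>) \<partial>M) = exp (t * \<psi> \<theta>)"
proof -
  define m where "m t = (\<integral>\<omega>. exp (\<theta> * X t \<omega>) \<partial>M)" for t
  have mpos: "0 < m t" if "0 \<le> t" for t
  proof -
    have "m t \<noteq> 0"
    proof
      assume "m t = 0"
      then have "AE \<omega> in M. exp (\<theta> * X t \<omega>) = 0" unfolding m_def
        by (subst (asm) integral_nonneg_eq_0_iff_AE[OF exp_X_integrable[OF \<theta> that]]) auto
      then show False by simp
    qed
    moreover have "0 \<le> m t" unfolding m_def by simp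
    ultimately show ?thesis by simp
  qed
  have madd: "m (s + t) = m s * m t" if "0 \<le> s" "0 \<le> t" for s t
    using mgf_add[OF that, of \<theta>] mpos[of s] mpos[of t] mpos[of "s + t"] that \<theta>
    by (simp add: mgf_eq_integral m_def[symmetric] flip: ennreal_mult)
  have lim: "(m \<longlongrightarrow> 1) (at_right 0)"
  proof -
    obtain t0 G where t0: "0 < t0" "G \<in> borel_measurable M" "(\<integral>\<^sup>+\<omega>. G \<omega> \<partial>M) < \<infinity>"
      "\<And>t \<omega>. \<omega> \<in> space M \<Longrightarrow> 0 \<le> t \<Longrightarrow> t < t0 \<Longrightarrow> ennreal (exp (\<theta> * X t \<omega>)) \<le> G \<omega>"
      using exp_dominated[OF \<theta>] by blast
    show ?thesis
    proof (rule tendsto_at_right_sequentially[OF t0(1)])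
      fix S assume S: "\<And>n. 0 < S n" "\<And>n. S n < t0" "S \<longlonglongrightarrow> (0::real)"
      have "(\<lambda>n. mgf \<theta> (S n)) \<longlonglongrightarrow> (\<integral>\<^sup>+\<omega>. 1 \<partial>M)" unfolding mgf_def
      proof (rule nn_integral_dominated_convergence[where w=G])
        show "AE \<omega> in M. (\<lambda>n. ennreal (exp (\<theta> * X (S n) \<omega>))) \<longlonglongrightarrow> 1"
        proof (rule AE_I2)
          fix \<omega> assume \<omega>: "\<omega> \<in> space M"
          have "(\<lambda>n. X (S n) \<omega>) \<longlonglongrightarrow> X 0 \<omega>"
            by (rule filterlim_compose[OF X_right_continuous[OF \<omega> order.refl]])
               (use S in \<open>auto simp: filterlim_at less_imp_neq[symmetric] intro!: always_eventually\<close>)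
          then have "(\<lambda>n. ennreal (exp (\<theta> * X (S n) \<omega>))) \<longlonglongrightarrow> ennreal (exp (\<theta> * X 0 \<omega>))"
            by (intro tendsto_intros)
          then show "(\<lambda>n. ennreal (exp (\<theta> * X (S n) \<omega>))) \<longlonglongrightarrow> 1" by (simp add: X_0[OF \<omega>])
        qed
        show "\<And>n. (\<lambda>\<omega>. ennreal (exp (\<theta> * X (S n) \<omega>))) \<in> borel_measurable M"
          using S(1) by (auto simp: less_imp_le)
        show "\<And>n. AE \<omega> in M. ennreal (exp (\<theta> * X (S n) \<omega>)) \<le> G \<omega>"
          using S t0(4) by (auto simp: less_imp_le)
      qed (use t0 in auto)
      then have "(\<lambda>n. ennreal (m (S n))) \<longlonglongrightarrow> ennreal 1"
        using S(1) \<theta> by (simp add: emeasure_space_1 mgf_eq_integral m_def[symmetric] less_imp_le)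
      then show "(\<lambda>n. m (S n)) \<longlonglongrightarrow> 1"
        by (rule iffD1[OF tendsto_ennreal_iff, rotated 2]) (use S(1) mpos in \<open>auto intro!: always_eventually simp: less_imp_le\<close>)
    qed
  qed
  have "ln (m t) = t * ln (m 1)" if "0 \<le> t" for t
  proof (rule additive_linear[where l="\<lambda>t. ln (m t)"])
    show "ln (m (s + t)) = ln (m s) + ln (m t)" if "0 \<le> s" "0 \<le> t" for s t
      using madd[OF that] mpos[OF that(1)] mpos[OF that(2)] by (simp add: ln_mult)
    show "((\<lambda>t. ln (m t)) \<longlongrightarrow> 0) (at_right 0)" using tendsto_ln[OF lim] by simp
  qed (rule that)
  then have ex: "m t = exp (t * ln (m 1))" if "0 \<le> t" for t
    using mpos[OF that] that by (metis exp_ln)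
  have "\<psi> \<theta> = ln (m 1)" unfolding laplace_exponent_def
  proof (rule the_equality)
    show "\<forall>t\<ge>0. (\<integral>\<omega>. exp (\<theta> * X t \<omega>) \<partial>M) = exp (t * ln (m 1))" unfolding m_def[symmetric] using ex by blast
    fix r assume "\<forall>t\<ge>0. (\<integral>\<omega>. exp (\<theta> * X t \<omega>) \<partial>M) = exp (t * r)"
    from this[rule_format, of 1] have "m 1 = exp r" unfolding m_def by simp
    then show "r = ln (m 1)" by simp
  qed
  then show ?thesis using ex[OF t] by (simp add: m_def)
qed

lemma mgf_eq: "0 \<le> \<theta> \<Longrightarrow> 0 \<le> t \<Longrightarrow> mgf \<theta> t = ennreal (exp (t * \<psi> \<theta>))"
  by (simp add: mgf_eq_integral integral_exp_X)

text \<open>Otherwise X t \<le> 0 almost surely for each t > 0. Stationary increments make the path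
  non-increasing along rational times, right-continuity along all times, and that is the excluded
  case.\<close>

lemma ex_positive: "\<exists>t>0. \<exists>\<epsilon>>0. 0 < prob {\<omega>\<in>space M. \<epsilon> < X t \<omega>}"
proof (rule ccontr)
  assume neg: "\<not> (\<exists>t>0. \<exists>\<epsilon>>0. 0 < prob {\<omega>\<in>space M. \<epsilon> < X t \<omega>})"
  have nonpos: "AE \<omega> in M. X t \<omega> \<le> 0" if "0 < t" for t
  proof -
    have m[measurable]: "X t \<in> borel_measurable M" using that by simp
    have "AE \<omega> in M. \<forall>n::nat. \<not> inverse (real (Suc n)) < X t \<omega>"
    proof (subst AE_all_countable, rule allI)
      fix n :: nat
      have "prob {\<omega>\<in>space M. inverse (real (Suc n)) < X t \<omega>} = 0"
      proof -
        have "0 < inverse (real (Suc n))" by simp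
        then have "\<not> 0 < prob {\<omega>\<in>space M. inverse (real (Suc n)) < X t \<omega>}" using neg that by blast
        then show ?thesis using measure_nonneg[of M "{\<omega>\<in>space M. inverse (real (Suc n)) < X t \<omega>}"] by linarith
      qed
      then show "AE \<omega> in M. \<not> inverse (real (Suc n)) < X t \<omega>"
        by (subst AE_iff_measurable[OF _ refl]) (auto simp: emeasure_eq_measure)
    qed
    then show ?thesis
    proof eventually_elim
      case (elim \<omega>)
      show ?case
      proof (rule ccontr)
        assume "\<not> X t \<omega> \<le> 0"
        then obtain n where "inverse (real (Suc n)) < X t \<omega>" using reals_Archimedean[of "X t \<omega>"] by auto
        then show False using elim by blast
      qed
    qed
  qed
  have mono1: "AE \<omega> in M. X (s + t) \<omega> \<le> X s \<omega>" if "0 \<le> s" "0 < t" for s t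
  proof -
    have m[measurable]: "X t \<in> borel_measurable M" "X s \<in> borel_measurable M" "X (s + t) \<in> borel_measurable M" using that by simp_all
    have "(\<integral>\<^sup>+\<omega>. of_bool (0 < shifted s \<omega> t) \<partial>M) = (\<integral>\<^sup>+\<omega>. \<integral>\<^sup>+\<omega>'. of_bool (0 < path \<omega>' t) \<partial>M \<partial>M)"
      by (rule markov[OF that(1), of "\<lambda>v w. of_bool (0 < w t)"]) measurable
    also have "(\<integral>\<^sup>+\<omega>'. of_bool (0 < path \<omega>' t) \<partial>M) = (\<integral>\<^sup>+\<omega>'. 0 \<partial>M)"
      by (rule nn_integral_cong_AE) (use nonpos[OF that(2)] that in auto)
    finally have z: "(\<integral>\<^sup>+\<omega>. of_bool (0 < shifted s \<omega> t) \<partial>M) = 0" by simp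
    have "(\<lambda>\<omega>. of_bool (0 < shifted s \<omega> t) :: ennreal) \<in> borel_measurable M"
      using shifted_measurable[OF that(1), measurable] by measurable
    from iffD1[OF nn_integral_0_iff_AE[OF this] z]
    have "AE \<omega> in M. \<not> 0 < shifted s \<omega> t" by simp
    then show ?thesis by eventually_elim (use that in \<open>auto simp: shifted_eq\<close>)
  qed
  have "AE \<omega> in M. \<forall>s\<in>\<rat>. \<forall>t\<in>\<rat>. 0 \<le> s \<longrightarrow> s < t \<longrightarrow> X t \<omega> \<le> X s \<omega>"
  proof (intro AE_ball_countable[THEN iffD2] countable_rat ballI)
    fix s t :: real assume "s \<in> \<rat>" "t \<in> \<rat>"
    show "AE \<omega> in M. 0 \<le> s \<longrightarrow> s < t \<longrightarrow> X t \<omega> \<le> X s \<omega>"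
      using mono1[of s "t - s"] by (cases "0 \<le> s \<and> s < t") auto
  qed
  then have "AE \<omega> in M. \<forall>s t. 0 \<le> s \<longrightarrow> s \<le> t \<longrightarrow> X t \<omega> \<le> X s \<omega>"
    using AE_space
  proof eventually_elim
    case (elim \<omega>)
    show ?case
    proof (intro allI impI)
      fix s t :: real assume st: "0 \<le> s" "s \<le> t"
      show "X t \<omega> \<le> X s \<omega>"
      proof (rule ccontr)
        assume "\<not> X t \<omega> \<le> X s \<omega>"
        then have lt: "X s \<omega> < X t \<omega>" by simp
        then have "s < t" using st by (cases "s = t") auto
        obtain d where d: "X s \<omega> < d" "d < X t \<omega>" using lt dense by blast
        have "\<forall>\<^sub>F u in at_right s. X u \<omega> < d"
          using order_tendstoD(2)[OF X_right_continuous[OF elim(2) st(1)] d(1)] .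
        then obtain b where b: "b > s" "\<And>u. s < u \<Longrightarrow> u < b \<Longrightarrow> X u \<omega> < d" by (auto simp: eventually_at_right_field)
        obtain u where u: "u \<in> \<rat>" "s < u" "u < min b t" using Rats_dense_in_real[of s "min b t"] b(1) \<open>s < t\<close> by auto
        obtain v where v: "v \<in> \<rat>" "t < v" "d < X v \<omega>"
          using ex_rat_right[OF elim(2), of t "t + 1" d] st d by auto
        have "X v \<omega> \<le> X u \<omega>" using elim(1) u v st by auto
        then show False using b(2)[of u] u v by auto
      qed
    qed
  qed
  with not_neg_subordinator show False by blast
qed

text \<open>An exponential Markov inequality: exp(\<epsilon> \<theta>) times the probability of X t
  > \<epsilon> is at most exp(t \<psi>(\<theta>)), so \<psi> grows at least linearly.\<close>

lemma \<psi>_at_top: "filterlim \<psi> at_top at_top"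
proof -
  obtain t \<epsilon> where te: "0 < t" "0 < \<epsilon>" "0 < prob {\<omega>\<in>space M. \<epsilon> < X t \<omega>}" using ex_positive by blast
  let ?P = "prob {\<omega>\<in>space M. \<epsilon> < X t \<omega>}"
  have m[measurable]: "X t \<in> borel_measurable M" using te by simp
  have le: "(\<epsilon> * \<theta> + ln ?P) / t \<le> \<psi> \<theta>" if \<theta>: "0 \<le> \<theta>" for \<theta>
  proof -
    have "exp (\<epsilon> * \<theta>) * ?P = (\<integral>\<omega>. exp (\<epsilon> * \<theta>) * indicator {\<omega>\<in>space M. \<epsilon> < X t \<omega>} \<omega> \<partial>M)" by simp
    also have "\<dots> \<le> (\<integral>\<omega>. exp (\<theta> * X t \<omega>) \<partial>M)"
    proof (rule integral_mono)
      show "integrable M (\<lambda>\<omega>. exp (\<theta> * X t \<omega>))" using \<theta> te by (intro exp_X_integrable) auto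
      show "exp (\<epsilon> * \<theta>) * indicator {\<omega>\<in>space M. \<epsilon> < X t \<omega>} \<omega> \<le> exp (\<theta> * X t \<omega>)" for \<omega>
        using \<theta> by (auto simp: indicator_def mult.commute[of \<epsilon>] intro!: mult_left_mono)
      show "integrable M (\<lambda>\<omega>. exp (\<epsilon> * \<theta>) * indicator {\<omega>\<in>space M. \<epsilon> < X t \<omega>} \<omega>)"
        by (intro integrable_mult_right integrable_real_indicator) (auto simp: emeasure_eq_measure)
    qed
    also have "\<dots> = exp (t * \<psi> \<theta>)" using \<theta> te by (intro integral_exp_X) auto
    finally have "ln (exp (\<epsilon> * \<theta>) * ?P) \<le> ln (exp (t * \<psi> \<theta>))" using te(3) by (subst ln_le_cancel_iff) auto
    then have "ln (exp (\<epsilon> * \<theta>) * ?P) \<le> t * \<psi> \<theta>" by simp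
    then show ?thesis using te by (simp add: ln_mult field_simps)
  qed
  have "filterlim (\<lambda>\<theta>. (\<epsilon> * \<theta> + ln ?P) / t) at_top at_top"
  proof -
    have "filterlim (\<lambda>\<theta>. (\<epsilon> / t) * \<theta>) at_top at_top"
      using te by (intro filterlim_tendsto_pos_mult_at_top[OF tendsto_const] filterlim_ident) auto
    then have "filterlim (\<lambda>\<theta>. ln ?P / t + (\<epsilon> / t) * \<theta>) at_top at_top"
      by (rule filterlim_tendsto_add_at_top[OF tendsto_const])
    then show ?thesis by (simp add: add_divide_distrib add.commute)
  qed
  then show ?thesis
    by (rule filterlim_at_top_mono) (use le in \<open>auto intro: eventually_mono[OF eventually_ge_at_top[of 0]]\<close>)
qed

text \<open>The strong Markov property at \<open>\<tau>\<^sub>y\<^sup>+\<close> for the exponential martingale, where \<open>X = y\<close> at \<open>\<tau>\<^sub>y\<^sup>+\<close>.\<close>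

lemma exp_X_crossed:
  assumes \<theta>: "0 \<le> \<theta>" and y: "0 \<le> y" and t: "0 \<le> t"
  shows "(\<integral>\<^sup>+\<omega>. of_bool (crossed y t (path \<omega>)) * ennreal (exp (\<theta> * X t \<omega>)) \<partial>M) =
    (\<integral>\<^sup>+\<omega>. of_bool (crossed y t (path \<omega>)) * ennreal (exp (\<theta> * y + \<psi> \<theta> * (t - T y \<omega>))) \<partial>M)"
proof -
  have [measurable]: "X t \<in> borel_measurable M" using t by simp
  \<comment> \<open>The cut-off at y + 1 bounds the exponential at the dyadic time for dominated
    convergence. On each path with finite passage time it is eventually inactive, as X at these
    times tends to y.\<close>
  let ?g = "\<lambda>n k w. of_bool (grid n k \<le> t \<and> w (grid n k) \<le> y + 1) :: ennreal"
  define A where "A n \<omega> = of_bool (\<tau> y \<omega> < \<infinity>) * ?g n (cell n y \<omega>) (stopped (gridT n y \<omega>) \<omega>)" for n \<omega>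
  have A_eq: "A n \<omega> = of_bool (\<tau> y \<omega> < \<infinity> \<and> gridT n y \<omega> \<le> t \<and> X (gridT n y \<omega>) \<omega> \<le> y + 1)" for n \<omega>
    by (simp add: A_def stopped_eq)
  define F where "F n \<omega> = A n \<omega> * ennreal (exp (\<theta> * X t \<omega>))" for n \<omega>
  define G where "G n \<omega> = A n \<omega> * ennreal (exp (\<theta> * X (gridT n y \<omega>) \<omega> + \<psi> \<theta> * (t - gridT n y \<omega>)))" for n \<omega>
  have Am[measurable]: "A n \<in> borel_measurable M" for n
  proof -
    have "(\<lambda>\<omega>. of_bool (\<tau> y \<omega> < \<infinity>) * ?g n k (stopped (grid n k) \<omega>)) \<in> borel_measurable M" for k
      using stopped_measurable[OF grid_nonneg, of n k, measurable] by measurable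
    from measurable_compose_countable[OF this cell_measurable[of n y]] show ?thesis unfolding A_def[abs_def] .
  qed
  have Gm[measurable]: "G n \<in> borel_measurable M" for n
  proof -
    have "(\<lambda>\<omega>. A n \<omega> * ennreal (exp (\<theta> * X (grid n k) \<omega> + \<psi> \<theta> * (t - grid n k)))) \<in> borel_measurable M" for k
    proof -
      have [measurable]: "X (grid n k) \<in> borel_measurable M" by simp
      show ?thesis by measurable
    qed
    from measurable_compose_countable[OF this cell_measurable[of n y]] show ?thesis unfolding G_def[abs_def] .
  qed
  have FG: "(\<integral>\<^sup>+\<omega>. F n \<omega> \<partial>M) = (\<integral>\<^sup>+\<omega>. G n \<omega> \<partial>M)" for n
  proof -
    let ?\<Psi> = "\<lambda>k x w. ennreal (exp (\<theta> * (x + w (t - grid n k))))"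
    have "(\<integral>\<^sup>+\<omega>. F n \<omega> \<partial>M) = (\<integral>\<^sup>+\<omega>. of_bool (\<tau> y \<omega> < \<infinity>) * ?g n (cell n y \<omega>) (stopped (gridT n y \<omega>) \<omega>) *
        ?\<Psi> (cell n y \<omega>) (X (gridT n y \<omega>) \<omega>) (shifted (gridT n y \<omega>) \<omega>) \<partial>M)"
      by (intro nn_integral_cong) (auto simp: F_def A_def shifted_eq)
    also have "\<dots> = (\<integral>\<^sup>+\<omega>. of_bool (\<tau> y \<omega> < \<infinity>) * ?g n (cell n y \<omega>) (stopped (gridT n y \<omega>) \<omega>) *
        (\<integral>\<^sup>+\<omega>'. ?\<Psi> (cell n y \<omega>) (X (gridT n y \<omega>) \<omega>) (path \<omega>') \<partial>M) \<partial>M)"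
      by (rule markov_gridT[of "?g n" ?\<Psi>]) measurable
    also have "\<dots> = (\<integral>\<^sup>+\<omega>. G n \<omega> \<partial>M)"
    proof (rule nn_integral_cong)
      fix \<omega>
      show "of_bool (\<tau> y \<omega> < \<infinity>) * ?g n (cell n y \<omega>) (stopped (gridT n y \<omega>) \<omega>) *
        (\<integral>\<^sup>+\<omega>'. ?\<Psi> (cell n y \<omega>) (X (gridT n y \<omega>) \<omega>) (path \<omega>') \<partial>M) = G n \<omega>"
      proof (cases "gridT n y \<omega> \<le> t")
        case True
        let ?x = "X (gridT n y \<omega>) \<omega>" and ?s = "t - gridT n y \<omega>"
        have [measurable]: "X ?s \<in> borel_measurable M" using True by simp
        have "(\<integral>\<^sup>+\<omega>'. ?\<Psi> (cell n y \<omega>) ?x (path \<omega>') \<partial>M) = (\<integral>\<^sup>+\<omega>'. ennreal (exp (\<theta> * ?x)) * ennreal (exp (\<theta> * X ?s \<omega>')) \<partial>M)"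
          using True by (intro nn_integral_cong) (simp add: distrib_left exp_add flip: ennreal_mult)
        also have "\<dots> = ennreal (exp (\<theta> * ?x)) * mgf \<theta> ?s" unfolding mgf_def by (rule nn_integral_cmult) measurable
        also have "\<dots> = ennreal (exp (\<theta> * ?x + \<psi> \<theta> * ?s))" using True \<theta> by (simp add: mgf_eq exp_add mult.commute flip: ennreal_mult)
        finally show ?thesis by (simp add: G_def A_def)
      qed (simp add: G_def A_def)
    qed
    finally show ?thesis .
  qed
  have Alim: "AE \<omega> in M. (\<lambda>n. A n \<omega>) \<longlonglongrightarrow> of_bool (crossed y t (path \<omega>))"
    using X_at_T AE_space
  proof eventually_elim
    case (elim \<omega>)
    show ?case
    proof (cases "crossed y t (path \<omega>)")
      case True
      then have fin: "\<tau> y \<omega> < \<infinity>" by (rule crossed_imp_finite[OF elim(2)])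
      then have "T y \<omega> < t" using True T_less_iff[OF elim(2) fin] by simp
      then have "\<forall>\<^sub>F n in sequentially. gridT n y \<omega> < t" by (rule order_tendstoD(2)[OF gridT_tendsto])
      moreover have "\<forall>\<^sub>F n in sequentially. X (gridT n y \<omega>) \<omega> < y + 1"
        using X_gridT_tendsto[OF elim(2), of y] elim(1) fin y by (intro order_tendstoD(2)) auto
      ultimately have "\<forall>\<^sub>F n in sequentially. A n \<omega> = of_bool (crossed y t (path \<omega>))"
        by eventually_elim (use fin True in \<open>auto simp: A_eq\<close>)
      then show ?thesis by (rule tendsto_eventually)
    next
      case False
      have "A n \<omega> = 0" for n
        using False T_less_iff[OF elim(2), of y t] gridT_bounds(1)[of y \<omega> n] by (auto simp: A_eq)
      then show ?thesis using False by simp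
    qed
  qed
  have "(\<lambda>n. \<integral>\<^sup>+\<omega>. F n \<omega> \<partial>M) \<longlonglongrightarrow> (\<integral>\<^sup>+\<omega>. of_bool (crossed y t (path \<omega>)) * ennreal (exp (\<theta> * X t \<omega>)) \<partial>M)"
  proof (rule nn_integral_dominated_convergence[where w="\<lambda>\<omega>. ennreal (exp (\<theta> * X t \<omega>))"])
    show "AE \<omega> in M. (\<lambda>n. F n \<omega>) \<longlonglongrightarrow> of_bool (crossed y t (path \<omega>)) * ennreal (exp (\<theta> * X t \<omega>))"
      using Alim
    proof eventually_elim
      case (elim \<omega>)
      show ?case unfolding F_def by (rule tendsto_mult_ennreal[OF elim tendsto_const]) simp
    qed
    show "(\<integral>\<^sup>+\<omega>. ennreal (exp (\<theta> * X t \<omega>)) \<partial>M) < \<infinity>" using mgf_finite[OF \<theta> t] by (simp add: mgf_def)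
    show "F n \<in> borel_measurable M" for n unfolding F_def by measurable
    show "(\<lambda>\<omega>. of_bool (crossed y t (path \<omega>)) * ennreal (exp (\<theta> * X t \<omega>))) \<in> borel_measurable M" by measurable
    show "(\<lambda>\<omega>. ennreal (exp (\<theta> * X t \<omega>))) \<in> borel_measurable M" by measurable
    show "AE \<omega> in M. F n \<omega> \<le> ennreal (exp (\<theta> * X t \<omega>))" for n
      by (rule AE_I2) (simp add: F_def A_eq)
  qed
  moreover have "(\<lambda>n. \<integral>\<^sup>+\<omega>. G n \<omega> \<partial>M) \<longlonglongrightarrow> (\<integral>\<^sup>+\<omega>. of_bool (crossed y t (path \<omega>)) * ennreal (exp (\<theta> * y + \<psi> \<theta> * (t - T y \<omega>))) \<partial>M)"
  proof (rule nn_integral_dominated_convergence[where w="\<lambda>\<omega>. ennreal (exp (\<theta> * (y + 1) + \<bar>\<psi> \<theta>\<bar> * t))"])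
    show "AE \<omega> in M. (\<lambda>n. G n \<omega>) \<longlonglongrightarrow> of_bool (crossed y t (path \<omega>)) * ennreal (exp (\<theta> * y + \<psi> \<theta> * (t - T y \<omega>)))"
      using Alim X_at_T AE_space
    proof eventually_elim
      case (elim \<omega>)
      show ?case
      proof (cases "\<tau> y \<omega> < \<infinity>")
        case True
        have "(\<lambda>n. ennreal (exp (\<theta> * X (gridT n y \<omega>) \<omega> + \<psi> \<theta> * (t - gridT n y \<omega>)))) \<longlonglongrightarrow> ennreal (exp (\<theta> * X (T y \<omega>) \<omega> + \<psi> \<theta> * (t - T y \<omega>)))"
          by (intro tendsto_intros X_gridT_tendsto gridT_tendsto elim)
        then have "(\<lambda>n. G n \<omega>) \<longlonglongrightarrow> of_bool (crossed y t (path \<omega>)) * ennreal (exp (\<theta> * X (T y \<omega>) \<omega> + \<psi> \<theta> * (t - T y \<omega>)))"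
          unfolding G_def by (intro tendsto_mult_ennreal elim(1)) simp_all
        then show ?thesis using elim(2) True y by simp
      next
        case False
        then have "\<not> crossed y t (path \<omega>)" using crossed_imp_finite[OF elim(3)] by blast
        then show ?thesis using False by (simp add: G_def A_eq)
      qed
    qed
    show "AE \<omega> in M. G n \<omega> \<le> ennreal (exp (\<theta> * (y + 1) + \<bar>\<psi> \<theta>\<bar> * t))" for n
    proof (rule AE_I2)
      fix \<omega>
      show "G n \<omega> \<le> ennreal (exp (\<theta> * (y + 1) + \<bar>\<psi> \<theta>\<bar> * t))"
      proof (cases "gridT n y \<omega> \<le> t \<and> X (gridT n y \<omega>) \<omega> \<le> y + 1")
        case True
        have "\<theta> * X (gridT n y \<omega>) \<omega> \<le> \<theta> * (y + 1)" using True \<theta> by (intro mult_left_mono) auto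
        moreover have "\<psi> \<theta> * (t - gridT n y \<omega>) \<le> \<bar>\<psi> \<theta>\<bar> * t"
          using True grid_nonneg[of n "cell n y \<omega>"] by (intro mult_mono) auto
        ultimately show ?thesis by (auto simp: G_def A_eq intro!: ennreal_leI)
      qed (auto simp: G_def A_eq)
    qed
    show "(\<lambda>\<omega>. of_bool (crossed y t (path \<omega>)) * ennreal (exp (\<theta> * y + \<psi> \<theta> * (t - T y \<omega>)))) \<in> borel_measurable M" by measurable
  qed (simp_all add: emeasure_space_1)
  ultimately show ?thesis unfolding FG by (rule LIMSEQ_unique)
qed

end

section \<open>Passage times and time reversal\<close>

context snlp begin

text \<open>Divided by exp(t \<psi>(\<theta>)), this is the probability under the exponentially
  tilted law that y is not exceeded before t.\<close>

definition survival :: "real \<Rightarrow> real \<Rightarrow> real \<Rightarrow> ennreal" where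
  "survival \<theta> y t = (\<integral>\<^sup>+\<omega>. of_bool (\<not> crossed y t (path \<omega>)) * ennreal (exp (\<theta> * X t \<omega>)) \<partial>M)"

lemma crossed_iff_T:
  assumes "\<omega> \<in> space M" shows "crossed y t (path \<omega>) \<longleftrightarrow> \<tau> y \<omega> < \<infinity> \<and> T y \<omega> < t"
  using assms T_less_iff[OF assms] crossed_imp_finite[OF assms] by blast

lemma survival_split:
  assumes \<theta>: "0 \<le> \<theta>" and y: "0 \<le> y" and t: "0 \<le> t"
  shows "ennreal (exp (\<psi> \<theta> * t)) = survival \<theta> y t +
    ennreal (exp (\<theta> * y + \<psi> \<theta> * t)) * (\<integral>\<^sup>+\<omega>. of_bool (crossed y t (path \<omega>)) * ennreal (exp (- \<psi> \<theta> * T y \<omega>)) \<partial>M)"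
proof -
  have [measurable]: "X t \<in> borel_measurable M" using t by simp
  have "ennreal (exp (\<psi> \<theta> * t)) = mgf \<theta> t" using mgf_eq[OF \<theta> t] by (simp add: mult.commute)
  also have "\<dots> = (\<integral>\<^sup>+\<omega>. of_bool (\<not> crossed y t (path \<omega>)) * ennreal (exp (\<theta> * X t \<omega>)) + of_bool (crossed y t (path \<omega>)) * ennreal (exp (\<theta> * X t \<omega>)) \<partial>M)"
    unfolding mgf_def by (intro nn_integral_cong) auto
  also have "\<dots> = survival \<theta> y t + (\<integral>\<^sup>+\<omega>. of_bool (crossed y t (path \<omega>)) * ennreal (exp (\<theta> * X t \<omega>)) \<partial>M)"
    unfolding survival_def by (rule nn_integral_add) measurable
  also have "(\<integral>\<^sup>+\<omega>. of_bool (crossed y t (path \<omega>)) * ennreal (exp (\<theta> * X t \<omega>)) \<partial>M)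
     = (\<integral>\<^sup>+\<omega>. ennreal (exp (\<theta> * y + \<psi> \<theta> * t)) * (of_bool (crossed y t (path \<omega>)) * ennreal (exp (- \<psi> \<theta> * T y \<omega>))) \<partial>M)"
    unfolding exp_X_crossed[OF assms]
    by (intro nn_integral_cong) (simp add: exp_add[symmetric] algebra_simps flip: ennreal_mult)
  also have "\<dots> = ennreal (exp (\<theta> * y + \<psi> \<theta> * t)) * (\<integral>\<^sup>+\<omega>. of_bool (crossed y t (path \<omega>)) * ennreal (exp (- \<psi> \<theta> * T y \<omega>)) \<partial>M)"
    by (rule nn_integral_cmult) measurable
  finally show ?thesis .
qed

lemma survival_le:
  assumes \<theta>: "0 \<le> \<theta>" and t: "0 < t" shows "survival \<theta> y t \<le> ennreal (exp (\<theta> * y))"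
proof -
  have "survival \<theta> y t \<le> (\<integral>\<^sup>+\<omega>. ennreal (exp (\<theta> * y)) \<partial>M)"
    unfolding survival_def
  proof (rule nn_integral_mono_AE)
    show "AE \<omega> in M. of_bool (\<not> crossed y t (path \<omega>)) * ennreal (exp (\<theta> * X t \<omega>)) \<le> ennreal (exp (\<theta> * y))"
      using no_jump_up by eventually_elim (use \<theta> t in \<open>auto intro!: ennreal_leI mult_left_mono\<close>)
  qed
  then show ?thesis by (simp add: emeasure_space_1)
qed

definition passage_laplace :: "real \<Rightarrow> real \<Rightarrow> ennreal" where
  "passage_laplace p y = (\<integral>\<^sup>+\<omega>. of_bool (\<tau> y \<omega> < \<infinity>) * ennreal (exp (- p * T y \<omega>)) \<partial>M)"

lemma passage_laplace_le_1: "0 \<le> p \<Longrightarrow> passage_laplace p y \<le> 1"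
proof -
  assume p: "0 \<le> p"
  have "passage_laplace p y \<le> (\<integral>\<^sup>+\<omega>. 1 \<partial>M)" unfolding passage_laplace_def
    by (intro nn_integral_mono) (use p in \<open>auto simp: mult_nonneg_nonneg\<close>)
  then show ?thesis by (simp add: emeasure_space_1)
qed

text \<open>After discounting at rate \<psi>(\<theta>) > 0, what \<open>survival_split\<close>
  leaves for paths still below y is at most exp(\<theta> y - \<psi>(\<theta>) t). It vanishes as t
  grows, and the crossed part carries the whole mass.\<close>

lemma passage_laplace_\<psi>:
  assumes \<theta>: "0 \<le> \<theta>" and \<psi>: "0 < \<psi> \<theta>" and y: "0 \<le> y"
  shows "passage_laplace (\<psi> \<theta>) y = ennreal (exp (- \<theta> * y))"
proof -
  define a where "a t = (\<integral>\<^sup>+\<omega>. of_bool (crossed y t (path \<omega>)) * ennreal (exp (- \<psi> \<theta> * T y \<omega>)) \<partial>M)" for t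
  have "(\<lambda>n. a (real n)) \<longlonglongrightarrow> passage_laplace (\<psi> \<theta>) y"
    unfolding a_def passage_laplace_def
  proof (rule nn_integral_dominated_convergence[where w="\<lambda>_. 1"])
    show "AE \<omega> in M. (\<lambda>n. of_bool (crossed y (real n) (path \<omega>)) * ennreal (exp (- \<psi> \<theta> * T y \<omega>)))
      \<longlonglongrightarrow> of_bool (\<tau> y \<omega> < \<infinity>) * ennreal (exp (- \<psi> \<theta> * T y \<omega>))"
    proof (rule AE_I2)
      fix \<omega> assume \<omega>: "\<omega> \<in> space M"
      obtain N :: nat where N: "T y \<omega> < real N" using reals_Archimedean2 by blast
      have "\<forall>\<^sub>F n in sequentially. crossed y (real n) (path \<omega>) \<longleftrightarrow> \<tau> y \<omega> < \<infinity>"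
        using eventually_ge_at_top[of N] by eventually_elim (use N in \<open>auto simp: crossed_iff_T[OF \<omega>]\<close>)
      then show "(\<lambda>n. of_bool (crossed y (real n) (path \<omega>)) * ennreal (exp (- \<psi> \<theta> * T y \<omega>)))
      \<longlonglongrightarrow> of_bool (\<tau> y \<omega> < \<infinity>) * ennreal (exp (- \<psi> \<theta> * T y \<omega>))"
        by (intro tendsto_eventually) (auto elim!: eventually_mono)
    qed
  qed (use \<psi> in \<open>auto simp: emeasure_space_1\<close>)
  then have lim: "(\<lambda>n. ennreal (exp (\<theta> * y)) * a (real n)) \<longlonglongrightarrow> ennreal (exp (\<theta> * y)) * passage_laplace (\<psi> \<theta>) y"
    by (intro tendsto_mult_ennreal tendsto_const) auto
  have eq: "1 = ennreal (exp (- \<psi> \<theta> * t)) * survival \<theta> y t + ennreal (exp (\<theta> * y)) * a t" if "0 \<le> t" for t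
  proof -
    have "1 = ennreal (exp (- \<psi> \<theta> * t)) * ennreal (exp (\<psi> \<theta> * t))"
      by (simp flip: ennreal_mult exp_add)
    also have "\<dots> = ennreal (exp (- \<psi> \<theta> * t)) * survival \<theta> y t + ennreal (exp (- \<psi> \<theta> * t)) * ennreal (exp (\<theta> * y + \<psi> \<theta> * t)) * a t"
      unfolding survival_split[OF \<theta> y that] a_def by (simp add: distrib_left mult.assoc)
    also have "ennreal (exp (- \<psi> \<theta> * t)) * ennreal (exp (\<theta> * y + \<psi> \<theta> * t)) = ennreal (exp (\<theta> * y))"
      by (simp flip: ennreal_mult exp_add)
    finally show ?thesis .
  qed
  have s0: "(\<lambda>n. ennreal (exp (- \<psi> \<theta> * real n)) * survival \<theta> y (real n)) \<longlonglongrightarrow> 0"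
  proof (rule tendsto_sandwich[of "\<lambda>_. 0" _ _ "\<lambda>n. ennreal (exp (- \<psi> \<theta> * real n) * exp (\<theta> * y))"])
    show "\<forall>\<^sub>F n in sequentially. ennreal (exp (- \<psi> \<theta> * real n)) * survival \<theta> y (real n) \<le> ennreal (exp (- \<psi> \<theta> * real n) * exp (\<theta> * y))"
      using eventually_gt_at_top[of 0]
      by eventually_elim (subst ennreal_mult, use \<theta> in \<open>auto intro!: mult_left_mono survival_le\<close>)
    have "(\<lambda>n. exp (- \<psi> \<theta> * real n)) = (\<lambda>n. exp (- \<psi> \<theta>) ^ n)" by (simp add: fun_eq_iff mult.commute flip: exp_of_nat_mult)
    then have "(\<lambda>n. exp (- \<psi> \<theta> * real n)) \<longlonglongrightarrow> 0" using \<psi> by (simp add: LIMSEQ_power_zero)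
    then have "(\<lambda>n. exp (- \<psi> \<theta> * real n) * exp (\<theta> * y)) \<longlonglongrightarrow> 0 * exp (\<theta> * y)" by (intro tendsto_intros)
    then show "(\<lambda>n. ennreal (exp (- \<psi> \<theta> * real n) * exp (\<theta> * y))) \<longlonglongrightarrow> 0" by (simp add: tendsto_ennrealI flip: ennreal_0)
  qed auto
  have "(\<lambda>n. ennreal (exp (- \<psi> \<theta> * real n)) * survival \<theta> y (real n) + ennreal (exp (\<theta> * y)) * a (real n))
     \<longlonglongrightarrow> 0 + ennreal (exp (\<theta> * y)) * passage_laplace (\<psi> \<theta>) y"
    by (intro tendsto_add s0 lim)
  moreover have "ennreal (exp (- \<psi> \<theta> * real n)) * survival \<theta> y (real n) + ennreal (exp (\<theta> * y)) * a (real n) = 1" for n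
    by (rule eq[symmetric]) simp
  ultimately have "(\<lambda>n::nat. 1 :: ennreal) \<longlonglongrightarrow> ennreal (exp (\<theta> * y)) * passage_laplace (\<psi> \<theta>) y"
    by (simp only: add_0)
  then have one: "1 = ennreal (exp (\<theta> * y)) * passage_laplace (\<psi> \<theta>) y" by (simp add: LIMSEQ_const_iff)
  have "passage_laplace (\<psi> \<theta>) y = ennreal (exp (- \<theta> * y)) * ennreal (exp (\<theta> * y)) * passage_laplace (\<psi> \<theta>) y"
    by (simp flip: ennreal_mult exp_add)
  also have "\<dots> = ennreal (exp (- \<theta> * y))" by (simp add: mult.assoc flip: one)
  finally show ?thesis .
qed

text \<open>Both \<open>passage_laplace_\<psi>\<close> and \<open>survival_split\<close> contain the
  contribution of crossings before t; cancelling it leaves the passages at or after t. In this form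
  t enters only through an exponential factor and an indicator, so it can be integrated out
  explicitly.\<close>

lemma survival_eq:
  assumes \<theta>: "0 \<le> \<theta>" and \<psi>: "0 < \<psi> \<theta>" and y: "0 \<le> y" and t: "0 \<le> t"
  shows "survival \<theta> y t = ennreal (exp (\<theta> * y + \<psi> \<theta> * t)) *
    (\<integral>\<^sup>+\<omega>. of_bool (\<tau> y \<omega> < \<infinity> \<and> t \<le> T y \<omega>) * ennreal (exp (- \<psi> \<theta> * T y \<omega>)) \<partial>M)"
proof -
  define a where "a = (\<integral>\<^sup>+\<omega>. of_bool (crossed y t (path \<omega>)) * ennreal (exp (- \<psi> \<theta> * T y \<omega>)) \<partial>M)"
  define a' where "a' = (\<integral>\<^sup>+\<omega>. of_bool (\<tau> y \<omega> < \<infinity> \<and> t \<le> T y \<omega>) * ennreal (exp (- \<psi> \<theta> * T y \<omega>)) \<partial>M)"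
  let ?e = "ennreal (exp (\<theta> * y + \<psi> \<theta> * t))"
  have "passage_laplace (\<psi> \<theta>) y = (\<integral>\<^sup>+\<omega>. of_bool (crossed y t (path \<omega>)) * ennreal (exp (- \<psi> \<theta> * T y \<omega>)) +
     of_bool (\<tau> y \<omega> < \<infinity> \<and> t \<le> T y \<omega>) * ennreal (exp (- \<psi> \<theta> * T y \<omega>)) \<partial>M)"
    unfolding passage_laplace_def by (intro nn_integral_cong) (auto simp: crossed_iff_T)
  also have "\<dots> = a + a'" unfolding a_def a'_def by (rule nn_integral_add) measurable
  finally have aa: "ennreal (exp (- \<theta> * y)) = a + a'" using passage_laplace_\<psi>[OF \<theta> \<psi> y] by simp
  have afin: "?e * a \<noteq> \<top>" using aa by (auto simp: ennreal_mult_eq_top_iff)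
  have "?e * a + ?e * a' = ?e * ennreal (exp (- \<theta> * y))" unfolding aa by (simp add: distrib_left)
  also have "\<dots> = ennreal (exp (\<psi> \<theta> * t))" by (simp flip: ennreal_mult exp_add)
  also have "\<dots> = ?e * a + survival \<theta> y t" using survival_split[OF \<theta> y t] by (simp add: a_def add.commute)
  finally have "?e * a' = survival \<theta> y t" using afin by (simp add: ennreal_add_left_cancel)
  then show ?thesis by (simp add: a'_def)
qed

text \<open>Time reversal on the grid \<open>{k \<delta>}\<close>: the increments are exchangeable.\<close>

lemma reversal_grid:
  fixes N :: nat
  assumes \<delta>: "0 \<le> \<delta>"
  shows "(\<integral>\<^sup>+\<omega>. of_bool (\<forall>k<N. X (real N * \<delta>) \<omega> - X (real k * \<delta>) \<omega> \<le> y) * ennreal (exp (\<theta> * X (real N * \<delta>) \<omega>)) \<partial>M) =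
    (\<integral>\<^sup>+\<omega>. of_bool (\<forall>k<N. X (real (Suc k) * \<delta>) \<omega> \<le> y) * ennreal (exp (\<theta> * X (real N * \<delta>) \<omega>)) \<partial>M)"
proof (cases "N = 0")
  case False
  define D where "D i \<omega> = X (real (Suc i) * \<delta>) \<omega> - X (real i * \<delta>) \<omega>" for i \<omega>
  let ?I = "{..<N}" and ?P = "PiM {..<N} (\<lambda>_. borel :: real measure)"
  have ne: "?I \<noteq> {}" using False by (simp add: lessThan_empty_iff)
  have Dm[measurable]: "D i \<in> borel_measurable M" for i
    unfolding D_def using \<delta> by (intro borel_measurable_diff X_measurable) auto
  have D_fun: "D i = (\<lambda>\<omega>. X (real i * \<delta> + \<delta>) \<omega> - X (real i * \<delta>) \<omega>)" for i
    by (simp add: fun_eq_iff D_def algebra_simps)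
  have ind: "indep_vars (\<lambda>_. borel) D ?I"
    unfolding D_def using \<delta> by (intro independent_increments) (auto simp: incseq_def intro!: mult_right_mono)
  have law: "distr M borel (D i) = distr M borel (\<lambda>\<omega>. X \<delta> \<omega> - X 0 \<omega>)" for i
    unfolding D_fun using \<delta> by (intro stationary_increments) auto
  define rv where "rv i = N - Suc i" for i
  have rv: "inj_on rv ?I" "rv ` ?I \<subseteq> ?I" unfolding rv_def inj_on_def by auto
  have L1: "distr M ?P (\<lambda>\<omega>. \<lambda>i\<in>?I. D i \<omega>) = PiM ?I (\<lambda>_. distr M borel (\<lambda>\<omega>. X \<delta> \<omega> - X 0 \<omega>))"
    using iffD1[OF indep_vars_iff_distr_eq_PiM'[OF ne] ind] law by simp
  have L2: "distr M ?P (\<lambda>\<omega>. \<lambda>i\<in>?I. D (rv i) \<omega>) = PiM ?I (\<lambda>_. distr M borel (\<lambda>\<omega>. X \<delta> \<omega> - X 0 \<omega>))"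
  proof -
    have "distr M ?P (\<lambda>\<omega>. \<lambda>i\<in>?I. D (rv i) \<omega>) = distr (distr M ?P (\<lambda>\<omega>. \<lambda>i\<in>?I. D i \<omega>)) ?P (\<lambda>v. \<lambda>i\<in>?I. v (rv i))"
    proof (subst distr_distr)
      show "(\<lambda>v. \<lambda>i\<in>?I. v (rv i)) \<in> measurable ?P ?P"
        using rv(2) by (intro measurable_restrict measurable_component_singleton) auto
      show "(\<lambda>\<omega>. \<lambda>i\<in>?I. D i \<omega>) \<in> measurable M ?P" by (intro measurable_restrict Dm)
      show "distr M ?P (\<lambda>\<omega>. \<lambda>i\<in>?I. D (rv i) \<omega>) = distr M ?P ((\<lambda>v. \<lambda>i\<in>?I. v (rv i)) \<circ> (\<lambda>\<omega>. \<lambda>i\<in>?I. D i \<omega>))"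
        using rv(2) by (intro distr_cong) (auto simp: restrict_def fun_eq_iff)
    qed
    also have "\<dots> = distr (PiM ?I (\<lambda>_. distr M borel (\<lambda>\<omega>. X \<delta> \<omega> - X 0 \<omega>))) (PiM ?I (\<lambda>_. distr M borel (\<lambda>\<omega>. X \<delta> \<omega> - X 0 \<omega>))) (\<lambda>v. \<lambda>i\<in>?I. v (rv i))"
      unfolding L1 by (rule distr_cong) (auto intro!: sets_PiM_cong)
    also have "\<dots> = PiM ?I (\<lambda>_. distr M borel (\<lambda>\<omega>. X \<delta> \<omega> - X 0 \<omega>))"
      using rv \<delta> by (intro distr_PiM_reindex prob_space_distr) auto
    finally show ?thesis .
  qed
  \<comment> \<open>For increments in their natural order the sum over {k..<N} is the increment from
    step k to step N. For the reversed order it is the position at step N - k, while the total sum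
    is unchanged.\<close>
  define F :: "(nat \<Rightarrow> real) \<Rightarrow> ennreal" where
    "F v = of_bool (\<forall>k\<in>?I. (\<Sum>i\<in>{k..<N}. v i) \<le> y) * ennreal (exp (\<theta> * (\<Sum>i\<in>?I. v i)))" for v
  have comp[measurable]: "(\<lambda>v. v i) \<in> borel_measurable ?P" if "i \<in> ?I" for i
    using that by (rule measurable_component_singleton)
  have sm[measurable]: "(\<lambda>v. \<Sum>i\<in>{k..<N}. v i) \<in> borel_measurable ?P" "(\<lambda>v. \<Sum>i\<in>?I. v i) \<in> borel_measurable ?P" for k
    by (intro borel_measurable_sum comp; simp)+
  have Fm: "F \<in> borel_measurable ?P" unfolding F_def by measurable
  have vm: "(\<lambda>\<omega>. \<lambda>i\<in>?I. D (f i) \<omega>) \<in> measurable M ?P" for f by (intro measurable_restrict Dm)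
  have "(\<integral>\<^sup>+\<omega>. F (\<lambda>i\<in>?I. D i \<omega>) \<partial>M) = (\<integral>\<^sup>+v. F v \<partial>distr M ?P (\<lambda>\<omega>. \<lambda>i\<in>?I. D i \<omega>))"
    by (rule nn_integral_distr[symmetric, OF vm]) (simp add: Fm)
  also have "\<dots> = (\<integral>\<^sup>+v. F v \<partial>distr M ?P (\<lambda>\<omega>. \<lambda>i\<in>?I. D (rv i) \<omega>))" unfolding L1 L2 ..
  also have "\<dots> = (\<integral>\<^sup>+\<omega>. F (\<lambda>i\<in>?I. D (rv i) \<omega>) \<partial>M)"
    by (rule nn_integral_distr[OF vm]) (simp add: Fm)
  finally have eq: "(\<integral>\<^sup>+\<omega>. F (\<lambda>i\<in>?I. D i \<omega>) \<partial>M) = (\<integral>\<^sup>+\<omega>. F (\<lambda>i\<in>?I. D (rv i) \<omega>) \<partial>M)" .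
  have tel: "(\<Sum>i\<in>{k..<n}. D i \<omega>) = X (real n * \<delta>) \<omega> - X (real k * \<delta>) \<omega>" if "k \<le> n" for k n \<omega>
    unfolding D_def using sum_Suc_diff'[OF that, of "\<lambda>i. X (real i * \<delta>) \<omega>"] .
  have tot: "(\<Sum>i\<in>?I. D i \<omega>) = X (real N * \<delta>) \<omega>" if "\<omega> \<in> space M" for \<omega>
    using tel[of 0 N \<omega>] X_0[OF that] by (simp add: atLeast0LessThan)
  have F1: "F (\<lambda>i\<in>?I. D i \<omega>) = of_bool (\<forall>k<N. X (real N * \<delta>) \<omega> - X (real k * \<delta>) \<omega> \<le> y) * ennreal (exp (\<theta> * X (real N * \<delta>) \<omega>))"
    if "\<omega> \<in> space M" for \<omega>
  proof -
    have "(\<Sum>i\<in>{k..<N}. (\<lambda>i\<in>?I. D i \<omega>) i) = (\<Sum>i\<in>{k..<N}. D i \<omega>)" for k by (intro sum.cong) auto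
    moreover have "(\<Sum>i\<in>?I. (\<lambda>i\<in>?I. D i \<omega>) i) = (\<Sum>i\<in>?I. D i \<omega>)" by (intro sum.cong) auto
    ultimately show ?thesis unfolding F_def by (simp add: tot[OF that] tel Ball_def)
  qed
  have F2: "F (\<lambda>i\<in>?I. D (rv i) \<omega>) = of_bool (\<forall>k<N. X (real (Suc k) * \<delta>) \<omega> \<le> y) * ennreal (exp (\<theta> * X (real N * \<delta>) \<omega>))"
    if "\<omega> \<in> space M" for \<omega>
  proof -
    have a: "(\<Sum>i\<in>{k..<N}. (\<lambda>i\<in>?I. D (rv i) \<omega>) i) = X (real (Suc (rv k)) * \<delta>) \<omega>" if k: "k < N" for k
    proof -
      have "(\<Sum>i\<in>{k..<N}. (\<lambda>i\<in>?I. D (rv i) \<omega>) i) = (\<Sum>i\<in>{k..<N}. D (rv i) \<omega>)" by (intro sum.cong) auto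
      also have "\<dots> = (\<Sum>j\<in>{0..<N-k}. D j \<omega>)"
        by (rule sum.reindex_bij_witness[of _ rv rv]) (auto simp: rv_def)
      also have "\<dots> = X (real (N - k) * \<delta>) \<omega>" using tel[of 0 "N - k" \<omega>] X_0[OF \<open>\<omega> \<in> space M\<close>] by simp
      also have "N - k = Suc (rv k)" using k by (simp add: rv_def)
      finally show ?thesis .
    qed
    have "(\<Sum>i\<in>?I. (\<lambda>i\<in>?I. D (rv i) \<omega>) i) = X (real N * \<delta>) \<omega>"
      using a[of 0] False by (simp add: rv_def atLeast0LessThan)
    moreover have "(\<forall>k\<in>?I. X (real (Suc (rv k)) * \<delta>) \<omega> \<le> y) \<longleftrightarrow> (\<forall>k<N. X (real (Suc k) * \<delta>) \<omega> \<le> y)"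
    proof (intro iffI allI impI ballI)
      fix k assume *: "\<forall>k\<in>?I. X (real (Suc (rv k)) * \<delta>) \<omega> \<le> y" "k < N"
      have "rv (rv k) = k" "rv k \<in> ?I" using *(2) by (auto simp: rv_def)
      then show "X (real (Suc k) * \<delta>) \<omega> \<le> y" using *(1) by metis
    next
      fix k assume *: "\<forall>k<N. X (real (Suc k) * \<delta>) \<omega> \<le> y" "k \<in> ?I"
      have "rv k < N" using *(2) by (auto simp: rv_def)
      then show "X (real (Suc (rv k)) * \<delta>) \<omega> \<le> y" using *(1) by blast
    qed
    moreover have "(\<forall>k\<in>?I. (\<Sum>i\<in>{k..<N}. (\<lambda>i\<in>?I. D (rv i) \<omega>) i) \<le> y) \<longleftrightarrow> (\<forall>k\<in>?I. X (real (Suc (rv k)) * \<delta>) \<omega> \<le> y)"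
      using a by auto
    ultimately show ?thesis unfolding F_def by simp
  qed
  from eq show ?thesis by (simp add: F1 F2 cong: nn_integral_cong_simp)
qed simp

text \<open>The limit of the grid version along meshes t / 2^m. The grid event on the right also
  inspects time t itself, which \<open>crossed\<close> does not see; \<open>no_jump_up\<close>
  supplies the missing inequality there.\<close>

lemma reversal:
  assumes \<theta>: "0 \<le> \<theta>" and t: "0 < t"
  shows "(\<integral>\<^sup>+\<omega>. of_bool (\<forall>r. 0 \<le> r \<longrightarrow> r < t \<longrightarrow> X t \<omega> - X r \<omega> \<le> y) * ennreal (exp (\<theta> * X t \<omega>)) \<partial>M) = survival \<theta> y t"
proof -
  have Xt[measurable]: "X t \<in> borel_measurable M" using t by simp
  have Xg[measurable]: "X (real k * (t / 2 ^ m)) \<in> borel_measurable M" for k m using t by simp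
  let ?A = "\<lambda>m \<omega>. of_bool (\<forall>k<2 ^ m. X t \<omega> - X (real k * (t / 2 ^ m)) \<omega> \<le> y) :: ennreal"
  let ?B = "\<lambda>m \<omega>. of_bool (\<forall>k<2 ^ m. X (real (Suc k) * (t / 2 ^ m)) \<omega> \<le> y) :: ennreal"
  let ?e = "\<lambda>\<omega>. ennreal (exp (\<theta> * X t \<omega>))"
  have eq: "(\<integral>\<^sup>+\<omega>. ?A m \<omega> * ?e \<omega> \<partial>M) = (\<integral>\<^sup>+\<omega>. ?B m \<omega> * ?e \<omega> \<partial>M)" for m
    using reversal_grid[of "t / 2 ^ m" "2 ^ m" y \<theta>] t by simp
  \<comment> \<open>By right-continuity a strict violation at time r persists at grid points just to
    its right. The index is positive because the reversed event starts with the first step, not with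
    time 0.\<close>
  have near: "\<forall>\<^sub>F m in sequentially. \<exists>k<2 ^ m. 0 < k \<and> P (X (real k * (t / 2 ^ m)) \<omega>)"
    if \<omega>: "\<omega> \<in> space M" and r: "0 \<le> r" "r < t" and P: "open {u. P u}" "P (X r \<omega>)" for \<omega> r P
  proof -
    let ?k = "\<lambda>m. nat \<lfloor>2 ^ m * (r / t)\<rfloor>"
    have rt: "0 \<le> r / t" using r by simp
    have "(\<lambda>m. t * grid m (?k m)) \<longlonglongrightarrow> t * (r / t)" by (intro tendsto_mult_left grid_floor_tendsto rt)
    then have lim': "(\<lambda>m. t * grid m (?k m)) \<longlonglongrightarrow> r" using t by simp
    have gt: "r < t * grid m (?k m)" for m using grid_floor(1)[OF rt, of m] t by (simp add: divide_less_eq mult.commute)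
    have "filterlim (\<lambda>m. t * grid m (?k m)) (at_right r) sequentially"
      using lim' gt by (auto simp: filterlim_at less_imp_neq[symmetric] intro!: always_eventually)
    then have "(\<lambda>m. X (t * grid m (?k m)) \<omega>) \<longlonglongrightarrow> X r \<omega>" by (rule filterlim_compose[OF X_right_continuous[OF \<omega> r(1)]])
    then have "\<forall>\<^sub>F m in sequentially. X (t * grid m (?k m)) \<omega> \<in> {u. P u}" by (rule topological_tendstoD) (use P in auto)
    moreover have "\<forall>\<^sub>F m in sequentially. t * grid m (?k m) < t" using order_tendstoD(2)[OF lim' r(2)] .
    ultimately show ?thesis
    proof eventually_elim
      case (elim m)
      have e: "t * grid m (?k m) = real (Suc (?k m)) * (t / 2 ^ m)" by (simp add: grid_def add.commute)
      have "grid m (?k m) < 1" using elim(2) t by simp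
      then have "real (Suc (?k m)) < 2 ^ m" by (simp add: grid_def)
      then have "Suc (?k m) < 2 ^ m" by (metis of_nat_less_iff of_nat_numeral of_nat_power)
      then show ?case using elim(1) unfolding e by (intro exI[of _ "Suc (?k m)"]) auto
    qed
  qed
  have pt: "0 \<le> real k * (t / 2 ^ m) \<and> real k * (t / 2 ^ m) < t" if "k < 2 ^ m" for k m :: nat
  proof -
    have "real k < 2 ^ m" using that by (metis of_nat_less_iff of_nat_numeral of_nat_power)
    then have "real k * (t / 2 ^ m) < 2 ^ m * (t / 2 ^ m)" using t by (intro mult_strict_right_mono) auto
    then show ?thesis using t by simp
  qed
  have limA: "(\<lambda>m. ?A m \<omega>) \<longlonglongrightarrow> of_bool (\<forall>r. 0 \<le> r \<longrightarrow> r < t \<longrightarrow> X t \<omega> - X r \<omega> \<le> y)" if \<omega>: "\<omega> \<in> space M" for \<omega>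
  proof (cases "\<forall>r. 0 \<le> r \<longrightarrow> r < t \<longrightarrow> X t \<omega> - X r \<omega> \<le> y")
    case True
    then have "?A m \<omega> = 1" for m using pt by auto
    then show ?thesis using True by simp
  next
    case False
    then obtain r where r: "0 \<le> r" "r < t" "X r \<omega> < X t \<omega> - y" by (auto simp: not_le algebra_simps)
    have "\<forall>\<^sub>F m in sequentially. \<exists>k<2 ^ m. 0 < k \<and> X (real k * (t / 2 ^ m)) \<omega> < X t \<omega> - y"
      using r by (intro near[OF \<omega> r(1,2)]) (auto simp flip: lessThan_def)
    then have "\<forall>\<^sub>F m in sequentially. ?A m \<omega> = 0" by eventually_elim (force simp: not_le)
    then have "(\<lambda>m. ?A m \<omega>) \<longlonglongrightarrow> 0" by (rule tendsto_eventually)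
    moreover have "(of_bool (\<forall>r. 0 \<le> r \<longrightarrow> r < t \<longrightarrow> X t \<omega> - X r \<omega> \<le> y) :: ennreal) = 0" using False by simp
    ultimately show ?thesis by (simp only:)
  qed
  have limB: "AE \<omega> in M. (\<lambda>m. ?B m \<omega>) \<longlonglongrightarrow> of_bool (\<not> crossed y t (path \<omega>))"
    using no_jump_up AE_space
  proof eventually_elim
    case (elim \<omega>)
    show ?case
    proof (cases "crossed y t (path \<omega>)")
      case False
      have "X (real (Suc k) * (t / 2 ^ m)) \<omega> \<le> y" if "k < 2 ^ m" for k m
      proof (cases "Suc k < 2 ^ m")
        case True
        then show ?thesis using pt[OF True] False t by (force simp: crossed_path[OF elim(2)])
      next
        case f: False
        then have "real (Suc k) = 2 ^ m" using that by (metis Suc_lessI of_nat_numeral of_nat_power)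
        then show ?thesis using elim(1) t False by simp
      qed
      then have "?B m \<omega> = 1" for m by auto
      then show ?thesis using False by simp
    next
      case True
      then obtain r where r: "0 < r" "r < t" "y < X r \<omega>" by (auto simp: crossed_path[OF elim(2)])
      have "\<forall>\<^sub>F m in sequentially. \<exists>k<2 ^ m. 0 < k \<and> y < X (real k * (t / 2 ^ m)) \<omega>"
        using r by (intro near[OF elim(2), of r]) (auto simp flip: greaterThan_def)
      then have "\<forall>\<^sub>F m in sequentially. ?B m \<omega> = 0"
      proof eventually_elim
        case (elim m)
        then obtain k where "k < 2 ^ m" "0 < k" "y < X (real k * (t / 2 ^ m)) \<omega>" by blast
        then show ?case by (cases k) (auto simp: not_le intro!: exI[of _ "k - 1"])
      qed
      then have "(\<lambda>m. ?B m \<omega>) \<longlonglongrightarrow> 0" by (rule tendsto_eventually)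
      moreover have "(of_bool (\<not> crossed y t (path \<omega>)) :: ennreal) = 0" using True by simp
      ultimately show ?thesis by (simp only:)
    qed
  qed
  have fin: "(\<integral>\<^sup>+\<omega>. ?e \<omega> \<partial>M) < \<infinity>" using mgf_finite[OF \<theta>, of t] t by (simp add: mgf_def)
  have Am: "?A m \<in> borel_measurable M" for m by measurable
  \<comment> \<open>The condition ranges over uncountably many times, so its measurability is read
    off from the pointwise limit of the grid events.\<close>
  have Alim: "(\<lambda>\<omega>. of_bool (\<forall>r. 0 \<le> r \<longrightarrow> r < t \<longrightarrow> X t \<omega> - X r \<omega> \<le> y) :: ennreal) \<in> borel_measurable M"
    by (rule borel_measurable_LIMSEQ_order[OF limA Am])
  have "(\<lambda>m. \<integral>\<^sup>+\<omega>. ?A m \<omega> * ?e \<omega> \<partial>M) \<longlonglongrightarrow> (\<integral>\<^sup>+\<omega>. of_bool (\<forall>r. 0 \<le> r \<longrightarrow> r < t \<longrightarrow> X t \<omega> - X r \<omega> \<le> y) * ?e \<omega> \<partial>M)"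
  proof (rule nn_integral_dominated_convergence[where w="?e"])
    show "AE \<omega> in M. (\<lambda>m. ?A m \<omega> * ?e \<omega>) \<longlonglongrightarrow> of_bool (\<forall>r. 0 \<le> r \<longrightarrow> r < t \<longrightarrow> X t \<omega> - X r \<omega> \<le> y) * ?e \<omega>"
      by (rule AE_I2, rule tendsto_mult_ennreal[OF limA tendsto_const]) auto
    show "AE \<omega> in M. ?A m \<omega> * ?e \<omega> \<le> ?e \<omega>" for m by (rule AE_I2) simp
    show "?e \<in> borel_measurable M" by measurable
    show "(\<lambda>\<omega>. ?A m \<omega> * ?e \<omega>) \<in> borel_measurable M" for m by measurable
    show "(\<lambda>\<omega>. of_bool (\<forall>r. 0 \<le> r \<longrightarrow> r < t \<longrightarrow> X t \<omega> - X r \<omega> \<le> y) * ?e \<omega>) \<in> borel_measurable M"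
      by (rule borel_measurable_times_ennreal[OF Alim]) measurable
  qed (rule fin)
  moreover have "(\<lambda>m. \<integral>\<^sup>+\<omega>. ?B m \<omega> * ?e \<omega> \<partial>M) \<longlonglongrightarrow> survival \<theta> y t"
    unfolding survival_def
  proof (rule nn_integral_dominated_convergence[where w="?e"])
    show "AE \<omega> in M. (\<lambda>m. ?B m \<omega> * ?e \<omega>) \<longlonglongrightarrow> of_bool (\<not> crossed y t (path \<omega>)) * ?e \<omega>"
      using limB
    proof eventually_elim
      case (elim \<omega>)
      show ?case by (rule tendsto_mult_ennreal[OF elim tendsto_const]) auto
    qed
    show "AE \<omega> in M. ?B m \<omega> * ?e \<omega> \<le> ?e \<omega>" for m by (rule AE_I2) simp
    show "?e \<in> borel_measurable M" by measurable
    show "(\<lambda>\<omega>. ?B m \<omega> * ?e \<omega>) \<in> borel_measurable M" for m by measurable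
    show "(\<lambda>\<omega>. of_bool (\<not> crossed y t (path \<omega>)) * ?e \<omega>) \<in> borel_measurable M" by measurable
  qed (rule fin)
  ultimately show ?thesis unfolding eq by (rule LIMSEQ_unique)
qed

end

section \<open>Occupation functionals and resolvents\<close>

text \<open>The value at \<open>t\<close> of a right-continuous path, jointly measurable in the path and \<open>t\<close>.\<close>

definition right_lim :: "(real \<Rightarrow> real) \<Rightarrow> real \<Rightarrow> real" where
  "right_lim w t = lim (\<lambda>n. w (grid n (nat \<lfloor>2 ^ n * t\<rfloor>)))"

lemma const_path_measurable[measurable (raw)]: "(\<lambda>_. w) \<in> measurable N path_space"
  by (rule measurable_const) (simp add: space_PiM PiE_def)

lemma right_lim_measurable[measurable (raw)]:
  assumes f[measurable]: "f \<in> measurable N path_space" and g[measurable]: "g \<in> borel_measurable N"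
  shows "(\<lambda>x. right_lim (f x) (g x)) \<in> borel_measurable N"
  unfolding right_lim_def
proof (rule borel_measurable_lim_metric)
  fix n
  have "(\<lambda>x. f x (grid n k)) \<in> borel_measurable N" for k by measurable
  moreover have "(\<lambda>x. nat \<lfloor>2 ^ n * g x\<rfloor>) \<in> measurable N (count_space UNIV)" by measurable
  ultimately show "(\<lambda>x. f x (grid n (nat \<lfloor>2 ^ n * g x\<rfloor>))) \<in> borel_measurable N"
    by (rule measurable_compose_countable)
qed

text \<open>On a right-continuous path this says that x + w is nonnegative on all of [0,t). Time 0
  is included, unlike in the passage time, so that the resolvent vanishes for negative starting
  points and becomes a causal function.\<close>

definition alive :: "real \<Rightarrow> real \<Rightarrow> (real \<Rightarrow> real) \<Rightarrow> bool" where
  "alive x t w \<longleftrightarrow> (\<forall>r\<in>\<rat>. 0 \<le> r \<and> r < t \<longrightarrow> 0 \<le> x + w r)"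

lemma alive_measurable[measurable (raw)]:
  assumes [measurable]: "f \<in> borel_measurable N" "g \<in> borel_measurable N" "h \<in> measurable N path_space"
  shows "Measurable.pred N (\<lambda>x. alive (f x) (g x) (h x))"
proof -
  have "alive (f x) (g x) (h x) \<longleftrightarrow> (\<forall>i::rat. 0 \<le> real_of_rat i \<and> real_of_rat i < g x \<longrightarrow> 0 \<le> f x + h x (real_of_rat i))" for x
    by (auto simp: alive_def Rats_def)
  then show ?thesis by simp
qed

definition occ :: "real set \<Rightarrow> real \<Rightarrow> (real \<Rightarrow> real) \<Rightarrow> real \<Rightarrow> real" where
  "occ A x w t = (LBINT s:{0..t}. indicator A (x + right_lim w s))"

lemma occ_measurable[measurable (raw)]:
  assumes [measurable]: "A \<in> sets borel" "f \<in> borel_measurable N" "g \<in> measurable N path_space" "h \<in> borel_measurable N"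
  shows "(\<lambda>z. occ A (f z) (g z) (h z)) \<in> borel_measurable N"
proof -
  have "(\<lambda>z. \<integral>s. (if 0 \<le> s \<and> s \<le> h z then indicator A (f z + right_lim (g z) s) else 0 :: real) \<partial>lborel) \<in> borel_measurable N"
    by measurable
  also have "(\<lambda>z. \<integral>s. (if 0 \<le> s \<and> s \<le> h z then indicator A (f z + right_lim (g z) s) else 0 :: real) \<partial>lborel) = (\<lambda>z. occ A (f z) (g z) (h z))"
    unfolding occ_def set_lebesgue_integral_def by (intro ext Bochner_Integration.integral_cong) (auto simp: indicator_def)
  finally show ?thesis .
qed

definition wt :: "real \<Rightarrow> real \<Rightarrow> real set \<Rightarrow> real \<Rightarrow> (real \<Rightarrow> real) \<Rightarrow> real \<Rightarrow> real" where
  "wt p q A x w t = exp (- p * t - q * occ A x w t) * of_bool (alive x t w)"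

lemma wt_measurable[measurable (raw)]:
  assumes [measurable]: "A \<in> sets borel" "f \<in> borel_measurable N" "g \<in> measurable N path_space" "h \<in> borel_measurable N"
  shows "(\<lambda>z. wt p q A (f z) (g z) (h z)) \<in> borel_measurable N"
  unfolding wt_def by measurable

lemma pot_integrand_measurable:
  assumes A: "A \<in> sets borel" and f: "f \<in> borel_measurable borel"
  shows "(\<lambda>t. of_bool (0 < t) * ennreal (wt p q A x w t) * f (x + right_lim w t)) \<in> borel_measurable borel"
proof -
  have 1: "(\<lambda>t. wt p q A x w t) \<in> borel_measurable borel"
    by (rule wt_measurable[OF A borel_measurable_const const_path_measurable measurable_ident_sets[OF refl, unfolded id_def]])
  have 2: "(\<lambda>t. right_lim w t) \<in> borel_measurable borel"
    by (rule right_lim_measurable[OF const_path_measurable measurable_ident_sets[OF refl, unfolded id_def]])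
  have 3: "(\<lambda>t. f (x + right_lim w t)) \<in> borel_measurable borel"
    by (rule measurable_compose[OF borel_measurable_add[OF borel_measurable_const 2] f])
  show ?thesis
    by (intro borel_measurable_times_ennreal measurable_compose[OF 1 measurable_ennreal] 3) measurable
qed

lemma wt_nonneg[simp]: "0 \<le> wt p q A x w t" by (simp add: wt_def)

definition pot :: "real \<Rightarrow> real \<Rightarrow> real set \<Rightarrow> (real \<Rightarrow> ennreal) \<Rightarrow> real \<Rightarrow> (real \<Rightarrow> real) \<Rightarrow> ennreal" where
  "pot p q A f x w = (\<integral>\<^sup>+t. of_bool (0 < t) * ennreal (wt p q A x w t) * f (x + right_lim w t) \<partial>lborel)"

lemma pot_measurable[measurable (raw)]:
  assumes [measurable]: "A \<in> sets borel" "f \<in> borel_measurable borel" "g \<in> borel_measurable N" "h \<in> measurable N path_space"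
  shows "(\<lambda>z. pot p q A f (g z) (h z)) \<in> borel_measurable N"
  unfolding pot_def by measurable

context snlp begin

section \<open>Evaluation on sample paths and splitting at a fixed time\<close>

lemma right_lim_path:
  assumes "\<omega> \<in> space M" "0 \<le> t" shows "right_lim (path \<omega>) t = X t \<omega>"
  unfolding right_lim_def
proof (rule limI)
  have "(\<lambda>n. X (grid n (nat \<lfloor>2 ^ n * t\<rfloor>)) \<omega>) \<longlonglongrightarrow> X t \<omega>"
    by (rule filterlim_compose[OF X_right_continuous[OF assms]])
       (use grid_floor_tendsto[OF assms(2)] grid_floor(1)[OF assms(2)] in \<open>auto simp: filterlim_at less_imp_neq[symmetric] intro!: always_eventually\<close>)
  then show "(\<lambda>n. path \<omega> (grid n (nat \<lfloor>2 ^ n * t\<rfloor>))) \<longlonglongrightarrow> X t \<omega>" by simp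
qed

lemma right_lim_shifted:
  assumes "\<omega> \<in> space M" "0 \<le> s" "0 \<le> t" shows "right_lim (shifted s \<omega>) t = X (s + t) \<omega> - X s \<omega>"
  unfolding right_lim_def
proof (rule limI)
  have "(\<lambda>n. s + grid n (nat \<lfloor>2 ^ n * t\<rfloor>)) \<longlonglongrightarrow> s + t"
    by (intro tendsto_intros grid_floor_tendsto assms)
  then have "(\<lambda>n. X (s + grid n (nat \<lfloor>2 ^ n * t\<rfloor>)) \<omega>) \<longlonglongrightarrow> X (s + t) \<omega>"
    by (intro filterlim_compose[OF X_right_continuous[OF assms(1), of "s + t"]])
       (use assms grid_floor(1)[OF assms(3)] in \<open>auto simp: filterlim_at less_imp_neq[symmetric] intro!: always_eventually\<close>)
  then have "(\<lambda>n. X (s + grid n (nat \<lfloor>2 ^ n * t\<rfloor>)) \<omega> - X s \<omega>) \<longlonglongrightarrow> X (s + t) \<omega> - X s \<omega>"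
    by (intro tendsto_intros)
  then show "(\<lambda>n. shifted s \<omega> (grid n (nat \<lfloor>2 ^ n * t\<rfloor>))) \<longlonglongrightarrow> X (s + t) \<omega> - X s \<omega>"
    by (simp add: shifted_eq)
qed

lemma right_lim_stopped:
  assumes "\<omega> \<in> space M" "0 \<le> t" "t < s" shows "right_lim (stopped s \<omega>) t = X t \<omega>"
  unfolding right_lim_def
proof (rule limI)
  have "(\<lambda>n. X (grid n (nat \<lfloor>2 ^ n * t\<rfloor>)) \<omega>) \<longlonglongrightarrow> X t \<omega>"
    by (rule filterlim_compose[OF X_right_continuous[OF assms(1,2)]])
       (use grid_floor_tendsto[OF assms(2)] grid_floor(1)[OF assms(2)] in \<open>auto simp: filterlim_at less_imp_neq[symmetric] intro!: always_eventually\<close>)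
  moreover have "\<forall>\<^sub>F n in sequentially. grid n (nat \<lfloor>2 ^ n * t\<rfloor>) < s"
    using order_tendstoD(2)[OF grid_floor_tendsto[OF assms(2)] assms(3)] .
  then have "\<forall>\<^sub>F n in sequentially. X (grid n (nat \<lfloor>2 ^ n * t\<rfloor>)) \<omega> = stopped s \<omega> (grid n (nat \<lfloor>2 ^ n * t\<rfloor>))"
    by eventually_elim (simp add: stopped_eq)
  ultimately show "(\<lambda>n. stopped s \<omega> (grid n (nat \<lfloor>2 ^ n * t\<rfloor>))) \<longlonglongrightarrow> X t \<omega>"
    by (rule Lim_transform_eventually)
qed

lemma ex_rat_right_less:
  assumes "\<omega> \<in> space M" "0 \<le> r" "r < t" "X r \<omega> < y"
  shows "\<exists>q\<in>\<rat>. r < q \<and> q < t \<and> X q \<omega> < y"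
proof -
  have "\<forall>\<^sub>F s in at_right r. X s \<omega> < y"
    using order_tendstoD(2)[OF X_right_continuous[OF assms(1,2)] assms(4)] .
  then obtain b where b: "b > r" "\<And>s. r < s \<Longrightarrow> s < b \<Longrightarrow> X s \<omega> < y"
    by (auto simp: eventually_at_right_field)
  obtain q where "q \<in> \<rat>" "r < q" "q < min b t" using Rats_dense_in_real[of r "min b t"] b(1) assms(3) by auto
  then show ?thesis using b by auto
qed

lemma alive_path:
  assumes "\<omega> \<in> space M"
  shows "alive x t (path \<omega>) \<longleftrightarrow> (\<forall>r. 0 \<le> r \<longrightarrow> r < t \<longrightarrow> 0 \<le> x + X r \<omega>)"
proof
  assume *: "alive x t (path \<omega>)"
  show "\<forall>r. 0 \<le> r \<longrightarrow> r < t \<longrightarrow> 0 \<le> x + X r \<omega>"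
  proof (intro allI impI)
    fix r assume r: "0 \<le> r" "r < t"
    show "0 \<le> x + X r \<omega>"
    proof (rule ccontr)
      assume "\<not> 0 \<le> x + X r \<omega>"
      then obtain q where "q \<in> \<rat>" "r < q" "q < t" "X q \<omega> < - x"
        using ex_rat_right_less[OF assms r, of "- x"] by auto
      then show False using * r unfolding alive_def by (auto dest!: bspec[of _ _ q])
    qed
  qed
qed (auto simp: alive_def)

lemma alive_shifted:
  assumes "\<omega> \<in> space M" "0 \<le> s"
  shows "alive (x + X s \<omega>) t (shifted s \<omega>) \<longleftrightarrow> (\<forall>r. s \<le> r \<longrightarrow> r < s + t \<longrightarrow> 0 \<le> x + X r \<omega>)"
proof
  assume *: "alive (x + X s \<omega>) t (shifted s \<omega>)"
  show "\<forall>r. s \<le> r \<longrightarrow> r < s + t \<longrightarrow> 0 \<le> x + X r \<omega>"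
  proof (intro allI impI)
    fix r assume r: "s \<le> r" "r < s + t"
    show "0 \<le> x + X r \<omega>"
    proof (rule ccontr)
      assume n: "\<not> 0 \<le> x + X r \<omega>"
      have "\<forall>\<^sub>F u in at_right r. X u \<omega> < - x"
        using order_tendstoD(2)[OF X_right_continuous[OF assms(1), of r], of "- x"] n assms r by simp
      then obtain b where b: "b > r" "\<And>u. r < u \<Longrightarrow> u < b \<Longrightarrow> X u \<omega> < - x"
        by (auto simp: eventually_at_right_field)
      obtain q where q: "q \<in> \<rat>" "r - s < q" "q < min (b - s) t" using Rats_dense_in_real[of "r - s" "min (b - s) t"] b(1) r by auto
      then have "0 \<le> x + X s \<omega> + shifted s \<omega> q" using * r unfolding alive_def by (auto dest!: bspec[of _ _ q])
      then show False using b(2)[of "s + q"] q r by (simp add: shifted_eq)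
    qed
  qed
qed (auto simp: alive_def shifted_eq)

lemma alive_stopped: "t \<le> s \<Longrightarrow> alive x t (stopped s \<omega>) \<longleftrightarrow> alive x t (path \<omega>)"
  unfolding alive_def by (intro ball_cong) (auto simp: stopped_eq)

lemma alive_split:
  assumes "\<omega> \<in> space M" "0 \<le> s" "0 \<le> t"
  shows "alive x (s + t) (path \<omega>) \<longleftrightarrow> alive x s (path \<omega>) \<and> alive (x + X s \<omega>) t (shifted s \<omega>)"
  unfolding alive_path[OF assms(1)] alive_shifted[OF assms(1,2)]
proof safe
  fix r assume a: "\<forall>r\<ge>0. r < s \<longrightarrow> 0 \<le> x + X r \<omega>" "\<forall>r\<ge>s. r < s + t \<longrightarrow> 0 \<le> x + X r \<omega>" "0 \<le> r" "r < s + t"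
  show "0 \<le> x + X r \<omega>" using a by (cases "r < s") auto
qed (use assms in auto)

lemma ind_integrable: "A \<in> sets borel \<Longrightarrow> set_integrable lborel {s..t} (\<lambda>r. indicator A (x + right_lim w r) :: real)"
  by (rule set_integrable_Icc_bounded[where B=1], measurable) (auto simp: indicator_def)

lemma occ_stopped:
  assumes "\<omega> \<in> space M" shows "occ A x (stopped s \<omega>) s = occ A x (path \<omega>) s"
  unfolding occ_def set_lebesgue_integral_def
proof (rule integral_discrete_difference[of "{s}"])
  fix r assume "r \<notin> {s}"
  then show "indicator {0..s} r *\<^sub>R indicator A (x + right_lim (stopped s \<omega>) r) = (indicator {0..s} r *\<^sub>R indicator A (x + right_lim (path \<omega>) r) :: real)"
    using right_lim_stopped[OF assms, of r s] right_lim_path[OF assms, of r] by (cases "0 \<le> r \<and> r < s") auto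
qed auto

lemma occ_split:
  assumes \<omega>: "\<omega> \<in> space M" and s: "0 \<le> s" and t: "0 \<le> t" and A: "A \<in> sets borel"
  shows "occ A x (path \<omega>) (s + t) = occ A x (path \<omega>) s + occ A (x + X s \<omega>) (shifted s \<omega>) t"
proof -
  have "occ A x (path \<omega>) (s + t) = occ A x (path \<omega>) s + (LBINT r:{s..s+t}. indicator A (x + right_lim (path \<omega>) r))"
    unfolding occ_def by (rule LBINT_Icc_split[OF ind_integrable[OF A]]) (use s t in auto)
  also have "(LBINT r:{s..s+t}. indicator A (x + right_lim (path \<omega>) r)) = occ A (x + X s \<omega>) (shifted s \<omega>) t"
    unfolding occ_def set_lebesgue_integral_def
  proof (subst lborel_integral_real_affine[of 1 _ s])
    show "\<bar>1\<bar> *\<^sub>R (LBINT r. indicator {s..s + t} (s + 1 * r) *\<^sub>R indicator A (x + right_lim (path \<omega>) (s + 1 * r))) =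
      (LBINT r. indicator {0..t} r *\<^sub>R indicator A (x + X s \<omega> + right_lim (shifted s \<omega>) r) :: real)"
    proof (simp, intro Bochner_Integration.integral_cong refl)
      fix r
      show "indicator {s..s + t} (s + r) * indicator A (x + right_lim (path \<omega>) (s + r)) =
        (indicator {0..t} r * indicator A (x + X s \<omega> + right_lim (shifted s \<omega>) r) :: real)"
        using right_lim_shifted[OF \<omega> s, of r] right_lim_path[OF \<omega>, of "s + r"] s by (cases "0 \<le> r") (auto simp: indicator_def)
    qed
  qed simp
  finally show ?thesis .
qed

text \<open>The weight is a multiplicative functional: occupation times add up, and survival up to s
  + t is survival up to s followed by survival of the shifted path.\<close>

lemma wt_split:
  assumes "\<omega> \<in> space M" "0 \<le> s" "0 \<le> t" "A \<in> sets borel"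
  shows "wt p q A x (path \<omega>) (s + t) = wt p q A x (path \<omega>) s * wt p q A (x + X s \<omega>) (shifted s \<omega>) t"
  unfolding wt_def occ_split[OF assms] alive_split[OF assms(1-3)]
  by (simp add: algebra_simps flip: exp_add)

lemma wt_stopped:
  assumes "\<omega> \<in> space M" shows "wt p q A x (stopped s \<omega>) s = wt p q A x (path \<omega>) s"
  by (simp add: wt_def occ_stopped[OF assms] alive_stopped)

definition res :: "real \<Rightarrow> real \<Rightarrow> real set \<Rightarrow> (real \<Rightarrow> ennreal) \<Rightarrow> real \<Rightarrow> ennreal" where
  "res p q A f x = (\<integral>\<^sup>+\<omega>. pot p q A f x (path \<omega>) \<partial>M)"

lemma res_measurable[measurable (raw)]:
  assumes [measurable]: "A \<in> sets borel" "f \<in> borel_measurable borel" "g \<in> borel_measurable N"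
  shows "(\<lambda>z. res p q A f (g z)) \<in> borel_measurable N"
  unfolding res_def by measurable

lemma res_neg: "x < 0 \<Longrightarrow> res p q A f x = 0"
proof -
  assume x: "x < 0"
  have "of_bool (0 < t) * ennreal (wt p q A x (path \<omega>) t) * f (x + right_lim (path \<omega>) t) = 0" if "\<omega> \<in> space M" for \<omega> t
  proof (cases "0 < t")
    case True
    then have "\<not> alive x t (path \<omega>)" using x X_0[OF that] by (auto simp: alive_path[OF that] intro!: exI[of _ 0])
    then show ?thesis by (simp add: wt_def)
  qed simp
  then have "res p q A f x = (\<integral>\<^sup>+\<omega>. \<integral>\<^sup>+t. 0 \<partial>(lborel :: real measure) \<partial>M)"
    unfolding res_def pot_def by (intro nn_integral_cong)
  then show ?thesis by simp
qed

definition passage_lt :: "real \<Rightarrow> real \<Rightarrow> real" where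
  "passage_lt p y = enn2real (passage_laplace p y)"

lemma passage_laplace_measurable[measurable]: "passage_laplace p \<in> borel_measurable borel"
  unfolding passage_laplace_def[abs_def] by measurable

lemma passage_lt_measurable[measurable]: "passage_lt p \<in> borel_measurable borel"
  unfolding passage_lt_def[abs_def] by measurable

lemma ennreal_passage_lt: "0 \<le> p \<Longrightarrow> ennreal (passage_lt p y) = passage_laplace p y"
  unfolding passage_lt_def using passage_laplace_le_1[of p y] by (intro ennreal_enn2real) (auto simp: less_top[symmetric] top_unique)

lemma passage_lt_bounds: "0 \<le> p \<Longrightarrow> 0 \<le> passage_lt p y \<and> passage_lt p y \<le> 1"
  using passage_laplace_le_1[of p y] ennreal_passage_lt[of p y] by (auto simp: passage_lt_def enn2real_nonneg simp flip: ennreal_le_1)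

end

section \<open>Laplace transform of the killed resolvent\<close>

lemma nn_integral_exp_Icc:
  fixes \<kappa> :: real
  assumes "0 \<le> v" "\<kappa> \<noteq> 0"
  shows "(\<integral>\<^sup>+t. of_bool (0 < t \<and> t \<le> v) * ennreal (exp (\<kappa> * t)) \<partial>lborel) = ennreal ((exp (\<kappa> * v) - 1) / \<kappa>)"
proof -
  have "(\<integral>\<^sup>+t. of_bool (0 < t \<and> t \<le> v) * ennreal (exp (\<kappa> * t)) \<partial>lborel) = (\<integral>\<^sup>+t. ennreal (exp (\<kappa> * t)) * indicator {0..v} t \<partial>lborel)"
    by (intro nn_integral_cong_AE eventually_mono[OF AE_lborel_singleton[of 0]]) (auto simp: indicator_def)
  also have "\<dots> = ennreal (exp (\<kappa> * v) / \<kappa> - exp (\<kappa> * 0) / \<kappa>)"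
    by (rule nn_integral_FTC_Icc) (use assms in \<open>auto intro!: derivative_eq_intros\<close>)
  finally show ?thesis by (simp add: diff_divide_distrib)
qed

context snlp begin

lemma wt_0: "wt p 0 A x w t = exp (- p * t) * of_bool (alive x t w)"
  by (simp add: wt_def)

text \<open>Fubini, the substitution \<open>y = x + X\<^sub>t\<close> and time reversal turn the killing below \<open>0\<close> into
  killing above \<open>y\<close>, where the exponential martingale applies.\<close>

lemma res_laplace:
  assumes p: "0 \<le> p" and \<theta>: "0 \<le> \<theta>" and \<psi>: "p < \<psi> \<theta>"
    and A[measurable]: "A \<in> sets borel" and f[measurable]: "f \<in> borel_measurable borel" and f0: "\<And>y. y < 0 \<Longrightarrow> f y = 0"
  shows "(\<integral>\<^sup>+x. ennreal (exp (- \<theta> * x)) * res p 0 A f x \<partial>lborel) =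
    (\<integral>\<^sup>+y. f y * ennreal ((passage_lt p y - exp (- \<theta> * y)) / (\<psi> \<theta> - p)) \<partial>lborel)"
proof -
  interpret LM: pair_sigma_finite lborel M by unfold_locales
  have \<psi>0: "0 < \<psi> \<theta>" using p \<psi> by simp
  let ?r = right_lim
  let ?E = "\<lambda>x::real. ennreal (exp x)"
  define G where "G x t w = of_bool (0 < t) * (?E (- p * t) * (?E (- \<theta> * x) * (of_bool (alive x t w) * f (x + ?r w t))))" for x t w
  have Gm[measurable (raw)]: "(\<lambda>z. G (g z) (h z) (k z)) \<in> borel_measurable N"
    if [measurable]: "g \<in> borel_measurable N" "h \<in> borel_measurable N" "k \<in> measurable N path_space" for g h k and N :: "'z measure"
    unfolding G_def by measurable
  define R where "R t \<omega> y = of_bool (\<forall>r. 0 \<le> r \<longrightarrow> r < t \<longrightarrow> X t \<omega> - X r \<omega> \<le> y) * ?E (\<theta> * X t \<omega>)" for t \<omega> y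
  define S where "S t y \<omega> = of_bool (\<tau> y \<omega> < \<infinity> \<and> t \<le> T y \<omega>) * ?E (- \<psi> \<theta> * T y \<omega>)" for t y \<omega>
  have Sm[measurable (raw)]: "(\<lambda>z. S (g z) (h z) (k z)) \<in> borel_measurable N"
    if [measurable]: "g \<in> borel_measurable N" "h \<in> borel_measurable N" "k \<in> measurable N M" for g h k and N :: "'z measure"
    unfolding S_def by measurable
  have "(\<integral>\<^sup>+x. ?E (- \<theta> * x) * res p 0 A f x \<partial>lborel) = (\<integral>\<^sup>+x. \<integral>\<^sup>+\<omega>. \<integral>\<^sup>+t. G x t (path \<omega>) \<partial>lborel \<partial>M \<partial>lborel)"
  proof (rule nn_integral_cong)
    fix x :: real
    have pt: "?E (- \<theta> * x) * (of_bool (0 < t) * ennreal (wt p 0 A x w t) * f (x + ?r w t)) = G x t w" for t w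
      by (cases "alive x t w") (simp_all add: G_def wt_0 mult_ac)
    have "?E (- \<theta> * x) * res p 0 A f x = (\<integral>\<^sup>+\<omega>. ?E (- \<theta> * x) * pot p 0 A f x (path \<omega>) \<partial>M)"
      unfolding res_def by (rule nn_integral_cmult[symmetric]) measurable
    also have "\<dots> = (\<integral>\<^sup>+\<omega>. \<integral>\<^sup>+t. G x t (path \<omega>) \<partial>lborel \<partial>M)"
    proof (rule nn_integral_cong)
      fix \<omega>
      have gm: "(\<lambda>t. of_bool (0 < t) * ennreal (wt p 0 A x w t) * f (x + ?r w t)) \<in> borel_measurable lborel" for w
        using pot_integrand_measurable[OF A f] by simp
      show "?E (- \<theta> * x) * pot p 0 A f x (path \<omega>) = (\<integral>\<^sup>+t. G x t (path \<omega>) \<partial>lborel)"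
        unfolding pot_def pt[symmetric] by (rule nn_integral_cmult[OF gm, symmetric])
    qed
    finally show "?E (- \<theta> * x) * res p 0 A f x = (\<integral>\<^sup>+\<omega>. \<integral>\<^sup>+t. G x t (path \<omega>) \<partial>lborel \<partial>M)" .
  qed
  also have "\<dots> = (\<integral>\<^sup>+\<omega>. \<integral>\<^sup>+x. \<integral>\<^sup>+t. G x t (path \<omega>) \<partial>lborel \<partial>lborel \<partial>M)"
    by (rule LM.Fubini'[symmetric]) measurable
  also have "\<dots> = (\<integral>\<^sup>+\<omega>. \<integral>\<^sup>+t. \<integral>\<^sup>+x. G x t (path \<omega>) \<partial>lborel \<partial>lborel \<partial>M)"
    by (intro nn_integral_cong lborel_pair.Fubini') measurable
  also have "\<dots> = (\<integral>\<^sup>+t. \<integral>\<^sup>+\<omega>. \<integral>\<^sup>+x. G x t (path \<omega>) \<partial>lborel \<partial>M \<partial>lborel)"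
    by (rule LM.Fubini') measurable
  also have "\<dots> = (\<integral>\<^sup>+t. \<integral>\<^sup>+y. of_bool (0 < t) * (?E ((\<psi> \<theta> - p) * t) * f y) * (\<integral>\<^sup>+\<omega>. S t y \<omega> \<partial>M) \<partial>lborel \<partial>lborel)"
  proof (rule nn_integral_cong)
    fix t :: real
    show "(\<integral>\<^sup>+\<omega>. \<integral>\<^sup>+x. G x t (path \<omega>) \<partial>lborel \<partial>M) = (\<integral>\<^sup>+y. of_bool (0 < t) * (?E ((\<psi> \<theta> - p) * t) * f y) * (\<integral>\<^sup>+\<omega>. S t y \<omega> \<partial>M) \<partial>lborel)"
    proof (cases "0 < t")
      case True
      have [measurable]: "X t \<in> borel_measurable M" using True by simp
      have "(\<integral>\<^sup>+\<omega>. \<integral>\<^sup>+x. G x t (path \<omega>) \<partial>lborel \<partial>M) = (\<integral>\<^sup>+\<omega>. \<integral>\<^sup>+y. G (y - X t \<omega>) t (path \<omega>) \<partial>lborel \<partial>M)"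
      proof (rule nn_integral_cong)
        fix \<omega>
        have "(\<lambda>x. G x t (path \<omega>)) \<in> borel_measurable borel"
          by (rule Gm[OF measurable_ident_sets[OF refl, unfolded id_def] borel_measurable_const const_path_measurable])
        from nn_integral_real_affine[OF this, of 1 "- X t \<omega>"]
        show "(\<integral>\<^sup>+x. G x t (path \<omega>) \<partial>lborel) = (\<integral>\<^sup>+y. G (y - X t \<omega>) t (path \<omega>) \<partial>lborel)" by (simp add: add.commute)
      qed
      also have "\<dots> = (\<integral>\<^sup>+y. \<integral>\<^sup>+\<omega>. G (y - X t \<omega>) t (path \<omega>) \<partial>M \<partial>lborel)"
        by (rule LM.Fubini') measurable
      also have "\<dots> = (\<integral>\<^sup>+y. of_bool (0 < t) * (?E ((\<psi> \<theta> - p) * t) * f y) * (\<integral>\<^sup>+\<omega>. S t y \<omega> \<partial>M) \<partial>lborel)"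
      proof (rule nn_integral_cong)
        fix y :: real
        show "(\<integral>\<^sup>+\<omega>. G (y - X t \<omega>) t (path \<omega>) \<partial>M) = of_bool (0 < t) * (?E ((\<psi> \<theta> - p) * t) * f y) * (\<integral>\<^sup>+\<omega>. S t y \<omega> \<partial>M)"
        proof (cases "0 \<le> y")
          case y: True
          \<comment> \<open>Seen from the endpoint y, survival above 0 bounds the increments up to
            the final time, which is precisely the event that time reversal handles.\<close>
          have al: "alive (y - X t \<omega>) t (path \<omega>) \<longleftrightarrow> (\<forall>r. 0 \<le> r \<longrightarrow> r < t \<longrightarrow> X t \<omega> - X r \<omega> \<le> y)" if "\<omega> \<in> space M" for \<omega>
            unfolding alive_path[OF that] by (auto simp: algebra_simps)
          have Geq: "G (y - X t \<omega>) t (path \<omega>) = (?E (- p * t) * ?E (- \<theta> * y) * f y) * R t \<omega> y" if "\<omega> \<in> space M" for \<omega>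
          proof -
            have "?E (- \<theta> * (y - X t \<omega>)) = ?E (- \<theta> * y) * ?E (\<theta> * X t \<omega>)"
              by (simp add: right_diff_distrib flip: ennreal_mult exp_add)
            then show ?thesis unfolding G_def R_def al[OF that] using True right_lim_path[OF that, of t] by (simp add: mult_ac)
          qed
          have Ra: "R t \<omega> y = of_bool (alive (y - X t \<omega>) t (path \<omega>)) * ?E (\<theta> * X t \<omega>)" if "\<omega> \<in> space M" for \<omega>
            by (simp add: R_def al[OF that])
          have Rm: "(\<lambda>\<omega>. R t \<omega> y) \<in> borel_measurable M" by (subst measurable_cong[OF Ra]) measurable
          have "(\<integral>\<^sup>+\<omega>. G (y - X t \<omega>) t (path \<omega>) \<partial>M) = (\<integral>\<^sup>+\<omega>. (?E (- p * t) * ?E (- \<theta> * y) * f y) * R t \<omega> y \<partial>M)"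
            by (intro nn_integral_cong Geq)
          also have "\<dots> = (?E (- p * t) * ?E (- \<theta> * y) * f y) * survival \<theta> y t"
            unfolding reversal[OF \<theta> True, of y, symmetric] R_def[symmetric] by (rule nn_integral_cmult[OF Rm])
          also have "survival \<theta> y t = ?E (\<theta> * y + \<psi> \<theta> * t) * (\<integral>\<^sup>+\<omega>. S t y \<omega> \<partial>M)"
            unfolding S_def using True by (intro survival_eq \<theta> \<psi>0 y) simp
          also have "(?E (- p * t) * ?E (- \<theta> * y) * f y) * (?E (\<theta> * y + \<psi> \<theta> * t) * (\<integral>\<^sup>+\<omega>. S t y \<omega> \<partial>M))
             = (?E (- p * t) * ?E (- \<theta> * y) * ?E (\<theta> * y + \<psi> \<theta> * t)) * f y * (\<integral>\<^sup>+\<omega>. S t y \<omega> \<partial>M)" by (simp add: mult_ac)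
          \<comment> \<open>The factor exp(-\<theta> y) from the transform in the starting point
            cancels the factor exp(\<theta> y) from \<open>survival_eq\<close>.\<close>
          also have "?E (- p * t) * ?E (- \<theta> * y) * ?E (\<theta> * y + \<psi> \<theta> * t) = ?E ((\<psi> \<theta> - p) * t)"
            by (simp add: algebra_simps flip: ennreal_mult exp_add)
          finally show ?thesis using True by simp
        next
          case False
          then have "f y = 0" using f0 by simp
          then have "G (y - X t \<omega>) t (path \<omega>) = 0" if "\<omega> \<in> space M" for \<omega>
            using right_lim_path[OF that, of t] True by (simp add: G_def)
          then have "(\<integral>\<^sup>+\<omega>. G (y - X t \<omega>) t (path \<omega>) \<partial>M) = (\<integral>\<^sup>+\<omega>. 0 \<partial>M)" by (intro nn_integral_cong)
          then show ?thesis using \<open>f y = 0\<close> by simp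
        qed
      qed
      finally show ?thesis .
    qed (simp add: G_def)
  qed
  also have "\<dots> = (\<integral>\<^sup>+y. \<integral>\<^sup>+t. of_bool (0 < t) * (?E ((\<psi> \<theta> - p) * t) * f y) * (\<integral>\<^sup>+\<omega>. S t y \<omega> \<partial>M) \<partial>lborel \<partial>lborel)"
    by (rule lborel_pair.Fubini') measurable
  also have "\<dots> = (\<integral>\<^sup>+y. f y * ennreal ((passage_lt p y - exp (- \<theta> * y)) / (\<psi> \<theta> - p)) \<partial>lborel)"
  proof (rule nn_integral_cong)
    fix y :: real
    show "(\<integral>\<^sup>+t. of_bool (0 < t) * (?E ((\<psi> \<theta> - p) * t) * f y) * (\<integral>\<^sup>+\<omega>. S t y \<omega> \<partial>M) \<partial>lborel) =
      f y * ennreal ((passage_lt p y - exp (- \<theta> * y)) / (\<psi> \<theta> - p))"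
    proof (cases "0 \<le> y")
      case True
      let ?\<kappa> = "\<psi> \<theta> - p"
      have "(\<integral>\<^sup>+t. of_bool (0 < t) * (?E (?\<kappa> * t) * f y) * (\<integral>\<^sup>+\<omega>. S t y \<omega> \<partial>M) \<partial>lborel) =
         (\<integral>\<^sup>+t. f y * (\<integral>\<^sup>+\<omega>. of_bool (0 < t) * ?E (?\<kappa> * t) * S t y \<omega> \<partial>M) \<partial>lborel)"
        by (intro nn_integral_cong, subst nn_integral_cmult) (auto simp: mult_ac)
      also have "\<dots> = f y * (\<integral>\<^sup>+t. \<integral>\<^sup>+\<omega>. of_bool (0 < t) * ?E (?\<kappa> * t) * S t y \<omega> \<partial>M \<partial>lborel)"
        by (rule nn_integral_cmult) measurable
      also have "(\<integral>\<^sup>+t. \<integral>\<^sup>+\<omega>. of_bool (0 < t) * ?E (?\<kappa> * t) * S t y \<omega> \<partial>M \<partial>lborel) =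
        (\<integral>\<^sup>+\<omega>. \<integral>\<^sup>+t. of_bool (0 < t) * ?E (?\<kappa> * t) * S t y \<omega> \<partial>lborel \<partial>M)"
        by (rule LM.Fubini'[symmetric]) measurable
      also have "\<dots> = (\<integral>\<^sup>+\<omega>. of_bool (\<tau> y \<omega> < \<infinity>) * ennreal ((exp (- p * T y \<omega>) - exp (- \<psi> \<theta> * T y \<omega>)) / ?\<kappa>) \<partial>M)"
      proof (rule nn_integral_cong)
        fix \<omega>
        let ?T = "T y \<omega>"
        have "(\<integral>\<^sup>+t. of_bool (0 < t) * ?E (?\<kappa> * t) * S t y \<omega> \<partial>lborel) =
          (\<integral>\<^sup>+t. (of_bool (\<tau> y \<omega> < \<infinity>) * ?E (- \<psi> \<theta> * ?T)) * (of_bool (0 < t \<and> t \<le> ?T) * ?E (?\<kappa> * t)) \<partial>lborel)"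
          by (intro nn_integral_cong) (auto simp: S_def mult_ac)
        also have "\<dots> = (of_bool (\<tau> y \<omega> < \<infinity>) * ?E (- \<psi> \<theta> * ?T)) * ennreal ((exp (?\<kappa> * ?T) - 1) / ?\<kappa>)"
          using \<psi> by (subst nn_integral_cmult) (auto simp: nn_integral_exp_Icc)
        also have "\<dots> = of_bool (\<tau> y \<omega> < \<infinity>) * ennreal (exp (- \<psi> \<theta> * ?T) * ((exp (?\<kappa> * ?T) - 1) / ?\<kappa>))"
          using \<psi> by (subst ennreal_mult) (auto simp: mult_ac intro!: divide_nonneg_pos)
        also have "exp (- \<psi> \<theta> * ?T) * ((exp (?\<kappa> * ?T) - 1) / ?\<kappa>) = (exp (- p * ?T) - exp (- \<psi> \<theta> * ?T)) / ?\<kappa>"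
          by (simp add: right_diff_distrib left_diff_distrib flip: exp_add)
        finally show "(\<integral>\<^sup>+t. of_bool (0 < t) * ?E (?\<kappa> * t) * S t y \<omega> \<partial>lborel) = of_bool (\<tau> y \<omega> < \<infinity>) * ennreal ((exp (- p * ?T) - exp (- \<psi> \<theta> * ?T)) / ?\<kappa>)" .
      qed
      also have "\<dots> = ennreal ((passage_lt p y - exp (- \<theta> * y)) / ?\<kappa>)"
      proof -
        let ?J = "\<integral>\<^sup>+\<omega>. of_bool (\<tau> y \<omega> < \<infinity>) * ennreal ((exp (- p * T y \<omega>) - exp (- \<psi> \<theta> * T y \<omega>)) / ?\<kappa>) \<partial>M"
        \<comment> \<open>The difference of the two passage transforms is reached by adding
          exp(-\<theta> y) on both sides, since subtraction of extended nonnegative reals truncates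
          at 0.\<close>
        have "ennreal ?\<kappa> * ?J + ?E (- \<theta> * y) = ennreal ?\<kappa> * ?J + passage_laplace (\<psi> \<theta>) y"
          by (simp only: passage_laplace_\<psi>[OF \<theta> \<psi>0 True])
        also have "\<dots> = (\<integral>\<^sup>+\<omega>. ennreal ?\<kappa> * (of_bool (\<tau> y \<omega> < \<infinity>) * ennreal ((exp (- p * T y \<omega>) - exp (- \<psi> \<theta> * T y \<omega>)) / ?\<kappa>)) +
           of_bool (\<tau> y \<omega> < \<infinity>) * ?E (- \<psi> \<theta> * T y \<omega>) \<partial>M)"
          unfolding passage_laplace_def by (subst nn_integral_add) (auto simp: nn_integral_cmult)
        also have "\<dots> = passage_laplace p y"
          unfolding passage_laplace_def
        proof (rule nn_integral_cong)
          fix \<omega>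
          have "exp (- \<psi> \<theta> * T y \<omega>) \<le> exp (- p * T y \<omega>)" using \<psi> by (auto intro!: mult_right_mono)
          then show "ennreal ?\<kappa> * (of_bool (\<tau> y \<omega> < \<infinity>) * ennreal ((exp (- p * T y \<omega>) - exp (- \<psi> \<theta> * T y \<omega>)) / ?\<kappa>)) +
           of_bool (\<tau> y \<omega> < \<infinity>) * ?E (- \<psi> \<theta> * T y \<omega>) = of_bool (\<tau> y \<omega> < \<infinity>) * ?E (- p * T y \<omega>)"
            using \<psi> by (auto simp flip: ennreal_mult ennreal_plus)
        qed
        finally have e: "ennreal ?\<kappa> * ?J + ?E (- \<theta> * y) = ennreal (passage_lt p y)" by (simp add: ennreal_passage_lt[OF p])
        then have "ennreal ?\<kappa> * ?J \<noteq> \<top>" by (metis ennreal_add_eq_top ennreal_neq_top)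
        then have "?J \<noteq> \<top>" using \<psi> by (auto simp: ennreal_mult_eq_top_iff)
        then obtain j where j: "0 \<le> j" "?J = ennreal j" by (cases ?J) auto
        have "?\<kappa> * j + exp (- \<theta> * y) = passage_lt p y"
          using e passage_lt_bounds[OF p, of y] \<psi> j by (simp flip: ennreal_mult ennreal_plus)
        then have "j = (passage_lt p y - exp (- \<theta> * y)) / ?\<kappa>" using \<psi> by (simp add: field_simps)
        then show ?thesis using j by simp
      qed
      finally show ?thesis .
    next
      case False
      then show ?thesis using f0[of y] by simp
    qed
  qed
  finally show ?thesis .
qed

end

section \<open>Resolvents and scale functions\<close>

text \<open>Says that \<nu> has density \<open>k\<close> on [0,d), with the negative part of
  \<open>k\<close> added on the left since no sign of \<open>k\<close> is known in advance.
  Agreement on half-lines extends to Borel sets by a Dynkin argument, where boundedness of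
  \<open>k\<close> keeps all masses finite, and then to functions by monotone approximation.\<close>

lemma sum_of_measures_determined:
  fixes \<nu> :: "real measure" and k :: "real \<Rightarrow> real"
  assumes \<nu>[measurable_cong]: "sets \<nu> = sets borel" and km[measurable]: "k \<in> borel_measurable borel"
    and kB: "\<And>y. y \<in> {0..<d} \<Longrightarrow> \<bar>k y\<bar> \<le> C"
    and int: "\<And>r. r \<le> d \<Longrightarrow> emeasure \<nu> {0..<r} = ennreal (LBINT y:{0..<r}. k y) \<and> 0 \<le> (LBINT y:{0..<r}. k y)"
    and f: "f \<in> borel_measurable borel"
  shows "(\<integral>\<^sup>+y. f y * indicator {0..<d} y \<partial>\<nu>) + (\<integral>\<^sup>+y. f y * (indicator {0..<d} y * ennreal (- k y)) \<partial>lborel) =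
    (\<integral>\<^sup>+y. f y * (indicator {0..<d} y * ennreal (k y)) \<partial>lborel)"
proof -
  define P where "P B = (\<integral>\<^sup>+y. indicator B y * (indicator {0..<d} y * ennreal (k y)) \<partial>lborel)" for B
  define N where "N B = (\<integral>\<^sup>+y. indicator B y * (indicator {0..<d} y * ennreal (- k y)) \<partial>lborel)" for B
  define V where "V B = (\<integral>\<^sup>+y. indicator B y * indicator {0..<d} y \<partial>\<nu>)" for B
  have V_eq: "V B = emeasure \<nu> (B \<inter> {0..<d})" if [measurable]: "B \<in> sets borel" for B
    unfolding V_def indicator_inter_arith[symmetric] by (rule nn_integral_indicator) (simp add: \<nu>)
  have bnd: "(\<integral>\<^sup>+y. indicator B y * (indicator {0..<d} y * ennreal (s * k y)) \<partial>lborel) < \<infinity>" if "\<bar>s\<bar> \<le> 1" for B and s :: real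
  proof -
    have "(\<integral>\<^sup>+y. indicator B y * (indicator {0..<d} y * ennreal (s * k y)) \<partial>lborel) \<le> (\<integral>\<^sup>+y. ennreal C * indicator {0..<d} y \<partial>lborel)"
    proof (rule nn_integral_mono)
      fix y
      show "indicator B y * (indicator {0..<d} y * ennreal (s * k y)) \<le> ennreal C * indicator {0..<d} y"
      proof (cases "y \<in> B \<and> y \<in> {0..<d}")
        case True
        have "\<bar>s\<bar> * \<bar>k y\<bar> \<le> 1 * C" using kB[of y] True that by (intro mult_mono) auto
        then have "s * k y \<le> C" using abs_ge_self[of "s * k y"] by (simp add: abs_mult)
        then show ?thesis using True by (auto intro: ennreal_leI)
      qed (auto simp: indicator_def)
    qed
    also have "\<dots> = ennreal C * emeasure lborel {0..<d}" by (simp add: nn_integral_cmult_indicator)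
    also have "\<dots> < \<infinity>" by (cases "0 \<le> d") (simp_all add: ennreal_mult_less_top)
    finally show ?thesis .
  qed
  have Pfin: "P B < \<infinity>" and Nfin: "N B < \<infinity>" for B
    using bnd[of 1 B] bnd[of "-1" B] by (simp_all add: P_def N_def)
  have VNP: "V B + N B = P B" if "B \<in> sets borel" for B
  proof -
    have Bs: "B \<in> sigma_sets UNIV (range lessThan)" using that by (simp add: borel_Iio)
    have "Int_stable (range (lessThan :: real \<Rightarrow> _))"
    proof (rule Int_stableI)
      fix A B :: "real set" assume "A \<in> range lessThan" "B \<in> range lessThan"
      then obtain a b where "A = {..<a}" "B = {..<b}" by auto
      then have "A \<inter> B = {..<min a b}" by auto
      then show "A \<inter> B \<in> range lessThan" by blast
    qed
    moreover have "range lessThan \<subseteq> Pow (UNIV :: real set)" by simp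
    ultimately show ?thesis using Bs
    proof (induction rule: sigma_sets_induct_disjoint)
      case (basic B)
      then obtain r where B: "B = {..<r}" by auto
      define r' where "r' = min r d"
      have Bi: "{..<r} \<inter> {0..<d} = {0..<r'}" by (auto simp: r'_def)
      have ind: "indicator {..<r} y * (indicator {0..<d} y * z) = indicator {0..<r'} y * z" for y and z :: ennreal
        by (auto simp: indicator_def r'_def)
      have ki: "integrable lborel (\<lambda>y. indicator {0..<r'} y *\<^sub>R k y)"
      proof (rule Bochner_Integration.integrable_bound[of _ "\<lambda>y. C * indicator {0..<r'} y"])
        show "integrable lborel (\<lambda>y. C * indicator {0..<r'} y)"
          by (cases "0 \<le> r'") (auto intro!: integrable_mult_right integrable_real_indicator)
        have "norm (indicator {0..<r'} y *\<^sub>R k y) \<le> norm (C * indicator {0..<r'} y)" for y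
          using kB[of y] by (auto simp: indicator_def r'_def)
        then show "AE y in lborel. norm (indicator {0..<r'} y *\<^sub>R k y) \<le> norm (C * indicator {0..<r'} y)" by simp
      qed measurable
      have P': "P B = (\<integral>\<^sup>+y. ennreal (indicator {0..<r'} y *\<^sub>R k y) \<partial>lborel)"
        unfolding P_def B ind by (intro nn_integral_cong) (auto simp: indicator_def)
      have N': "N B = (\<integral>\<^sup>+y. ennreal (- (indicator {0..<r'} y *\<^sub>R k y)) \<partial>lborel)"
        unfolding N_def B ind by (intro nn_integral_cong) (auto simp: indicator_def)
      have "(LBINT y:{0..<r'}. k y) = enn2real (P B) - enn2real (N B)"
        unfolding set_lebesgue_integral_def P' N' by (rule real_lebesgue_integral_def[OF ki])
      moreover have "V B = ennreal (LBINT y:{0..<r'}. k y)" "0 \<le> (LBINT y:{0..<r'}. k y)"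
        using int[of r'] V_eq[of B] by (auto simp: B Bi r'_def)
      moreover obtain u where "P B = ennreal u" "0 \<le> u" using Pfin[of B] by (cases "P B") auto
      moreover obtain v where "N B = ennreal v" "0 \<le> v" using Nfin[of B] by (cases "N B") auto
      ultimately show ?case by (simp flip: ennreal_plus)
    next
      case empty
      then show ?case by (simp add: V_def N_def P_def)
    next
      case (compl B)
      then have Bb[measurable]: "B \<in> sets borel" by (simp add: borel_Iio)
      have spl: "P UNIV = P B + P (UNIV - B)" "N UNIV = N B + N (UNIV - B)" "V UNIV = V B + V (UNIV - B)"
      proof -
        show "P UNIV = P B + P (UNIV - B)" unfolding P_def
          by (subst nn_integral_add[symmetric]) (auto intro!: nn_integral_cong simp: indicator_def)
        show "N UNIV = N B + N (UNIV - B)" unfolding N_def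
          by (subst nn_integral_add[symmetric]) (auto intro!: nn_integral_cong simp: indicator_def)
        show "V UNIV = V B + V (UNIV - B)" unfolding V_def
          by (subst nn_integral_add[symmetric]) (auto intro!: nn_integral_cong simp: indicator_def)
      qed
      have U: "V UNIV + N UNIV = P UNIV"
      proof -
        have "V UNIV = ennreal (LBINT y:{0..<d}. k y)" "0 \<le> (LBINT y:{0..<d}. k y)" using int[of d] V_eq[of UNIV] by auto
        moreover have ki: "integrable lborel (\<lambda>y. indicator {0..<d} y *\<^sub>R k y)"
        proof (rule Bochner_Integration.integrable_bound[of _ "\<lambda>y. C * indicator {0..<d} y"])
          show "integrable lborel (\<lambda>y. C * indicator {0..<d} y)"
            by (cases "0 \<le> d") (auto intro!: integrable_mult_right integrable_real_indicator)
          have "norm (indicator {0..<d} y *\<^sub>R k y) \<le> norm (C * indicator {0..<d} y)" for y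
            using kB[of y] by (auto simp: indicator_def)
          then show "AE y in lborel. norm (indicator {0..<d} y *\<^sub>R k y) \<le> norm (C * indicator {0..<d} y)" by simp
        qed measurable
        have P': "P UNIV = (\<integral>\<^sup>+y. ennreal (indicator {0..<d} y *\<^sub>R k y) \<partial>lborel)"
          unfolding P_def by (intro nn_integral_cong) (auto simp: indicator_def)
        have N': "N UNIV = (\<integral>\<^sup>+y. ennreal (- (indicator {0..<d} y *\<^sub>R k y)) \<partial>lborel)"
          unfolding N_def by (intro nn_integral_cong) (auto simp: indicator_def)
        have "(LBINT y:{0..<d}. k y) = enn2real (P UNIV) - enn2real (N UNIV)"
          unfolding set_lebesgue_integral_def P' N' by (rule real_lebesgue_integral_def[OF ki])
        moreover obtain u where "P UNIV = ennreal u" "0 \<le> u" using Pfin[of UNIV] by (cases "P UNIV") auto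
        moreover obtain v where "N UNIV = ennreal v" "0 \<le> v" using Nfin[of UNIV] by (cases "N UNIV") auto
        ultimately show ?thesis by (simp flip: ennreal_plus)
      qed
      \<comment> \<open>Complements are handled by adding the finite mass \<open>P B\<close> to both
        sides and cancelling it at the end, again without subtraction.\<close>
      have "P B + (V (UNIV - B) + N (UNIV - B)) = (V B + N B) + (V (UNIV - B) + N (UNIV - B))" by (simp only: compl.IH)
      also have "\<dots> = V UNIV + N UNIV" unfolding spl by (simp only: ac_simps)
      also have "\<dots> = P B + P (UNIV - B)" unfolding U spl(1) ..
      finally have "P B + (V (UNIV - B) + N (UNIV - B)) = P B + P (UNIV - B)" .
      then show ?case using Pfin[of B] by (auto simp: ennreal_add_left_cancel)
    next
      case (union B)
      then have Bb[measurable]: "B i \<in> sets borel" for i by (auto simp: borel_Iio)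
      have ind: "indicator (\<Union>i. B i) y * z = (\<Sum>i. indicator (B i) y * z)" for y and z :: ennreal
        unfolding ennreal_suminf_multc suminf_indicator[OF union(1)] ..
      have "P (\<Union>i. B i) = (\<Sum>i. P (B i))" "N (\<Union>i. B i) = (\<Sum>i. N (B i))" "V (\<Union>i. B i) = (\<Sum>i. V (B i))"
        unfolding P_def N_def V_def ind by (rule nn_integral_suminf; measurable)+
      then show ?case using union(3) by (simp add: suminf_add)
    qed
  qed
  from f show ?thesis
  proof (induction rule: borel_measurable_induct)
    case (cong f g)
    then have "f = g" by auto
    then show ?case using cong by simp
  next
    case (set B)
    then show ?case using VNP[of B] by (simp add: V_def N_def P_def)
  next
    case (mult u c)
    note [measurable] = \<open>u \<in> borel_measurable borel\<close>
    show ?case using mult.IH by (simp add: mult.assoc nn_integral_cmult flip: distrib_left)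
  next
    case (add u v)
    note [measurable] = \<open>u \<in> borel_measurable borel\<close> \<open>v \<in> borel_measurable borel\<close>
    have e: "(\<integral>\<^sup>+y. (v y + u y) * g y \<partial>\<mu>) = (\<integral>\<^sup>+y. v y * g y \<partial>\<mu>) + (\<integral>\<^sup>+y. u y * g y \<partial>\<mu>)"
      if [measurable_cong]: "sets \<mu> = sets borel" and [measurable]: "g \<in> borel_measurable borel" for g :: "real \<Rightarrow> ennreal" and \<mu>
      unfolding distrib_right by (rule nn_integral_add) measurable
    have eqs: "(\<integral>\<^sup>+y. (v y + u y) * indicator {0..<d} y \<partial>\<nu>) = (\<integral>\<^sup>+y. v y * indicator {0..<d} y \<partial>\<nu>) + (\<integral>\<^sup>+y. u y * indicator {0..<d} y \<partial>\<nu>)"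
      "(\<integral>\<^sup>+y. (v y + u y) * (indicator {0..<d} y * ennreal (- k y)) \<partial>lborel) = (\<integral>\<^sup>+y. v y * (indicator {0..<d} y * ennreal (- k y)) \<partial>lborel) + (\<integral>\<^sup>+y. u y * (indicator {0..<d} y * ennreal (- k y)) \<partial>lborel)"
      "(\<integral>\<^sup>+y. (v y + u y) * (indicator {0..<d} y * ennreal (k y)) \<partial>lborel) = (\<integral>\<^sup>+y. v y * (indicator {0..<d} y * ennreal (k y)) \<partial>lborel) + (\<integral>\<^sup>+y. u y * (indicator {0..<d} y * ennreal (k y)) \<partial>lborel)"
      by (rule e; simp add: \<nu>)+
    have "a + b = c \<Longrightarrow> a' + b' = c' \<Longrightarrow> (a' + a) + (b' + b) = c' + c" for a b c a' b' c' :: ennreal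
      by (metis add.assoc add.commute)
    from this[OF add.IH(1) add.IH(2)] show ?case unfolding eqs .
  next
    case (seq U)
    note [measurable] = seq(1)
    have mono: "incseq (\<lambda>i y. U i y * g y)" for g :: "real \<Rightarrow> ennreal"
      using \<open>incseq U\<close> by (auto simp: incseq_def le_fun_def intro!: mult_right_mono)
    have sup: "(\<integral>\<^sup>+y. (SUP i. U i) y * g y \<partial>\<mu>) = (SUP i. \<integral>\<^sup>+y. U i y * g y \<partial>\<mu>)"
      if [measurable_cong]: "sets \<mu> = sets borel" and [measurable]: "g \<in> borel_measurable borel" for g :: "real \<Rightarrow> ennreal" and \<mu>
    proof -
      have "(SUP i. U i) y * g y = (SUP i. U i y * g y)" for y by (simp add: SUP_mult_right_ennreal image_comp)
      then show ?thesis using nn_integral_monotone_convergence_SUP[OF mono[of g], of \<mu>] by simp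
    qed
    have inc: "incseq (\<lambda>i. \<integral>\<^sup>+y. U i y * g y \<partial>\<mu>)" for g \<mu>
      using mono[of g] by (auto simp: incseq_def le_fun_def intro!: nn_integral_mono)
    have eqs: "(\<integral>\<^sup>+y. (SUP i. U i) y * indicator {0..<d} y \<partial>\<nu>) = (SUP i. \<integral>\<^sup>+y. U i y * indicator {0..<d} y \<partial>\<nu>)"
      "(\<integral>\<^sup>+y. (SUP i. U i) y * (indicator {0..<d} y * ennreal (- k y)) \<partial>lborel) = (SUP i. \<integral>\<^sup>+y. U i y * (indicator {0..<d} y * ennreal (- k y)) \<partial>lborel)"
      "(\<integral>\<^sup>+y. (SUP i. U i) y * (indicator {0..<d} y * ennreal (k y)) \<partial>lborel) = (SUP i. \<integral>\<^sup>+y. U i y * (indicator {0..<d} y * ennreal (k y)) \<partial>lborel)"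
      by (rule sup; simp add: \<nu>)+
    show ?case unfolding eqs ennreal_SUP_add[OF inc inc, symmetric] seq.IH ..
  qed
qed

context snlp begin

text \<open>Inverting Laplace transforms needs large arguments only. As \<psi> tends to infinity,
  one threshold secures everything at once, and \<Phi>(p) does not have to be identified.\<close>

lemma scale_facts:
  assumes "is_scale_function M X p W"
  obtains \<theta>0 where "0 \<le> \<theta>0" "\<And>\<theta>. \<theta>0 \<le> \<theta> \<Longrightarrow> p < \<psi> \<theta>"
    "\<And>\<theta>. \<theta>0 \<le> \<theta> \<Longrightarrow> set_integrable lborel {0..} (\<lambda>y. exp (- \<theta> * y) * W y)"
    "\<And>\<theta>. \<theta>0 \<le> \<theta> \<Longrightarrow> (LBINT y:{0..}. exp (- \<theta> * y) * W y) = 1 / (\<psi> \<theta> - p)"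
proof -
  have "\<forall>\<^sub>F \<theta> in at_top. p < \<psi> \<theta>" using \<psi>_at_top by (rule filterlim_at_top_dense[THEN iffD1, rule_format])
  then obtain N where N: "\<And>\<theta>. N \<le> \<theta> \<Longrightarrow> p < \<psi> \<theta>" by (auto simp: eventually_at_top_linorder)
  \<comment> \<open>The added 1 turns the weak inequality \<theta> \<ge> \<open>?t\<close> into the
    strict inequality that the definition of a scale function requires.\<close>
  let ?t = "max (max N 0) (right_inverse_exponent M X p + 1)"
  show ?thesis
    by (rule that[of ?t]) (use assms N in \<open>auto simp: is_scale_function_def\<close>)
qed

lemma scale_causal: "is_scale_function M X p W \<Longrightarrow> causal W"
  by (auto simp: is_scale_function_def intro: causal_continuous)

lemma scale_continuous: "is_scale_function M X p W \<Longrightarrow> continuous_on {0..} W"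
  by (simp add: is_scale_function_def)

lemma scale_right_continuous: "is_scale_function M X p W \<Longrightarrow> 0 \<le> x \<Longrightarrow> continuous (at_right x) W"
proof -
  assume "is_scale_function M X p W" "0 \<le> x"
  then have "continuous (at x within {0..}) W" using scale_continuous by (auto simp: continuous_on_eq_continuous_within)
  then show ?thesis by (rule continuous_within_subset) (use \<open>0 \<le> x\<close> in auto)
qed

lemma alive_mono: "alive x t w \<Longrightarrow> x \<le> x' \<Longrightarrow> alive x' t w"
  unfolding alive_def by force

abbreviation I0 :: "real \<Rightarrow> real \<Rightarrow> real" where
  "I0 r \<equiv> indicator {0..<r}"

text \<open>Moving the start to the right postpones killing, and an interval longer by 1 absorbs the
  displacement. This gives the majorant for limits from the right and transports finiteness from one
  starting point to another.\<close>

lemma pot_interval_mono: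
  assumes "x \<le> x'" "x' \<le> x + 1"
  shows "pot p 0 A (indicator {0..<r}) x w \<le> pot p 0 A (indicator {0..<r+1}) x' w"
  unfolding pot_def wt_0
proof (rule nn_integral_mono)
  fix t
  show "of_bool (0 < t) * ennreal (exp (- p * t) * of_bool (alive x t w)) * indicator {0..<r} (x + right_lim w t)
    \<le> of_bool (0 < t) * ennreal (exp (- p * t) * of_bool (alive x' t w)) * indicator {0..<r + 1} (x' + right_lim w t)"
    using assms alive_mono[of x t w x'] by (auto simp: indicator_def)
qed

text \<open>The integrand is eventually constant along the sequence: a violation of x + w r \<ge> 0
  is strict and survives a small move to the right, and the indicator of [0,r) is right-continuous.
  The latter is why the intervals are closed at the left and open at the right.\<close>

lemma pot_interval_integrand_tendsto:
  assumes S: "\<And>n. x < S n" "S \<longlonglongrightarrow> x"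
  shows "(\<lambda>n. of_bool (0 < t) * ennreal (wt p 0 A (S n) w t) * (indicator {0..<r} (S n + z) :: ennreal))
    \<longlonglongrightarrow> of_bool (0 < t) * ennreal (wt p 0 A x w t) * indicator {0..<r} (x + z)"
proof -
  have al: "\<forall>\<^sub>F n in sequentially. alive (S n) t w = alive x t w"
  proof (cases "alive x t w")
    case True
    then show ?thesis using alive_mono[OF True less_imp_le[OF S(1)]] by simp
  next
    case False
    then obtain q where "q \<in> \<rat>" "0 \<le> q" "q < t" "\<not> 0 \<le> x + w q" unfolding alive_def by blast
    then have q: "q \<in> \<rat>" "0 \<le> q" "q < t" "x < - w q" by auto
    have "\<forall>\<^sub>F n in sequentially. S n < - w q" using order_tendstoD(2)[OF S(2) q(4)] .
    then show ?thesis by eventually_elim (use False q in \<open>auto simp: alive_def dest!: bspec[of _ _ q]\<close>)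
  qed
  have ind: "\<forall>\<^sub>F n in sequentially. S n + z \<in> {0..<r} \<longleftrightarrow> x + z \<in> {0..<r}"
  proof (cases "x + z < 0")
    case True
    then have "\<forall>\<^sub>F n in sequentially. S n < - z" using order_tendstoD(2)[OF S(2), of "- z"] by simp
    then show ?thesis by eventually_elim (use True in auto)
  next
    case f: False
    show ?thesis
    proof (cases "x + z < r")
      case True
      then have "\<forall>\<^sub>F n in sequentially. S n < r - z" using order_tendstoD(2)[OF S(2), of "r - z"] by simp
      then show ?thesis
      proof eventually_elim
        case (elim n)
        then show ?case using True f S(1)[of n] by simp
      qed
    next
      case False
      have "S n + z \<notin> {0..<r} \<and> x + z \<notin> {0..<r}" for n using False S(1)[of n] by simp
      then show ?thesis by (intro always_eventually) blast
    qed
  qed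
  from al ind have "\<forall>\<^sub>F n in sequentially. of_bool (0 < t) * ennreal (wt p 0 A (S n) w t) * (indicator {0..<r} (S n + z) :: ennreal)
     = of_bool (0 < t) * ennreal (wt p 0 A x w t) * indicator {0..<r} (x + z)"
    by eventually_elim (simp add: wt_0 indicator_def)
  then show ?thesis by (rule tendsto_eventually)
qed

text \<open>The left side is the passage transform at the larger rate \<psi>(\<theta>). Hence the
  right side of \<open>res_laplace\<close> is an integral of a nonnegative quantity, not truncated
  by the conversion to extended reals.\<close>

lemma passage_lt_ge:
  assumes "0 \<le> p" "0 \<le> \<theta>" "p < \<psi> \<theta>" "0 \<le> y" shows "exp (- \<theta> * y) \<le> passage_lt p y"
proof -
  have "ennreal (exp (- \<theta> * y)) = passage_laplace (\<psi> \<theta>) y" using assms by (intro passage_laplace_\<psi>[symmetric]) auto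
  also have "\<dots> \<le> passage_laplace p y" unfolding passage_laplace_def
    by (intro nn_integral_mono mult_left_mono ennreal_leI) (use assms in \<open>auto intro!: mult_right_mono\<close>)
  also have "\<dots> = ennreal (passage_lt p y)" using ennreal_passage_lt[OF assms(1)] by simp
  finally show ?thesis using passage_lt_bounds[OF assms(1), of y] by simp
qed

text \<open>The integrated form of the classical density exp(-\<Phi>(p) y) W(x) - W(x - y), with the
  exponential left as the passage transform. Both sides have the same Laplace transform in x for all
  large \<theta> and are right-continuous, so they agree at each x \<ge> 0.\<close>

lemma res_interval:
  assumes sc: "is_scale_function M X p W" and p: "0 \<le> p" and A[measurable]: "A \<in> sets borel" and x: "0 \<le> x"
  shows "res p 0 A (indicator {0..<r}) x = ennreal (W x * (LBINT y. I0 r y * passage_lt p y) - conv W (I0 r) x)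
    \<and> 0 \<le> W x * (LBINT y. I0 r y * passage_lt p y) - conv W (I0 r) x"
proof -
  obtain \<theta>0 where \<theta>0: "0 \<le> \<theta>0" "\<And>\<theta>. \<theta>0 \<le> \<theta> \<Longrightarrow> p < \<psi> \<theta>"
    "\<And>\<theta>. \<theta>0 \<le> \<theta> \<Longrightarrow> set_integrable lborel {0..} (\<lambda>y. exp (- \<theta> * y) * W y)"
    "\<And>\<theta>. \<theta>0 \<le> \<theta> \<Longrightarrow> (LBINT y:{0..}. exp (- \<theta> * y) * W y) = 1 / (\<psi> \<theta> - p)"
    using scale_facts[OF sc] by blast
  note Wc = scale_causal[OF sc]
  note [measurable] = causal_measurable[OF Wc]
  define \<phi> where "\<phi> r x = res p 0 A (indicator {0..<r}) x" for r x
  define C where "C r = (LBINT y. I0 r y * passage_lt p y)" for r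
  have \<phi>m[measurable]: "\<phi> r \<in> borel_measurable borel" for r unfolding \<phi>_def by measurable
  have I0i: "integrable lborel (I0 r)" for r by (cases "0 \<le> r") (auto intro!: integrable_real_indicator)
  have Ci: "integrable lborel (\<lambda>y. I0 r y * passage_lt p y)" for r
    by (rule Bochner_Integration.integrable_bound[OF I0i[of r]]) (use passage_lt_bounds[OF p] in \<open>auto simp: indicator_def\<close>)
  have Ei: "integrable lborel (\<lambda>y. I0 r y * exp (- \<theta> * y))" if "0 \<le> \<theta>" for r \<theta>
    by (rule Bochner_Integration.integrable_bound[OF I0i[of r]]) (use that in \<open>auto simp: indicator_def\<close>)
  have I0c: "causal (I0 r)" for r by (auto simp: causal_def indicator_def intro!: exI[of _ 1])
  have L: "(\<integral>\<^sup>+x. ennreal (exp (- \<theta> * x)) * \<phi> r x \<partial>lborel) = ennreal ((C r - (LBINT y. I0 r y * exp (- \<theta> * y))) / (\<psi> \<theta> - p))"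
    if \<theta>: "\<theta>0 \<le> \<theta>" for \<theta> r
  proof -
    have \<theta>': "0 \<le> \<theta>" "p < \<psi> \<theta>" using \<theta> \<theta>0 by auto
    have "(\<integral>\<^sup>+x. ennreal (exp (- \<theta> * x)) * \<phi> r x \<partial>lborel) = (\<integral>\<^sup>+y. indicator {0..<r} y * ennreal ((passage_lt p y - exp (- \<theta> * y)) / (\<psi> \<theta> - p)) \<partial>lborel)"
      unfolding \<phi>_def by (rule res_laplace[OF p \<theta>']) (auto simp: indicator_def)
    also have "\<dots> = (\<integral>\<^sup>+y. ennreal ((I0 r y * passage_lt p y - I0 r y * exp (- \<theta> * y)) / (\<psi> \<theta> - p)) \<partial>lborel)"
      by (intro nn_integral_cong) (auto simp: indicator_def)
    also have "\<dots> = ennreal (LBINT y. (I0 r y * passage_lt p y - I0 r y * exp (- \<theta> * y)) / (\<psi> \<theta> - p))"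
    proof (rule nn_integral_eq_integral)
      show "integrable lborel (\<lambda>y. (I0 r y * passage_lt p y - I0 r y * exp (- \<theta> * y)) / (\<psi> \<theta> - p))"
        using Ci Ei[OF \<theta>'(1)] by (intro integrable_divide_zero Bochner_Integration.integrable_diff) auto
      have "0 \<le> (I0 r y * passage_lt p y - I0 r y * exp (- \<theta> * y)) / (\<psi> \<theta> - p)" for y
        using passage_lt_ge[OF p \<theta>', of y] \<theta>' by (auto simp: indicator_def)
      then show "AE y in lborel. 0 \<le> (I0 r y * passage_lt p y - I0 r y * exp (- \<theta> * y)) / (\<psi> \<theta> - p)" by simp
    qed
    also have "(LBINT y. (I0 r y * passage_lt p y - I0 r y * exp (- \<theta> * y)) / (\<psi> \<theta> - p)) = (C r - (LBINT y. I0 r y * exp (- \<theta> * y))) / (\<psi> \<theta> - p)"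
      unfolding C_def using Ci Ei[OF \<theta>'(1)] by simp
    finally show ?thesis .
  qed
  have aefin: "AE x in lborel. \<phi> r x \<noteq> \<infinity>" for r
  proof -
    have "AE x in lborel. ennreal (exp (- \<theta>0 * x)) * \<phi> r x \<noteq> \<infinity>"
    proof (rule nn_integral_PInf_AE)
      show "(\<integral>\<^sup>+x. ennreal (exp (- \<theta>0 * x)) * \<phi> r x \<partial>lborel) \<noteq> \<infinity>"
        unfolding L[OF order.refl] by simp
    qed measurable
    then show ?thesis by eventually_elim (auto simp: ennreal_mult_eq_top_iff)
  qed
  \<comment> \<open>The finite transform at \<theta>0 makes \<phi> finite almost everywhere, hence
    at some point just to the right of x. Monotonicity brings finiteness back to x itself.\<close>
  have near: "\<exists>x'. x < x' \<and> x' < x + 1 \<and> \<phi> (r + 1) x' \<noteq> \<infinity>" for r x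
  proof (rule ccontr)
    assume "\<not> ?thesis"
    then have "AE x' in lborel. x' \<notin> {x<..<x+1}" using aefin[of "r + 1"] by (auto elim!: eventually_mono)
    then have "emeasure lborel {x<..<x+1} = 0" by (subst (asm) AE_iff_measurable[of "{x<..<x+1}"]) auto
    then show False by simp
  qed
  have rle: "\<phi> r x \<le> \<phi> (r + 1) x'" if "x \<le> x'" "x' \<le> x + 1" for r x x'
    unfolding \<phi>_def res_def by (intro nn_integral_mono pot_interval_mono that)
  have fin: "\<phi> r x < \<infinity>" for r x
  proof -
    obtain x' where "x < x'" "x' < x + 1" "\<phi> (r + 1) x' \<noteq> \<infinity>" using near by blast
    then show ?thesis using rle[of x x' r] by (simp add: less_top order.strict_trans1)
  qed
  have rc: "continuous (at_right x) (\<lambda>x. enn2real (\<phi> r x))" for r x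
  proof -
    obtain x' where x': "x < x'" "x' < x + 1" "\<phi> (r + 1) x' \<noteq> \<infinity>" using near by blast
    show ?thesis
    proof (rule continuous_at_rightI_seq[OF x'(1)])
      fix S assume S: "\<And>n. x < S n" "\<And>n. S n < x'" "S \<longlonglongrightarrow> x"
      have Sm: "S n \<le> x'" "x' \<le> S n + 1" for n using S(1)[of n] S(2)[of n] x' by auto
      have "(\<lambda>n. \<phi> r (S n)) \<longlonglongrightarrow> \<phi> r x"
        unfolding \<phi>_def res_def
      proof (rule nn_integral_dominated_convergence[where w="\<lambda>\<omega>. pot p 0 A (indicator {0..<r+1}) x' (path \<omega>)"])
        show "(\<integral>\<^sup>+\<omega>. pot p 0 A (indicator {0..<r+1}) x' (path \<omega>) \<partial>M) < \<infinity>"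
          using fin[of "r + 1" x'] by (simp add: \<phi>_def res_def)
        show "AE \<omega> in M. pot p 0 A (indicator {0..<r}) (S n) (path \<omega>) \<le> pot p 0 A (indicator {0..<r+1}) x' (path \<omega>)" for n
          by (intro AE_I2 pot_interval_mono Sm)
        have "AE \<omega> in M. pot p 0 A (indicator {0..<r+1}) x' (path \<omega>) \<noteq> \<infinity>"
          using fin[of "r + 1" x'] by (intro nn_integral_PInf_AE) (auto simp: \<phi>_def res_def)
        then show "AE \<omega> in M. (\<lambda>n. pot p 0 A (indicator {0..<r}) (S n) (path \<omega>)) \<longlonglongrightarrow> pot p 0 A (indicator {0..<r}) x (path \<omega>)"
        proof eventually_elim
          case (elim \<omega>)
          let ?w = "path \<omega>"
          have gm: "(\<lambda>t. of_bool (0 < t) * ennreal (wt p 0 A y ?w t) * indicator {0..<r} (y + right_lim ?w t)) \<in> borel_measurable lborel" for y r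
            using pot_integrand_measurable[OF A, of "indicator {0..<r}" p 0 y ?w] by simp
          show ?case unfolding pot_def
          proof (rule nn_integral_dominated_convergence[where w="\<lambda>t. of_bool (0 < t) * ennreal (wt p 0 A x' ?w t) * indicator {0..<r+1} (x' + right_lim ?w t)"])
            show "AE t in lborel. of_bool (0 < t) * ennreal (wt p 0 A (S n) ?w t) * indicator {0..<r} (S n + right_lim ?w t)
              \<le> of_bool (0 < t) * ennreal (wt p 0 A x' ?w t) * indicator {0..<r+1} (x' + right_lim ?w t)" for n
              using Sm[of n] alive_mono[of "S n" _ ?w x'] by (intro AE_I2) (auto simp: indicator_def wt_0)
            show "(\<integral>\<^sup>+t. of_bool (0 < t) * ennreal (wt p 0 A x' ?w t) * indicator {0..<r+1} (x' + right_lim ?w t) \<partial>lborel) < \<infinity>"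
              using elim by (simp add: pot_def less_top)
            show "AE t in lborel. (\<lambda>n. of_bool (0 < t) * ennreal (wt p 0 A (S n) ?w t) * indicator {0..<r} (S n + right_lim ?w t))
               \<longlonglongrightarrow> of_bool (0 < t) * ennreal (wt p 0 A x ?w t) * indicator {0..<r} (x + right_lim ?w t)"
              by (intro AE_I2 pot_interval_integrand_tendsto S)
          qed (rule gm)+
        qed
      qed measurable
      then show "(\<lambda>n. enn2real (\<phi> r (S n))) \<longlonglongrightarrow> enn2real (\<phi> r x)"
        using fin[of r x] by (intro tendsto_enn2real) (simp_all add: ennreal_enn2real)
    qed
  qed
  define k where "k x = enn2real (\<phi> r x) - (W x * C r - conv W (I0 r) x)" for x
  have \<phi>neg: "\<phi> r x = 0" if "x < 0" for x r unfolding \<phi>_def by (rule res_neg[OF that])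
  have LI: "set_integrable lborel {0..} (\<lambda>x. exp (- \<theta> * x) * k x) \<and> (LBINT x:{0..}. exp (- \<theta> * x) * k x) = 0"
    if \<theta>: "\<theta>0 \<le> \<theta>" for \<theta>
  proof -
    have \<theta>': "0 \<le> \<theta>" "p < \<psi> \<theta>" using \<theta> \<theta>0 by auto
    let ?E = "LBINT y. I0 r y * exp (- \<theta> * y)"
    have e1: "indicator {0..} x *\<^sub>R (exp (- \<theta> * x) * enn2real (\<phi> r x)) = exp (- \<theta> * x) * enn2real (\<phi> r x)" for x
      using \<phi>neg[of x r] by (auto simp: indicator_def)
    have nn: "(\<integral>\<^sup>+x. ennreal (exp (- \<theta> * x) * enn2real (\<phi> r x)) \<partial>lborel) = ennreal ((C r - ?E) / (\<psi> \<theta> - p))"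
      unfolding L[OF \<theta>, symmetric] using fin by (intro nn_integral_cong) (simp add: ennreal_mult ennreal_enn2real)
    have i1: "integrable lborel (\<lambda>x. exp (- \<theta> * x) * enn2real (\<phi> r x))"
    proof (rule integrableI_nonneg)
      show "(\<integral>\<^sup>+x. ennreal (exp (- \<theta> * x) * enn2real (\<phi> r x)) \<partial>lborel) < \<infinity>" unfolding nn by simp
    qed simp_all
    have CE: "0 \<le> C r - ?E"
    proof -
      have "?E \<le> C r" unfolding C_def
      proof (rule integral_mono[OF Ei[OF \<theta>'(1)] Ci])
        show "I0 r y * exp (- \<theta> * y) \<le> I0 r y * passage_lt p y" for y
          using passage_lt_ge[OF p \<theta>', of y] by (cases "0 \<le> y") (auto intro!: mult_left_mono)
      qed
      then show ?thesis by simp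
    qed
    have v1: "(LBINT x. exp (- \<theta> * x) * enn2real (\<phi> r x)) = (C r - ?E) / (\<psi> \<theta> - p)"
      using nn_integral_eq_integral[OF i1] nn CE \<theta>' by (simp add: Bochner_Integration.integral_nonneg)
    have s1: "set_integrable lborel {0..} (\<lambda>x. exp (- \<theta> * x) * enn2real (\<phi> r x))"
      unfolding set_integrable_def e1 by (rule i1)
    have sI: "set_integrable lborel {0..} (\<lambda>x. exp (- \<theta> * x) * I0 r x)" "(LBINT x:{0..}. exp (- \<theta> * x) * I0 r x) = ?E"
    proof -
      have "indicator {0..} x *\<^sub>R (exp (- \<theta> * x) * I0 r x) = I0 r x * exp (- \<theta> * x)" for x by (auto simp: indicator_def)
      then show "set_integrable lborel {0..} (\<lambda>x. exp (- \<theta> * x) * I0 r x)" "(LBINT x:{0..}. exp (- \<theta> * x) * I0 r x) = ?E"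
        using Ei[OF \<theta>'(1), of r] by (simp_all only: set_integrable_def set_lebesgue_integral_def)
    qed
    note sW = \<theta>0(3)[OF \<theta>] and vW = \<theta>0(4)[OF \<theta>]
    note cl = conv_laplace[OF Wc I0c sW sI(1)]
    have s2: "set_integrable lborel {0..} (\<lambda>x. exp (- \<theta> * x) * W x * C r)" using sW by simp
    have eq: "exp (- \<theta> * x) * k x = exp (- \<theta> * x) * enn2real (\<phi> r x) - (exp (- \<theta> * x) * W x * C r - exp (- \<theta> * x) * conv W (I0 r) x)" for x
      unfolding k_def by (simp add: algebra_simps)
    have "set_integrable lborel {0..} (\<lambda>x. exp (- \<theta> * x) * k x)"
      unfolding eq by (intro set_integral_diff s1 s2 cl(1))
    moreover have "(LBINT x:{0..}. exp (- \<theta> * x) * k x) = (C r - ?E) / (\<psi> \<theta> - p) - (1 / (\<psi> \<theta> - p) * C r - 1 / (\<psi> \<theta> - p) * ?E)"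
    proof -
      have "(LBINT x:{0..}. exp (- \<theta> * x) * enn2real (\<phi> r x)) = (C r - ?E) / (\<psi> \<theta> - p)"
        unfolding set_lebesgue_integral_def e1 by (rule v1)
      moreover have "(LBINT x:{0..}. exp (- \<theta> * x) * W x * C r) = 1 / (\<psi> \<theta> - p) * C r"
        using vW by simp
      ultimately show ?thesis
        unfolding eq set_integral_diff(2)[OF s1 set_integral_diff(1)[OF s2 cl(1)]] set_integral_diff(2)[OF s2 cl(1)] cl(2) vW sI(2)
        by simp
    qed
    ultimately show ?thesis by (simp add: diff_divide_distrib)
  qed
  have "k x = 0"
  proof (rule laplace_transform_eq_0[of \<theta>0 k])
    show "continuous (at_right x) k" if "0 \<le> x" for x unfolding k_def
      by (intro continuous_diff continuous_mult rc continuous_const conv_right_continuous Wc I0c scale_continuous[OF sc] scale_right_continuous[OF sc] that)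
  qed (use LI x in auto)
  then have kx: "enn2real (\<phi> r x) = W x * C r - conv W (I0 r) x" by (simp add: k_def)
  have "\<phi> r x = ennreal (enn2real (\<phi> r x))" using fin[of r x] by simp
  then show ?thesis using kx enn2real_nonneg[of "\<phi> r x"] unfolding \<phi>_def C_def by simp
qed

text \<open>For fixed x the resolvent is integration against a measure, whose values on the
  intervals [0,r) are known from \<open>res_interval\<close>. These values determine the integral of
  every bounded function supported in [0,d).\<close>

lemma res_formula:
  assumes sc: "is_scale_function M X p W" and p: "0 \<le> p" and A[measurable]: "A \<in> sets borel" and x: "0 \<le> x"
    and f[measurable]: "f \<in> borel_measurable borel" and fB: "\<And>y. 0 \<le> f y \<and> f y \<le> B" and f0: "\<And>y. y \<notin> {0..<d} \<Longrightarrow> f y = 0"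
  shows "res p 0 A (\<lambda>y. ennreal (f y)) x = ennreal (W x * (LBINT y. f y * passage_lt p y) - conv W f x)"
    and "0 \<le> W x * (LBINT y. f y * passage_lt p y) - conv W f x"
proof -
  note Wc = scale_causal[OF sc]
  note [measurable] = causal_measurable[OF Wc]
  have fc: "causal f"
    unfolding causal_def using f0 fB by (auto intro!: exI[of _ B] simp: abs_of_nonneg)
  define k where "k y = W x * passage_lt p y - W (x - y)" for y
  have km[measurable]: "k \<in> borel_measurable borel" unfolding k_def by measurable
  obtain C where C: "0 < C" "\<And>y. y \<le> x \<Longrightarrow> \<bar>W y\<bar> \<le> C" using causal_bound[OF Wc, of x] by blast
  have kC: "\<bar>k y\<bar> \<le> 2 * C" if "y \<in> {0..<d}" for y
  proof -
    have "\<bar>W x * passage_lt p y\<bar> \<le> C * 1" unfolding abs_mult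
      using C passage_lt_bounds[OF p, of y] by (intro mult_mono) auto
    moreover have "\<bar>W (x - y)\<bar> \<le> C" using that by (intro C) auto
    ultimately show ?thesis unfolding k_def by linarith
  qed
  have split: "(LBINT y. g y * k y) = W x * (LBINT y. g y * passage_lt p y) - conv W g x \<and> integrable lborel (\<lambda>y. g y * k y)"
    if gc: "causal g" and gi: "integrable lborel (\<lambda>y. g y * passage_lt p y)" for g
  proof -
    have eq: "g y * k y = W x * (g y * passage_lt p y) - W (x - y) * g y" for y by (simp add: k_def algebra_simps)
    show ?thesis unfolding eq conv_def using gi conv_integrable[OF Wc gc, of x] by simp
  qed
  have I0i: "integrable lborel (I0 r)" for r by (cases "0 \<le> r") (auto intro!: integrable_real_indicator)
  have Ci: "integrable lborel (\<lambda>y. I0 r y * passage_lt p y)" for r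
    by (rule Bochner_Integration.integrable_bound[OF I0i[of r]]) (use passage_lt_bounds[OF p] in \<open>auto simp: indicator_def\<close>)
  have I0c: "causal (I0 r)" for r by (auto simp: causal_def indicator_def intro!: exI[of _ 1])
  \<comment> \<open>The discounted occupation measure of the process started at x and killed below
    0.\<close>
  define \<nu> where "\<nu> = distr (density (M \<Otimes>\<^sub>M lborel) (\<lambda>(\<omega>, t). of_bool (0 < t) * ennreal (wt p 0 A x (path \<omega>) t))) borel (\<lambda>(\<omega>, t). x + right_lim (path \<omega>) t)"
  have s\<nu>: "sets \<nu> = sets borel" by (simp add: \<nu>_def)
  have res\<nu>: "res p 0 A h x = (\<integral>\<^sup>+y. h y \<partial>\<nu>)" if [measurable]: "h \<in> borel_measurable borel" for h
  proof -
    have "(\<integral>\<^sup>+y. h y \<partial>\<nu>) = (\<integral>\<^sup>+z. (case z of (\<omega>, t) \<Rightarrow> of_bool (0 < t) * ennreal (wt p 0 A x (path \<omega>) t) * h (x + right_lim (path \<omega>) t)) \<partial>(M \<Otimes>\<^sub>M lborel))"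
      unfolding \<nu>_def by (subst nn_integral_distr) (auto simp: nn_integral_density split_beta intro!: nn_integral_cong)
    also have "\<dots> = res p 0 A h x" unfolding res_def pot_def
      by (subst lborel.nn_integral_fst[symmetric]) auto
    finally show ?thesis by simp
  qed
  have int: "emeasure \<nu> {0..<r} = ennreal (LBINT y:{0..<r}. k y) \<and> 0 \<le> (LBINT y:{0..<r}. k y)" for r
    using res_interval[OF sc p A x, of r] split[OF I0c Ci, of r] res\<nu>[of "indicator {0..<r}"] s\<nu>
    by (simp add: set_lebesgue_integral_def)
  have f_bound: "\<bar>f y\<bar> \<le> \<bar>B * I0 d y\<bar>" for y using fB[of y] f0[of y] by (auto simp: indicator_def)
  have fi: "integrable lborel (\<lambda>y. f y * passage_lt p y)"
  proof (rule Bochner_Integration.integrable_bound[of _ "\<lambda>y. B * I0 d y"])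
    show "integrable lborel (\<lambda>y. B * I0 d y)" using I0i by simp
    have "\<bar>f y * passage_lt p y\<bar> \<le> \<bar>B * I0 d y\<bar> * 1" for y
      unfolding abs_mult[of "f y"] using f_bound[of y] passage_lt_bounds[OF p, of y] by (intro mult_mono) auto
    then show "AE y in lborel. norm (f y * passage_lt p y) \<le> norm (B * I0 d y)" by simp
  qed measurable
  let ?K = "LBINT y. f y * k y"
  have fki: "integrable lborel (\<lambda>y. f y * k y)" using split[OF fc fi] by simp
  have eq1: "ennreal (f y) * indicator {0..<d} y = ennreal (f y)" for y using f0[of y] by (auto simp: indicator_def)
  have eq2: "ennreal (f y) * (indicator {0..<d} y * ennreal (s * k y)) = ennreal (s * (f y * k y))" for y s
  proof (cases "y \<in> {0..<d}")
    case True
    then show ?thesis using fB[of y] by (simp add: mult.left_commute flip: ennreal_mult')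
  qed (simp add: f0)
  have "(\<integral>\<^sup>+y. ennreal (f y) * indicator {0..<d} y \<partial>\<nu>) + (\<integral>\<^sup>+y. ennreal (f y) * (indicator {0..<d} y * ennreal (- k y)) \<partial>lborel) =
    (\<integral>\<^sup>+y. ennreal (f y) * (indicator {0..<d} y * ennreal (k y)) \<partial>lborel)"
    by (rule sum_of_measures_determined[OF s\<nu> km kC int]) auto
  then have E: "res p 0 A (\<lambda>y. ennreal (f y)) x + (\<integral>\<^sup>+y. ennreal (- (f y * k y)) \<partial>lborel) = (\<integral>\<^sup>+y. ennreal (f y * k y) \<partial>lborel)"
    using eq2[of _ 1] eq2[of _ "-1"] by (simp add: eq1 res\<nu>)
  have fin: "(\<integral>\<^sup>+y. ennreal (- (f y * k y)) \<partial>lborel) \<noteq> \<top>" "(\<integral>\<^sup>+y. ennreal (f y * k y) \<partial>lborel) \<noteq> \<top>"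
    using fki by (auto simp: real_integrable_def)
  have K: "?K = enn2real (\<integral>\<^sup>+y. ennreal (f y * k y) \<partial>lborel) - enn2real (\<integral>\<^sup>+y. ennreal (- (f y * k y)) \<partial>lborel)"
    by (rule real_lebesgue_integral_def[OF fki])
  obtain u where u: "(\<integral>\<^sup>+y. ennreal (f y * k y) \<partial>lborel) = ennreal u" "0 \<le> u" using fin(2) by (cases "\<integral>\<^sup>+y. ennreal (f y * k y) \<partial>lborel") auto
  obtain v where v: "(\<integral>\<^sup>+y. ennreal (- (f y * k y)) \<partial>lborel) = ennreal v" "0 \<le> v" using fin(1) by (cases "\<integral>\<^sup>+y. ennreal (- (f y * k y)) \<partial>lborel") auto
  have "res p 0 A (\<lambda>y. ennreal (f y)) x \<noteq> \<top>" using E u by auto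
  then obtain r where r: "res p 0 A (\<lambda>y. ennreal (f y)) x = ennreal r" "0 \<le> r" by (cases "res p 0 A (\<lambda>y. ennreal (f y)) x") auto
  have "r + v = u" using E u v r by (simp flip: ennreal_plus)
  then have "?K = r" using K u v by simp
  then have "res p 0 A (\<lambda>y. ennreal (f y)) x = ennreal ?K \<and> 0 \<le> ?K" using r by simp
  then show "res p 0 A (\<lambda>y. ennreal (f y)) x = ennreal (W x * (LBINT y. f y * passage_lt p y) - conv W f x)"
    and "0 \<le> W x * (LBINT y. f y * passage_lt p y) - conv W f x"
    using split[OF fc fi] by simp_all
qed

end

section \<open>Adding an occupation penalty\<close>

lemma right_lim_borel: "(\<lambda>s. right_lim w s) \<in> borel_measurable borel"
  by (rule right_lim_measurable[OF const_path_measurable measurable_ident_sets[OF refl, unfolded id_def]])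

lemma occ_diff:
  assumes A: "A \<in> sets borel" and st: "0 \<le> s" "s \<le> t"
  shows "occ A x w s \<le> occ A x w t" "occ A x w t - occ A x w s \<le> t - s"
proof -
  have [measurable]: "(\<lambda>r. indicator A (x + right_lim w r) :: real) \<in> borel_measurable borel"
    using A right_lim_borel[of w] by measurable
  have i: "set_integrable lborel {u..v} (\<lambda>r. indicator A (x + right_lim w r) :: real)" for u v
    by (rule set_integrable_Icc_bounded[where B=1], fact) (auto simp: indicator_def)
  have e: "occ A x w t = occ A x w s + (LBINT r:{s..t}. indicator A (x + right_lim w r))"
    unfolding occ_def by (rule LBINT_Icc_split[OF i st])
  have "(LBINT r:{s..t}. indicator A (x + right_lim w r)) \<le> (LBINT r:{s..t}. 1 :: real)"
    by (intro set_integral_mono i set_integrable_Icc_bounded[where B=1]) (auto simp: indicator_def)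
  moreover have "0 \<le> (LBINT r:{s..t}. indicator A (x + right_lim w r) :: real)"
    unfolding set_lebesgue_integral_def by (intro Bochner_Integration.integral_nonneg) auto
  ultimately show "occ A x w s \<le> occ A x w t" "occ A x w t - occ A x w s \<le> t - s"
    using e st by (auto simp: set_lebesgue_integral_def)
qed

lemma occ_0: "A \<in> sets borel \<Longrightarrow> occ A x w 0 = 0"
  unfolding occ_def set_lebesgue_integral_def
  by (rule integral_eq_zero_AE) (auto intro!: eventually_mono[OF AE_lborel_singleton[of 0]])

lemma occ_tendsto:
  assumes A: "A \<in> sets borel" and S: "\<And>n. t \<le> S n" "S \<longlonglongrightarrow> t" and t: "0 \<le> t"
  shows "(\<lambda>n. occ A x w (S n)) \<longlonglongrightarrow> occ A x w t"
proof (rule tendsto_sandwich[of "\<lambda>_. occ A x w t" _ _ "\<lambda>n. occ A x w t + (S n - t)"])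
  have "(\<lambda>n. occ A x w t + (S n - t)) \<longlonglongrightarrow> occ A x w t + (t - t)" by (intro tendsto_intros S)
  then show "(\<lambda>n. occ A x w t + (S n - t)) \<longlonglongrightarrow> occ A x w t" by simp
  show "\<forall>\<^sub>F n in sequentially. occ A x w t \<le> occ A x w (S n)"
    using occ_diff(1)[OF A t S(1)] by simp
  show "\<forall>\<^sub>F n in sequentially. occ A x w (S n) \<le> occ A x w t + (S n - t)"
    using occ_diff(2)[OF A t S(1), of x w] by (simp add: algebra_simps)
qed simp

text \<open>The counterpart of \<open>shifted\<close> as a functional of a bare path, jointly
  measurable in the path and in the shift s; this is needed when s is an integration
  variable.\<close>

definition shift :: "real \<Rightarrow> (real \<Rightarrow> real) \<Rightarrow> real \<Rightarrow> real" where
  "shift s w t = right_lim w (s + max 0 t) - right_lim w s"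

lemma shift_measurable[measurable (raw)]:
  assumes [measurable]: "f \<in> borel_measurable N" "g \<in> measurable N path_space"
  shows "(\<lambda>z. shift (f z) (g z)) \<in> measurable N path_space"
  unfolding shift_def by (intro measurable_path_space) measurable

context snlp begin

lemma shift_path: "\<omega> \<in> space M \<Longrightarrow> 0 \<le> s \<Longrightarrow> shift s (path \<omega>) = shifted s \<omega>"
  by (rule ext) (simp add: shift_def shifted_def right_lim_path)

text \<open>A pathwise Duhamel formula: dropping the penalty from the weight at t is compensated by
  integrating over a time s in A at which the penalty is switched on. It is
  \<open>exp_integral_identity\<close> for the occupation time, and it is stated as a sum of
  nonnegative terms.\<close>

lemma wt_resolvent:
  assumes \<omega>: "\<omega> \<in> space M" and A[measurable]: "A \<in> sets borel" and q: "0 \<le> q" and t: "0 < t"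
  shows "ennreal (wt p 0 A x (path \<omega>) t) = ennreal (wt p q A x (path \<omega>) t) + ennreal q *
    (\<integral>\<^sup>+s. of_bool (0 < s \<and> s < t) * (ennreal (wt p 0 A x (path \<omega>) s) * indicator A (x + right_lim (path \<omega>) s) *
       ennreal (wt p q A (x + right_lim (path \<omega>) s) (shift s (path \<omega>)) (t - s))) \<partial>lborel)"
proof (cases "alive x t (path \<omega>)")
  case False
  have "wt p 0 A x (path \<omega>) s * wt p q A (x + right_lim (path \<omega>) s) (shift s (path \<omega>)) (t - s) = 0" if s: "0 < s" "s < t" for s
    using alive_split[OF \<omega>, of s "t - s" x] False s
    by (auto simp: wt_def shift_path[OF \<omega>] right_lim_path[OF \<omega>])
  then have "of_bool (0 < s \<and> s < t) * (ennreal (wt p 0 A x (path \<omega>) s) * indicator A (x + right_lim (path \<omega>) s) *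
       ennreal (wt p q A (x + right_lim (path \<omega>) s) (shift s (path \<omega>)) (t - s))) = 0" for s
    by fastforce
  then have "(\<integral>\<^sup>+s. of_bool (0 < s \<and> s < t) * (ennreal (wt p 0 A x (path \<omega>) s) * indicator A (x + right_lim (path \<omega>) s) *
       ennreal (wt p q A (x + right_lim (path \<omega>) s) (shift s (path \<omega>)) (t - s))) \<partial>lborel) = (\<integral>\<^sup>+s. 0 \<partial>(lborel :: real measure))"
    by (intro nn_integral_cong)
  then show ?thesis using False by (simp add: wt_def)
next
  case True
  let ?w = "path \<omega>"
  define g where "g s = (indicator A (x + right_lim ?w s) :: real)" for s
  have gm[measurable]: "g \<in> borel_measurable borel" unfolding g_def using right_lim_borel[of ?w] by measurable
  define G where "G s = occ A x ?w s" for s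
  have G_eq: "G s = (LBINT r:{0..s}. g r)" for s by (simp add: G_def occ_def g_def)
  \<comment> \<open>The fully penalised weight at t. For s < t the unpenalised weight up to s times
    the penalised weight from s to t equals c exp(q G s), so the exponential identity only has to be
    multiplied by c.\<close>
  define c where "c = exp (- p * t - q * G t)"
  have id: "exp (q * G t) - 1 = q * (LBINT s:{0..t}. g s * exp (q * G s))"
    unfolding G_eq by (rule exp_integral_identity) (use t in \<open>auto simp: g_def indicator_def\<close>)
  have [measurable]: "G \<in> borel_measurable borel"
    unfolding G_def[abs_def] by (rule occ_measurable[OF A borel_measurable_const const_path_measurable measurable_ident_sets[OF refl, unfolded id_def]])
  have Gt: "0 \<le> G s" "G s \<le> G t" if "0 \<le> s" "s \<le> t" for s
    using occ_diff(1)[OF A order.refl that(1)] occ_diff(1)[OF A that] by (simp_all add: G_def occ_0[OF A])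
  have ib: "set_integrable lborel {0..t} (\<lambda>s. g s * exp (q * G s))"
  proof (rule set_integrable_Icc_bounded[where B="exp (q * G t)"])
    fix s assume "s \<in> {0..t}"
    then have "exp (q * G s) \<le> exp (q * G t)" using Gt[of s] q by (auto intro!: mult_left_mono)
    then show "\<bar>g s * exp (q * G s)\<bar> \<le> exp (q * G t)" by (auto simp: g_def indicator_def abs_mult)
  qed measurable
  have pt: "of_bool (0 < s \<and> s < t) * (ennreal (wt p 0 A x ?w s) * indicator A (x + right_lim ?w s) *
       ennreal (wt p q A (x + right_lim ?w s) (shift s ?w) (t - s))) = ennreal (c * (indicator {0..t} s *\<^sub>R (g s * exp (q * G s))))"
    if s: "s \<noteq> 0" "s \<noteq> t" for s
  proof (cases "0 < s \<and> s < t")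
    case st: True
    have al: "alive x s ?w" "alive (x + X s \<omega>) (t - s) (shifted s \<omega>)"
      using alive_split[OF \<omega>, of s "t - s" x] True st by auto
    have oc: "occ A (x + X s \<omega>) (shifted s \<omega>) (t - s) = G t - G s"
      using occ_split[OF \<omega>, of s "t - s" A x] st A by (simp add: G_def)
    have "ennreal (wt p 0 A x ?w s) * indicator A (x + right_lim ?w s) * ennreal (wt p q A (x + right_lim ?w s) (shift s ?w) (t - s))
      = ennreal (exp (- p * s) * g s * exp (- p * (t - s) - q * (G t - G s)))"
      using st al oc by (simp add: wt_def shift_path[OF \<omega>] right_lim_path[OF \<omega>] g_def indicator_def flip: ennreal_mult)
    also have "exp (- p * s) * g s * exp (- p * (t - s) - q * (G t - G s)) = c * (g s * exp (q * G s))"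
    proof -
      have "exp (- p * s) * exp (- p * (t - s) - q * (G t - G s)) = c * exp (q * G s)"
        unfolding c_def by (simp add: algebra_simps flip: exp_add)
      then show ?thesis by (simp add: mult_ac)
    qed
    finally show ?thesis using st by simp
  qed (use s in \<open>auto simp: indicator_def\<close>)
  have "(\<integral>\<^sup>+s. of_bool (0 < s \<and> s < t) * (ennreal (wt p 0 A x ?w s) * indicator A (x + right_lim ?w s) *
       ennreal (wt p q A (x + right_lim ?w s) (shift s ?w) (t - s))) \<partial>lborel) = (\<integral>\<^sup>+s. ennreal (c * (indicator {0..t} s *\<^sub>R (g s * exp (q * G s)))) \<partial>lborel)"
    by (intro nn_integral_cong_AE eventually_mono[OF AE_conjI[OF AE_lborel_singleton[of 0] AE_lborel_singleton[of t]]]) (use pt in blast)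
  also have "\<dots> = ennreal (LBINT s. c * (indicator {0..t} s *\<^sub>R (g s * exp (q * G s))))"
    using ib by (intro nn_integral_eq_integral) (auto simp: set_integrable_def c_def g_def)
  also have "(LBINT s. c * (indicator {0..t} s *\<^sub>R (g s * exp (q * G s)))) = c * (LBINT s:{0..t}. g s * exp (q * G s))"
    by (simp add: set_lebesgue_integral_def)
  finally have I: "(\<integral>\<^sup>+s. of_bool (0 < s \<and> s < t) * (ennreal (wt p 0 A x ?w s) * indicator A (x + right_lim ?w s) *
       ennreal (wt p q A (x + right_lim ?w s) (shift s ?w) (t - s))) \<partial>lborel) = ennreal (c * (LBINT s:{0..t}. g s * exp (q * G s)))" .
  have Inn: "0 \<le> (LBINT s:{0..t}. g s * exp (q * G s))"
    unfolding set_lebesgue_integral_def by (intro Bochner_Integration.integral_nonneg) (auto simp: g_def)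
  have "exp (- p * t) = c * exp (q * G t)" by (simp add: c_def flip: exp_add)
  also have "\<dots> = c + q * (c * (LBINT s:{0..t}. g s * exp (q * G s)))" using id by (simp add: algebra_simps)
  finally have "wt p 0 A x ?w t = wt p q A x ?w t + q * (c * (LBINT s:{0..t}. g s * exp (q * G s)))"
    using True by (simp add: wt_def c_def G_def)
  then show ?thesis unfolding I using q Inn by (simp add: c_def flip: ennreal_mult ennreal_plus)
qed

text \<open>Integrate \<open>wt_resolvent\<close> against f along the path, exchange s and t, and
  substitute t = s + r: the inner integral becomes the potential of the path shifted by s.\<close>

lemma pot_resolvent:
  assumes \<omega>: "\<omega> \<in> space M" and A[measurable]: "A \<in> sets borel" and q: "0 \<le> q" and f[measurable]: "f \<in> borel_measurable borel"
  shows "pot p 0 A f x (path \<omega>) = pot p q A f x (path \<omega>) + ennreal q *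
    (\<integral>\<^sup>+s. of_bool (0 < s) * (ennreal (wt p 0 A x (path \<omega>) s) * indicator A (x + right_lim (path \<omega>) s) *
       pot p q A f (x + right_lim (path \<omega>) s) (shift s (path \<omega>))) \<partial>lborel)"
proof -
  let ?w = "path \<omega>"
  let ?y = "\<lambda>s. x + right_lim ?w s"
  note [measurable] = right_lim_borel[of ?w]
  have w0: "(\<lambda>s. wt p 0 A x ?w s) \<in> borel_measurable borel" and wq: "(\<lambda>s. wt p q A x ?w s) \<in> borel_measurable borel" for q
    by (rule wt_measurable[OF A borel_measurable_const const_path_measurable measurable_ident_sets[OF refl, unfolded id_def]])+
  note [measurable] = w0 wq
  have shm[measurable (raw)]: "h \<in> borel_measurable N \<Longrightarrow> (\<lambda>z. shift (h z) ?w) \<in> measurable N path_space" for h and N :: "'z measure"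
    by (rule shift_measurable[OF _ const_path_measurable])
  define B where "B s = ennreal (wt p 0 A x ?w s) * indicator A (?y s)" for s
  have Bm[measurable]: "B \<in> borel_measurable borel" unfolding B_def by measurable
  define Q where "Q s r = ennreal (wt p q A (?y s) (shift s ?w) r)" for s r
  have Qm[measurable (raw)]: "(\<lambda>z. Q (h z) (k z)) \<in> borel_measurable N" if [measurable]: "h \<in> borel_measurable N" "k \<in> borel_measurable N" for h k and N :: "'z measure"
    unfolding Q_def by measurable
  have "pot p 0 A f x ?w = (\<integral>\<^sup>+t. of_bool (0 < t) * ennreal (wt p q A x ?w t) * f (?y t) + ennreal q * (\<integral>\<^sup>+s. of_bool (0 < s \<and> s < t) * (B s * Q s (t - s)) * f (?y t) \<partial>lborel) \<partial>lborel)"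
    unfolding pot_def
  proof (rule nn_integral_cong)
    fix t :: real
    show "of_bool (0 < t) * ennreal (wt p 0 A x ?w t) * f (?y t) = of_bool (0 < t) * ennreal (wt p q A x ?w t) * f (?y t) + ennreal q * (\<integral>\<^sup>+s. of_bool (0 < s \<and> s < t) * (B s * Q s (t - s)) * f (?y t) \<partial>lborel)"
    proof (cases "0 < t")
      case True
      have "(\<integral>\<^sup>+s. of_bool (0 < s \<and> s < t) * (B s * Q s (t - s)) * f (?y t) \<partial>lborel) = (\<integral>\<^sup>+s. of_bool (0 < s \<and> s < t) * (B s * Q s (t - s)) \<partial>lborel) * f (?y t)"
        by (rule nn_integral_multc) measurable
      then show ?thesis using wt_resolvent[OF \<omega> A q True, of p x] True
        by (simp add: B_def[symmetric] Q_def[symmetric] distrib_right mult.assoc)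
    qed (auto intro!: nn_integral_zero' AE_I2)
  qed
  also have "\<dots> = pot p q A f x ?w + ennreal q * (\<integral>\<^sup>+t. \<integral>\<^sup>+s. of_bool (0 < s \<and> s < t) * (B s * Q s (t - s)) * f (?y t) \<partial>lborel \<partial>lborel)"
    unfolding pot_def by (subst nn_integral_add) (auto simp: nn_integral_cmult)
  also have "(\<integral>\<^sup>+t. \<integral>\<^sup>+s. of_bool (0 < s \<and> s < t) * (B s * Q s (t - s)) * f (?y t) \<partial>lborel \<partial>lborel)
     = (\<integral>\<^sup>+s. \<integral>\<^sup>+t. of_bool (0 < s \<and> s < t) * (B s * Q s (t - s)) * f (?y t) \<partial>lborel \<partial>lborel)"
    by (rule lborel_pair.Fubini') measurable
  also have "\<dots> = (\<integral>\<^sup>+s. of_bool (0 < s) * (B s * pot p q A f (?y s) (shift s ?w)) \<partial>lborel)"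
  proof (rule nn_integral_cong)
    fix s :: real
    show "(\<integral>\<^sup>+t. of_bool (0 < s \<and> s < t) * (B s * Q s (t - s)) * f (?y t) \<partial>lborel) = of_bool (0 < s) * (B s * pot p q A f (?y s) (shift s ?w))"
    proof (cases "0 < s")
      case True
      have "(\<integral>\<^sup>+t. of_bool (0 < s \<and> s < t) * (B s * Q s (t - s)) * f (?y t) \<partial>lborel) =
        (\<integral>\<^sup>+r. of_bool (0 < s \<and> s < s + r) * (B s * Q s r) * f (?y (s + r)) \<partial>lborel)"
        by (subst nn_integral_real_affine[where c=1 and t=s]) auto
      also have "\<dots> = (\<integral>\<^sup>+r. B s * (of_bool (0 < r) * Q s r * f (?y s + right_lim (shift s ?w) r)) \<partial>lborel)"
      proof (rule nn_integral_cong)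
        fix r
        show "of_bool (0 < s \<and> s < s + r) * (B s * Q s r) * f (?y (s + r)) = B s * (of_bool (0 < r) * Q s r * f (?y s + right_lim (shift s ?w) r))"
        proof (cases "0 < r")
          case r: True
          have "?y (s + r) = ?y s + right_lim (shift s ?w) r"
            using r True by (simp add: shift_path[OF \<omega>] right_lim_path[OF \<omega>] right_lim_shifted[OF \<omega>])
          then show ?thesis using r True by (simp add: mult.assoc add.assoc)
        qed simp
      qed
      also have "\<dots> = B s * pot p q A f (?y s) (shift s ?w)"
        unfolding pot_def Q_def by (rule nn_integral_cmult) (use pot_integrand_measurable[OF A f] in simp)
      finally show ?thesis using True by simp
    qed simp
  qed
  finally show ?thesis by (simp add: B_def mult.assoc)
qed

text \<open>The Markov property at each fixed s replaces the potential of the shifted path in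
  \<open>pot_resolvent\<close> by its mean, the resolvent at the current position.\<close>

lemma res_resolvent:
  assumes A[measurable]: "A \<in> sets borel" and q: "0 \<le> q" and f[measurable]: "f \<in> borel_measurable borel"
  shows "res p 0 A f x = res p q A f x + ennreal q * res p 0 A (\<lambda>y. indicator A y * res p q A f y) x"
proof -
  interpret LM: pair_sigma_finite lborel M by unfold_locales
  define H where "H s w = of_bool (0 < s) * (ennreal (wt p 0 A x w s) * indicator A (x + right_lim w s) *
       pot p q A f (x + right_lim w s) (shift s w))" for s w
  have Hm[measurable (raw)]: "(\<lambda>z. H (h z) (k z)) \<in> borel_measurable N" if [measurable]: "h \<in> borel_measurable N" "k \<in> measurable N path_space" for h k and N :: "'z measure"
    unfolding H_def by measurable
  define J where "J s w = of_bool (0 < s) * ennreal (wt p 0 A x w s) * (indicator A (x + right_lim w s) * res p q A f (x + right_lim w s))" for s w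
  have Jm[measurable (raw)]: "(\<lambda>z. J (h z) (k z)) \<in> borel_measurable N" if [measurable]: "h \<in> borel_measurable N" "k \<in> measurable N path_space" for h k and N :: "'z measure"
    unfolding J_def by measurable
  have mk: "(\<integral>\<^sup>+\<omega>. H s (path \<omega>) \<partial>M) = (\<integral>\<^sup>+\<omega>. J s (path \<omega>) \<partial>M)" for s
  proof (cases "0 < s")
    case True
    let ?\<Psi> = "\<lambda>v w. ennreal (wt p 0 A x v s) * indicator A (x + v s) * pot p q A f (x + v s) w"
    have ps: "(\<lambda>z. fst z s) \<in> borel_measurable (path_space \<Otimes>\<^sub>M path_space)"
      by (rule measurable_compose[OF measurable_fst measurable_component_singleton]) simp
    have m: "(\<lambda>(v, w). ?\<Psi> v w) \<in> borel_measurable (path_space \<Otimes>\<^sub>M path_space)"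
      unfolding split_beta using ps by measurable
    have "(\<integral>\<^sup>+\<omega>. H s (path \<omega>) \<partial>M) = (\<integral>\<^sup>+\<omega>. ?\<Psi> (stopped s \<omega>) (shifted s \<omega>) \<partial>M)"
      using True by (intro nn_integral_cong) (simp add: H_def wt_stopped shift_path right_lim_path stopped_eq)
    also have "\<dots> = (\<integral>\<^sup>+\<omega>. \<integral>\<^sup>+\<omega>'. ?\<Psi> (stopped s \<omega>) (path \<omega>') \<partial>M \<partial>M)"
      using True by (intro markov[OF _ m]) simp
    also have "\<dots> = (\<integral>\<^sup>+\<omega>. J s (path \<omega>) \<partial>M)"
    proof (rule nn_integral_cong)
      fix \<omega> assume \<omega>: "\<omega> \<in> space M"
      have "(\<integral>\<^sup>+\<omega>'. ?\<Psi> (stopped s \<omega>) (path \<omega>') \<partial>M) = ennreal (wt p 0 A x (stopped s \<omega>) s) * indicator A (x + stopped s \<omega> s) * res p q A f (x + stopped s \<omega> s)"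
        unfolding res_def by (rule nn_integral_cmult) measurable
      then show "(\<integral>\<^sup>+\<omega>'. ?\<Psi> (stopped s \<omega>) (path \<omega>') \<partial>M) = J s (path \<omega>)"
        using True by (simp add: J_def wt_stopped[OF \<omega>] right_lim_path[OF \<omega>] stopped_eq mult.assoc)
    qed
    finally show ?thesis .
  qed (simp add: H_def J_def)
  have "res p 0 A f x = (\<integral>\<^sup>+\<omega>. pot p q A f x (path \<omega>) + ennreal q * (\<integral>\<^sup>+s. H s (path \<omega>) \<partial>lborel) \<partial>M)"
    unfolding res_def H_def by (intro nn_integral_cong pot_resolvent A q f)
  also have "\<dots> = res p q A f x + ennreal q * (\<integral>\<^sup>+\<omega>. \<integral>\<^sup>+s. H s (path \<omega>) \<partial>lborel \<partial>M)"
    unfolding res_def by (subst nn_integral_add) (auto simp: nn_integral_cmult)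
  also have "(\<integral>\<^sup>+\<omega>. \<integral>\<^sup>+s. H s (path \<omega>) \<partial>lborel \<partial>M) = (\<integral>\<^sup>+s. \<integral>\<^sup>+\<omega>. H s (path \<omega>) \<partial>M \<partial>lborel)"
    by (rule LM.Fubini') measurable
  also have "\<dots> = (\<integral>\<^sup>+s. \<integral>\<^sup>+\<omega>. J s (path \<omega>) \<partial>M \<partial>lborel)" by (simp add: mk)
  also have "\<dots> = (\<integral>\<^sup>+\<omega>. \<integral>\<^sup>+s. J s (path \<omega>) \<partial>lborel \<partial>M)"
    by (rule LM.Fubini'[symmetric]) measurable
  also have "\<dots> = res p 0 A (\<lambda>y. indicator A y * res p q A f y) x"
    unfolding res_def pot_def J_def by simp
  finally show ?thesis .
qed

text \<open>The kernel formula is applied twice, to f and to the function equal to u on A and 0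
  elsewhere, which is admissible because A is bounded and u is locally bounded by the unpenalised
  resolvent. In both results the passage transform enters only as a multiple of W x, and the two
  multiples merge into K.\<close>

lemma res_equation:
  assumes sc: "is_scale_function M X p W" and p: "0 \<le> p" and q: "0 \<le> q" and A[measurable]: "A \<in> sets borel" and AD: "A \<subseteq> {0..<d}"
    and f[measurable]: "f \<in> borel_measurable borel" and fB: "\<And>y. 0 \<le> f y \<and> f y \<le> B" and f0: "\<And>y. y \<notin> {0..<d} \<Longrightarrow> f y = 0"
  defines "u \<equiv> \<lambda>x. enn2real (res p q A (\<lambda>y. ennreal (f y)) x)"
  obtains K where "\<And>x. res p q A (\<lambda>y. ennreal (f y)) x = ennreal (u x)" "\<And>x. x < 0 \<Longrightarrow> u x = 0" "causal u"
    "\<And>x. 0 \<le> x \<Longrightarrow> u x = K * W x - conv W f x + q * conv W (\<lambda>y. indicator A y * u y) x"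
    "continuous_on {0..} u"
proof -
  note Wc = scale_causal[OF sc] and Wcont = scale_continuous[OF sc]
  let ?f = "\<lambda>y. ennreal (f y)"
  define F where "F = (LBINT y. f y * passage_lt p y)"
  have fc: "causal f" unfolding causal_def using f0 fB by (auto intro!: exI[of _ B] simp: abs_of_nonneg)
  have le: "res p q A ?f x \<le> res p 0 A ?f x" for x
    unfolding res_resolvent[OF A q, of ?f p x, simplified] by simp
  have V: "res p 0 A ?f x = ennreal (W x * F - conv W f x)" "0 \<le> W x * F - conv W f x" if "0 \<le> x" for x
    using res_formula[OF sc p A that f fB f0] by (simp_all add: F_def)
  have um[measurable]: "u \<in> borel_measurable borel" unfolding u_def by measurable
  have uneg: "u x = 0" if "x < 0" for x unfolding u_def by (simp add: res_neg[OF that])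
  have fin: "res p q A ?f x = ennreal (u x)" for x
  proof (cases "x < 0")
    case False
    then have "res p q A ?f x \<noteq> \<top>" using le[of x] V[of x] by (auto simp: top_unique)
    then show ?thesis unfolding u_def by (simp add: less_top)
  qed (simp add: uneg res_neg)
  have unn: "0 \<le> u x" for x unfolding u_def by simp
  have ule: "u x \<le> W x * F - conv W f x" if "0 \<le> x" for x
    using le[of x] V[OF that] fin[of x] by simp
  have rc: "causal (\<lambda>x. W x * F - conv W f x)"
    using causal_diff[OF causal_cmult[OF Wc, of F] causal_conv[OF Wc fc]] by (simp add: mult.commute)
  have uc: "causal u"
    unfolding causal_def
  proof (intro conjI allI impI um uneg)
    fix e
    obtain B' where "0 < B'" "\<And>x. x \<le> e \<Longrightarrow> \<bar>W x * F - conv W f x\<bar> \<le> B'" using causal_bound[OF rc] by blast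
    then show "\<exists>B. \<forall>x\<le>e. \<bar>u x\<bar> \<le> B" using ule unn uneg
      by (intro exI[of _ B'] allI impI) (metis abs_le_iff abs_of_nonneg abs_zero le_less_linear less_imp_le order_trans)
  qed
  define g where "g y = indicator A y * u y" for y
  have gm[measurable]: "g \<in> borel_measurable borel" unfolding g_def by measurable
  have gc: "causal g" unfolding g_def by (rule causal_indicator[OF uc]) simp
  obtain B2 where B2: "0 < B2" "\<And>x. x \<le> d \<Longrightarrow> \<bar>u x\<bar> \<le> B2" using causal_bound[OF uc] by blast
  have gB: "0 \<le> g y \<and> g y \<le> B2" for y
  proof (cases "y \<in> A")
    case True
    then have "y \<le> d" using AD by auto
    then show ?thesis using B2(2)[of y] unn[of y] True by (simp add: g_def)
  qed (use B2(1) in \<open>simp add: g_def\<close>)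
  have g0: "g y = 0" if "y \<notin> {0..<d}" for y using that AD by (auto simp: g_def indicator_def)
  define Gc where "Gc = (LBINT y. g y * passage_lt p y)"
  have ge: "(\<lambda>y. indicator A y * res p q A ?f y) = (\<lambda>y. ennreal (g y))"
    by (auto simp: g_def fin indicator_def)
  have U: "u x = (F - q * Gc) * W x - conv W f x + q * conv W g x" if x: "0 \<le> x" for x
  proof -
    have G: "res p 0 A (\<lambda>y. ennreal (g y)) x = ennreal (W x * Gc - conv W g x)" "0 \<le> W x * Gc - conv W g x"
      using res_formula[OF sc p A x gm gB g0] by (simp_all add: Gc_def)
    have "ennreal (W x * F - conv W f x) = ennreal (u x) + ennreal q * ennreal (W x * Gc - conv W g x)"
    proof -
      have "res p 0 A ?f x = res p q A ?f x + ennreal q * res p 0 A (\<lambda>y. indicator A y * res p q A ?f y) x"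
        by (rule res_resolvent[OF A q]) simp
      from this[unfolded ge] show ?thesis by (simp only: G(1) V(1)[OF x] fin)
    qed
    then have "W x * F - conv W f x = u x + q * (W x * Gc - conv W g x)"
      using V(2)[OF x] G(2) q unn[of x] by (simp flip: ennreal_mult ennreal_plus)
    then show ?thesis by (simp add: algebra_simps)
  qed
  have "continuous_on {0..} (\<lambda>x. (F - q * Gc) * W x - conv W f x + q * conv W g x)"
    by (intro continuous_intros Wcont continuous_at_imp_continuous_on ballI conv_continuous Wc fc gc)
  then have "continuous_on {0..} u" by (rule continuous_on_eq) (simp add: U)
  then show ?thesis using that fin uneg uc U unfolding g_def by blast
qed

end

section \<open>Strong Markov property of the resolvent at upward passage\<close>

context snlp begin

text \<open>At level 0 the passage transform equals 1 at a positive rate, which forces the passage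
  time to be 0 almost surely.\<close>

lemma regular_upward: "AE \<omega> in M. \<tau> 0 \<omega> = 0"
proof -
  have "\<forall>\<^sub>F \<theta> in at_top. 0 < \<psi> \<theta>" using \<psi>_at_top by (rule filterlim_at_top_dense[THEN iffD1, rule_format])
  then obtain N where N: "\<And>\<theta>. N \<le> \<theta> \<Longrightarrow> 0 < \<psi> \<theta>" by (auto simp: eventually_at_top_linorder)
  define \<theta> where "\<theta> = max N 0"
  have \<theta>: "0 \<le> \<theta>" "0 < \<psi> \<theta>" using N[of \<theta>] by (auto simp: \<theta>_def)
  define h where "h \<omega> = (of_bool (\<tau> 0 \<omega> < \<infinity>) * ennreal (exp (- \<psi> \<theta> * T 0 \<omega>)) :: ennreal)" for \<omega>
  have [measurable]: "h \<in> borel_measurable M" unfolding h_def by measurable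
  have h1: "h \<omega> \<le> 1" for \<omega> using \<theta> by (auto simp: h_def)
  have I: "(\<integral>\<^sup>+\<omega>. h \<omega> \<partial>M) = 1"
    using passage_laplace_\<psi>[OF \<theta>, of 0] by (simp add: passage_laplace_def h_def)
  have "(\<integral>\<^sup>+\<omega>. 1 - h \<omega> \<partial>M) = (\<integral>\<^sup>+\<omega>. 1 \<partial>M) - (\<integral>\<^sup>+\<omega>. h \<omega> \<partial>M)"
    by (rule nn_integral_diff) (auto simp: I h1)
  then have "(\<integral>\<^sup>+\<omega>. 1 - h \<omega> \<partial>M) = 0" by (simp add: I emeasure_space_1)
  then have "AE \<omega> in M. 1 - h \<omega> = 0" by (subst (asm) nn_integral_0_iff_AE) auto
  then show ?thesis
  proof eventually_elim
    case (elim \<omega>)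
    then have h: "h \<omega> = 1" using h1[of \<omega>] by (metis diff_eq_0_iff_ennreal ennreal_one_neq_top order_antisym)
    then have fin: "\<tau> 0 \<omega> < \<infinity>" by (cases "\<tau> 0 \<omega> < \<infinity>") (simp_all add: h_def)
    then have "T 0 \<omega> = 0" using h \<theta> by (simp add: h_def)
    then show ?case using \<tau>_finite[OF fin] by simp
  qed
qed

text \<open>Started at c, the path rises above c at arbitrarily small times and by right-continuity
  stays there for a while. Before that it has moved by less than the minimum of c and 1, so it has
  neither been killed nor left (c, c + 1) at the top; c > 0 is what makes this margin
  positive.\<close>

lemma res_pos:
  assumes c: "0 < c" and A[measurable]: "A \<in> sets borel"
  shows "0 < res p q A (indicator {c<..<c+1}) c"
proof -
  have "AE \<omega> in M. 0 < pot p q A (indicator {c<..<c+1}) c (path \<omega>)"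
    using regular_upward AE_space
  proof eventually_elim
    case (elim \<omega>)
    let ?d = "min c 1"
    have "\<forall>\<^sub>F s in at_right 0. \<bar>X s \<omega>\<bar> < ?d"
    proof -
      have "((\<lambda>s. \<bar>X s \<omega>\<bar>) \<longlongrightarrow> \<bar>0\<bar>) (at_right 0)"
        using X_right_continuous[OF elim(2), of 0] X_0[OF elim(2)] by (intro tendsto_rabs) simp
      then show ?thesis by (rule order_tendstoD(2)) (use c in auto)
    qed
    then obtain b where b: "b > 0" "\<And>s. 0 < s \<Longrightarrow> s < b \<Longrightarrow> \<bar>X s \<omega>\<bar> < ?d" by (auto simp: eventually_at_right_field)
    have "\<tau> 0 \<omega> < ereal b" using elim(1) b by simp
    then obtain r where r: "0 < r" "r < b" "0 < X r \<omega>" using \<tau>_less_iff[OF elim(2)] crossed_path[OF elim(2)] by blast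
    have "\<forall>\<^sub>F s in at_right r. 0 < X s \<omega>"
      using order_tendstoD(1)[OF X_right_continuous[OF elim(2), of r] r(3)] r by simp
    then obtain b' where b': "b' > r" "\<And>s. r < s \<Longrightarrow> s < b' \<Longrightarrow> 0 < X s \<omega>" by (auto simp: eventually_at_right_field)
    let ?e = "min b b'"
    let ?F = "\<lambda>t. of_bool (0 < t) * ennreal (wt p q A c (path \<omega>) t) * indicator {c<..<c+1} (c + right_lim (path \<omega>) t) :: ennreal"
    have Fm: "?F \<in> borel_measurable lborel" using pot_integrand_measurable[OF A, of "indicator {c<..<c+1}"] by simp
    have Fpos: "?F t \<noteq> 0" if t: "r < t" "t < ?e" for t
    proof -
      have X: "0 < X t \<omega>" "X t \<omega> < 1" using b'(2)[of t] b(2)[of t] t r by auto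
      have "0 \<le> c + X s \<omega>" if "0 \<le> s" "s < t" for s
        using that b(2)[of s] t X_0[OF elim(2)] c by (cases "s = 0") auto
      then have "alive c t (path \<omega>)" by (simp add: alive_path[OF elim(2)])
      then show ?thesis using X t r by (simp add: wt_def right_lim_path[OF elim(2)])
    qed
    have "(\<integral>\<^sup>+t. ?F t \<partial>lborel) \<noteq> 0"
    proof
      assume "(\<integral>\<^sup>+t. ?F t \<partial>lborel) = 0"
      then have "AE t in lborel. ?F t = 0" using nn_integral_0_iff_AE[OF Fm] by blast
      then have "AE t in lborel. t \<notin> {r<..<?e}" by eventually_elim (use Fpos in auto)
      then have "emeasure lborel {r<..<?e} = 0" by (subst (asm) AE_iff_measurable[of "{r<..<?e}"]) auto
      then show False using r b' by simp
    qed
    then show ?case unfolding pot_def by (simp add: zero_less_iff_neq_zero)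
  qed
  note pos = this
  show ?thesis
  proof (rule ccontr)
    assume "\<not> ?thesis"
    then have "res p q A (indicator {c<..<c+1}) c = 0" by simp
    then have "AE \<omega> in M. pot p q A (indicator {c<..<c+1}) c (path \<omega>) = 0"
      unfolding res_def by (subst (asm) nn_integral_0_iff_AE) auto
    then have "AE \<omega> in M. False" using pos by eventually_elim simp
    then show False by simp
  qed
qed

text \<open>For x \<ge> 0 this encodes that passage above precedes passage below 0 strictly: the
  path stays nonnegative not just up to the upward passage but up to some dyadic time beyond it.
  Only countably many conditions are involved.\<close>

definition survives :: "real \<Rightarrow> real \<Rightarrow> 'a \<Rightarrow> bool" where
  "survives x y \<omega> \<longleftrightarrow> \<tau> y \<omega> < \<infinity> \<and> (\<exists>n. alive x (gridT n y \<omega>) (path \<omega>))"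

lemma survives_measurable[measurable]: "Measurable.pred M (survives x y)"
proof -
  have "Measurable.pred M (\<lambda>\<omega>. alive x (gridT n y \<omega>) (path \<omega>))" for n
    by (rule measurable_compose_countable[OF _ cell_measurable]) measurable
  then show ?thesis unfolding survives_def[abs_def] by measurable
qed

lemma alive_antimono: "alive x t w \<Longrightarrow> t' \<le> t \<Longrightarrow> alive x t' w"
  unfolding alive_def by auto

lemma passage_below_iff:
  assumes \<omega>: "\<omega> \<in> space M" and x: "0 \<le> x"
  shows "\<tau> y \<omega> < passage_below 0 (\<lambda>t. x + X t \<omega>) \<longleftrightarrow> survives x y \<omega>"
proof
  assume l: "\<tau> y \<omega> < passage_below 0 (\<lambda>t. x + X t \<omega>)"
  then have fin: "\<tau> y \<omega> < \<infinity>" by (rule order.strict_trans2) simp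
  obtain s where s: "\<tau> y \<omega> < ereal s" "ereal s < passage_below 0 (\<lambda>t. x + X t \<omega>)" using ereal_dense2[OF l] by blast
  then have "T y \<omega> < s" using \<tau>_finite[OF fin] by (metis less_ereal.simps(1))
  then have "\<forall>\<^sub>F n in sequentially. gridT n y \<omega> < s" by (rule order_tendstoD(2)[OF gridT_tendsto])
  then obtain n where n: "gridT n y \<omega> < s" by (auto simp: eventually_sequentially)
  have "0 \<le> x + X r \<omega>" if r: "0 \<le> r" "r < gridT n y \<omega>" for r
  proof (cases "r = 0")
    case False
    show ?thesis
    proof (rule ccontr)
      assume "\<not> 0 \<le> x + X r \<omega>"
      then have "passage_below 0 (\<lambda>t. x + X t \<omega>) \<le> ereal r"
        unfolding passage_below_def using r False by (intro Inf_lower) auto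
      also have "\<dots> < ereal s" using r n by simp
      finally show False using s(2) by simp
    qed
  qed (use x X_0[OF \<omega>] in simp)
  then show "survives x y \<omega>" unfolding survives_def alive_path[OF \<omega>] using fin by blast
next
  assume "survives x y \<omega>"
  then obtain n where fin: "\<tau> y \<omega> < \<infinity>" and al: "alive x (gridT n y \<omega>) (path \<omega>)" by (auto simp: survives_def)
  have "ereal (gridT n y \<omega>) \<le> passage_below 0 (\<lambda>t. x + X t \<omega>)"
    unfolding passage_below_def
  proof (rule Inf_greatest, clarsimp)
    fix t assume "0 < t" "x + X t \<omega> < 0"
    then show "gridT n y \<omega> \<le> t" using al unfolding alive_path[OF \<omega>] by (meson not_le less_imp_le)
  qed
  moreover have "\<tau> y \<omega> < ereal (gridT n y \<omega>)" using \<tau>_finite[OF fin] gridT_bounds(1)[of y \<omega> n] by (metis less_ereal.simps(1))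
  ultimately show "\<tau> y \<omega> < passage_below 0 (\<lambda>t. x + X t \<omega>)" by (rule order.strict_trans2[rotated])
qed

definition passage_functional :: "real \<Rightarrow> real \<Rightarrow> real set \<Rightarrow> real \<Rightarrow> real \<Rightarrow> 'a \<Rightarrow> real" where
  "passage_functional p q A x y \<omega> = of_bool (survives x y \<omega>) * exp (- p * T y \<omega> - q * occ A x (path \<omega>) (T y \<omega>))"

lemma passage_functional_measurable[measurable (raw)]:
  assumes [measurable]: "A \<in> sets borel"
  shows "passage_functional p q A x y \<in> borel_measurable M"
  unfolding passage_functional_def[abs_def] by measurable

lemma occ_nonneg: "0 \<le> occ A x w t"
  unfolding occ_def set_lebesgue_integral_def by (intro Bochner_Integration.integral_nonneg) auto

text \<open>Starting below \<open>c\<close>, the support of \<open>f\<close> can only be reached after \<open>\<tau>\<^sub>c\<^sup>+\<close>.\<close>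

lemma res_strong_markov:
  assumes p: "0 \<le> p" and q: "0 \<le> q" and A[measurable]: "A \<in> sets borel" and xc: "0 \<le> x" "x \<le> c"
    and f[measurable]: "f \<in> borel_measurable borel" and f0: "\<And>y. y \<le> c \<Longrightarrow> f y = 0"
    and u: "\<And>x. res p q A f x = ennreal (u x)" and unn: "\<And>x. 0 \<le> u x" and uB: "\<And>x. x \<le> c + 1 \<Longrightarrow> u x \<le> B" and uc: "continuous_on {0..} u"
  shows "res p q A f x = (\<integral>\<^sup>+\<omega>. ennreal (passage_functional p q A x (c - x) \<omega>) \<partial>M) * res p q A f c"
proof -
  define y where "y = c - x"
  have y: "0 \<le> y" using xc by (simp add: y_def)
  have um[measurable]: "(\<lambda>x. ennreal (u x)) \<in> borel_measurable borel" unfolding u[symmetric] by measurable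
  let ?s = "\<lambda>n \<omega>. gridT n y \<omega>"
  define F where "F \<omega> t = of_bool (0 < t) * ennreal (wt p q A x (path \<omega>) t) * f (x + right_lim (path \<omega>) t)" for \<omega> t
  have Fm: "F \<omega> \<in> borel_measurable borel" for \<omega> unfolding F_def by (rule pot_integrand_measurable[OF A f])
  \<comment> \<open>The cut-off keeps the position where u is bounded by \<open>B\<close>. Since the
    position at the dyadic times tends to c, it equals 1 eventually on almost every path with finite
    passage time.\<close>
  define b where "b n \<omega> = (of_bool (\<tau> y \<omega> < \<infinity> \<and> x + X (?s n \<omega>) \<omega> \<le> c + 1) :: ennreal)" for n \<omega>
  define P where "P n \<omega> = (\<integral>\<^sup>+t. of_bool (?s n \<omega> < t) * F \<omega> t \<partial>lborel)" for n \<omega>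
  define L where "L n \<omega> = b n \<omega> * P n \<omega>" for n \<omega>
  define R where "R n \<omega> = b n \<omega> * (ennreal (wt p q A x (path \<omega>) (?s n \<omega>)) * ennreal (u (x + X (?s n \<omega>) \<omega>)))" for n \<omega>
  \<comment> \<open>After the dyadic time the weight factorises, so the remaining potential is a
    fresh one started from the position at that time.\<close>
  have Ps: "P n \<omega> = ennreal (wt p q A x (path \<omega>) (?s n \<omega>)) * pot p q A f (x + X (?s n \<omega>) \<omega>) (shifted (?s n \<omega>) \<omega>)" if \<omega>: "\<omega> \<in> space M" for n \<omega>
  proof -
    let ?t = "?s n \<omega>"
    have t0: "0 < ?t" by (rule grid_pos)
    have "P n \<omega> = (\<integral>\<^sup>+r. of_bool (?t < ?t + r) * F \<omega> (?t + r) \<partial>lborel)"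
      unfolding P_def by (subst nn_integral_real_affine[where c=1 and t="?t"]) (auto intro!: borel_measurable_times_ennreal Fm)
    also have "\<dots> = (\<integral>\<^sup>+r. ennreal (wt p q A x (path \<omega>) ?t) * (of_bool (0 < r) * ennreal (wt p q A (x + X ?t \<omega>) (shifted ?t \<omega>) r) * f (x + X ?t \<omega> + right_lim (shifted ?t \<omega>) r)) \<partial>lborel)"
    proof (rule nn_integral_cong)
      fix r
      show "of_bool (?t < ?t + r) * F \<omega> (?t + r) = ennreal (wt p q A x (path \<omega>) ?t) * (of_bool (0 < r) * ennreal (wt p q A (x + X ?t \<omega>) (shifted ?t \<omega>) r) * f (x + X ?t \<omega> + right_lim (shifted ?t \<omega>) r))"
      proof (cases "0 < r")
        case True
        then have "wt p q A x (path \<omega>) (?t + r) = wt p q A x (path \<omega>) ?t * wt p q A (x + X ?t \<omega>) (shifted ?t \<omega>) r"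
          by (intro wt_split \<omega> A) auto
        moreover have "x + right_lim (path \<omega>) (?t + r) = x + X ?t \<omega> + right_lim (shifted ?t \<omega>) r"
          using True by (simp add: right_lim_path[OF \<omega>] right_lim_shifted[OF \<omega>])
        ultimately show ?thesis using True t0 by (simp add: F_def ennreal_mult mult.assoc add.assoc)
      qed simp
    qed
    also have "\<dots> = ennreal (wt p q A x (path \<omega>) ?t) * pot p q A f (x + X ?t \<omega>) (shifted ?t \<omega>)"
      unfolding pot_def by (rule nn_integral_cmult) (use pot_integrand_measurable[OF A f] in simp)
    finally show ?thesis .
  qed
  let ?g = "\<lambda>n k w. of_bool (x + w (grid n k) \<le> c + 1) * ennreal (wt p q A x w (grid n k)) :: ennreal"
  have comp: "(\<lambda>w. w r) \<in> borel_measurable path_space" for r :: real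
    by (rule measurable_component_singleton) simp
  note [measurable] = comp
  have Lm: "L n \<in> borel_measurable M" and Rm: "R n \<in> borel_measurable M" and LR: "(\<integral>\<^sup>+\<omega>. L n \<omega> \<partial>M) = (\<integral>\<^sup>+\<omega>. R n \<omega> \<partial>M)" for n
  proof -
    have Leq: "L n \<omega> = of_bool (\<tau> y \<omega> < \<infinity>) * ?g n (cell n y \<omega>) (stopped (?s n \<omega>) \<omega>) * pot p q A f (x + X (?s n \<omega>) \<omega>) (shifted (?s n \<omega>) \<omega>)" if "\<omega> \<in> space M" for \<omega>
      by (simp add: L_def Ps[OF that] b_def wt_stopped[OF that] stopped_eq mult_ac)
    have Req: "R n \<omega> = of_bool (\<tau> y \<omega> < \<infinity>) * ?g n (cell n y \<omega>) (stopped (?s n \<omega>) \<omega>) * res p q A f (x + X (?s n \<omega>) \<omega>)" if "\<omega> \<in> space M" for \<omega>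
      by (simp add: R_def b_def wt_stopped[OF that] stopped_eq mult_ac u)
    have gm: "?g n k \<in> borel_measurable path_space" for k by measurable
    have psm: "(\<lambda>(z, w). pot p q A f (x + z) w) \<in> borel_measurable (borel \<Otimes>\<^sub>M path_space)" by measurable
    have m1: "(\<lambda>\<omega>. of_bool (\<tau> y \<omega> < \<infinity>) * ?g n k (stopped (grid n k) \<omega>) * pot p q A f (x + X (grid n k) \<omega>) (shifted (grid n k) \<omega>)) \<in> borel_measurable M"
      and m2: "(\<lambda>\<omega>. of_bool (\<tau> y \<omega> < \<infinity>) * ?g n k (stopped (grid n k) \<omega>) * res p q A f (x + X (grid n k) \<omega>)) \<in> borel_measurable M" for k
    proof -
      have [measurable]: "X (grid n k) \<in> borel_measurable M" "stopped (grid n k) \<in> measurable M path_space" "shifted (grid n k) \<in> measurable M path_space"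
        by (simp_all add: stopped_measurable shifted_measurable)
      have [measurable]: "(\<lambda>\<omega>. ?g n k (stopped (grid n k) \<omega>)) \<in> borel_measurable M" by (rule measurable_compose[OF _ gm]) measurable
      show "(\<lambda>\<omega>. of_bool (\<tau> y \<omega> < \<infinity>) * ?g n k (stopped (grid n k) \<omega>) * pot p q A f (x + X (grid n k) \<omega>) (shifted (grid n k) \<omega>)) \<in> borel_measurable M" by measurable
      show "(\<lambda>\<omega>. of_bool (\<tau> y \<omega> < \<infinity>) * ?g n k (stopped (grid n k) \<omega>) * res p q A f (x + X (grid n k) \<omega>)) \<in> borel_measurable M" by measurable
    qed
    show "L n \<in> borel_measurable M"
      by (subst measurable_cong[OF Leq], assumption) (rule measurable_compose_countable[OF m1 cell_measurable])
    show "R n \<in> borel_measurable M"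
      by (subst measurable_cong[OF Req], assumption) (rule measurable_compose_countable[OF m2 cell_measurable])
    have "(\<integral>\<^sup>+\<omega>. L n \<omega> \<partial>M) = (\<integral>\<^sup>+\<omega>. of_bool (\<tau> y \<omega> < \<infinity>) * ?g n (cell n y \<omega>) (stopped (?s n \<omega>) \<omega>) * pot p q A f (x + X (?s n \<omega>) \<omega>) (shifted (?s n \<omega>) \<omega>) \<partial>M)"
      by (intro nn_integral_cong Leq)
    also have "\<dots> = (\<integral>\<^sup>+\<omega>. of_bool (\<tau> y \<omega> < \<infinity>) * ?g n (cell n y \<omega>) (stopped (?s n \<omega>) \<omega>) * (\<integral>\<^sup>+\<omega>'. pot p q A f (x + X (?s n \<omega>) \<omega>) (path \<omega>') \<partial>M) \<partial>M)"
      by (rule markov_gridT[of "?g n" "\<lambda>k z w. pot p q A f (x + z) w", OF gm psm])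
    also have "\<dots> = (\<integral>\<^sup>+\<omega>. R n \<omega> \<partial>M)" unfolding res_def[symmetric] by (intro nn_integral_cong Req[symmetric])
    finally show "(\<integral>\<^sup>+\<omega>. L n \<omega> \<partial>M) = (\<integral>\<^sup>+\<omega>. R n \<omega> \<partial>M)" .
  qed
  have blim: "AE \<omega> in M. \<tau> y \<omega> < \<infinity> \<longrightarrow> (\<forall>\<^sub>F n in sequentially. b n \<omega> = 1)"
    using X_at_T AE_space
  proof eventually_elim
    case (elim \<omega>)
    show ?case
    proof
      assume fin: "\<tau> y \<omega> < \<infinity>"
      then have XT: "X (T y \<omega>) \<omega> = y" using elim(1) y by blast
      have "\<forall>\<^sub>F n in sequentially. X (?s n \<omega>) \<omega> < y + 1"
        using X_gridT_tendsto[OF elim(2), of y] XT by (intro order_tendstoD(2)) auto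
      then show "\<forall>\<^sub>F n in sequentially. b n \<omega> = 1"
        by eventually_elim (use fin in \<open>auto simp: b_def y_def\<close>)
    qed
  qed
  have F0: "F \<omega> t = 0" if \<omega>: "\<omega> \<in> space M" and t: "0 < t" "\<tau> y \<omega> = \<infinity> \<or> t < T y \<omega>" for \<omega> t
  proof -
    have "\<not> y < X t \<omega>"
    proof
      assume "y < X t \<omega>"
      have "crossed y s (path \<omega>)" if "t < s" for s unfolding crossed_path[OF \<omega>] using \<open>y < X t \<omega>\<close> t that by blast
      then have c: "\<tau> y \<omega> < \<infinity> \<and> T y \<omega> < s" if "t < s" for s using crossed_iff_T[OF \<omega>] that by blast
      have "\<tau> y \<omega> \<noteq> \<infinity>" using c[of "t + 1"] by auto
      then have "t < T y \<omega>" using t by auto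
      then show False using c[of "T y \<omega>"] by simp
    qed
    then have "f (x + X t \<omega>) = 0" by (intro f0) (simp add: y_def)
    then show ?thesis using t by (simp add: F_def right_lim_path[OF \<omega>])
  qed
  have potF: "pot p q A f x (path \<omega>) = (\<integral>\<^sup>+t. F \<omega> t \<partial>lborel)" for \<omega> by (simp add: pot_def F_def)
  have Ifin: "(\<integral>\<^sup>+\<omega>. pot p q A f x (path \<omega>) \<partial>M) < \<infinity>" using u[of x] by (simp add: res_def[symmetric])
  have "(\<lambda>n. \<integral>\<^sup>+\<omega>. L n \<omega> \<partial>M) \<longlonglongrightarrow> (\<integral>\<^sup>+\<omega>. pot p q A f x (path \<omega>) \<partial>M)"
  proof (rule nn_integral_dominated_convergence[where w="\<lambda>\<omega>. pot p q A f x (path \<omega>)"])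
    show "AE \<omega> in M. L n \<omega> \<le> pot p q A f x (path \<omega>)" for n
    proof (rule AE_I2)
      fix \<omega>
      have "P n \<omega> \<le> pot p q A f x (path \<omega>)" unfolding P_def potF by (intro nn_integral_mono) auto
      then show "L n \<omega> \<le> pot p q A f x (path \<omega>)" by (auto simp: L_def b_def)
    qed
    have "AE \<omega> in M. pot p q A f x (path \<omega>) \<noteq> \<infinity>" using Ifin by (intro nn_integral_PInf_AE) auto
    then show "AE \<omega> in M. (\<lambda>n. L n \<omega>) \<longlonglongrightarrow> pot p q A f x (path \<omega>)"
      using blim AE_space
    proof eventually_elim
      case (elim \<omega>)
      show ?case
      proof (cases "\<tau> y \<omega> < \<infinity>")
        case True
        have "(\<lambda>n. P n \<omega>) \<longlonglongrightarrow> (\<integral>\<^sup>+t. F \<omega> t \<partial>lborel)"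
          unfolding P_def
        proof (rule nn_integral_dominated_convergence[where w="F \<omega>"])
          show "(\<integral>\<^sup>+t. F \<omega> t \<partial>lborel) < \<infinity>" using elim(1) by (simp add: potF less_top)
          show "AE t in lborel. (\<lambda>n. of_bool (?s n \<omega> < t) * F \<omega> t) \<longlonglongrightarrow> F \<omega> t"
            using AE_lborel_singleton[of "T y \<omega>"]
          proof eventually_elim
            case (elim t)
            show ?case
            proof (cases "T y \<omega> < t")
              case True
              have "\<forall>\<^sub>F n in sequentially. ?s n \<omega> < t" using order_tendstoD(2)[OF gridT_tendsto True] .
              then have "\<forall>\<^sub>F n in sequentially. of_bool (?s n \<omega> < t) * F \<omega> t = F \<omega> t" by eventually_elim simp
              then show ?thesis by (rule tendsto_eventually)
            next
              case False
              then have "F \<omega> t = 0" using F0[OF \<open>\<omega> \<in> space M\<close>, of t] elim by (cases "0 < t") (auto simp: F_def)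
              then show ?thesis by simp
            qed
          qed
        qed (auto intro!: borel_measurable_times_ennreal Fm)
        moreover have "\<forall>\<^sub>F n in sequentially. P n \<omega> = L n \<omega>"
          using elim(2)[rule_format, OF True] by eventually_elim (simp add: L_def)
        ultimately show ?thesis unfolding potF by (rule Lim_transform_eventually)
      next
        case False
        then have "F \<omega> t = 0" for t using F0[OF elim(3), of t] by (cases "0 < t") (auto simp: F_def)
        then have "pot p q A f x (path \<omega>) = 0" by (simp add: potF)
        moreover have "L n \<omega> = 0" for n using False by (simp add: L_def b_def)
        ultimately show ?thesis by simp
      qed
    qed
    show "(\<integral>\<^sup>+\<omega>. pot p q A f x (path \<omega>) \<partial>M) < \<infinity>" by (rule Ifin)
  qed (simp_all add: Lm)
  then have lim1: "(\<lambda>n. \<integral>\<^sup>+\<omega>. L n \<omega> \<partial>M) \<longlonglongrightarrow> res p q A f x" by (simp add: res_def)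
  have "(\<lambda>n. \<integral>\<^sup>+\<omega>. R n \<omega> \<partial>M) \<longlonglongrightarrow> (\<integral>\<^sup>+\<omega>. ennreal (passage_functional p q A x y \<omega>) * ennreal (u c) \<partial>M)"
  proof (rule nn_integral_dominated_convergence[where w="\<lambda>_. ennreal B"])
    show "AE \<omega> in M. R n \<omega> \<le> ennreal B" for n
    proof (rule AE_I2)
      fix \<omega>
      show "R n \<omega> \<le> ennreal B"
      proof (cases "x + X (?s n \<omega>) \<omega> \<le> c + 1")
        case True
        have w1: "wt p q A x (path \<omega>) (?s n \<omega>) \<le> 1"
        proof -
          have "0 \<le> p * ?s n \<omega>" "0 \<le> q * occ A x (path \<omega>) (?s n \<omega>)" using p q occ_nonneg by auto
          then have "- p * ?s n \<omega> - q * occ A x (path \<omega>) (?s n \<omega>) \<le> 0" by simp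
          then show ?thesis by (simp add: wt_def)
        qed
        have "wt p q A x (path \<omega>) (?s n \<omega>) * u (x + X (?s n \<omega>) \<omega>) \<le> 1 * B"
          using w1 uB[OF True] unn by (intro mult_mono) auto
        then have "ennreal (wt p q A x (path \<omega>) (?s n \<omega>)) * ennreal (u (x + X (?s n \<omega>) \<omega>)) \<le> ennreal B"
          by (simp add: unn flip: ennreal_mult) (auto intro: ennreal_leI)
        then show ?thesis by (auto simp: R_def b_def)
      qed (simp add: R_def b_def)
    qed
    show "AE \<omega> in M. (\<lambda>n. R n \<omega>) \<longlonglongrightarrow> ennreal (passage_functional p q A x y \<omega>) * ennreal (u c)"
      using blim X_at_T AE_space
    proof eventually_elim
      case (elim \<omega>)
      show ?case
      proof (cases "survives x y \<omega>")
        case True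
        then obtain n0 where fin: "\<tau> y \<omega> < \<infinity>" and al: "alive x (?s n0 \<omega>) (path \<omega>)" by (auto simp: survives_def)
        have XT: "X (T y \<omega>) \<omega> = y" using elim(2) y fin by blast
        have ev: "\<forall>\<^sub>F n in sequentially. ?s n \<omega> < ?s n0 \<omega>" using order_tendstoD(2)[OF gridT_tendsto gridT_bounds(1)] .
        have "(\<lambda>n. x + X (?s n \<omega>) \<omega>) \<longlonglongrightarrow> x + y" using X_gridT_tendsto[OF elim(3), of y] XT by (intro tendsto_intros) simp
        then have Xl: "(\<lambda>n. x + X (?s n \<omega>) \<omega>) \<longlonglongrightarrow> c" by (simp add: y_def)
        \<comment> \<open>Continuity of u holds on the half-line only. Once the dyadic times fall
          below the one up to which the path survives, the positions lie in that half-line.\<close>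
        have nn: "\<forall>\<^sub>F n in sequentially. x + X (?s n \<omega>) \<omega> \<in> {0..}"
          using ev by eventually_elim (use al in \<open>auto simp: alive_path[OF elim(3)]\<close>)
        have ul: "(\<lambda>n. u (x + X (?s n \<omega>) \<omega>)) \<longlonglongrightarrow> u c"
          by (rule continuous_on_tendsto_compose[OF uc Xl _ nn]) (use xc in auto)
        let ?E = "\<lambda>t. exp (- p * t - q * occ A x (path \<omega>) t)"
        have El: "(\<lambda>n. ?E (?s n \<omega>)) \<longlonglongrightarrow> ?E (T y \<omega>)"
          by (intro tendsto_intros gridT_tendsto occ_tendsto A) (use gridT_bounds(1) in \<open>auto intro: less_imp_le\<close>)
        have "(\<lambda>n. ennreal (?E (?s n \<omega>) * u (x + X (?s n \<omega>) \<omega>))) \<longlonglongrightarrow> ennreal (?E (T y \<omega>) * u c)"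
          by (intro tendsto_ennrealI tendsto_mult El ul)
        moreover have "\<forall>\<^sub>F n in sequentially. ennreal (?E (?s n \<omega>) * u (x + X (?s n \<omega>) \<omega>)) = R n \<omega>"
          using elim(1)[rule_format, OF fin] ev
        proof eventually_elim
          case (elim n)
          have "alive x (?s n \<omega>) (path \<omega>)" using alive_antimono[OF al] elim(2) by simp
          then show ?case using elim(1) by (simp add: R_def wt_def unn flip: ennreal_mult)
        qed
        ultimately have "(\<lambda>n. R n \<omega>) \<longlonglongrightarrow> ennreal (?E (T y \<omega>) * u c)" by (rule Lim_transform_eventually)
        then show ?thesis using True by (simp add: passage_functional_def unn flip: ennreal_mult)
      next
        case False
        then have "R n \<omega> = 0" for n by (auto simp: R_def b_def survives_def wt_def)
        then show ?thesis using False by (simp add: passage_functional_def)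
      qed
    qed
    show "(\<lambda>\<omega>. ennreal (passage_functional p q A x y \<omega>) * ennreal (u c)) \<in> borel_measurable M" by measurable
  qed (auto simp: Rm emeasure_space_1)
  moreover have "(\<integral>\<^sup>+\<omega>. ennreal (passage_functional p q A x y \<omega>) * ennreal (u c) \<partial>M) = (\<integral>\<^sup>+\<omega>. ennreal (passage_functional p q A x y \<omega>) \<partial>M) * ennreal (u c)"
    by (rule nn_integral_multc) measurable
  ultimately have "(\<lambda>n. \<integral>\<^sup>+\<omega>. L n \<omega> \<partial>M) \<longlonglongrightarrow> (\<integral>\<^sup>+\<omega>. ennreal (passage_functional p q A x y \<omega>) \<partial>M) * ennreal (u c)"
    by (simp add: LR)
  from LIMSEQ_unique[OF lim1 this] show ?thesis by (simp add: u y_def)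
qed

end

section \<open>Paths of bounded variation\<close>

lemma half_le_one_minus_exp: "0 \<le> s \<Longrightarrow> s \<le> 1 \<Longrightarrow> s / 2 \<le> 1 - exp (- s)" for s :: real
proof -
  assume s: "0 \<le> s" "s \<le> 1"
  have "exp (- s) \<le> 1 / (1 + s)"
    using exp_ge_add_one_self[of s] s by (simp add: exp_minus field_simps)
  also have "\<dots> \<le> 1 - s / 2" using s by (simp add: field_simps) (use mult_left_mono[of s 1 s] in auto)
  finally show ?thesis by simp
qed

lemma one_minus_power_le_exp: "0 \<le> d \<Longrightarrow> d \<le> 1 \<Longrightarrow> (1 - d) ^ n \<le> exp (- (real n * d))" for d :: real
proof -
  assume "0 \<le> d" "d \<le> 1"
  then have "(1 - d) ^ n \<le> exp (- d) ^ n" using exp_ge_add_one_self[of "- d"] by (intro power_mono) auto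
  also have "\<dots> = exp (- (real n * d))" by (simp flip: exp_of_nat_mult)
  finally show ?thesis .
qed

context snlp begin

definition incr :: "nat \<Rightarrow> nat \<Rightarrow> 'a \<Rightarrow> real" where
  "incr n k \<omega> = X (real (Suc k) / 2 ^ n) \<omega> - X (real k / 2 ^ n) \<omega>"

lemma incr_measurable[measurable]: "incr n k \<in> borel_measurable M"
  unfolding incr_def[abs_def] by (intro borel_measurable_diff X_measurable) auto

lemma incr_indep: "indep_vars (\<lambda>_. borel) (incr n) {..<N}"
  unfolding incr_def[abs_def] by (intro independent_increments) (auto simp: incseq_def intro!: divide_right_mono)

lemma incr_law:
  fixes h :: "real \<Rightarrow> ennreal"
  assumes [measurable]: "h \<in> borel_measurable borel"
  shows "(\<integral>\<^sup>+\<omega>. h (incr n k \<omega>) \<partial>M) = (\<integral>\<^sup>+\<omega>. h (incr n 0 \<omega>) \<partial>M)"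
proof -
  have f: "incr n k = (\<lambda>\<omega>. X (real k / 2 ^ n + 1 / 2 ^ n) \<omega> - X (real k / 2 ^ n) \<omega>)" for k
    by (simp add: fun_eq_iff incr_def add_divide_distrib add.commute)
  have "distr M borel (incr n k) = distr M borel (\<lambda>\<omega>. X (1 / 2 ^ n) \<omega> - X 0 \<omega>)" for k
    unfolding f by (rule stationary_increments) auto
  then have "distr M borel (incr n k) = distr M borel (incr n 0)" by simp
  then have "(\<integral>\<^sup>+z. h z \<partial>distr M borel (incr n k)) = (\<integral>\<^sup>+z. h z \<partial>distr M borel (incr n 0))" by simp
  then show ?thesis by (simp add: nn_integral_distr)
qed

lemma incr_product:
  fixes h :: "real \<Rightarrow> ennreal"
  assumes [measurable]: "h \<in> borel_measurable borel"
  shows "(\<integral>\<^sup>+\<omega>. (\<Prod>k<N. h (incr n k \<omega>)) \<partial>M) = (\<integral>\<^sup>+\<omega>. h (incr n 0 \<omega>) \<partial>M) ^ N"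
proof -
  have "indep_vars (\<lambda>_. borel) (\<lambda>k \<omega>. h (incr n k \<omega>)) {..<N}"
    using indep_vars_compose[OF incr_indep[of n N], of "\<lambda>_. h" "\<lambda>_. borel"] by (simp add: comp_def)
  from indep_vars_nn_integral[OF _ this] have "(\<integral>\<^sup>+\<omega>. (\<Prod>k<N. h (incr n k \<omega>)) \<partial>M) = (\<Prod>k<N. \<integral>\<^sup>+\<omega>. h (incr n k \<omega>) \<partial>M)"
    by simp
  also have "\<dots> = (\<Prod>k<N. \<integral>\<^sup>+\<omega>. h (incr n 0 \<omega>) \<partial>M)" by (intro prod.cong refl incr_law assms)
  finally show ?thesis by simp
qed

text \<open>No positive jumps: on a compact time interval the positive increments are uniformly small.\<close>

lemma incr_eventually_small:
  assumes \<epsilon>: "0 < \<epsilon>"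
  shows "AE \<omega> in M. \<forall>\<^sub>F n in sequentially. \<forall>k<2 ^ n. incr n k \<omega> \<le> \<epsilon>"
  using no_positive_jumps AE_space
proof eventually_elim
  case (elim \<omega>)
  note \<omega> = elim(2)
  \<comment> \<open>One-sided limits make the oscillation small on either side of s. Only a pair of
    times with u < s \<le> v sees the jump at s, and that jump is not positive.\<close>
  have loc: "\<exists>\<delta>>0. \<forall>u v. 0 \<le> u \<longrightarrow> u < v \<longrightarrow> \<bar>u - s\<bar> < \<delta> \<longrightarrow> \<bar>v - s\<bar> < \<delta> \<longrightarrow> X v \<omega> - X u \<omega> \<le> \<epsilon>" if s: "0 \<le> s" for s
  proof -
    have "\<forall>\<^sub>F v in at_right s. \<bar>X v \<omega> - X s \<omega>\<bar> < \<epsilon> / 4"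
      using tendstoD[OF X_right_continuous[OF \<omega> s], of "\<epsilon> / 4"] \<epsilon> by (simp add: dist_real_def)
    then obtain b where b: "b > s" "\<And>v. s < v \<Longrightarrow> v < b \<Longrightarrow> \<bar>X v \<omega> - X s \<omega>\<bar> < \<epsilon> / 4"
      by (auto simp: eventually_at_right_field)
    have bR: "\<bar>X v \<omega> - X s \<omega>\<bar> < \<epsilon> / 4" if "s \<le> v" "v < b" for v using b(2)[of v] that \<epsilon> by (cases "v = s") auto
    show ?thesis
    proof (cases "s = 0")
      case True
      show ?thesis
      proof (intro exI[of _ b] conjI allI impI)
        fix u v :: real assume "0 \<le> u" "u < v" "\<bar>u - s\<bar> < b" "\<bar>v - s\<bar> < b"
        then have "\<bar>X v \<omega> - X s \<omega>\<bar> < \<epsilon> / 4" "\<bar>X u \<omega> - X s \<omega>\<bar> < \<epsilon> / 4" using True bR[of u] bR[of v] by auto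
        then show "X v \<omega> - X u \<omega> \<le> \<epsilon>" using \<epsilon> by linarith
      qed (use b True in auto)
    next
      case False
      then have spos: "0 < s" using s by simp
      obtain l where l: "((\<lambda>s. X s \<omega>) \<longlongrightarrow> l) (at_left s)" using left_limits[OF \<omega> spos] by auto
      have "\<forall>\<^sub>F v in at_left s. \<bar>X v \<omega> - l\<bar> < \<epsilon> / 4" using tendstoD[OF l, of "\<epsilon> / 4"] \<epsilon> by (simp add: dist_real_def)
      then obtain a where a: "a < s" "\<And>v. a < v \<Longrightarrow> v < s \<Longrightarrow> \<bar>X v \<omega> - l\<bar> < \<epsilon> / 4"
        by (auto simp: eventually_at_left_field)
      have "Lim (at_left s) (\<lambda>s. X s \<omega>) = l" using l by (intro tendsto_Lim) auto
      then have Xl: "X s \<omega> \<le> l" using elim(1) spos by auto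
      show ?thesis
      proof (intro exI[of _ "min (b - s) (s - a)"] conjI allI impI)
        fix u v :: real assume uv: "0 \<le> u" "u < v" "\<bar>u - s\<bar> < min (b - s) (s - a)" "\<bar>v - s\<bar> < min (b - s) (s - a)"
        consider "v < s" | "s \<le> u" | "u < s" "s \<le> v" by linarith
        then show "X v \<omega> - X u \<omega> \<le> \<epsilon>"
        proof cases
          case 1
          then have "\<bar>X v \<omega> - l\<bar> < \<epsilon> / 4" "\<bar>X u \<omega> - l\<bar> < \<epsilon> / 4" using uv a(2)[of v] a(2)[of u] by auto
          then show ?thesis using \<epsilon> by linarith
        next
          case 2
          then have "\<bar>X v \<omega> - X s \<omega>\<bar> < \<epsilon> / 4" "\<bar>X u \<omega> - X s \<omega>\<bar> < \<epsilon> / 4" using uv bR[of v] bR[of u] by auto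
          then show ?thesis using \<epsilon> by linarith
        next
          case 3
          then have "\<bar>X v \<omega> - X s \<omega>\<bar> < \<epsilon> / 4" "\<bar>X u \<omega> - l\<bar> < \<epsilon> / 4" using uv bR[of v] a(2)[of u] by auto
          then show ?thesis using \<epsilon> Xl by linarith
        qed
      qed (use a b in auto)
    qed
  qed
  have "\<forall>s\<in>{0..1}. \<exists>\<delta>. 0 < \<delta> \<and> (\<forall>u v. 0 \<le> u \<longrightarrow> u < v \<longrightarrow> \<bar>u - s\<bar> < \<delta> \<longrightarrow> \<bar>v - s\<bar> < \<delta> \<longrightarrow> X v \<omega> - X u \<omega> \<le> \<epsilon>)"
    using loc by (meson atLeastAtMost_iff)
  from bchoice[OF this] obtain \<delta> where \<delta>: "\<And>s. s \<in> {0..1} \<Longrightarrow> 0 < \<delta> s"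
    "\<And>s u v. s \<in> {0..1} \<Longrightarrow> 0 \<le> u \<Longrightarrow> u < v \<Longrightarrow> \<bar>u - s\<bar> < \<delta> s \<Longrightarrow> \<bar>v - s\<bar> < \<delta> s \<Longrightarrow> X v \<omega> - X u \<omega> \<le> \<epsilon>"
    by blast
  have cov: "{0..1} \<subseteq> \<Union>((\<lambda>s. ball s (\<delta> s)) ` {0..1::real})"
  proof
    fix s :: real assume "s \<in> {0..1}"
    then show "s \<in> \<Union>((\<lambda>s. ball s (\<delta> s)) ` {0..1})" using \<delta>(1)[of s] by (intro UN_I[of s]) auto
  qed
  \<comment> \<open>A Lebesgue number of the cover: as soon as the mesh is below \<open>e\<close>,
    both ends of each dyadic interval lie in one of the balls.\<close>
  obtain e where e: "0 < e" "\<And>x. x \<in> {0..1} \<Longrightarrow> \<exists>G\<in>(\<lambda>s. ball s (\<delta> s)) ` {0..1}. ball x e \<subseteq> G"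
    by (rule Heine_Borel_lemma[OF compact_Icc cov]) auto
  have "\<forall>\<^sub>F n in sequentially. (1/2) ^ n < e"
    using order_tendstoD(2)[OF LIMSEQ_realpow_zero[of "1/2"] e(1)] by simp
  then show ?case
  proof eventually_elim
    case (elim n)
    show ?case
    proof (intro allI impI)
      fix k :: nat assume k: "k < 2 ^ n"
      let ?u = "real k / 2 ^ n" and ?v = "real (Suc k) / 2 ^ n"
      have "real k \<le> 2 ^ n" using k by (metis less_imp_le of_nat_le_iff of_nat_numeral of_nat_power)
      then have u: "?u \<in> {0..1}" by simp
      have vu: "?v - ?u = (1/2) ^ n" by (simp add: power_one_over flip: diff_divide_distrib)
      obtain s where s: "s \<in> {0..1}" "ball ?u e \<subseteq> ball s (\<delta> s)" using e(2)[OF u] by auto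
      have "0 < ?v - ?u" "?v - ?u < e" unfolding vu using elim by simp_all
      then have "?u \<in> ball ?u e" "?v \<in> ball ?u e" using e(1) by (auto simp: dist_real_def)
      then have "?u \<in> ball s (\<delta> s)" "?v \<in> ball s (\<delta> s)" using s(2) by blast+
      then have "\<bar>?u - s\<bar> < \<delta> s" "\<bar>?v - s\<bar> < \<delta> s" by (simp_all add: dist_real_def abs_minus_commute)
      then show "incr n k \<omega> \<le> \<epsilon>" unfolding incr_def using \<open>0 < ?v - ?u\<close> by (intro \<delta>(2)[OF s(1)]) auto
    qed
  qed
qed

lemma sum_incr: "\<omega> \<in> space M \<Longrightarrow> (\<Sum>k<2 ^ n. incr n k \<omega>) = X 1 \<omega>"
  unfolding incr_def using sum_lessThan_telescope[of "\<lambda>k. X (real k / 2 ^ n) \<omega>" "2 ^ n"] X_0 by simp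

lemma bounded_variation_small_increments:
  assumes bv: "bounded_variation_paths M X"
  obtains L where "0 \<le> L" "\<And>n. 2 ^ n * (\<integral>\<omega>. 1 - exp (- max 0 (incr n 0 \<omega>)) \<partial>M) \<le> L"
proof -
  define P where "P n \<omega> = (\<Sum>k<2 ^ n. max 0 (incr n k \<omega>))" for n \<omega>
  have Pb: "AE \<omega> in M. \<exists>B. \<forall>n. P n \<omega> \<le> B"
    using bv[unfolded bounded_variation_paths_def]
  proof eventually_elim
    case (elim \<omega>)
    then obtain B where B: "\<And>(n::nat) (u::nat \<Rightarrow> real). 0 \<le> u 0 \<Longrightarrow> incseq u \<Longrightarrow> u n \<le> 1 \<Longrightarrow> (\<Sum>i<n. \<bar>X (u (Suc i)) \<omega> - X (u i) \<omega>\<bar>) \<le> B"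
      unfolding bounded_variation_upto_def by (meson zero_le_one)
    have "P n \<omega> \<le> B" for n
    proof -
      have "P n \<omega> \<le> (\<Sum>k<2 ^ n. \<bar>X (real (Suc k) / 2 ^ n) \<omega> - X (real k / 2 ^ n) \<omega>\<bar>)"
        unfolding P_def incr_def by (intro sum_mono) auto
      also have "\<dots> \<le> B" by (rule B) (auto simp: incseq_def divide_right_mono)
      finally show ?thesis .
    qed
    then show ?case by blast
  qed
  define G where "G \<omega> = (INF n. ennreal (exp (- P n \<omega>)))" for \<omega>
  have Pm[measurable]: "P n \<in> borel_measurable M" for n unfolding P_def[abs_def] by measurable
  have Gm[measurable]: "G \<in> borel_measurable M" unfolding G_def[abs_def] by measurable
  have G0: "AE \<omega> in M. G \<omega> \<noteq> 0"
    using Pb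
  proof eventually_elim
    case (elim \<omega>)
    then obtain B where B: "\<And>n. P n \<omega> \<le> B" by blast
    have "ennreal (exp (- B)) \<le> G \<omega>" unfolding G_def using B by (intro INF_greatest ennreal_leI) auto
    then show ?case by (metis exp_gt_zero ennreal_eq_0_iff le_zero_eq linorder_not_le)
  qed
  define \<kappa> where "\<kappa> = (\<integral>\<^sup>+\<omega>. G \<omega> \<partial>M)"
  have \<kappa>0: "\<kappa> \<noteq> 0"
  proof
    assume "\<kappa> = 0"
    then have "AE \<omega> in M. G \<omega> = 0" unfolding \<kappa>_def by (subst (asm) nn_integral_0_iff_AE) auto
    then have "AE \<omega> in M. False" using G0 by eventually_elim simp
    then show False by simp
  qed
  define \<delta> where "\<delta> n = (\<integral>\<omega>. 1 - exp (- max 0 (incr n 0 \<omega>)) \<partial>M)" for n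
  have ei: "integrable M (\<lambda>\<omega>. exp (- max 0 (incr n 0 \<omega>)))" for n
    by (rule integrable_const_bound[where B=1]) auto
  have \<delta>: "0 \<le> \<delta> n" "\<delta> n \<le> 1" for n
  proof -
    show "0 \<le> \<delta> n" unfolding \<delta>_def by (intro Bochner_Integration.integral_nonneg) auto
    have "\<delta> n = 1 - (\<integral>\<omega>. exp (- max 0 (incr n 0 \<omega>)) \<partial>M)"
      unfolding \<delta>_def using ei by (simp add: prob_space)
    then show "\<delta> n \<le> 1" by (simp add: Bochner_Integration.integral_nonneg)
  qed
  have a: "(\<integral>\<^sup>+\<omega>. ennreal (exp (- max 0 (incr n 0 \<omega>))) \<partial>M) = ennreal (1 - \<delta> n)" for n
    using ei[of n] by (subst nn_integral_eq_integral) (auto simp: \<delta>_def prob_space)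
  have \<kappa>le: "\<kappa> \<le> ennreal (exp (- (2 ^ n * \<delta> n)))" for n
  proof -
    have "\<kappa> \<le> (\<integral>\<^sup>+\<omega>. ennreal (exp (- P n \<omega>)) \<partial>M)" unfolding \<kappa>_def G_def by (intro nn_integral_mono INF_lower) simp
    also have "\<dots> = (\<integral>\<^sup>+\<omega>. (\<Prod>k<2 ^ n. ennreal (exp (- max 0 (incr n k \<omega>)))) \<partial>M)"
      unfolding P_def by (intro nn_integral_cong) (simp add: prod_ennreal exp_sum sum_negf[symmetric])
    also have "\<dots> = ennreal (1 - \<delta> n) ^ (2 ^ n)"
      using incr_product[of "\<lambda>z. ennreal (exp (- max 0 z))" n "2 ^ n"] a by simp
    also have "\<dots> = ennreal ((1 - \<delta> n) ^ (2 ^ n))" using \<delta>[of n] by (simp add: ennreal_power)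
    also have "\<dots> \<le> ennreal (exp (- (real (2 ^ n) * \<delta> n)))"
      by (intro ennreal_leI one_minus_power_le_exp \<delta>)
    finally show ?thesis by simp
  qed
  have "\<kappa> \<le> 1" by (rule order_trans[OF \<kappa>le[of 0]]) (use \<delta>(1)[of 0] in simp)
  then obtain r where r: "\<kappa> = ennreal r" "0 \<le> r" by (cases \<kappa>) (auto simp: top_unique)
  have r0: "0 < r" using r \<kappa>0 by (cases "r = 0") auto
  have "2 ^ n * \<delta> n \<le> - ln r" for n
  proof -
    have "r \<le> exp (- (2 ^ n * \<delta> n))" using \<kappa>le[of n] r by simp
    then have "ln r \<le> - (2 ^ n * \<delta> n)" using r0 by (subst ln_exp[symmetric], subst ln_le_cancel_iff) auto
    then show ?thesis by simp
  qed
  moreover have "0 \<le> - ln r" using r r0 \<open>\<kappa> \<le> 1\<close> by simp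
  ultimately show ?thesis using that[of "- ln r"] by (simp add: \<delta>_def)
qed

text \<open>Since X 1 is at most the sum of positive parts of dyadic increments, which are
  eventually at most \<epsilon>, its exponential moment is bounded by a product of truncated ones.
  Each factor is at most 1 + c \<delta> n with 2^n \<delta> n bounded, and Fatou's lemma passes to
  the limit.\<close>

lemma laplace_exponent_linear_bound:
  assumes bv: "bounded_variation_paths M X"
  obtains C where "0 < C" "\<And>\<theta>. 0 \<le> \<theta> \<Longrightarrow> \<psi> \<theta> \<le> C * \<theta>"
proof -
  obtain L where L: "0 \<le> L" "\<And>n. 2 ^ n * (\<integral>\<omega>. 1 - exp (- max 0 (incr n 0 \<omega>)) \<partial>M) \<le> L"
    using bounded_variation_small_increments[OF bv] by blast
  define \<delta> where "\<delta> n = (\<integral>\<omega>. 1 - exp (- max 0 (incr n 0 \<omega>)) \<partial>M)" for n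
  have ei: "integrable M (\<lambda>\<omega>. exp (- max 0 (incr n 0 \<omega>)))" for n
    by (rule integrable_const_bound[where B=1]) auto
  have \<delta>0: "0 \<le> \<delta> n" for n unfolding \<delta>_def by (intro Bochner_Integration.integral_nonneg) auto
  have main: "\<psi> \<theta> \<le> 2 * L * \<theta> * exp (\<theta> * \<epsilon>)" if \<theta>: "0 \<le> \<theta>" and \<epsilon>: "0 < \<epsilon>" "\<epsilon> \<le> 1" for \<theta> \<epsilon>
  proof -
    \<comment> \<open>Truncation at \<epsilon> makes exp(\<theta> m z) - 1 comparable to 1 -
      exp(-max 0 z), the quantity under control. The factor 2 in the comparison is that of
      \<open>half_le_one_minus_exp\<close>, which needs \<epsilon> \<le> 1.\<close>
    define m where "m z = min (max 0 z) \<epsilon>" for z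
    have m: "0 \<le> m z" "m z \<le> \<epsilon>" "m z \<le> 2 * (1 - exp (- max 0 z))" for z
    proof -
      show "0 \<le> m z" "m z \<le> \<epsilon>" using \<epsilon> by (auto simp: m_def)
      have "m z \<le> 2 * (min (max 0 z) 1 / 2)" using \<epsilon> by (auto simp: m_def)
      also have "\<dots> \<le> 2 * (1 - exp (- min (max 0 z) 1))" by (intro mult_left_mono half_le_one_minus_exp) auto
      also have "\<dots> \<le> 2 * (1 - exp (- max 0 z))" by auto
      finally show "m z \<le> 2 * (1 - exp (- max 0 z))" .
    qed
    have [measurable]: "m \<in> borel_measurable borel" unfolding m_def[abs_def] by measurable
    define c where "c = 2 * \<theta> * exp (\<theta> * \<epsilon>)"
    have c0: "0 \<le> c" using \<theta> by (simp add: c_def)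
    have em: "exp (\<theta> * m z) \<le> 1 + c * (1 - exp (- max 0 z))" for z
    proof -
      have "exp (\<theta> * m z) - exp 0 \<le> exp (\<theta> * m z) * (\<theta> * m z - 0)" by (rule exp_diff_le)
      also have "\<dots> \<le> exp (\<theta> * \<epsilon>) * (\<theta> * (2 * (1 - exp (- max 0 z))))"
        using m[of z] \<theta> by (auto intro!: mult_mono mult_left_mono simp del: exp_le_cancel_iff simp: exp_le_cancel_iff)
      also have "\<dots> = c * (1 - exp (- max 0 z))" by (simp only: c_def mult_ac)
      finally show ?thesis by simp
    qed
    have E1: "(\<integral>\<^sup>+\<omega>. ennreal (exp (\<theta> * m (incr n 0 \<omega>))) \<partial>M) \<le> ennreal (1 + c * \<delta> n)" for n
    proof -
      have "(\<integral>\<^sup>+\<omega>. ennreal (exp (\<theta> * m (incr n 0 \<omega>))) \<partial>M) \<le> (\<integral>\<^sup>+\<omega>. ennreal (1 + c * (1 - exp (- max 0 (incr n 0 \<omega>)))) \<partial>M)"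
        by (intro nn_integral_mono ennreal_leI em)
      also have "\<dots> = ennreal (\<integral>\<omega>. 1 + c * (1 - exp (- max 0 (incr n 0 \<omega>))) \<partial>M)"
        using ei[of n] c0 by (intro nn_integral_eq_integral) (auto intro!: AE_I2 add_nonneg_nonneg mult_nonneg_nonneg)
      also have "(\<integral>\<omega>. 1 + c * (1 - exp (- max 0 (incr n 0 \<omega>))) \<partial>M) = 1 + c * \<delta> n"
        unfolding \<delta>_def using ei[of n] by (simp add: prob_space)
      finally show ?thesis .
    qed
    have E2: "(\<integral>\<^sup>+\<omega>. (\<Prod>k<2 ^ n. ennreal (exp (\<theta> * m (incr n k \<omega>)))) \<partial>M) \<le> ennreal (exp (c * L))" for n
    proof -
      have "(\<integral>\<^sup>+\<omega>. (\<Prod>k<2 ^ n. ennreal (exp (\<theta> * m (incr n k \<omega>)))) \<partial>M) = (\<integral>\<^sup>+\<omega>. ennreal (exp (\<theta> * m (incr n 0 \<omega>))) \<partial>M) ^ (2 ^ n)"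
        by (rule incr_product[of "\<lambda>z. ennreal (exp (\<theta> * m z))"]) measurable
      also have "\<dots> \<le> ennreal (1 + c * \<delta> n) ^ (2 ^ n)" by (intro power_mono E1) simp
      also have "\<dots> = ennreal ((1 + c * \<delta> n) ^ (2 ^ n))" using c0 \<delta>0[of n] by (intro ennreal_power) auto
      also have "\<dots> \<le> ennreal (exp (c * \<delta> n) ^ (2 ^ n))"
        using c0 \<delta>0[of n] exp_ge_add_one_self[of "c * \<delta> n"] by (intro ennreal_leI power_mono) auto
      also have "exp (c * \<delta> n) ^ (2 ^ n) = exp (c * (2 ^ n * \<delta> n))" by (simp add: mult_ac flip: exp_of_nat_mult)
      also have "\<dots> \<le> exp (c * L)" using L(2)[of n] c0 by (auto intro!: mult_left_mono simp: \<delta>_def)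
      finally show ?thesis by (simp add: ennreal_leI)
    qed
    have "AE \<omega> in M. ennreal (exp (\<theta> * X 1 \<omega>)) \<le> liminf (\<lambda>n. \<Prod>k<2 ^ n. ennreal (exp (\<theta> * m (incr n k \<omega>))))"
      using incr_eventually_small[OF \<epsilon>(1)] AE_space
    proof eventually_elim
      case (elim \<omega>)
      show ?case
      proof (rule Liminf_bounded)
        show "\<forall>\<^sub>F n in sequentially. ennreal (exp (\<theta> * X 1 \<omega>)) \<le> (\<Prod>k<2 ^ n. ennreal (exp (\<theta> * m (incr n k \<omega>))))"
          using elim(1)
        proof eventually_elim
          case (elim n)
          have "X 1 \<omega> \<le> (\<Sum>k<2 ^ n. m (incr n k \<omega>))"
            unfolding sum_incr[OF \<open>\<omega> \<in> space M\<close>, symmetric, of n] using elim by (intro sum_mono) (auto simp: m_def)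
          then have "exp (\<theta> * X 1 \<omega>) \<le> exp (\<Sum>k<2 ^ n. \<theta> * m (incr n k \<omega>))"
            using \<theta> by (simp add: mult_left_mono flip: sum_distrib_left)
          then show ?case by (simp add: prod_ennreal exp_sum ennreal_leI)
        qed
      qed
    qed
    then have "mgf \<theta> 1 \<le> (\<integral>\<^sup>+\<omega>. liminf (\<lambda>n. \<Prod>k<2 ^ n. ennreal (exp (\<theta> * m (incr n k \<omega>)))) \<partial>M)"
      unfolding mgf_def by (rule nn_integral_mono_AE)
    also have "\<dots> \<le> liminf (\<lambda>n. \<integral>\<^sup>+\<omega>. (\<Prod>k<2 ^ n. ennreal (exp (\<theta> * m (incr n k \<omega>)))) \<partial>M)"
      by (rule nn_integral_liminf) measurable
    also have "\<dots> \<le> ennreal (exp (c * L))"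
      by (rule Liminf_le) (simp_all add: E2 always_eventually)
    finally have "exp (\<psi> \<theta>) \<le> exp (c * L)" using mgf_eq[OF \<theta>, of 1] by simp
    then show ?thesis by (simp add: c_def mult_ac)
  qed
  \<comment> \<open>Letting \<epsilon> tend to 0 removes the factor exp(\<theta> \<epsilon>), which
    would spoil linearity. The summand 1 only makes the constant positive when L = 0.\<close>
  have "\<psi> \<theta> \<le> (2 * L + 1) * \<theta>" if \<theta>: "0 \<le> \<theta>" for \<theta>
  proof -
    have "(\<lambda>n. 2 * L * \<theta> * exp (\<theta> * inverse (real (Suc n)))) \<longlonglongrightarrow> 2 * L * \<theta> * exp (\<theta> * 0)"
      by (intro tendsto_intros LIMSEQ_inverse_real_of_nat)
    then have "\<psi> \<theta> \<le> 2 * L * \<theta> * exp (\<theta> * 0)"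
      by (rule tendsto_lowerbound) (auto intro!: always_eventually main[OF \<theta>] simp: inverse_le_1_iff)
    then show ?thesis using \<theta> by (simp add: algebra_simps)
  qed
  then show ?thesis using L(1) that[of "2 * L + 1"] by simp
qed

text \<open>An Abelian argument: linear growth of \<psi> keeps the transform of W above 1 / (C
  \<theta>), whereas W \<le> \<eta> near 0 would bound it by \<eta> / \<theta> plus a term decaying
  exponentially in \<theta>. This makes the denominator of the formula nonzero when c = 0.\<close>

lemma scale_0_nonzero:
  assumes sc: "is_scale_function M X p W" and p: "0 \<le> p" and bv: "bounded_variation_paths M X"
  shows "W 0 \<noteq> 0"
proof
  assume W0: "W 0 = 0"
  obtain \<theta>0 where \<theta>0: "0 \<le> \<theta>0" "\<And>\<theta>. \<theta>0 \<le> \<theta> \<Longrightarrow> p < \<psi> \<theta>"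
    "\<And>\<theta>. \<theta>0 \<le> \<theta> \<Longrightarrow> set_integrable lborel {0..} (\<lambda>y. exp (- \<theta> * y) * W y)"
    "\<And>\<theta>. \<theta>0 \<le> \<theta> \<Longrightarrow> (LBINT y:{0..}. exp (- \<theta> * y) * W y) = 1 / (\<psi> \<theta> - p)"
    using scale_facts[OF sc] by blast
  obtain C where C: "0 < C" "\<And>\<theta>. 0 \<le> \<theta> \<Longrightarrow> \<psi> \<theta> \<le> C * \<theta>" using laplace_exponent_linear_bound[OF bv] by blast
  \<comment> \<open>Half of the lower bound 1 / C, so that the final inequality 1 / C \<le> \<eta>
    fails.\<close>
  define \<eta> where "\<eta> = 1 / (2 * C)"
  have \<eta>: "0 < \<eta>" using C by (simp add: \<eta>_def)
  have "(W \<longlongrightarrow> 0) (at_right 0)" using scale_right_continuous[OF sc order.refl] W0 by (simp add: continuous_within)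
  from tendstoD[OF this \<eta>] obtain \<delta> where \<delta>: "0 < \<delta>" "\<And>y. 0 < y \<Longrightarrow> y < \<delta> \<Longrightarrow> \<bar>W y\<bar> < \<eta>"
    by (auto simp: eventually_at_right_field dist_real_def)
  have W\<eta>: "\<bar>W y\<bar> \<le> \<eta>" if "0 \<le> y" "y < \<delta>" for y using \<delta>(2)[of y] that W0 \<eta> by (cases "y = 0") auto
  define I where "I = (LBINT y:{0..}. \<bar>exp (- \<theta>0 * y) * W y\<bar>)"
  have Ii: "set_integrable lborel {0..} (\<lambda>y. \<bar>exp (- \<theta>0 * y) * W y\<bar>)" using set_integrable_abs[OF \<theta>0(3)[OF order.refl]] .
  have bound: "1 / C \<le> \<eta> + \<theta> * exp (- (\<theta> - \<theta>0) * \<delta>) * I" if \<theta>: "\<theta>0 \<le> \<theta>" "0 < \<theta>" for \<theta>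
  proof -
    define e where "e = exp (- (\<theta> - \<theta>0) * \<delta>)"
    have \<psi>: "0 < \<psi> \<theta> - p" "\<psi> \<theta> - p \<le> C * \<theta>" using \<theta>0(2)[OF \<theta>(1)] C(2)[of \<theta>] \<theta> p by auto
    \<comment> \<open>Split at \<delta>: before it W is small, and beyond it the excess decay over
      the integrable weight at \<theta>0 is at most \<open>e\<close>.\<close>
    have pt: "\<bar>exp (- \<theta> * y) * W y\<bar> \<le> \<eta> * exp (- y * \<theta>) + e * \<bar>exp (- \<theta>0 * y) * W y\<bar>" if y: "0 \<le> y" for y
    proof (cases "y < \<delta>")
      case True
      have "\<bar>exp (- \<theta> * y) * W y\<bar> \<le> exp (- \<theta> * y) * \<eta>" unfolding abs_mult using W\<eta>[OF y True] by simp
      then show ?thesis by (simp add: mult_ac e_def add_increasing2)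
    next
      case False
      have "exp (- \<theta> * y) = exp (- (\<theta> - \<theta>0) * y) * exp (- \<theta>0 * y)" by (simp add: algebra_simps flip: exp_add)
      also have "\<dots> \<le> e * exp (- \<theta>0 * y)"
      proof -
        have "(\<theta> - \<theta>0) * \<delta> \<le> (\<theta> - \<theta>0) * y" using False \<theta> by (intro mult_left_mono) auto
        then have "- (\<theta> - \<theta>0) * y \<le> - (\<theta> - \<theta>0) * \<delta>" by (simp add: algebra_simps)
        then show ?thesis unfolding e_def by (intro mult_right_mono iffD2[OF exp_le_cancel_iff]) auto
      qed
      finally have "exp (- \<theta> * y) * \<bar>W y\<bar> \<le> e * exp (- \<theta>0 * y) * \<bar>W y\<bar>" by (rule mult_right_mono) simp
      then show ?thesis using \<eta> by (simp add: abs_mult mult_ac add_increasing)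
    qed
    have ex: "has_bochner_integral lborel (\<lambda>y. indicator {0..} y *\<^sub>R exp (- y * \<theta>)) (1 / \<theta>)"
    proof -
      have "(\<integral>\<^sup>+y. ennreal (indicator {0..} y *\<^sub>R exp (- y * \<theta>)) \<partial>lborel) = (\<integral>\<^sup>+y. ennreal (exp (- y * \<theta>)) * indicator {0..} y \<partial>lborel)"
        by (intro nn_integral_cong) (auto simp: indicator_def)
      also have "\<dots> = ennreal (0 - (- (exp (- 0 * \<theta>) / \<theta>)))"
      proof (rule nn_integral_FTC_atLeast)
        show "((\<lambda>y. - (exp (- y * \<theta>) / \<theta>)) \<longlongrightarrow> 0) at_top"
        proof -
          have "filterlim (\<lambda>y::real. - y * \<theta>) at_bot at_top"
          proof (subst filterlim_uminus_at_bot)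
            have "filterlim (\<lambda>y::real. \<theta> * y) at_top at_top"
              using \<theta>(2) by (intro filterlim_tendsto_pos_mult_at_top[OF tendsto_const] filterlim_ident)
            then show "filterlim (\<lambda>y::real. - (- y * \<theta>)) at_top at_top" by (simp add: mult.commute)
          qed
          then have "((\<lambda>y. exp (- y * \<theta>)) \<longlongrightarrow> 0) at_top" by (rule filterlim_compose[OF exp_at_bot])
          then have "((\<lambda>y. - (exp (- y * \<theta>) / \<theta>)) \<longlongrightarrow> - (0 / \<theta>)) at_top" using \<theta>(2) by (intro tendsto_intros) auto
          then show ?thesis by simp
        qed
      qed (use \<theta>(2) in \<open>auto intro!: derivative_eq_intros\<close>)
      finally show ?thesis using \<theta> by (intro has_bochner_integral_nn_integral) auto
    qed
    have exi: "integrable lborel (\<lambda>y. indicator {0..} y *\<^sub>R exp (- y * \<theta>))" and exv: "(LBINT y. indicator {0..} y *\<^sub>R exp (- y * \<theta>)) = 1 / \<theta>"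
      using ex by (simp_all add: has_bochner_integral_iff)
    have "1 / (C * \<theta>) \<le> 1 / (\<psi> \<theta> - p)" using \<psi> C \<theta> by (intro divide_left_mono) auto
    also have "\<dots> = (LBINT y:{0..}. exp (- \<theta> * y) * W y)" using \<theta>0(4)[OF \<theta>(1)] by simp
    also have "\<dots> \<le> (LBINT y. \<eta> * (indicator {0..} y *\<^sub>R exp (- y * \<theta>)) + e * (indicator {0..} y *\<^sub>R \<bar>exp (- \<theta>0 * y) * W y\<bar>))"
      unfolding set_lebesgue_integral_def
    proof (rule integral_mono)
      show "integrable lborel (\<lambda>y. indicator {0..} y *\<^sub>R (exp (- \<theta> * y) * W y))" using \<theta>0(3)[OF \<theta>(1)] by (simp only: set_integrable_def)
      show "integrable lborel (\<lambda>y. \<eta> * (indicator {0..} y *\<^sub>R exp (- y * \<theta>)) + e * (indicator {0..} y *\<^sub>R \<bar>exp (- \<theta>0 * y) * W y\<bar>))"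
        using exi Ii[unfolded set_integrable_def] by (intro Bochner_Integration.integrable_add integrable_mult_right) auto
      show "indicator {0..} y *\<^sub>R (exp (- \<theta> * y) * W y) \<le> \<eta> * (indicator {0..} y *\<^sub>R exp (- y * \<theta>)) + e * (indicator {0..} y *\<^sub>R \<bar>exp (- \<theta>0 * y) * W y\<bar>)" for y
        using order_trans[OF abs_ge_self pt[of y]] by (cases "0 \<le> y") auto
    qed
    also have "\<dots> = \<eta> * (1 / \<theta>) + e * I"
      unfolding I_def set_lebesgue_integral_def exv[symmetric]
      using exi Ii[unfolded set_integrable_def] by (subst Bochner_Integration.integral_add) (auto simp del: mult_scaleR_right)
    finally have "\<theta> * (1 / (C * \<theta>)) \<le> \<theta> * (\<eta> * (1 / \<theta>) + e * I)" using \<theta> by (intro mult_left_mono) auto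
    moreover have "\<theta> * (1 / (C * \<theta>)) = 1 / C" using \<theta> C by simp
    moreover have "\<theta> * (\<eta> * (1 / \<theta>) + e * I) = \<eta> + \<theta> * e * I" using \<theta> by (simp add: distrib_left)
    ultimately show ?thesis unfolding e_def by linarith
  qed
  have "((\<lambda>\<theta>. \<eta> + \<theta> * exp (- (\<theta> - \<theta>0) * \<delta>) * I) \<longlongrightarrow> \<eta> + 0 * I) at_top"
  proof (intro tendsto_intros)
    have "((\<lambda>\<theta>. (\<theta> * \<delta>) / exp (\<theta> * \<delta>)) \<longlongrightarrow> 0) at_top"
    proof (rule filterlim_compose[where g="\<lambda>x::real. x / exp x"])
      show "((\<lambda>x::real. x / exp x) \<longlongrightarrow> 0) at_top" using tendsto_power_div_exp_0[of 1] by simp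
      show "filterlim (\<lambda>\<theta>. \<theta> * \<delta>) at_top at_top"
        using filterlim_tendsto_pos_mult_at_top[OF tendsto_const \<delta>(1) filterlim_ident] by (simp add: mult.commute)
    qed
    then have "((\<lambda>\<theta>. ((\<theta> * \<delta>) / exp (\<theta> * \<delta>)) * (exp (\<theta>0 * \<delta>) / \<delta>)) \<longlongrightarrow> 0 * (exp (\<theta>0 * \<delta>) / \<delta>)) at_top"
      by (intro tendsto_intros)
    moreover have "((\<theta> * \<delta>) / exp (\<theta> * \<delta>)) * (exp (\<theta>0 * \<delta>) / \<delta>) = \<theta> * exp (- (\<theta> - \<theta>0) * \<delta>)" for \<theta>
    proof -
      have "exp (- (\<theta> - \<theta>0) * \<delta>) = exp (\<theta>0 * \<delta>) / exp (\<theta> * \<delta>)" by (simp add: algebra_simps flip: exp_diff)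
      then show ?thesis using \<delta>(1) by simp
    qed
    ultimately show "((\<lambda>\<theta>. \<theta> * exp (- (\<theta> - \<theta>0) * \<delta>)) \<longlongrightarrow> 0) at_top" by simp
  qed
  then have "1 / C \<le> \<eta> + 0 * I"
  proof (rule tendsto_lowerbound)
    show "\<forall>\<^sub>F \<theta> in at_top. 1 / C \<le> \<eta> + \<theta> * exp (- (\<theta> - \<theta>0) * \<delta>) * I"
      using eventually_ge_at_top[of "max \<theta>0 1"] by eventually_elim (rule bound, auto)
  qed simp
  then show False using C by (simp add: \<eta>_def field_simps)
qed

end

section \<open>Volterra equations for scale functions\<close>

lemma conv_commute: "conv f g x = conv g f x"
  unfolding conv_def
  by (subst lborel_integral_real_affine[of "-1" "\<lambda>y. f (x - y) * g y" x]) (simp_all add: mult.commute)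

lemma conv_cong_AE:
  assumes "causal f" "causal g" "causal h" "AE y in lborel. y \<le> x \<longrightarrow> g y = h y"
  shows "conv f g x = conv f h x"
  unfolding conv_def
proof (rule integral_cong_AE)
  show "AE y in lborel. f (x - y) * g y = f (x - y) * h y"
    using assms(4) by eventually_elim (use causal_neg[OF assms(1)] in \<open>force simp: not_le\<close>)
qed (use assms(1-3)[THEN causal_measurable, measurable] in measurable)

lemma conv_0:
  assumes "causal f" "causal g" shows "conv f g 0 = 0"
  unfolding conv_def
proof (rule integral_eq_zero_AE)
  show "AE y in lborel. f (0 - y) * g y = 0"
    using AE_lborel_singleton[of 0]
  proof eventually_elim
    case (elim y)
    then show ?case using causal_neg[OF assms(1), of "- y"] causal_neg[OF assms(2), of y] by (cases "y < 0") auto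
  qed
qed

text \<open>Here \<open>D\<close> is the function \<open>\<W>\<^sub>a\<close> of the paper and \<open>H\<close> the numerator of the formula.\<close>

lemma two_sided_scale_equation:
  assumes W: "causal W" and R: "causal R" and RW: "\<And>x. R x = W x + q * conv W R x" and ab: "0 \<le> a" "a \<le> b"
    and D: "\<And>x. D x = R x - q * conv R (\<lambda>y. indicator {0..a} y * W y) x"
    and H: "\<And>x. H x = D x - q * conv W (\<lambda>y. indicator {b..} y * D y) x"
  shows "causal H" and "H x = W x + q * conv W (\<lambda>y. indicator {a<..<b} y * H y) x"
proof -
  define Wa where "Wa y = indicator {0..a} y * W y" for y
  have Wac: "causal Wa" unfolding Wa_def by (rule causal_indicator[OF W]) simp
  have D': "D x = R x - q * conv R Wa x" for x using D[of x] by (simp add: Wa_def[abs_def])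
  have D'': "D = (\<lambda>x. R x - q * conv R Wa x)" by (rule ext) (rule D')
  have Dc: "causal D" unfolding D'' by (intro causal_diff causal_cmult causal_conv R Wac)
  define Db where "Db y = indicator {b..} y * D y" for y
  have Dbc: "causal Db" unfolding Db_def by (rule causal_indicator[OF Dc]) simp
  have H': "H = (\<lambda>x. D x - q * conv W Db x)" by (rule ext) (simp add: H Db_def[abs_def])
  show Hc: "causal H" unfolding H' by (intro causal_diff causal_cmult causal_conv W Dbc Dc)
  have qWR: "(\<lambda>x. q * conv W R x) = (\<lambda>x. R x - W x)" by (rule ext) (simp add: RW)
  \<comment> \<open>Convolving W with D produces W * R twice, once alone and once against
    \<open>Wa\<close>. The resolvent identity replaces q W * R by R - W in both places and
    eliminates R in favour of D.\<close>
  have cWD: "q * conv W D x = D x - W x + q * conv W Wa x" for x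
  proof -
    have "q * conv W D x = q * (conv W R x - conv W (\<lambda>x. q * conv R Wa x) x)"
      unfolding D'' by (subst conv_diff_right) (auto intro: R W Wac causal_cmult causal_conv)
    also have "conv W (\<lambda>x. q * conv R Wa x) x = conv (\<lambda>x. q * conv W R x) Wa x"
      by (simp add: conv_cmult_right conv_cmult_left conv_assoc[OF W R Wac])
    also have "\<dots> = conv R Wa x - conv W Wa x" unfolding qWR by (rule conv_diff_left[OF R W Wac])
    also have "q * (conv W R x - (conv R Wa x - conv W Wa x)) = (R x - W x) - q * conv R Wa x + q * conv W Wa x"
      using RW[of x] by (simp add: algebra_simps)
    finally show ?thesis using D'[of x] by linarith
  qed
  \<comment> \<open>Up to a the cut-off in \<open>Wa\<close> is invisible to the convolution, and
    the resolvent identity collapses the expression to W. So subtracting \<open>Wa\<close> from D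
    leaves precisely the part of D beyond a.\<close>
  have Da: "D x = W x" if "x \<le> a" for x
  proof -
    have "conv R Wa x = conv R W x"
      by (rule conv_cong_AE[OF R Wac W]) (use that causal_neg[OF W] in \<open>auto simp: Wa_def indicator_def\<close>)
    then show ?thesis using RW[of x] by (simp add: D' conv_commute[of R W])
  qed
  have DWa: "D y - Wa y = indicator {a<..} y * D y" for y
    using Da[of y] causal_neg[OF W, of y] by (auto simp: Wa_def indicator_def not_le)
  have D1: "D x = W x + q * conv W (\<lambda>y. indicator {a<..} y * D y) x" for x
  proof -
    have E: "conv W (\<lambda>y. indicator {a<..} y * D y) x = conv W D x - conv W Wa x"
      using conv_diff_right[OF Dc Wac W, of x] unfolding DWa .
    show ?thesis unfolding E using cWD[of x] by (simp add: right_diff_distrib)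
  qed
  have Dac: "causal (\<lambda>y. indicator {a<..} y * D y)" by (rule causal_indicator[OF Dc]) simp
  \<comment> \<open>The correction term of H looks only at arguments from b on. Hence removing the
    part of D beyond b from the part beyond a leaves H on (a,b), apart from the null set
    {b}.\<close>
  have Hb: "H y = D y" if "y < b" for y
  proof -
    have "conv W Db y = conv W (\<lambda>_. 0) y"
      by (rule conv_cong_AE[OF W Dbc]) (use that in \<open>auto simp: Db_def causal_def\<close>)
    then show ?thesis by (simp add: H' conv_def)
  qed
  have "H x = W x + q * (conv W (\<lambda>y. indicator {a<..} y * D y) x - conv W Db x)"
    unfolding H' using D1[of x] by (simp add: algebra_simps)
  also have "conv W (\<lambda>y. indicator {a<..} y * D y) x - conv W Db x = conv W (\<lambda>y. indicator {a<..} y * D y - Db y) x"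
    by (rule conv_diff_right[OF Dac Dbc W, symmetric])
  also have "\<dots> = conv W (\<lambda>y. indicator {a<..<b} y * H y) x"
  proof (rule conv_cong_AE[OF W causal_diff[OF Dac Dbc] causal_indicator[OF Hc]])
    show "AE y in lborel. y \<le> x \<longrightarrow> indicator {a<..} y * D y - Db y = indicator {a<..<b} y * H y"
      using AE_lborel_singleton[of b] by eventually_elim (use ab Hb in \<open>auto simp: Db_def indicator_def\<close>)
  qed simp
  finally show "H x = W x + q * conv W (\<lambda>y. indicator {a<..<b} y * H y) x" .
qed

text \<open>The difference u - K H satisfies the homogeneous equation on [0,d]; bounding W there by
  a constant C turns it into the inequality of \<open>volterra_zero\<close>. The constant K need not
  be known.\<close>

lemma volterra_unique:
  assumes W: "causal W" and u: "causal u" and H: "causal H" and A: "A \<in> sets borel"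
    and ue: "\<And>x. 0 \<le> x \<Longrightarrow> x \<le> d \<Longrightarrow> u x = K * W x + q * conv W (\<lambda>y. indicator A y * u y) x"
    and He: "\<And>x. H x = W x + q * conv W (\<lambda>y. indicator A y * H y) x"
    and x: "0 \<le> x" "x \<le> d"
  shows "u x = K * H x"
proof -
  define D where "D x = u x - K * H x" for x
  have Dc: "causal D" unfolding D_def by (intro causal_diff causal_cmult u H)
  note [measurable] = causal_measurable[OF Dc] causal_measurable[OF W] A
  have DAc: "causal (\<lambda>y. indicator A y * D y)" by (rule causal_indicator[OF Dc A])
  have De: "D x = q * conv W (\<lambda>y. indicator A y * D y) x" if "0 \<le> x" "x \<le> d" for x
  proof -
    have "conv W (\<lambda>y. indicator A y * D y) x = conv W (\<lambda>y. indicator A y * u y - K * (indicator A y * H y)) x"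
      by (simp add: D_def algebra_simps)
    also have "\<dots> = conv W (\<lambda>y. indicator A y * u y) x - K * conv W (\<lambda>y. indicator A y * H y) x"
      by (subst conv_diff_right) (auto intro!: causal_cmult causal_indicator[OF _ A] u H W simp: conv_cmult_right[of W K])
    finally have E: "q * conv W (\<lambda>y. indicator A y * D y) x =
      q * conv W (\<lambda>y. indicator A y * u y) x - K * (q * conv W (\<lambda>y. indicator A y * H y) x)"
      by (simp only: right_diff_distrib mult.left_commute)
    have "K * H x = K * W x + K * (q * conv W (\<lambda>y. indicator A y * H y) x)" by (subst He) (rule distrib_left)
    then show ?thesis unfolding E using ue[OF that] by (simp only: D_def)
  qed
  obtain C where C: "0 < C" "\<And>y. y \<le> d \<Longrightarrow> \<bar>W y\<bar> \<le> C" using causal_bound[OF W] by blast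
  obtain B where B: "0 < B" "\<And>y. y \<le> d \<Longrightarrow> \<bar>D y\<bar> \<le> B" using causal_bound[OF Dc] by blast
  have "D x = 0"
  proof (rule volterra_zero[of D d B "\<bar>q\<bar> * C" x])
    fix x assume x: "x \<in> {0..d}"
    have Di: "set_integrable lborel {0..x} (\<lambda>y. \<bar>D y\<bar>)"
      by (rule set_integrable_Icc_bounded[where B=B]) (use B(2) x in auto)
    have "\<bar>conv W (\<lambda>y. indicator A y * D y) x\<bar> \<le> (LBINT y. C * (indicator {0..x} y *\<^sub>R \<bar>D y\<bar>))"
      unfolding conv_def real_norm_def[symmetric, of "integral\<^sup>L _ _"]
    proof (rule Bochner_Integration.integral_norm_bound_integral[OF conv_integrable[OF W DAc]])
      show "integrable lborel (\<lambda>y. C * (indicator {0..x} y *\<^sub>R \<bar>D y\<bar>))"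
        using Di unfolding set_integrable_def by (rule integrable_mult_right)
      fix y
      show "norm (W (x - y) * (indicator A y * D y)) \<le> C * (indicator {0..x} y *\<^sub>R \<bar>D y\<bar>)"
      proof (cases "y \<in> {0..x}")
        case True
        then have "\<bar>W (x - y)\<bar> * \<bar>indicator A y * D y\<bar> \<le> C * \<bar>D y\<bar>"
          using C x by (intro mult_mono) (auto simp: indicator_def)
        then show ?thesis using True by (simp add: abs_mult)
      next
        case False
        then have "W (x - y) * (indicator A y * D y) = 0" using causal_neg[OF W, of "x - y"] causal_neg[OF Dc, of y] by auto
        then show ?thesis using False by (simp only: norm_zero) simp
      qed
    qed
    then have "\<bar>q\<bar> * \<bar>conv W (\<lambda>y. indicator A y * D y) x\<bar> \<le> \<bar>q\<bar> * (LBINT y. C * (indicator {0..x} y *\<^sub>R \<bar>D y\<bar>))"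
      by (rule mult_left_mono) simp
    then show "\<bar>D x\<bar> \<le> \<bar>q\<bar> * C * (LBINT y:{0..x}. \<bar>D y\<bar>)"
      using De[of x] x by (simp add: abs_mult set_lebesgue_integral_def mult.assoc)
  qed (use B C x in auto)
  then show ?thesis by (simp add: D_def)
qed

context snlp begin

text \<open>In Laplace transforms this is the partial fraction identity 1/B = 1/A + (A - B)/(A B)
  with A = \<psi>(\<theta>) - p and B = \<psi>(\<theta>) - (p + q). Right-continuity makes it hold
  pointwise.\<close>

lemma scale_resolvent_identity:
  assumes W: "is_scale_function M X p W" and R: "is_scale_function M X (p + q) R" and q: "0 \<le> q"
  shows "R x = W x + q * conv W R x"
proof (cases "0 \<le> x")
  case True
  obtain \<theta>1 where \<theta>1: "0 \<le> \<theta>1" "\<And>\<theta>. \<theta>1 \<le> \<theta> \<Longrightarrow> p < \<psi> \<theta>"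
    "\<And>\<theta>. \<theta>1 \<le> \<theta> \<Longrightarrow> set_integrable lborel {0..} (\<lambda>y. exp (- \<theta> * y) * W y)"
    "\<And>\<theta>. \<theta>1 \<le> \<theta> \<Longrightarrow> (LBINT y:{0..}. exp (- \<theta> * y) * W y) = 1 / (\<psi> \<theta> - p)"
    using scale_facts[OF W] by blast
  obtain \<theta>2 where \<theta>2: "0 \<le> \<theta>2" "\<And>\<theta>. \<theta>2 \<le> \<theta> \<Longrightarrow> p + q < \<psi> \<theta>"
    "\<And>\<theta>. \<theta>2 \<le> \<theta> \<Longrightarrow> set_integrable lborel {0..} (\<lambda>y. exp (- \<theta> * y) * R y)"
    "\<And>\<theta>. \<theta>2 \<le> \<theta> \<Longrightarrow> (LBINT y:{0..}. exp (- \<theta> * y) * R y) = 1 / (\<psi> \<theta> - (p + q))"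
    using scale_facts[OF R] by blast
  note Wc = scale_causal[OF W] and Rc = scale_causal[OF R]
  define k where "k x = R x - (W x + q * conv W R x)" for x
  have eq: "exp (- \<theta> * x) * k x = exp (- \<theta> * x) * R x - (exp (- \<theta> * x) * W x + q * (exp (- \<theta> * x) * conv W R x))" for \<theta> x
    by (simp add: k_def algebra_simps)
  have L: "set_integrable lborel {0..} (\<lambda>x. exp (- \<theta> * x) * k x) \<and> (LBINT x:{0..}. exp (- \<theta> * x) * k x) = 0"
    if \<theta>: "max \<theta>1 \<theta>2 \<le> \<theta>" for \<theta>
  proof -
    have t: "\<theta>1 \<le> \<theta>" "\<theta>2 \<le> \<theta>" using \<theta> by auto
    note cl = conv_laplace[OF Wc Rc \<theta>1(3)[OF t(1)] \<theta>2(3)[OF t(2)]]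
    have qi: "set_integrable lborel {0..} (\<lambda>x. q * (exp (- \<theta> * x) * conv W R x))" using cl(1) by simp
    have i: "set_integrable lborel {0..} (\<lambda>x. exp (- \<theta> * x) * k x)"
      unfolding eq by (intro set_integral_diff set_integral_add \<theta>1(3)[OF t(1)] \<theta>2(3)[OF t(2)] qi)
    have "(LBINT x:{0..}. exp (- \<theta> * x) * k x) = 1 / (\<psi> \<theta> - (p + q)) - (1 / (\<psi> \<theta> - p) + q * (1 / (\<psi> \<theta> - p) * (1 / (\<psi> \<theta> - (p + q)))))"
      unfolding eq set_integral_diff(2)[OF \<theta>2(3)[OF t(2)] set_integral_add(1)[OF \<theta>1(3)[OF t(1)] qi]]
        set_integral_add(2)[OF \<theta>1(3)[OF t(1)] qi] set_integral_mult_right cl(2) \<theta>1(4)[OF t(1)] \<theta>2(4)[OF t(2)] ..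
    also have "\<dots> = 0"
    proof -
      have *: "1 / B - (1 / A + (A - B) * (1 / A * (1 / B))) = 0" if "A \<noteq> 0" "B \<noteq> 0" for A B :: real
        using that by (simp add: field_simps)
      have "(\<psi> \<theta> - p) - (\<psi> \<theta> - (p + q)) = q" by simp
      note s = *[of "\<psi> \<theta> - p" "\<psi> \<theta> - (p + q)", unfolded this]
      show ?thesis by (rule s) (use \<theta>1(2)[OF t(1)] \<theta>2(2)[OF t(2)] in auto)
    qed
    finally show ?thesis using i by simp
  qed
  have "k x = 0"
  proof (rule laplace_transform_eq_0[of "max \<theta>1 \<theta>2" k])
    show "continuous (at_right x) k" if "0 \<le> x" for x unfolding k_def
      by (intro continuous_diff continuous_add continuous_mult continuous_const conv_right_continuous Wc Rc scale_continuous[OF W]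
          scale_right_continuous[OF W] scale_right_continuous[OF R] that)
  qed (use L True in auto)
  then show ?thesis by (simp add: k_def)
next
  case False
  then show ?thesis using causal_neg[OF scale_causal[OF W]] causal_neg[OF scale_causal[OF R]]
      causal_neg[OF causal_conv[OF scale_causal[OF W] scale_causal[OF R]]] by simp
qed

text \<open>Two facts about one resolvent u are combined: u = K H near [0,c] by uniqueness for the
  Volterra equation, and u(x) = g(x) u(c) by the strong Markov property, with g(x) the expectation
  sought. Dividing removes K.\<close>

lemma passage_identity:
  assumes W: "is_scale_function M X p W" and R: "is_scale_function M X (p + q) R"
    and ab: "0 \<le> a" "a \<le> b" "b \<le> c" and c: "\<not> bounded_variation_paths M X \<Longrightarrow> 0 < c"
    and p: "0 \<le> p" and q: "0 \<le> q" and x: "0 \<le> x" "x \<le> c"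
    and D: "\<And>x. D x = R x - q * conv R (\<lambda>y. indicator {0..a} y * W y) x"
    and H: "\<And>x. H x = D x - q * conv W (\<lambda>y. indicator {b..} y * D y) x"
  shows "(\<integral>\<omega>. passage_functional p q {a<..<b} x (c - x) \<omega> \<partial>M) = H x / H c"
proof -
  let ?A = "{a<..<b}"
  \<comment> \<open>\<open>res_pos\<close> needs a positive level. For c = 0 the support of f is
    placed above 1 instead; it is still out of reach before the passage above c, and positivity at 1
    still yields K \<noteq> 0.\<close>
  define c' where "c' = (if 0 < c then c else 1)"
  have c': "0 < c'" "c \<le> c'" using ab by (auto simp: c'_def)
  note Wc = scale_causal[OF W] and Rc = scale_causal[OF R]
  have Hc: "causal H"
    by (rule two_sided_scale_equation(1)[OF Wc Rc scale_resolvent_identity[OF W R q] ab(1,2) D H])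
  have He: "H x = W x + q * conv W (\<lambda>y. indicator ?A y * H y) x" for x
    by (rule two_sided_scale_equation(2)[OF Wc Rc scale_resolvent_identity[OF W R q] ab(1,2) D H])
  define f where "f = (indicator {c'<..<c'+1} :: real \<Rightarrow> real)"
  have fe: "(\<lambda>y. ennreal (f y)) = indicator {c'<..<c'+1}" by (auto simp: f_def indicator_def)
  have fm[measurable]: "f \<in> borel_measurable borel" unfolding f_def by simp
  have fc: "causal f" unfolding causal_def
  proof (intro conjI allI impI fm)
    show "f x = 0" if "x < 0" for x using that c' by (simp add: f_def)
    show "\<exists>B. \<forall>x\<le>d. \<bar>f x\<bar> \<le> B" for d by (intro exI[of _ 1]) (simp add: f_def indicator_def)
  qed
  let ?u = "\<lambda>x. enn2real (res p q ?A (\<lambda>y. ennreal (f y)) x)"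
  obtain K where K: "\<And>x. res p q ?A (\<lambda>y. ennreal (f y)) x = ennreal (?u x)" "\<And>x. x < 0 \<Longrightarrow> ?u x = 0" "causal ?u"
    "\<And>x. 0 \<le> x \<Longrightarrow> ?u x = K * W x - conv W f x + q * conv W (\<lambda>y. indicator ?A y * ?u y) x"
    "continuous_on {0..} ?u"
    by (rule res_equation[OF W p q _ _ fm, of ?A "c' + 1" 1]) (use ab c' in \<open>auto simp: f_def indicator_def\<close>)
  define u where "u = ?u"
  have u: "\<And>x. res p q ?A (\<lambda>y. ennreal (f y)) x = ennreal (u x)" "causal u" "continuous_on {0..} u" "\<And>x. 0 \<le> u x"
    using K by (simp_all add: u_def)
  have ue: "u x = K * W x + q * conv W (\<lambda>y. indicator ?A y * u y) x" if "0 \<le> x" "x \<le> c'" for x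
  proof -
    \<comment> \<open>The convolution at x sees f on arguments up to x only, where it vanishes. This
      makes the equation homogeneous apart from the multiple of W.\<close>
    have "conv W f x = conv W (\<lambda>_. 0) x"
      by (rule conv_cong_AE[OF Wc fc]) (use that in \<open>auto simp: f_def causal_def indicator_def\<close>)
    then have "conv W f x = 0" by (simp add: conv_def)
    then show ?thesis using K(4)[OF that(1)] by (simp add: u_def)
  qed
  have uH: "u x = K * H x" if "0 \<le> x" "x \<le> c'" for x
    by (rule volterra_unique[OF Wc u(2) Hc _ ue He that]) simp_all
  have uc': "u c' \<noteq> 0"
  proof
    assume "u c' = 0"
    then have "res p q ?A (indicator {c'<..<c'+1}) c' = 0" using u(1)[of c'] by (simp add: fe)
    then show False using res_pos[OF c'(1), of ?A p q] by simp
  qed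
  then have K0: "K \<noteq> 0" using uH[of c'] c' by auto
  have uc: "u c \<noteq> 0"
  proof (cases "0 < c")
    case True
    then show ?thesis using uc' by (simp add: c'_def)
  next
    case False
    then have c0: "c = 0" and bv: "bounded_variation_paths M X" using ab c by auto
    \<comment> \<open>At 0 the convolution term drops out, so u(0) \<noteq> 0 reduces to W 0
      \<noteq> 0, which bounded variation provides.\<close>
    have "u 0 = K * W 0"
      using ue[of 0] c' conv_0[OF Wc causal_indicator[OF u(2), of ?A]] by simp
    then show ?thesis using K0 scale_0_nonzero[OF W p bv] c0 by simp
  qed
  have c0: "0 \<le> c" using ab by simp
  obtain B where B: "0 < B" "\<And>y. y \<le> c + 1 \<Longrightarrow> \<bar>u y\<bar> \<le> B" using causal_bound[OF u(2)] by blast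
  let ?G = "passage_functional p q ?A x (c - x)"
  have "res p q ?A (\<lambda>y. ennreal (f y)) x = (\<integral>\<^sup>+\<omega>. ennreal (?G \<omega>) \<partial>M) * res p q ?A (\<lambda>y. ennreal (f y)) c"
  proof (rule res_strong_markov[OF p q _ x _ _ u(1) u(4) _ u(3), of B])
    show "u y \<le> B" if "y \<le> c + 1" for y using B(2)[OF that] by simp
    show "ennreal (f y) = 0" if "y \<le> c" for y using that c' by (simp add: f_def)
  qed auto
  moreover have Gn: "0 \<le> ?G \<omega>" "?G \<omega> \<le> 1" for \<omega>
  proof -
    have "0 \<le> p * T (c - x) \<omega>" "0 \<le> q * occ ?A x (path \<omega>) (T (c - x) \<omega>)" using p q occ_nonneg by auto
    then have "- p * T (c - x) \<omega> - q * occ ?A x (path \<omega>) (T (c - x) \<omega>) \<le> 0" by simp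
    then show "0 \<le> ?G \<omega>" "?G \<omega> \<le> 1" by (auto simp: passage_functional_def)
  qed
  have Gi: "integrable M ?G" by (rule integrable_const_bound[where B=1]) (use Gn in auto)
  have "(\<integral>\<^sup>+\<omega>. ennreal (?G \<omega>) \<partial>M) = ennreal (\<integral>\<omega>. ?G \<omega> \<partial>M)"
    by (rule nn_integral_eq_integral[OF Gi]) (use Gn in auto)
  ultimately have "ennreal (u x) = ennreal ((\<integral>\<omega>. ?G \<omega> \<partial>M) * u c)"
    using Gn by (simp add: u(1) ennreal_mult' Bochner_Integration.integral_nonneg)
  then have "u x = (\<integral>\<omega>. ?G \<omega> \<partial>M) * u c"
    using u(4) Gn by (simp add: Bochner_Integration.integral_nonneg)
  then have "(\<integral>\<omega>. ?G \<omega> \<partial>M) = u x / u c" using uc by simp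
  also have "\<dots> = H x / H c" using uH[of x] uH[of c] x c0 c' K0 by simp
  finally show ?thesis .
qed

end

section \<open>The two-sided exit identity\<close>

context snlp begin

text \<open>The starting point \<open>z\<close> will be the random variable \<open>x + X 0\<close>, since the given process starts at
  \<open>0\<close> only almost surely.\<close>

definition exit_functional :: "real \<Rightarrow> real \<Rightarrow> real set \<Rightarrow> real \<Rightarrow> real \<Rightarrow> 'a \<Rightarrow> real" where
  "exit_functional p q A z y \<omega> = of_bool (\<tau> y \<omega> < passage_below 0 (\<lambda>t. z + X t \<omega>)) *
     exp (- p * T y \<omega> - q * occ A z (path \<omega>) (T y \<omega>))"

text \<open>A countable description that tests positive times only: passage below ignores time 0,
  and the starting point z may be negative here, so \<open>alive\<close> does not apply.\<close>

lemma less_passage_below_iff: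
  assumes \<omega>: "\<omega> \<in> space M"
  shows "\<tau> y \<omega> < passage_below 0 (\<lambda>t. z + X t \<omega>) \<longleftrightarrow>
    \<tau> y \<omega> < \<infinity> \<and> (\<exists>n. \<forall>i::rat. 0 < real_of_rat i \<longrightarrow> real_of_rat i < gridT n y \<omega> \<longrightarrow> 0 \<le> z + path \<omega> (real_of_rat i))"
proof
  assume l: "\<tau> y \<omega> < passage_below 0 (\<lambda>t. z + X t \<omega>)"
  then have fin: "\<tau> y \<omega> < \<infinity>" by (rule order.strict_trans2) simp
  obtain s where s: "\<tau> y \<omega> < ereal s" "ereal s < passage_below 0 (\<lambda>t. z + X t \<omega>)" using ereal_dense2[OF l] by blast
  then have "T y \<omega> < s" using \<tau>_finite[OF fin] by (metis less_ereal.simps(1))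
  then have "\<forall>\<^sub>F n in sequentially. gridT n y \<omega> < s" by (rule order_tendstoD(2)[OF gridT_tendsto])
  then obtain n where n: "gridT n y \<omega> < s" by (auto simp: eventually_sequentially)
  have "0 \<le> z + path \<omega> r" if r: "0 < r" "r < gridT n y \<omega>" for r
  proof (rule ccontr)
    assume "\<not> 0 \<le> z + path \<omega> r"
    then have "passage_below 0 (\<lambda>t. z + X t \<omega>) \<le> ereal r"
      unfolding passage_below_def using r by (intro Inf_lower) auto
    also have "\<dots> < ereal s" using r n by simp
    finally show False using s(2) by simp
  qed
  then show "\<tau> y \<omega> < \<infinity> \<and> (\<exists>n. \<forall>i::rat. 0 < real_of_rat i \<longrightarrow> real_of_rat i < gridT n y \<omega> \<longrightarrow> 0 \<le> z + path \<omega> (real_of_rat i))"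
    using fin by blast
next
  assume "\<tau> y \<omega> < \<infinity> \<and> (\<exists>n. \<forall>i::rat. 0 < real_of_rat i \<longrightarrow> real_of_rat i < gridT n y \<omega> \<longrightarrow> 0 \<le> z + path \<omega> (real_of_rat i))"
  then obtain n where fin: "\<tau> y \<omega> < \<infinity>"
    and al: "\<And>i::rat. 0 < real_of_rat i \<Longrightarrow> real_of_rat i < gridT n y \<omega> \<Longrightarrow> 0 \<le> z + path \<omega> (real_of_rat i)" by blast
  have "ereal (gridT n y \<omega>) \<le> passage_below 0 (\<lambda>t. z + X t \<omega>)"
    unfolding passage_below_def
  proof (rule Inf_greatest, clarsimp)
    fix t assume t: "0 < t" "z + X t \<omega> < 0"
    show "gridT n y \<omega> \<le> t"
    proof (rule ccontr)
      assume "\<not> gridT n y \<omega> \<le> t"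
      then obtain r where r: "r \<in> \<rat>" "t < r" "r < gridT n y \<omega>" "X r \<omega> < - z"
        using ex_rat_right_less[OF \<omega>, of t "gridT n y \<omega>" "- z"] t by auto
      then obtain i :: rat where i: "r = real_of_rat i" by (auto simp: Rats_def)
      show False using al[of i] r t(1) by (auto simp flip: i)
    qed
  qed
  moreover have "\<tau> y \<omega> < ereal (gridT n y \<omega>)" using \<tau>_finite[OF fin] gridT_bounds(1)[of y \<omega> n] by (metis less_ereal.simps(1))
  ultimately show "\<tau> y \<omega> < passage_below 0 (\<lambda>t. z + X t \<omega>)" by (rule order.strict_trans2[rotated])
qed

text \<open>Both the starting point and the level have to be allowed to be random, since both
  involve the initial value of the given process.\<close>

lemma exit_functional_measurable:
  assumes [measurable]: "A \<in> sets borel" "g \<in> borel_measurable M" "h \<in> borel_measurable M"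
  shows "(\<lambda>\<omega>. exit_functional p q A (g \<omega>) (h \<omega>) \<omega>) \<in> borel_measurable M"
proof -
  have [measurable]: "(\<lambda>\<omega>. path \<omega> r) \<in> borel_measurable M" for r
    by (rule measurable_compose[OF path_measurable measurable_component_singleton]) simp
  have [measurable]: "(\<lambda>\<omega>. gridT n (h \<omega>) \<omega>) \<in> borel_measurable M" for n
    unfolding cell_def grid_def by measurable
  have m: "(\<lambda>\<omega>. of_bool (\<tau> (h \<omega>) \<omega> < \<infinity> \<and> (\<exists>n. \<forall>i::rat. 0 < real_of_rat i \<longrightarrow> real_of_rat i < gridT n (h \<omega>) \<omega> \<longrightarrow> 0 \<le> g \<omega> + path \<omega> (real_of_rat i))) *
     exp (- p * T (h \<omega>) \<omega> - q * occ A (g \<omega>) (path \<omega>) (T (h \<omega>) \<omega>))) \<in> borel_measurable M"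
    by measurable
  show ?thesis unfolding exit_functional_def
    by (subst measurable_cong[OF arg_cong2[where f="(*)", OF arg_cong[where f=of_bool, OF less_passage_below_iff] refl]]) (auto intro: m)
qed

lemma exit_functional_eq_passage_functional:
  "\<omega> \<in> space M \<Longrightarrow> 0 \<le> x \<Longrightarrow> exit_functional p q A x y \<omega> = passage_functional p q A x y \<omega>"
  by (simp add: exit_functional_def passage_functional_def passage_below_iff)

lemma exit_functional_eq:
  assumes \<omega>: "\<omega> \<in> space M"
  shows "(let T = real_of_ereal (passage_above (z + y) (\<lambda>t. z + X t \<omega>))
       in exp (- p * T - q * (LBINT s:{0..T}. indicator A (z + X s \<omega>))))
     * indicator {f. passage_above (z + y) f < passage_below 0 f} (\<lambda>t. z + X t \<omega>) = exit_functional p q A z y \<omega>"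
proof -
  have pa: "passage_above (z + y) (\<lambda>t. z + X t \<omega>) = \<tau> y \<omega>" by (simp add: \<tau>_def passage_above_def)
  have "(LBINT s:{0..v}. indicator A (z + X s \<omega>)) = occ A z (path \<omega>) v" for v
    unfolding occ_def by (rule set_lebesgue_integral_cong) (auto simp: right_lim_path[OF \<omega>])
  then show ?thesis by (simp add: pa exit_functional_def Let_def)
qed

end

theorem theorem2:
  fixes M :: "'w measure" and X :: "real \<Rightarrow> 'w \<Rightarrow> real"
    and W :: "real \<Rightarrow> real \<Rightarrow> real"
    and a b c p q x :: real
  assumes "spectrally_negative_levy_process M X"
    and "\<And>r. 0 \<le> r \<Longrightarrow> is_scale_function M X r (W r)"
    and "0 \<le> a" and "a \<le> b" and "b \<le> c"
    and "\<not> bounded_variation_paths M X \<Longrightarrow> 0 < c"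
    and "0 \<le> p" and "0 \<le> q"
    and "0 \<le> x" and "x \<le> c"
  shows "expect_from M X x
      (\<lambda>f. let T = real_of_ereal (passage_above c f)
            in exp (- p * T - q * (LBINT s:{0..T}. indicator {a<..<b} (f s))))
      {f. passage_above c f < passage_below 0 f}
    = (scale_W2 W a p q x - q * (LBINT z:{b..x}. W p (x - z) * scale_W2 W a p q z))
      / (scale_W2 W a p q c - q * (LBINT z:{b..c}. W p (c - z) * scale_W2 W a p q z))"
proof -
  interpret X: spectrally_negative_levy_process M X by fact
  \<comment> \<open>All increments are unchanged, so Z inherits the assumptions and has the same
    Laplace exponent, scale functions and type of variation, but it starts at 0 on every
    path.\<close>
  define Z where "Z t \<omega> = X t \<omega> - X 0 \<omega>" for t \<omega>
  have Z_fun: "Z t = (\<lambda>\<omega>. X t \<omega> - X 0 \<omega>)" for t by (simp add: fun_eq_iff Z_def)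
  have Xm[measurable (raw)]: "0 \<le> t \<Longrightarrow> X t \<in> borel_measurable M" for t by (rule X.random_variable_X)
  have X0m[measurable]: "X 0 \<in> borel_measurable M" by (rule Xm) simp
  have LimZ: "Lim (at_left t) (\<lambda>s. Z s \<omega>) = Lim (at_left t) (\<lambda>s. X s \<omega>) - X 0 \<omega>" if t: "\<omega> \<in> space M" "0 < t" for \<omega> t
  proof -
    obtain l where l: "((\<lambda>s. X s \<omega>) \<longlongrightarrow> l) (at_left t)" using X.left_limits[OF t] by auto
    have "((\<lambda>s. Z s \<omega>) \<longlongrightarrow> l - X 0 \<omega>) (at_left t)" unfolding Z_def by (intro tendsto_intros l)
    then show ?thesis using l by (simp add: tendsto_Lim)
  qed
  have "snlp M Z"
  proof (intro snlp.intro spectrally_negative_levy_process.intro levy_process.intro snlp_axioms.intro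
      levy_process_axioms.intro spectrally_negative_levy_process_axioms.intro X.prob_space_axioms)
    show "Z t \<in> borel_measurable M" if "0 \<le> t" for t unfolding Z_fun using that by measurable
    show "AE \<omega> in M. Z 0 \<omega> = 0" by (simp add: Z_def)
    show "continuous (at_right t) (\<lambda>s. Z s \<omega>)" if "\<omega> \<in> space M" "0 \<le> t" for \<omega> t
      unfolding Z_def by (intro continuous_diff X.right_continuous[OF that] continuous_const)
    show "\<exists>l. ((\<lambda>s. Z s \<omega>) \<longlongrightarrow> l) (at_left t)" if t: "\<omega> \<in> space M" "0 < t" for \<omega> t
    proof -
      obtain l where l: "((\<lambda>s. X s \<omega>) \<longlongrightarrow> l) (at_left t)" using X.left_limits[OF t] by auto
      have "((\<lambda>s. Z s \<omega>) \<longlongrightarrow> l - X 0 \<omega>) (at_left t)" unfolding Z_def by (intro tendsto_intros l)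
      then show ?thesis ..
    qed
    show "X.indep_vars (\<lambda>_. borel) (\<lambda>i \<omega>. Z (t (Suc i)) \<omega> - Z (t i) \<omega>) {..<n}" if "0 \<le> t 0" "incseq t" for n t
      using X.independent_increments[OF that, of n] by (simp add: Z_def)
    show "distr M borel (\<lambda>\<omega>. Z (s + t) \<omega> - Z s \<omega>) = distr M borel (\<lambda>\<omega>. Z t \<omega> - Z 0 \<omega>)" if "0 \<le> s" "0 \<le> t" for s t
      using X.stationary_increments[OF that] by (simp add: Z_def)
    show "AE \<omega> in M. \<forall>t>0. Z t \<omega> \<le> Lim (at_left t) (\<lambda>s. Z s \<omega>)"
      using X.no_positive_jumps AE_space
    proof eventually_elim
      case (elim \<omega>)
      show ?case
      proof (intro allI impI)
        fix t :: real assume t: "0 < t"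
        show "Z t \<omega> \<le> Lim (at_left t) (\<lambda>s. Z s \<omega>)"
          unfolding LimZ[OF elim(2) t] unfolding Z_def using elim(1) t by simp
      qed
    qed
    show "\<not> (AE \<omega> in M. \<forall>s t. 0 \<le> s \<longrightarrow> s \<le> t \<longrightarrow> Z t \<omega> \<le> Z s \<omega>)"
      using X.not_neg_subordinator by (simp add: Z_def)
    show "Z 0 \<omega> = 0" for \<omega> by (simp add: Z_def)
  qed
  then interpret Z: snlp M Z .
  have lap: "laplace_exponent M X = laplace_exponent M Z"
  proof
    fix \<theta>
    have "(\<integral>\<omega>. exp (\<theta> * X t \<omega>) \<partial>M) = (\<integral>\<omega>. exp (\<theta> * Z t \<omega>) \<partial>M)" if t: "0 \<le> t" for t
    proof (rule integral_cong_AE)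
      show "(\<lambda>\<omega>. exp (\<theta> * X t \<omega>)) \<in> borel_measurable M" "(\<lambda>\<omega>. exp (\<theta> * Z t \<omega>)) \<in> borel_measurable M"
        using t unfolding Z_fun by measurable
      show "AE \<omega> in M. exp (\<theta> * X t \<omega>) = exp (\<theta> * Z t \<omega>)"
        using X.starts_at_0 by eventually_elim (simp add: Z_def)
    qed
    then show "laplace_exponent M X \<theta> = laplace_exponent M Z \<theta>" unfolding laplace_exponent_def by simp
  qed
  have sc: "is_scale_function M Z r (W r)" if "0 \<le> r" for r
    using assms(2)[OF that] by (simp add: is_scale_function_def right_inverse_exponent_def lap)
  have bv: "bounded_variation_paths M Z = bounded_variation_paths M X"
    by (simp add: bounded_variation_paths_def bounded_variation_upto_def Z_def)
  define D where "D y = scale_W2 W a p q y" for y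
  define H where "H y = D y - q * (LBINT z:{b..y}. W p (y - z) * D z)" for y
  have D_eq: "D y = W (p + q) y - q * conv (W (p + q)) (\<lambda>z. indicator {0..a} z * W p z) y" for y
    unfolding D_def scale_W2_def conv_def set_lebesgue_integral_def
    by (auto intro!: arg_cong[where f="\<lambda>v. q * v"] Bochner_Integration.integral_cong)
  have H_eq: "H y = D y - q * conv (W p) (\<lambda>z. indicator {b..} z * D z) y" for y
  proof -
    have "W p (y - z) = 0" if "y < z" for z
      using causal_neg[OF Z.scale_causal[OF sc[OF assms(7)]], of "y - z"] that by simp
    then show ?thesis unfolding H_def conv_def set_lebesgue_integral_def
      by (auto intro!: arg_cong[where f="\<lambda>v. q * v"] Bochner_Integration.integral_cong simp: indicator_def not_le)
  qed
  let ?A = "{a<..<b}"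
  let ?Y = "\<lambda>f. let T = real_of_ereal (passage_above c f)
            in exp (- p * T - q * (LBINT s:{0..T}. indicator ?A (f s)))"
  let ?E = "{f. passage_above c f < passage_below 0 f}"
  \<comment> \<open>Writing x + X t as (x + X 0) + Z t puts the initial value into a random starting
    point and a random distance to c. This identity holds on every path; only afterwards is X 0 = 0
    used, almost surely.\<close>
  have fe: "?Y (\<lambda>t. x + X t \<omega>) * indicator ?E (\<lambda>t. x + X t \<omega>) = Z.exit_functional p q ?A (x + X 0 \<omega>) (c - (x + X 0 \<omega>)) \<omega>"
    if "\<omega> \<in> space M" for \<omega>
    using Z.exit_functional_eq[OF that, of "x + X 0 \<omega>" "c - (x + X 0 \<omega>)" p q ?A] by (simp add: Z_def)
  have "expect_from M X x ?Y ?E = (\<integral>\<omega>. Z.exit_functional p q ?A (x + X 0 \<omega>) (c - (x + X 0 \<omega>)) \<omega> \<partial>M)"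
    unfolding expect_from_def by (rule Bochner_Integration.integral_cong[OF refl fe])
  also have "\<dots> = (\<integral>\<omega>. Z.passage_functional p q ?A x (c - x) \<omega> \<partial>M)"
  proof (rule integral_cong_AE)
    show "(\<lambda>\<omega>. Z.exit_functional p q ?A (x + X 0 \<omega>) (c - (x + X 0 \<omega>)) \<omega>) \<in> borel_measurable M"
      by (rule Z.exit_functional_measurable) measurable
    show "Z.passage_functional p q ?A x (c - x) \<in> borel_measurable M" by measurable
    show "AE \<omega> in M. Z.exit_functional p q ?A (x + X 0 \<omega>) (c - (x + X 0 \<omega>)) \<omega> = Z.passage_functional p q ?A x (c - x) \<omega>"
      using X.starts_at_0 AE_space by eventually_elim (simp add: Z.exit_functional_eq_passage_functional \<open>0 \<le> x\<close>)
  qed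
  also have "\<dots> = H x / H c"
  proof (rule Z.passage_identity[OF sc sc assms(3-5) _ assms(7-10) D_eq H_eq])
    show "0 \<le> p" "0 \<le> p + q" using assms(7,8) by auto
    show "0 < c" if "\<not> bounded_variation_paths M Z" using assms(6) that bv by simp
  qed
  finally show ?thesis unfolding H_def D_def .
qed

end
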